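(* Let $n\ge 1$ be a natural number. The bundle $\pi_{n+1,n}:\mathbb{J}^{D^{n+1}}(\pi)\rightarrow\mathbb{J}^{D^{n}}(\pi)$, equipped with the operations $\dot{-}$ and $\dot{+}$ given by $(\nabla^{+}\dot{-}\nabla^{-})(\gamma)=\nabla^{+}(\gamma)\dot{-}\nabla^{-}(\gamma)$ and $(\omega\dot{+}\nabla)(\gamma)=\omega(\gamma)\dot{+}\nabla(\gamma)$, is an affine bundle over the vector bundle $\mathbb{J}^{D^{n}}(\pi)\underset{E}{\times}\mathbb{S}^{D^{n+1}}(\pi)\rightarrow\mathbb{J}^{D^{n}}(\pi)$.
   Context: Setting. Everything takes place in the category of Fr\"olicher spaces; every "mapping" is a smooth mapping. For a Weil algebra $W=C^\infty(\mathbb R^k)/I$ and a Fr\"olicher space $X$, $X\otimes W$ is the Weil prolongation: the quotient of $C^\infty(\mathbb R^k,X)$ by $f\sim g$ iff $h\circ f-h\circ g\in I$ for all smooth $h:X\to\mathbb R$. It is functorial in $X$ and in $W$. An infinitesimal object $\mathbb D\ni 0$ (a formal subset of some $\mathbb R^k$ cut out by polynomial equations) has as Weil algebra $\mathcal W_{\mathbb D}$ the quotient of $C^\infty(\mathbb R^k)$ by the ideal generated by the equations. A polynomial map $f:\mathbb D\to\mathbb D'$ with $f(0)=0$ induces $\mathcal W_f:\mathcal W_{\mathbb D'}\to\mathcal W_{\mathbb D}$, hence $\mathrm{id}_X\otimes\mathcal W_f:X\otimes\mathcal W_{\mathbb D'}\to X\otimes\mathcal W_{\mathbb D}$, called "composition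 with $f$". Here $1=\{0\}$, $D=\{d:d^2=0\}$, $D_m=\{d:d^{m+1}=0\}$, $D^n=D\times\dots\times D$, $D\{n\}_{m}=\{(d_1,\dots,d_n)\in D^n: d_{i_1}\cdots d_{i_{m+1}}=0 \text{ for all } i_1<\dots<i_{m+1}\}$, $D^n\oplus D=\{(d_1,\dots,d_n,e)\in D^{n+1}: d_ie=0 \text{ for all } i\}$. $X$ is Weil exponentiable if $(X\otimes(W_1\otimes W_2))^Y=(X\otimes W_1)^Y\otimes W_2$ naturally for all $Y$, and microlinear if $X\otimes(-)$ sends finite limit diagrams of Weil algebras to limit diagrams. Standing assumption: $\pi:E\to M$ is a smooth mapping of microlinear, Weil exponentiable Fr\"olicher spaces. $(X\otimes\mathcal W_{\mathbb D})_x$ is the fibre over $x$ of $X\otimes\mathcal W_{\mathbb D}\to X\otimes\mathcal W_1=X$. $(E\otimes\mathcal W_D)_x^{\perp}$ is the set of $t\in(E\otimes\mathcal W_D)_x$ whose image under $\pi\otimes\mathrm{id}$ is the zero tangent vector at $\pi(x)$. $D^n$-tangentials. For $\gamma\in X\otimes\mathcal W_{D^n}$, $\alpha\in\mathbb R$, $1\le i\le n$, $\sigma\in\mathbf S_n$: $\alpha\underset{i}{\cdot}\gamma$ is the composition with $(d_1,\dots,d_n)\mapsto(d_1,\dots,\alpha d_i,\dots,d_n)$, and $\gamma^\sigma$ the composition with $(d_1,\dots,d_n)\mapsto(d_{\sigma(1)},\dots,d_{\sigma(n)})$. A $D^n$-pseudotangential over $\pi$ at $x\in E$ is a mapping $\nabla_x:(M\otimes\mathcal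 W_{D^n})_{\pi(x)}\to(E\otimes\mathcal W_{D^n})_x$ with: (1) $(\pi\otimes\mathrm{id})(\nabla_x(\gamma))=\gamma$; (2) $\nabla_x(\alpha\underset{i}{\cdot}\gamma)=\alpha\underset{i}{\cdot}\nabla_x(\gamma)$; (3) for all $m\ge1$ and $1\le i\le n$, with $\mu_i:D^n\times D_m\to D^n$, $\mu_i(d_1,\dots,d_n,e)=(d_1,\dots,ed_i,\dots,d_n)$, one has $(\nabla_x\otimes\mathrm{id}_{\mathcal W_{D_m}})\circ(\mathrm{id}_M\otimes\mathcal W_{\mu_i})=(\mathrm{id}_E\otimes\mathcal W_{\mu_i})\circ\nabla_x$; (4) $\nabla_x(\gamma^\sigma)=(\nabla_x(\gamma))^\sigma$. For a $D^{n+1}$-pseudotangential $\nabla_x$, $\hat\pi_{n+1,n}(\nabla_x)$ is the $D^n$-pseudotangential sending $\gamma$ to the composition with $(d_1,\dots,d_n)\mapsto(d_1,\dots,d_n,0)$ of $\nabla_x$ applied to the composition of $\gamma$ with $(d_1,\dots,d_{n+1})\mapsto(d_1,\dots,d_n)$. A $D$-tangential is a $D$-pseudotangential; inductively, a $D^{n+1}$-tangential is a $D^{n+1}$-pseudotangential $\nabla_x$ such that $\hat\pi_{n+1,n}(\nabla_x)$ is a $D^n$-tangential and, with $\kappa(d_1,\dots,d_{n+1})=(d_1,\dots,d_{n-1},d_nd_{n+1})\in D^n$, $\nabla_x((\mathrm{id}_M\otimes\mathcal W_\kappa)(\gamma))=(\mathrm{id}_E\otimes\mathcal W_\kappa)(\hat\pi_{n+1,n}(\nabla_x)(\gamma))$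 for all $\gamma\in(M\otimes\mathcal W_{D^n})_{\pi(x)}$. $\mathbb J^{D^n}_x(\pi)$ is the set of $D^n$-tangentials at $x$, $\mathbb J^{D^n}(\pi)=\bigcup_x\mathbb J^{D^n}_x(\pi)$, and $\pi_{n+1,n}$ is the restriction of $\hat\pi_{n+1,n}$. Symmetric forms. A symmetric $D^n$-form at $x$ is a mapping $\omega:(M\otimes\mathcal W_{D^n})_{\pi(x)}\to(E\otimes\mathcal W_D)_x^\perp$ with: (1) $\omega(\alpha\underset{i}{\cdot}\gamma)=\alpha\,\omega(\gamma)$; (2) $(\omega\otimes\mathrm{id}_{\mathcal W_{D_m}})\circ(\mathrm{id}_M\otimes\mathcal W_{\mu_i})=(\mathrm{id}_E\otimes\mathcal W_{(d,e)\in D\times D_m\mapsto de\in D})\circ\omega$; (3) $\omega(\gamma^\sigma)=\omega(\gamma)$; (4) $\omega$ vanishes on every composition of some $\gamma\in(M\otimes\mathcal W_{D^{n-1}})_{\pi(x)}$ with $(d_1,\dots,d_n)\mapsto(d_1,\dots,d_{n-2},d_{n-1}d_n)$. $\mathbb S^{D^n}_x(\pi)$ is the set (a vector space under pointwise operations) of such forms and $\mathbb S^{D^n}(\pi)=\bigcup_x\mathbb S_x^{D^n}(\pi)\to E$. Operations. Let $\Phi(d_1,\dots,d_n)=(d_1,\dots,d_n,0)$, $\Psi(d_1,\dots,d_n)=(d_1,\dots,d_n,d_1\cdots d_n)$ (both $D^n\to D^n\oplus D$), $\Xi(d)=(0,\dots,0,d)$ ($D\to D^n\oplus D$). If $\gamma_\pm\in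 X\otimes\mathcal W_{D^n}$ ($X$ microlinear) have the same restriction to $D\{n\}_{n-1}$, there is a unique $\gamma\in X\otimes\mathcal W_{D^n\oplus D}$ whose composition with $\Psi$ is $\gamma_+$ and with $\Phi$ is $\gamma_-$; $\gamma_+\dot-\gamma_-\in X\otimes\mathcal W_D$ is the composition of $\gamma$ with $\Xi$. If $t\in X\otimes\mathcal W_D$ and $\gamma\in X\otimes\mathcal W_{D^n}$ have the same base point, there is a unique $\gamma'\in X\otimes\mathcal W_{D^n\oplus D}$ whose composition with $\Xi$ is $t$ and with $\Phi$ is $\gamma$; $t\dot+\gamma$ is the composition of $\gamma'$ with $\Psi$. These are used with $n+1$ in place of $n$ and $X=E$: $\nabla^+\dot-\nabla^-$ is defined for $\nabla^\pm\in\mathbb J^{D^{n+1}}_x(\pi)$ with $\pi_{n+1,n}(\nabla^+)=\pi_{n+1,n}(\nabla^-)$ and lies in $\mathbb S_x^{D^{n+1}}(\pi)$; $\omega\dot+\nabla$ is defined for $\omega\in\mathbb S_x^{D^{n+1}}(\pi)$, $\nabla\in\mathbb J^{D^{n+1}}_x(\pi)$ and lies in $\mathbb J_x^{D^{n+1}}(\pi)$. Affine bundle. $p:A\to B$ is an affine bundle over a vector bundle $V\to B$ if each fibre $A_b$ is an affine space over $V_b$: with the given operations $\dot-:A_b\times A_b\to V_b$ and $\dot+:V_b\times A_b\to A_b$ one has $(a\dot-a')\dot+a'=a$, $(v\dot+a)\dot-a=v$, $0\dot+a=a$, $v\dot+(w\dot+a)=(v+w)\dot+a$. *)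

theory Defs
  imports "HOL-Analysis.Analysis" "HOL-Algebra.QuotRing" "HOL-Combinatorics.Permutations"
begin

section \<open>Smooth functions on \<open>R^k\<close>\<close>

text \<open>
  The number \<open>k\<close> varies inside the definitions below, so a point of \<open>R^k\<close> is a sequence that
  vanishes from position \<open>k\<close> on. Coordinates are numbered from \<open>0\<close>. With this encoding
  \<open>(d_1,...,d_n) \<mapsto> (d_1,...,d_n,0)\<close> does not change the underlying sequence.
\<close>

type_synonym vec = "nat \<Rightarrow> real"

definition Rn :: "nat \<Rightarrow> vec set" where
  "Rn k = {v. \<forall>i\<ge>k. v i = 0}"

text \<open>
  \<open>Cr r k f\<close>: the restriction of \<open>f\<close> to \<open>R^k\<close> is of class \<open>C^r\<close>. Continuity refers to the product
  topology on sequences, which induces the Euclidean topology on \<open>Rn k\<close>.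
\<close>

primrec Cr :: "nat \<Rightarrow> nat \<Rightarrow> (vec \<Rightarrow> real) \<Rightarrow> bool" where
  "Cr 0 k f \<longleftrightarrow> continuous_on (Rn k) f"
| "Cr (Suc r) k f \<longleftrightarrow> continuous_on (Rn k) f \<and>
     (\<forall>i<k. \<exists>f'. Cr r k f' \<and>
        (\<forall>x\<in>Rn k. ((\<lambda>t. f (x(i := t))) has_real_derivative f' x) (at (x i))))"

definition Cinf :: "nat \<Rightarrow> (vec \<Rightarrow> real) \<Rightarrow> bool" where
  "Cinf k f \<longleftrightarrow> (\<forall>r. Cr r k f)"

definition Cinf_real :: "(real \<Rightarrow> real) \<Rightarrow> bool" where
  "Cinf_real g \<longleftrightarrow> Cinf 1 (\<lambda>v. g (v 0))"


section \<open>Froelicher spaces\<close>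

record 'a fspace =
  pts :: "'a set"
  curves :: "(real \<Rightarrow> 'a) set"
  funs :: "('a \<Rightarrow> real) set"

text \<open>
  Only the values of a member of \<open>funs X\<close> on \<open>pts X\<close> matter; its values elsewhere are arbitrary.
\<close>

definition frolicher :: "'a fspace \<Rightarrow> bool" where
  "frolicher X \<longleftrightarrow>
     curves X = {c. range c \<subseteq> pts X \<and> (\<forall>f\<in>funs X. Cinf_real (f \<circ> c))} \<and>
     funs X = {f. \<forall>c\<in>curves X. Cinf_real (f \<circ> c)}"

definition smooth_map :: "'a fspace \<Rightarrow> 'b fspace \<Rightarrow> ('a \<Rightarrow> 'b) \<Rightarrow> bool" where
  "smooth_map X Y f \<longleftrightarrow> f \<in> pts X \<rightarrow> pts Y \<and> (\<forall>h\<in>funs Y. h \<circ> f \<in> funs X)"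

definition frolicher_iso :: "'a fspace \<Rightarrow> 'b fspace \<Rightarrow> ('a \<Rightarrow> 'b) \<Rightarrow> bool" where
  "frolicher_iso X Y f \<longleftrightarrow> bij_betw f (pts X) (pts Y) \<and>
     smooth_map X Y f \<and> smooth_map Y X (inv_into (pts X) f)"

text \<open>
  \<open>R^k\<close> with its standard structure. That it satisfies \<^const>\<open>frolicher\<close> is Boman's theorem.
\<close>

definition euc :: "nat \<Rightarrow> vec fspace" where
  "euc k = \<lparr>pts = Rn k,
            curves = {c. range c \<subseteq> Rn k \<and> (\<forall>i<k. Cinf_real (\<lambda>t. c t i))},
            funs = {f. Cinf k f}\<rparr>"

definition fsub :: "'a fspace \<Rightarrow> 'a set \<Rightarrow> 'a fspace" where
  "fsub X S = \<lparr>pts = S,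
               curves = {c \<in> curves X. range c \<subseteq> S},
               funs = {f. \<forall>c\<in>curves X. range c \<subseteq> S \<longrightarrow> Cinf_real (f \<circ> c)}\<rparr>"

definition fquot :: "'a fspace \<Rightarrow> ('a \<times> 'a) set \<Rightarrow> 'a set fspace" where
  "fquot X r = (let F = {f. (\<lambda>x. f (r `` {x})) \<in> funs X} in
     \<lparr>pts = pts X // r,
      curves = {c. range c \<subseteq> pts X // r \<and> (\<forall>f\<in>F. Cinf_real (f \<circ> c))},
      funs = F\<rparr>)"

text \<open>
  The exponential \<open>X^Y\<close>. Its structure is generated by the curves \<open>c\<close> whose transpose
  \<open>R \<times> Y \<rightarrow> X\<close> is smooth, i.e. sends every curve \<open>(s, d)\<close> of \<open>R \<times> Y\<close> to a curve of \<open>X\<close>.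
\<close>

definition fexp :: "'y fspace \<Rightarrow> 'a fspace \<Rightarrow> ('y \<Rightarrow> 'a) fspace" where
  "fexp Y X =
    (let P = {f \<in> extensional (pts Y). smooth_map Y X f};
         C = {c. range c \<subseteq> P \<and>
                (\<forall>s d. Cinf_real s \<and> d \<in> curves Y \<longrightarrow> (\<lambda>t. c (s t) (d t)) \<in> curves X)};
         F = {f. \<forall>c\<in>C. Cinf_real (f \<circ> c)}
     in \<lparr>pts = P,
         curves = {c. range c \<subseteq> P \<and> (\<forall>f\<in>F. Cinf_real (f \<circ> c))},
         funs = F\<rparr>)"


section \<open>Weil algebras\<close>

definition cinf_ring :: "nat \<Rightarrow> (vec \<Rightarrow> real) ring" where
  "cinf_ring k = \<lparr>carrier = {f \<in> extensional (Rn k). Cinf k f},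
                  mult = (\<lambda>f g. \<lambda>x\<in>Rn k. f x * g x),
                  one = (\<lambda>x\<in>Rn k. 1),
                  zero = (\<lambda>x\<in>Rn k. 0),
                  add = (\<lambda>f g. \<lambda>x\<in>Rn k. f x + g x)\<rparr>"

text \<open>A presentation \<open>C^\<infinity>(R^k)/I\<close>.\<close>

record weil =
  wdim :: nat
  wideal :: "(vec \<Rightarrow> real) set"

definition wring :: "weil \<Rightarrow> (vec \<Rightarrow> real) set ring" where
  "wring W = cinf_ring (wdim W) Quot wideal W"

definition wres :: "weil \<Rightarrow> (vec \<Rightarrow> real) \<Rightarrow> (vec \<Rightarrow> real) set" where
  "wres W h = wideal W +>\<^bsub>cinf_ring (wdim W)\<^esub> (restrict h (Rn (wdim W)))"

text \<open>
  A Weil algebra is a finite-dimensional commutative real algebra of the form \<open>R \<oplus> m\<close> with \<open>m\<close> an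
  ideal of nilpotent elements.
\<close>

definition weil_algebra :: "weil \<Rightarrow> bool" where
  "weil_algebra W \<longleftrightarrow>
     ideal (wideal W) (cinf_ring (wdim W)) \<and>
     (\<exists>B. finite B \<and> B \<subseteq> carrier (cinf_ring (wdim W)) \<and>
        (\<forall>f\<in>carrier (cinf_ring (wdim W)). \<exists>a.
            wres W f = wres W (\<lambda>x. \<Sum>b\<in>B. a b * b x))) \<and>
     (\<exists>m. ideal m (wring W) \<and>
        (\<forall>f\<in>carrier (cinf_ring (wdim W)). \<exists>!a::real. wres W (\<lambda>x. f x - a) \<in> m) \<and>
        (\<forall>w\<in>m. \<exists>r::nat. w [^]\<^bsub>wring W\<^esub> r = \<zero>\<^bsub>wring W\<^esub>))"

type_synonym whom = "(vec \<Rightarrow> real) set \<Rightarrow> (vec \<Rightarrow> real) set"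

definition weil_hom :: "weil \<Rightarrow> weil \<Rightarrow> whom \<Rightarrow> bool" where
  "weil_hom W V \<phi> \<longleftrightarrow> \<phi> \<in> ring_hom (wring W) (wring V) \<and>
     (\<forall>a::real. \<phi> (wres W (\<lambda>x. a)) = wres V (\<lambda>x. a))"

definition induces :: "weil \<Rightarrow> weil \<Rightarrow> (vec \<Rightarrow> vec) \<Rightarrow> whom \<Rightarrow> bool" where
  "induces W V f \<phi> \<longleftrightarrow> smooth_map (euc (wdim V)) (euc (wdim W)) f \<and>
     (\<forall>h\<in>carrier (cinf_ring (wdim W)). \<phi> (wres W h) = wres V (\<lambda>x. h (f x)))"

definition vtake :: "nat \<Rightarrow> vec \<Rightarrow> vec" where
  "vtake k x = (\<lambda>i. if i < k then x i else 0)"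

definition vdrop :: "nat \<Rightarrow> vec \<Rightarrow> vec" where
  "vdrop k x = (\<lambda>i. x (i + k))"

definition vjoin :: "nat \<Rightarrow> vec \<Rightarrow> vec \<Rightarrow> vec" where
  "vjoin k x z = (\<lambda>i. if i < k then x i else z (i - k))"

text \<open>
  \<open>C^\<infinity>(R^k)/I \<otimes> C^\<infinity>(R^l)/J = C^\<infinity>(R^(k+l))/(I, J)\<close>, where \<open>I\<close> and \<open>J\<close> are pulled back along
  the two projections.
\<close>

definition wtensor :: "weil \<Rightarrow> weil \<Rightarrow> weil" where
  "wtensor W V = (let N = wdim W + wdim V in
     \<lparr>wdim = N,
      wideal = genideal (cinf_ring N)
        ({\<lambda>x\<in>Rn N. h (vtake (wdim W) x) | h. h \<in> wideal W} \<union>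
         {\<lambda>x\<in>Rn N. h (vdrop (wdim W) x) | h. h \<in> wideal V})\<rparr>)"


section \<open>Weil prolongation\<close>

definition weil_rel :: "'a fspace \<Rightarrow> weil \<Rightarrow> ((vec \<Rightarrow> 'a) \<times> (vec \<Rightarrow> 'a)) set" where
  "weil_rel X W = {(f, g). f \<in> pts (fexp (euc (wdim W)) X) \<and> g \<in> pts (fexp (euc (wdim W)) X) \<and>
     (\<forall>h\<in>funs X. (\<lambda>x\<in>Rn (wdim W). h (f x) - h (g x)) \<in> wideal W)}"

definition weil_prol :: "'a fspace \<Rightarrow> weil \<Rightarrow> (vec \<Rightarrow> 'a) set fspace" where
  "weil_prol X W = fquot (fexp (euc (wdim W)) X) (weil_rel X W)"

definition wcls :: "'a fspace \<Rightarrow> weil \<Rightarrow> (vec \<Rightarrow> 'a) \<Rightarrow> (vec \<Rightarrow> 'a) set" where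
  "wcls X W g = weil_rel X W `` {restrict g (Rn (wdim W))}"

text \<open>\<open>u \<otimes> id_W : X \<otimes> W \<rightarrow> Y \<otimes> W\<close> for \<open>u : X \<rightarrow> Y\<close>.\<close>

definition wmap :: "'b fspace \<Rightarrow> weil \<Rightarrow> ('a \<Rightarrow> 'b) \<Rightarrow> (vec \<Rightarrow> 'a) set \<Rightarrow> (vec \<Rightarrow> 'b) set" where
  "wmap Y W u A = weil_rel Y W `` ((\<lambda>g. \<lambda>x\<in>Rn (wdim W). u (g x)) ` A)"

text \<open>Composition with \<open>f : R^l \<rightarrow> R^k\<close>, with values in \<open>X \<otimes> V\<close>, \<open>V = C^\<infinity>(R^l)/J\<close>.\<close>

definition wcomp :: "'a fspace \<Rightarrow> weil \<Rightarrow> (vec \<Rightarrow> vec) \<Rightarrow> (vec \<Rightarrow> 'a) set \<Rightarrow> (vec \<Rightarrow> 'a) set" where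
  "wcomp X V f A = weil_rel X V `` ((\<lambda>g. \<lambda>x\<in>Rn (wdim V). g (f x)) ` A)"

text \<open>
  \<open>id_X \<otimes> \<phi>\<close> for a homomorphism \<open>\<phi> : W \<rightarrow> V\<close>. Every \<open>\<phi>\<close> between Weil algebras is induced by some
  smooth \<open>f\<close>, and maps inducing the same \<open>\<phi>\<close> give the same composition.
\<close>

definition wfun :: "'a fspace \<Rightarrow> weil \<Rightarrow> weil \<Rightarrow> whom \<Rightarrow> (vec \<Rightarrow> 'a) set \<Rightarrow> (vec \<Rightarrow> 'a) set" where
  "wfun X W V \<phi> = wcomp X V (SOME f. induces W V f \<phi>)"


section \<open>Microlinearity and Weil exponentiability\<close>

text \<open>
  A finite diagram is given by a finite set \<open>J\<close> of vertices, objects \<open>Ws j\<close> and a finite set \<open>Q\<close> of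
  labelled arrows \<open>(i, j, \<phi>)\<close>. A cone of Weil algebras is called a limit if it is one in the
  category of real algebras, where limits are formed on underlying sets. In the full subcategory of
  Weil algebras the terminal object would be \<open>R\<close>, and \<open>X \<otimes> R = X\<close> is terminal only for a
  one-point \<open>X\<close>.
\<close>

definition weil_limit_cone ::
  "nat set \<Rightarrow> (nat \<Rightarrow> weil) \<Rightarrow> (nat \<times> nat \<times> whom) set \<Rightarrow> weil \<Rightarrow> (nat \<Rightarrow> whom) \<Rightarrow> bool" where
  "weil_limit_cone J Ws Q W p \<longleftrightarrow>
     finite J \<and> finite Q \<and> weil_algebra W \<and> (\<forall>j\<in>J. weil_algebra (Ws j)) \<and>
     (\<forall>(i, j, \<phi>)\<in>Q. i \<in> J \<and> j \<in> J \<and> weil_hom (Ws i) (Ws j) \<phi>) \<and>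
     (\<forall>j\<in>J. weil_hom W (Ws j) (p j)) \<and>
     (\<forall>(i, j, \<phi>)\<in>Q. \<forall>w\<in>carrier (wring W). \<phi> (p i w) = p j w) \<and>
     (\<forall>a. (\<forall>j\<in>J. a j \<in> carrier (wring (Ws j))) \<and> (\<forall>(i, j, \<phi>)\<in>Q. \<phi> (a i) = a j) \<longrightarrow>
        (\<exists>!w. w \<in> carrier (wring W) \<and> (\<forall>j\<in>J. p j w = a j)))"

text \<open>
  Limits of Froelicher spaces are limits of the underlying sets with the initial structure.
\<close>

definition frolicher_limit_cone ::
  "nat set \<Rightarrow> (nat \<Rightarrow> 'b fspace) \<Rightarrow> (nat \<times> nat \<times> ('b \<Rightarrow> 'b)) set \<Rightarrow>
     'b fspace \<Rightarrow> (nat \<Rightarrow> 'b \<Rightarrow> 'b) \<Rightarrow> bool" where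
  "frolicher_limit_cone J Ys Q Y q \<longleftrightarrow>
     (\<forall>(i, j, u)\<in>Q. smooth_map (Ys i) (Ys j) u) \<and>
     (\<forall>j\<in>J. smooth_map Y (Ys j) (q j)) \<and>
     (\<forall>(i, j, u)\<in>Q. \<forall>y\<in>pts Y. u (q i y) = q j y) \<and>
     (\<forall>a. (\<forall>j\<in>J. a j \<in> pts (Ys j)) \<and> (\<forall>(i, j, u)\<in>Q. u (a i) = a j) \<longrightarrow>
        (\<exists>!y. y \<in> pts Y \<and> (\<forall>j\<in>J. q j y = a j))) \<and>
     curves Y = {c. range c \<subseteq> pts Y \<and> (\<forall>j\<in>J. q j \<circ> c \<in> curves (Ys j))}"

definition microlinear :: "'a fspace \<Rightarrow> bool" where
  "microlinear X \<longleftrightarrow> (\<forall>J Ws Q W p. weil_limit_cone J Ws Q W p \<longrightarrow>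
     frolicher_limit_cone J (\<lambda>j. weil_prol X (Ws j))
       ((\<lambda>(i, j, \<phi>). (i, j, wfun X (Ws i) (Ws j) \<phi>)) ` Q)
       (weil_prol X W) (\<lambda>j. wfun X W (Ws j) (p j)))"

text \<open>
  The natural isomorphism \<open>\<Theta> Y : (X \<otimes> (W1 \<otimes> W2))^Y \<rightarrow> (X \<otimes> W1)^Y \<otimes> W2\<close>. The last clause says that
  it is the canonical one: both sides receive a map from \<open>C^\<infinity>(R^(k1+k2), X^Y)\<close>, by taking classes
  and currying, and \<open>\<Theta> Y\<close> identifies the two images of each \<open>g\<close>. The spaces \<open>Y\<close> range over all
  Froelicher spaces with points in the type \<open>'y\<close>.
\<close>

definition weil_exponentiable :: "'y itself \<Rightarrow> 'a fspace \<Rightarrow> bool" where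
  "weil_exponentiable ty X \<longleftrightarrow> (\<forall>W1 W2. weil_algebra W1 \<and> weil_algebra W2 \<longrightarrow>
     (\<exists>\<Theta> :: 'y fspace \<Rightarrow> ('y \<Rightarrow> (vec \<Rightarrow> 'a) set) \<Rightarrow> (vec \<Rightarrow> 'y \<Rightarrow> (vec \<Rightarrow> 'a) set) set.
        (\<forall>Y. frolicher Y \<longrightarrow>
           frolicher_iso (fexp Y (weil_prol X (wtensor W1 W2)))
                         (weil_prol (fexp Y (weil_prol X W1)) W2) (\<Theta> Y)) \<and>
        (\<forall>Y Y' u. frolicher Y \<and> frolicher Y' \<and> smooth_map Y' Y u \<longrightarrow>
           (\<forall>a\<in>pts (fexp Y (weil_prol X (wtensor W1 W2))).
              \<Theta> Y' (\<lambda>y\<in>pts Y'. a (u y)) =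
              wmap (fexp Y' (weil_prol X W1)) W2 (\<lambda>b. \<lambda>y\<in>pts Y'. b (u y)) (\<Theta> Y a))) \<and>
        (\<forall>Y g. frolicher Y \<and> smooth_map (euc (wdim W1 + wdim W2)) (fexp Y X) g \<longrightarrow>
           \<Theta> Y (\<lambda>y\<in>pts Y. wcls X (wtensor W1 W2) (\<lambda>v. g v y)) =
           wcls (fexp Y (weil_prol X W1)) W2
             (\<lambda>z. \<lambda>y\<in>pts Y. wcls X W1 (\<lambda>x. g (vjoin (wdim W1) x z) y)))))"


section \<open>Infinitesimal objects\<close>

text \<open>The Weil algebra of the formal subset of \<open>R^k\<close> cut out by the functions in \<open>P\<close>.\<close>

definition winf :: "nat \<Rightarrow> (vec \<Rightarrow> real) set \<Rightarrow> weil" where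
  "winf k P = \<lparr>wdim = k, wideal = genideal (cinf_ring k) ((\<lambda>p. restrict p (Rn k)) ` P)\<rparr>"

definition W_one :: weil where
  "W_one = winf 0 {}"

definition W_Dpow :: "nat \<Rightarrow> weil" where  \<comment> \<open>\<open>D^n\<close>\<close>
  "W_Dpow n = winf n {\<lambda>d. d i ^ 2 | i. i < n}"

abbreviation W_D :: weil where
  "W_D \<equiv> W_Dpow 1"

definition W_Dsub :: "nat \<Rightarrow> weil" where  \<comment> \<open>\<open>D_m\<close>\<close>
  "W_Dsub m = winf 1 {\<lambda>d. d 0 ^ (m + 1)}"

definition W_Dbrace :: "nat \<Rightarrow> nat \<Rightarrow> weil" where  \<comment> \<open>\<open>D{n}_m\<close>\<close>
  "W_Dbrace n m = winf n ({\<lambda>d. d i ^ 2 | i. i < n} \<union>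
     {\<lambda>d. \<Prod>i\<in>S. d i | S. S \<subseteq> {..<n} \<and> card S = m + 1})"

definition W_Dplus :: "nat \<Rightarrow> weil" where  \<comment> \<open>\<open>D^n \<oplus> D\<close>, with \<open>e\<close> as coordinate number \<open>n\<close>\<close>
  "W_Dplus n = winf (n + 1) ({\<lambda>d. d i ^ 2 | i. i \<le> n} \<union> {\<lambda>d. d i * d n | i. i < n})"

text \<open>
  The identification \<open>X \<otimes> W_1 = X\<close> is \<open>x \<mapsto> [const x]\<close>.
\<close>

definition wconst :: "'a fspace \<Rightarrow> weil \<Rightarrow> 'a \<Rightarrow> (vec \<Rightarrow> 'a) set" where
  "wconst X W x = wcls X W (\<lambda>v. x)"

definition fibre :: "'a fspace \<Rightarrow> weil \<Rightarrow> 'a \<Rightarrow> (vec \<Rightarrow> 'a) set set" where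
  "fibre X W x = {A \<in> pts (weil_prol X W). wcomp X W_one (\<lambda>v. (\<lambda>i. 0)) A = wconst X W_one x}"

definition fibre_space :: "'a fspace \<Rightarrow> weil \<Rightarrow> 'a \<Rightarrow> (vec \<Rightarrow> 'a) set fspace" where
  "fibre_space X W x = fsub (weil_prol X W) (fibre X W x)"

definition scale :: "'a fspace \<Rightarrow> nat \<Rightarrow> nat \<Rightarrow> real \<Rightarrow> (vec \<Rightarrow> 'a) set \<Rightarrow> (vec \<Rightarrow> 'a) set" where
  "scale X n i \<alpha> = wcomp X (W_Dpow n) (\<lambda>d. d(i := \<alpha> * d i))"

definition permute :: "'a fspace \<Rightarrow> nat \<Rightarrow> (nat \<Rightarrow> nat) \<Rightarrow> (vec \<Rightarrow> 'a) set \<Rightarrow> (vec \<Rightarrow> 'a) set" where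
  "permute X n \<sigma> = wcomp X (W_Dpow n) (\<lambda>d i. d (\<sigma> i))"

definition mu :: "nat \<Rightarrow> nat \<Rightarrow> vec \<Rightarrow> vec" where
  "mu n i d = (\<lambda>j. if j < n then (if j = i then d n * d i else d j) else 0)"

definition kappa :: "nat \<Rightarrow> vec \<Rightarrow> vec" where  \<comment> \<open>\<open>D^(n+1) \<rightarrow> D^n\<close> for \<open>n \<ge> 1\<close>\<close>
  "kappa n d = (\<lambda>j. if j < n - 1 then d j else if j = n - 1 then d (n - 1) * d n else 0)"

text \<open>
  \<open>id_X \<otimes> W_f\<close> for \<open>f : D1 \<times> D2 \<rightarrow> D'\<close>, followed by the identification
  \<open>X \<otimes> (W1 \<otimes> W2) = (X \<otimes> W1) \<otimes> W2\<close> and regarded as a map into \<open>S \<otimes> W2\<close> for a subspace \<open>S\<close> of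
  \<open>X \<otimes> W1\<close>: the class of \<open>g\<close> goes to the class of \<open>z \<mapsto> [x \<mapsto> g (f (x, z))]\<close>. This is used when
  all \<open>[x \<mapsto> g (f (x, z))]\<close> lie in \<open>S\<close>. The class is formed in \<open>S \<otimes> W2\<close>, not in \<open>(X \<otimes> W1) \<otimes> W2\<close>,
  because \<open>u \<otimes> id\<close> for a map \<open>u\<close> defined on \<open>S\<close> has domain \<open>S \<otimes> W2\<close>.
\<close>

definition wcurry :: "(vec \<Rightarrow> 'a) set fspace \<Rightarrow> 'a fspace \<Rightarrow> weil \<Rightarrow> weil \<Rightarrow> (vec \<Rightarrow> vec) \<Rightarrow>
    (vec \<Rightarrow> 'a) set \<Rightarrow> (vec \<Rightarrow> (vec \<Rightarrow> 'a) set) set" where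
  "wcurry S X W1 W2 f A = weil_rel S W2 ``
     ((\<lambda>g. \<lambda>z\<in>Rn (wdim W2). wcls X W1 (\<lambda>x. g (f (vjoin (wdim W1) x z)))) ` A)"


section \<open>\<open>D^n\<close>-tangentials\<close>

type_synonym ('m, 'e) tmap = "(vec \<Rightarrow> 'm) set \<Rightarrow> (vec \<Rightarrow> 'e) set"

definition pseudotangential ::
  "'e fspace \<Rightarrow> 'm fspace \<Rightarrow> ('e \<Rightarrow> 'm) \<Rightarrow> 'e \<Rightarrow> nat \<Rightarrow> ('m, 'e) tmap \<Rightarrow> bool" where
  "pseudotangential E M \<pi> x n T \<longleftrightarrow>
     T \<in> extensional (fibre M (W_Dpow n) (\<pi> x)) \<and>
     smooth_map (fibre_space M (W_Dpow n) (\<pi> x)) (fibre_space E (W_Dpow n) x) T \<and>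
     (\<forall>\<gamma>\<in>fibre M (W_Dpow n) (\<pi> x). wmap M (W_Dpow n) \<pi> (T \<gamma>) = \<gamma>) \<and>
     (\<forall>\<gamma>\<in>fibre M (W_Dpow n) (\<pi> x). \<forall>\<alpha>. \<forall>i<n. T (scale M n i \<alpha> \<gamma>) = scale E n i \<alpha> (T \<gamma>)) \<and>
     (\<forall>\<gamma>\<in>fibre M (W_Dpow n) (\<pi> x). \<forall>m\<ge>1. \<forall>i<n.
        wmap (fibre_space E (W_Dpow n) x) (W_Dsub m) T
          (wcurry (fibre_space M (W_Dpow n) (\<pi> x)) M (W_Dpow n) (W_Dsub m) (mu n i) \<gamma>) =
        wcurry (fibre_space E (W_Dpow n) x) E (W_Dpow n) (W_Dsub m) (mu n i) (T \<gamma>)) \<and>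
     (\<forall>\<gamma>\<in>fibre M (W_Dpow n) (\<pi> x). \<forall>\<sigma>. \<sigma> permutes {..<n} \<longrightarrow>
        T (permute M n \<sigma> \<gamma>) = permute E n \<sigma> (T \<gamma>))"

definition pi_hat ::
  "'e fspace \<Rightarrow> 'm fspace \<Rightarrow> ('e \<Rightarrow> 'm) \<Rightarrow> 'e \<Rightarrow> nat \<Rightarrow> ('m, 'e) tmap \<Rightarrow> ('m, 'e) tmap" where
  "pi_hat E M \<pi> x n T = (\<lambda>\<gamma>\<in>fibre M (W_Dpow n) (\<pi> x).
     wcomp E (W_Dpow n) (\<lambda>d. d(n := 0)) (T (wcomp M (W_Dpow (Suc n)) (vtake n) \<gamma>)))"

inductive tangential ::
  "'e fspace \<Rightarrow> 'm fspace \<Rightarrow> ('e \<Rightarrow> 'm) \<Rightarrow> 'e \<Rightarrow> nat \<Rightarrow> ('m, 'e) tmap \<Rightarrow> bool"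
  for E M \<pi> x where
  base: "pseudotangential E M \<pi> x 1 T \<Longrightarrow> tangential E M \<pi> x 1 T"
| step: "n \<ge> 1 \<Longrightarrow> pseudotangential E M \<pi> x (Suc n) T \<Longrightarrow>
     tangential E M \<pi> x n (pi_hat E M \<pi> x n T) \<Longrightarrow>
     (\<forall>\<gamma>\<in>fibre M (W_Dpow n) (\<pi> x).
        T (wcomp M (W_Dpow (Suc n)) (kappa n) \<gamma>) =
        wcomp E (W_Dpow (Suc n)) (kappa n) (pi_hat E M \<pi> x n T \<gamma>)) \<Longrightarrow>
     tangential E M \<pi> x (Suc n) T"

text \<open>The union over \<open>x\<close> is taken as a disjoint union.\<close>

definition jets ::
  "'e fspace \<Rightarrow> 'm fspace \<Rightarrow> ('e \<Rightarrow> 'm) \<Rightarrow> nat \<Rightarrow> ('e \<times> ('m, 'e) tmap) set" where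
  "jets E M \<pi> n = (SIGMA x:pts E. {T. tangential E M \<pi> x n T})"

definition jet_proj ::
  "'e fspace \<Rightarrow> 'm fspace \<Rightarrow> ('e \<Rightarrow> 'm) \<Rightarrow> nat \<Rightarrow> 'e \<times> ('m, 'e) tmap \<Rightarrow> 'e \<times> ('m, 'e) tmap" where
  "jet_proj E M \<pi> n = (\<lambda>(x, T). (x, pi_hat E M \<pi> x n T))"


section \<open>Symmetric forms\<close>

definition vertical :: "'e fspace \<Rightarrow> 'm fspace \<Rightarrow> ('e \<Rightarrow> 'm) \<Rightarrow> 'e \<Rightarrow> (vec \<Rightarrow> 'e) set set" where
  "vertical E M \<pi> x = {t \<in> fibre E W_D x. wmap M W_D \<pi> t = wconst M W_D (\<pi> x)}"

definition vertical_space ::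
  "'e fspace \<Rightarrow> 'm fspace \<Rightarrow> ('e \<Rightarrow> 'm) \<Rightarrow> 'e \<Rightarrow> (vec \<Rightarrow> 'e) set fspace" where
  "vertical_space E M \<pi> x = fsub (weil_prol E W_D) (vertical E M \<pi> x)"

text \<open>The vector space structure of the tangent spaces, using \<open>D(2) = D{2}_1\<close> for the sum.\<close>

definition tadd :: "'a fspace \<Rightarrow> (vec \<Rightarrow> 'a) set \<Rightarrow> (vec \<Rightarrow> 'a) set \<Rightarrow> (vec \<Rightarrow> 'a) set" where
  "tadd X s t = wcomp X W_D (\<lambda>d. (\<lambda>i. 0)(0 := d 0, 1 := d 0))
     (THE l. l \<in> pts (weil_prol X (W_Dbrace 2 1)) \<and>
        wcomp X W_D (\<lambda>d. (\<lambda>i. 0)(0 := d 0)) l = s \<and>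
        wcomp X W_D (\<lambda>d. (\<lambda>i. 0)(1 := d 0)) l = t)"

definition tscale :: "'a fspace \<Rightarrow> real \<Rightarrow> (vec \<Rightarrow> 'a) set \<Rightarrow> (vec \<Rightarrow> 'a) set" where
  "tscale X \<alpha> = scale X 1 0 \<alpha>"

definition symmetric_form ::
  "'e fspace \<Rightarrow> 'm fspace \<Rightarrow> ('e \<Rightarrow> 'm) \<Rightarrow> 'e \<Rightarrow> nat \<Rightarrow> ('m, 'e) tmap \<Rightarrow> bool" where
  "symmetric_form E M \<pi> x n \<omega> \<longleftrightarrow>
     \<omega> \<in> extensional (fibre M (W_Dpow n) (\<pi> x)) \<and>
     smooth_map (fibre_space M (W_Dpow n) (\<pi> x)) (vertical_space E M \<pi> x) \<omega> \<and>
     (\<forall>\<gamma>\<in>fibre M (W_Dpow n) (\<pi> x). \<forall>\<alpha>. \<forall>i<n. \<omega> (scale M n i \<alpha> \<gamma>) = tscale E \<alpha> (\<omega> \<gamma>)) \<and>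
     (\<forall>\<gamma>\<in>fibre M (W_Dpow n) (\<pi> x). \<forall>m\<ge>1. \<forall>i<n.
        wmap (vertical_space E M \<pi> x) (W_Dsub m) \<omega>
          (wcurry (fibre_space M (W_Dpow n) (\<pi> x)) M (W_Dpow n) (W_Dsub m) (mu n i) \<gamma>) =
        wcurry (vertical_space E M \<pi> x) E W_D (W_Dsub m) (mu 1 0) (\<omega> \<gamma>)) \<and>
     (\<forall>\<gamma>\<in>fibre M (W_Dpow n) (\<pi> x). \<forall>\<sigma>. \<sigma> permutes {..<n} \<longrightarrow>
        \<omega> (permute M n \<sigma> \<gamma>) = \<omega> \<gamma>) \<and>
     (n \<ge> 2 \<longrightarrow> (\<forall>\<gamma>\<in>fibre M (W_Dpow (n - 1)) (\<pi> x).
        \<omega> (wcomp M (W_Dpow n) (kappa (n - 1)) \<gamma>) = wconst E W_D x))"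

definition forms ::
  "'e fspace \<Rightarrow> 'm fspace \<Rightarrow> ('e \<Rightarrow> 'm) \<Rightarrow> nat \<Rightarrow> ('e \<times> ('m, 'e) tmap) set" where
  "forms E M \<pi> n = (SIGMA x:pts E. {\<omega>. symmetric_form E M \<pi> x n \<omega>})"

definition form_zero ::
  "'e fspace \<Rightarrow> 'm fspace \<Rightarrow> ('e \<Rightarrow> 'm) \<Rightarrow> nat \<Rightarrow> 'e \<Rightarrow> ('m, 'e) tmap" where
  "form_zero E M \<pi> n x = (\<lambda>\<gamma>\<in>fibre M (W_Dpow n) (\<pi> x). wconst E W_D x)"

definition form_add ::
  "'e fspace \<Rightarrow> 'm fspace \<Rightarrow> ('e \<Rightarrow> 'm) \<Rightarrow> nat \<Rightarrow> 'e \<Rightarrow>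
     ('m, 'e) tmap \<Rightarrow> ('m, 'e) tmap \<Rightarrow> ('m, 'e) tmap" where
  "form_add E M \<pi> n x \<omega> \<omega>' = (\<lambda>\<gamma>\<in>fibre M (W_Dpow n) (\<pi> x). tadd E (\<omega> \<gamma>) (\<omega>' \<gamma>))"

definition form_scale ::
  "'e fspace \<Rightarrow> 'm fspace \<Rightarrow> ('e \<Rightarrow> 'm) \<Rightarrow> nat \<Rightarrow> 'e \<Rightarrow> real \<Rightarrow> ('m, 'e) tmap \<Rightarrow> ('m, 'e) tmap" where
  "form_scale E M \<pi> n x \<alpha> \<omega> = (\<lambda>\<gamma>\<in>fibre M (W_Dpow n) (\<pi> x). tscale E \<alpha> (\<omega> \<gamma>))"


section \<open>Strong difference and strong addition\<close>

definition Phi :: "nat \<Rightarrow> vec \<Rightarrow> vec" where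
  "Phi n d = d(n := 0)"

definition Psi :: "nat \<Rightarrow> vec \<Rightarrow> vec" where
  "Psi n d = d(n := \<Prod>i<n. d i)"

definition Xi :: "nat \<Rightarrow> vec \<Rightarrow> vec" where
  "Xi n d = (\<lambda>i. 0)(n := d 0)"

definition sdiff :: "'a fspace \<Rightarrow> nat \<Rightarrow> (vec \<Rightarrow> 'a) set \<Rightarrow> (vec \<Rightarrow> 'a) set \<Rightarrow> (vec \<Rightarrow> 'a) set" where
  "sdiff X n \<gamma>p \<gamma>m = wcomp X W_D (Xi n)
     (THE \<gamma>. \<gamma> \<in> pts (weil_prol X (W_Dplus n)) \<and>
        wcomp X (W_Dpow n) (Psi n) \<gamma> = \<gamma>p \<and> wcomp X (W_Dpow n) (Phi n) \<gamma> = \<gamma>m)"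

definition sadd :: "'a fspace \<Rightarrow> nat \<Rightarrow> (vec \<Rightarrow> 'a) set \<Rightarrow> (vec \<Rightarrow> 'a) set \<Rightarrow> (vec \<Rightarrow> 'a) set" where
  "sadd X n t \<gamma> = wcomp X (W_Dpow n) (Psi n)
     (THE \<gamma>'. \<gamma>' \<in> pts (weil_prol X (W_Dplus n)) \<and>
        wcomp X W_D (Xi n) \<gamma>' = t \<and> wcomp X (W_Dpow n) (Phi n) \<gamma>' = \<gamma>)"

definition tang_diff ::
  "'e fspace \<Rightarrow> 'm fspace \<Rightarrow> ('e \<Rightarrow> 'm) \<Rightarrow> nat \<Rightarrow> 'e \<Rightarrow>
     ('m, 'e) tmap \<Rightarrow> ('m, 'e) tmap \<Rightarrow> ('m, 'e) tmap" where
  "tang_diff E M \<pi> n x Tp Tm = (\<lambda>\<gamma>\<in>fibre M (W_Dpow n) (\<pi> x). sdiff E n (Tp \<gamma>) (Tm \<gamma>))"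

definition tang_add ::
  "'e fspace \<Rightarrow> 'm fspace \<Rightarrow> ('e \<Rightarrow> 'm) \<Rightarrow> nat \<Rightarrow> 'e \<Rightarrow>
     ('m, 'e) tmap \<Rightarrow> ('m, 'e) tmap \<Rightarrow> ('m, 'e) tmap" where
  "tang_add E M \<pi> n x \<omega> T = (\<lambda>\<gamma>\<in>fibre M (W_Dpow n) (\<pi> x). sadd E n (\<omega> \<gamma>) (T \<gamma>))"


section \<open>Affine bundles\<close>

definition vector_bundle ::
  "'v set \<Rightarrow> 'b set \<Rightarrow> ('v \<Rightarrow> 'b) \<Rightarrow> ('b \<Rightarrow> 'v) \<Rightarrow> ('v \<Rightarrow> 'v \<Rightarrow> 'v) \<Rightarrow> (real \<Rightarrow> 'v \<Rightarrow> 'v) \<Rightarrow> bool" where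
  "vector_bundle V B q zer vadd vscale \<longleftrightarrow> q \<in> V \<rightarrow> B \<and>
     (\<forall>b\<in>B. let Vb = {v \<in> V. q v = b} in
        zer b \<in> Vb \<and> (\<forall>u\<in>Vb. \<forall>v\<in>Vb. vadd u v \<in> Vb) \<and> (\<forall>r. \<forall>v\<in>Vb. vscale r v \<in> Vb) \<and>
        (\<forall>u\<in>Vb. \<forall>v\<in>Vb. \<forall>w\<in>Vb. vadd (vadd u v) w = vadd u (vadd v w)) \<and>
        (\<forall>u\<in>Vb. \<forall>v\<in>Vb. vadd u v = vadd v u) \<and>
        (\<forall>v\<in>Vb. vadd (zer b) v = v) \<and>
        (\<forall>v\<in>Vb. \<exists>w\<in>Vb. vadd v w = zer b) \<and>
        (\<forall>r. \<forall>u\<in>Vb. \<forall>v\<in>Vb. vscale r (vadd u v) = vadd (vscale r u) (vscale r v)) \<and>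
        (\<forall>r s. \<forall>v\<in>Vb. vscale (r + s) v = vadd (vscale r v) (vscale s v)) \<and>
        (\<forall>r s. \<forall>v\<in>Vb. vscale r (vscale s v) = vscale (r * s) v) \<and>
        (\<forall>v\<in>Vb. vscale 1 v = v))"

definition affine_bundle ::
  "'a set \<Rightarrow> 'b set \<Rightarrow> ('a \<Rightarrow> 'b) \<Rightarrow>
   'v set \<Rightarrow> ('v \<Rightarrow> 'b) \<Rightarrow> ('b \<Rightarrow> 'v) \<Rightarrow> ('v \<Rightarrow> 'v \<Rightarrow> 'v) \<Rightarrow> (real \<Rightarrow> 'v \<Rightarrow> 'v) \<Rightarrow>
   ('a \<Rightarrow> 'a \<Rightarrow> 'v) \<Rightarrow> ('v \<Rightarrow> 'a \<Rightarrow> 'a) \<Rightarrow> bool" where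
  "affine_bundle A B p V q zer vadd vscale dminus dplus \<longleftrightarrow>
     p \<in> A \<rightarrow> B \<and> vector_bundle V B q zer vadd vscale \<and>
     (\<forall>b\<in>B. let Ab = {a \<in> A. p a = b}; Vb = {v \<in> V. q v = b} in
        (\<forall>a\<in>Ab. \<forall>a'\<in>Ab. dminus a a' \<in> Vb) \<and>
        (\<forall>v\<in>Vb. \<forall>a\<in>Ab. dplus v a \<in> Ab) \<and>
        (\<forall>a\<in>Ab. \<forall>a'\<in>Ab. dplus (dminus a a') a' = a) \<and>
        (\<forall>v\<in>Vb. \<forall>a\<in>Ab. dminus (dplus v a) a = v) \<and>
        (\<forall>a\<in>Ab. dplus (zer b) a = a) \<and>
        (\<forall>v\<in>Vb. \<forall>w\<in>Vb. \<forall>a\<in>Ab. dplus v (dplus w a) = dplus (vadd v w) a))"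

text \<open>The fibre product of the \<open>n\<close>-jets and the \<open>(n+1)\<close>-forms over \<open>E\<close>, as a bundle over the \<open>n\<close>-jets.\<close>

type_synonym ('m, 'e) jet = "'e \<times> ('m, 'e) tmap"

definition jet_forms ::
  "'e fspace \<Rightarrow> 'm fspace \<Rightarrow> ('e \<Rightarrow> 'm) \<Rightarrow> nat \<Rightarrow> (('m, 'e) jet \<times> ('m, 'e) jet) set" where
  "jet_forms E M \<pi> n = {(j, f). j \<in> jets E M \<pi> n \<and> f \<in> forms E M \<pi> (Suc n) \<and> fst j = fst f}"

definition jf_zero ::
  "'e fspace \<Rightarrow> 'm fspace \<Rightarrow> ('e \<Rightarrow> 'm) \<Rightarrow> nat \<Rightarrow> ('m, 'e) jet \<Rightarrow> ('m, 'e) jet \<times> ('m, 'e) jet" where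
  "jf_zero E M \<pi> n j = (j, (fst j, form_zero E M \<pi> (Suc n) (fst j)))"

definition jf_add ::
  "'e fspace \<Rightarrow> 'm fspace \<Rightarrow> ('e \<Rightarrow> 'm) \<Rightarrow> nat \<Rightarrow> ('m, 'e) jet \<times> ('m, 'e) jet \<Rightarrow>
     ('m, 'e) jet \<times> ('m, 'e) jet \<Rightarrow> ('m, 'e) jet \<times> ('m, 'e) jet" where
  "jf_add E M \<pi> n = (\<lambda>(j, (x, \<omega>)) (j', (x', \<omega>')). (j, (x, form_add E M \<pi> (Suc n) x \<omega> \<omega>')))"

definition jf_scale ::
  "'e fspace \<Rightarrow> 'm fspace \<Rightarrow> ('e \<Rightarrow> 'm) \<Rightarrow> nat \<Rightarrow> real \<Rightarrow>
     ('m, 'e) jet \<times> ('m, 'e) jet \<Rightarrow> ('m, 'e) jet \<times> ('m, 'e) jet" where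
  "jf_scale E M \<pi> n \<alpha> = (\<lambda>(j, (x, \<omega>)). (j, (x, form_scale E M \<pi> (Suc n) x \<alpha> \<omega>)))"

definition jet_diff ::
  "'e fspace \<Rightarrow> 'm fspace \<Rightarrow> ('e \<Rightarrow> 'm) \<Rightarrow> nat \<Rightarrow> ('m, 'e) jet \<Rightarrow> ('m, 'e) jet \<Rightarrow>
     ('m, 'e) jet \<times> ('m, 'e) jet" where
  "jet_diff E M \<pi> n = (\<lambda>(x, Tp) (x', Tm).
     (jet_proj E M \<pi> n (x, Tp), (x, tang_diff E M \<pi> (Suc n) x Tp Tm)))"

definition jet_add ::
  "'e fspace \<Rightarrow> 'm fspace \<Rightarrow> ('e \<Rightarrow> 'm) \<Rightarrow> nat \<Rightarrow> ('m, 'e) jet \<times> ('m, 'e) jet \<Rightarrow>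
     ('m, 'e) jet \<Rightarrow> ('m, 'e) jet" where
  "jet_add E M \<pi> n = (\<lambda>(j, (x, \<omega>)) (x', T). (x, tang_add E M \<pi> (Suc n) x \<omega> T))"

end

theory Submission
  imports Defs
begin

text \<open>
  The infinitesimal objects involved are all of the form \<open>D^N \<oplus> D \<oplus> ... \<oplus> D\<close>. By Taylor's formula,
  with Hadamard's lemma for the remainder, their algebras have a basis of squarefree monomials, and a
  function lies in the defining ideal iff its Taylor coefficients at these monomials vanish. This makes
  two cones of Weil algebras explicit limits: \<open>D^N \<oplus> D \<oplus> ... \<oplus> D\<close> is glued from \<open>D^N\<close> and copies of
  \<open>D\<close> at the origin, and \<open>D^N \<oplus> D\<close> from two copies of \<open>D^N\<close> along the faces \<open>d_i = 0\<close>. Microlinearity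
  turns them into unique fillers for the strong operations, natural and smooth in their data. The fillers
  of strong difference and strong addition are the same objects read in two ways, so each operation
  undoes the other; associativity is read off a filler over \<open>D^N \<oplus> D \<oplus> D\<close>; the sum of tangent vectors
  is the strong addition for \<open>N = 1\<close>. Two tangentials with the same projection agree on the last face by
  homogeneity and then on all faces by symmetry, which makes their strong difference defined.
\<close>

section \<open>Calculus on \<open>R^k\<close>\<close>

text \<open>The ideals are generated inside all of C^\<infinity>(R^k), so deciding membership takes
  two arguments: Hadamard quotients place a remainder in the ideal, and coefficient functionals,
  tested on all multiples of a function, keep everything else out. Each d_i^2 is a generator, so
  only squarefree coefficients count and they can be computed one coordinate at a time. Compositions
  are handled through smooth maps between the spaces R^k that respect the ideals. A limit of
  Froelicher spaces has as curves the families that are curves on every leg. Fillers of curves of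
  data are therefore curves, and smoothness of the new tangentials and forms is tested on curves
  throughout. The same view settles the homothety condition over D_m: a D_m-family of scalings is
  the class of a curve of real scalings. Agreement on D{N}_{N-1} is expressed by the N faces d_i =
  0, which scalings by 0 can reach.\<close>

lemma Rn_upd: "x \<in> Rn k \<Longrightarrow> i < k \<Longrightarrow> x(i := t) \<in> Rn k"
  by (auto simp: Rn_def)

lemma Rn_zero [simp]: "(\<lambda>i. 0) \<in> Rn k"
  by (simp add: Rn_def)

lemma Cr_cong:
  "(\<And>x. x \<in> Rn k \<Longrightarrow> f x = g x) \<Longrightarrow> Cr r k f \<longleftrightarrow> Cr r k g"
proof (cases r)
  case 0
  assume "\<And>x. x \<in> Rn k \<Longrightarrow> f x = g x"
  then show ?thesis using 0 by (auto intro: continuous_on_eq)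
next
  case (Suc r')
  assume eq: "\<And>x. x \<in> Rn k \<Longrightarrow> f x = g x"
  have "(\<lambda>t. f (x(i := t))) = (\<lambda>t. g (x(i := t)))" if "x \<in> Rn k" "i < k" for x i
    using eq that by (auto simp: Rn_upd)
  moreover have "continuous_on (Rn k) f \<longleftrightarrow> continuous_on (Rn k) g"
    using eq by (auto intro: continuous_on_eq)
  ultimately show ?thesis using Suc by auto
qed

lemma Cinf_cong:
  "(\<And>x. x \<in> Rn k \<Longrightarrow> f x = g x) \<Longrightarrow> Cinf k f \<longleftrightarrow> Cinf k g"
  unfolding Cinf_def using Cr_cong by blast

lemma Cr_Suc_D: "Cr (Suc r) k f \<Longrightarrow> Cr r k f"
  by (induction r arbitrary: f) (force, metis Cr.simps(2))

lemma Cr_continuous: "Cr r k f \<Longrightarrow> continuous_on (Rn k) f"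
  by (cases r) auto

lemma Cr_SucI:
  assumes "continuous_on (Rn k) f" "\<And>i. i < k \<Longrightarrow> Cr r k (f' i)"
    "\<And>i x. i < k \<Longrightarrow> x \<in> Rn k \<Longrightarrow> ((\<lambda>t. f (x(i := t))) has_real_derivative f' i x) (at (x i))"
  shows "Cr (Suc r) k f"
  using assms by auto

lemma Cr_SucE:
  assumes "Cr (Suc r) k f"
  obtains f' where "\<And>i. i < k \<Longrightarrow> Cr r k (f' i)"
    "\<And>i x. i < k \<Longrightarrow> x \<in> Rn k \<Longrightarrow> ((\<lambda>t. f (x(i := t))) has_real_derivative f' i x) (at (x i))"
proof -
  from assms have "\<forall>i. \<exists>f'. i < k \<longrightarrow> Cr r k f' \<and>
        (\<forall>x\<in>Rn k. ((\<lambda>t. f (x(i := t))) has_real_derivative f' x) (at (x i)))"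
    by auto
  then show ?thesis using that by metis
qed

declare Cr.simps(2) [simp del]

lemma Cr_const: "Cr r k (\<lambda>x. c)"
  by (induction r arbitrary: c) (auto intro!: Cr_SucI[where f' = "\<lambda>i x. 0"])

lemma Cr_coord: "Cr r k (\<lambda>x. x i)"
proof (cases r)
  case (Suc r')
  have "((\<lambda>t. (x(j := t)) i) has_real_derivative (if i = j then 1 else 0)) (at (x j))" for x :: vec and j
    by auto
  then show ?thesis unfolding Suc
    by (intro Cr_SucI[where f' = "\<lambda>j x. if i = j then 1 else 0"] Cr_const)
      (auto intro: continuous_on_subset[OF continuous_on_product_coordinates])
qed (auto intro: continuous_on_subset[OF continuous_on_product_coordinates])

lemma Cr_add: "Cr r k f \<Longrightarrow> Cr r k g \<Longrightarrow> Cr r k (\<lambda>x. f x + g x)"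
proof (induction r arbitrary: f g)
  case (Suc r)
  obtain f' where f': "\<And>i. i < k \<Longrightarrow> Cr r k (f' i)"
    "\<And>i x. i < k \<Longrightarrow> x \<in> Rn k \<Longrightarrow> ((\<lambda>t. f (x(i := t))) has_real_derivative f' i x) (at (x i))"
    using Cr_SucE[OF Suc.prems(1)] by blast
  obtain g' where g': "\<And>i. i < k \<Longrightarrow> Cr r k (g' i)"
    "\<And>i x. i < k \<Longrightarrow> x \<in> Rn k \<Longrightarrow> ((\<lambda>t. g (x(i := t))) has_real_derivative g' i x) (at (x i))"
    using Cr_SucE[OF Suc.prems(2)] by blast
  show ?case
  proof (rule Cr_SucI[where f' = "\<lambda>i x. f' i x + g' i x"])
    show "continuous_on (Rn k) (\<lambda>x. f x + g x)"
      using Suc.prems by (intro continuous_on_add) (auto dest: Cr_continuous)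
    show "Cr r k (\<lambda>x. f' i x + g' i x)" if "i < k" for i
      by (intro Suc.IH f' g' that)
    show "((\<lambda>t. f (x(i := t)) + g (x(i := t))) has_real_derivative f' i x + g' i x) (at (x i))"
      if "i < k" "x \<in> Rn k" for i x
      by (rule DERIV_add[OF f'(2)[OF that] g'(2)[OF that]])
  qed
qed (auto intro: continuous_intros)

lemma Cr_mult: "Cr r k f \<Longrightarrow> Cr r k g \<Longrightarrow> Cr r k (\<lambda>x. f x * g x)"
proof (induction r arbitrary: f g)
  case (Suc r)
  obtain f' where f': "\<And>i. i < k \<Longrightarrow> Cr r k (f' i)"
    "\<And>i x. i < k \<Longrightarrow> x \<in> Rn k \<Longrightarrow> ((\<lambda>t. f (x(i := t))) has_real_derivative f' i x) (at (x i))"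
    using Cr_SucE[OF Suc.prems(1)] by blast
  obtain g' where g': "\<And>i. i < k \<Longrightarrow> Cr r k (g' i)"
    "\<And>i x. i < k \<Longrightarrow> x \<in> Rn k \<Longrightarrow> ((\<lambda>t. g (x(i := t))) has_real_derivative g' i x) (at (x i))"
    using Cr_SucE[OF Suc.prems(2)] by blast
  have fr: "Cr r k f" "Cr r k g" using Suc.prems by (auto dest: Cr_Suc_D)
  show ?case
  proof (rule Cr_SucI[where f' = "\<lambda>i x. f' i x * g x + g' i x * f x"])
    show "continuous_on (Rn k) (\<lambda>x. f x * g x)"
      using Suc.prems by (intro continuous_on_mult) (auto dest: Cr_continuous)
    show "Cr r k (\<lambda>x. f' i x * g x + g' i x * f x)" if "i < k" for i
      by (intro Cr_add Suc.IH f' g' fr that)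
    show "((\<lambda>t. f (x(i := t)) * g (x(i := t))) has_real_derivative f' i x * g x + g' i x * f x) (at (x i))"
      if "i < k" "x \<in> Rn k" for i x
      using DERIV_mult[OF f'(2)[OF that] g'(2)[OF that]] by simp
  qed
qed (auto intro: continuous_intros)

lemma Cr_sum: "(\<And>i. i \<in> A \<Longrightarrow> Cr r k (f i)) \<Longrightarrow> Cr r k (\<lambda>x. \<Sum>i\<in>A. f i x)"
  by (induction A rule: infinite_finite_induct) (auto simp: Cr_const Cr_add)

text \<open>\<open>vec\<close> carries the product topology, where convergence is coordinatewise in
  terms of \<open>limitin\<close>; this brings the fact back to the filter notation of the
  derivative lemmas.\<close>

lemma tendsto_vec:
  fixes g :: "'b \<Rightarrow> vec"
  assumes "\<And>i. ((\<lambda>t. g t i) \<longlongrightarrow> l i) F"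
  shows "(g \<longlongrightarrow> l) F"
proof -
  have "limitin (product_topology (\<lambda>i. euclidean) UNIV) g l F"
    using assms by (subst limitin_componentwise) auto
  then show ?thesis
    by (simp add: euclidean_product_topology)
qed

text \<open>The intermediate point is only bounded by |s - c| \<le> |b - c|. This covers
  \<open>b = c\<close> as well and is all that a limit argument needs: \<open>s\<close> tends to
  \<open>c\<close> when \<open>b\<close> does.\<close>

lemma coordinate_MVT:
  assumes der: "\<And>x. x \<in> Rn k \<Longrightarrow> ((\<lambda>t. h (x(i := t))) has_real_derivative h' x) (at (x i))"
    and "u \<in> Rn k" "i < k"
  shows "\<exists>s. h (u(i := b)) - h (u(i := c)) = (b - c) * h' (u(i := s)) \<and> \<bar>s - c\<bar> \<le> \<bar>b - c\<bar>"
proof -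
  have d: "((\<lambda>t. h (u(i := t))) has_real_derivative h' (u(i := s))) (at s)" for s
    using der[of "u(i := s)"] assms(2,3) by (simp add: Rn_upd)
  consider "b = c" | "c < b" | "b < c" by linarith
  then show ?thesis
  proof cases
    case 2
    then show ?thesis using MVT2[OF 2 d] by fastforce
  next
    case 3
    from MVT2[OF 3 d] obtain s where "b < s" "s < c"
      "h (u(i := c)) - h (u(i := b)) = (c - b) * h' (u(i := s))" by blast
    then show ?thesis by (intro exI[of _ s]) (auto simp: algebra_simps)
  qed auto
qed

text \<open>
  The increment of \<open>h\<close> is telescoped over the coordinates; the mean value theorem and
  Caratheodory's characterisation of the derivative apply to each summand.
\<close>

lemma curve_chain_rule:
  assumes der: "\<And>i x. i < k \<Longrightarrow> x \<in> Rn k \<Longrightarrow>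
      ((\<lambda>t. h (x(i := t))) has_real_derivative h' i x) (at (x i))"
    and cont: "\<And>i. i < k \<Longrightarrow> continuous_on (Rn k) (h' i)"
    and y: "\<And>t. y t \<in> Rn k"
    and dy: "\<And>i. i < k \<Longrightarrow> ((\<lambda>t. y t i) has_real_derivative d i) (at a)"
  shows "((\<lambda>t. h (y t)) has_real_derivative (\<Sum>i<k. h' i (y a) * d i)) (at a)"
proof -
  \<comment> \<open>Moves from \<open>y a\<close> at \<open>j = 0\<close> to \<open>y t\<close> at
    \<open>j = k\<close>, one coordinate at a time.\<close>
  define z where "z j t = (\<lambda>i. if i < j then y t i else y a i)" for j t
  have z_Rn: "z j t \<in> Rn k" for j t
    using y[of t] y[of a] by (auto simp: Rn_def z_def)
  have z_Suc: "z (Suc j) t = (z j t)(j := y t j)" and z_same: "z j t = (z j t)(j := y a j)" for j t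
    by (auto simp: z_def)
  have "\<forall>j. \<exists>g. j < k \<longrightarrow> (\<forall>t. y t j - y a j = g t * (t - a)) \<and> isCont g a \<and> g a = d j"
    using dy unfolding CARAT_DERIV by blast
  then obtain g where g: "\<And>j t. j < k \<Longrightarrow> y t j - y a j = g j t * (t - a)"
    "\<And>j. j < k \<Longrightarrow> isCont (g j) a" "\<And>j. j < k \<Longrightarrow> g j a = d j" by metis
  have "\<forall>j t. \<exists>s. j < k \<longrightarrow> h (z (Suc j) t) - h (z j t) = (y t j - y a j) * h' j ((z j t)(j := s))
      \<and> \<bar>s - y a j\<bar> \<le> \<bar>y t j - y a j\<bar>"
  proof (intro allI)
    fix j t
    show "\<exists>s. j < k \<longrightarrow> h (z (Suc j) t) - h (z j t) = (y t j - y a j) * h' j ((z j t)(j := s))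
      \<and> \<bar>s - y a j\<bar> \<le> \<bar>y t j - y a j\<bar>"
    proof (cases "j < k")
      case True
      have "h (z j t) = h ((z j t)(j := y a j))" using z_same by simp
      then show ?thesis
        using coordinate_MVT[where u = "z j t" and b = "y t j" and c = "y a j", OF der[OF True] z_Rn True]
        unfolding z_Suc by metis
    qed simp
  qed
  then obtain s where s: "\<And>j t. j < k \<Longrightarrow>
      h (z (Suc j) t) - h (z j t) = (y t j - y a j) * h' j ((z j t)(j := s j t))"
    "\<And>j t. j < k \<Longrightarrow> \<bar>s j t - y a j\<bar> \<le> \<bar>y t j - y a j\<bar>" by metis
  \<comment> \<open>\<open>G\<close> is the Caratheodory slope of the composite at \<open>a\<close>:
    coordinate slopes times partial derivatives at intermediate points. Its continuity at
    \<open>a\<close> is the chain rule.\<close>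
  define G where "G t = (\<Sum>j<k. g j t * h' j ((z j t)(j := s j t)))" for t
  have z_k: "z k t = y t" and z_0: "z 0 t = y a" for t
    using y[of t] y[of a] by (auto simp: z_def Rn_def fun_eq_iff)
  have "h (y t) - h (y a) = G t * (t - a)" for t
  proof -
    have "h (y t) - h (y a) = (\<Sum>j<k. h (z (Suc j) t) - h (z j t))"
      using sum_lessThan_telescope[of "\<lambda>j. h (z j t)" k] by (simp add: z_k z_0)
    also have "\<dots> = G t * (t - a)"
      unfolding G_def sum_distrib_right by (rule sum.cong) (auto simp: s g)
    finally show ?thesis .
  qed
  moreover have tend: "((\<lambda>t. h' j ((z j t)(j := s j t))) \<longlongrightarrow> h' j (y a)) (at a)" if j: "j < k" for j
  proof (rule continuous_on_tendsto_compose[OF cont[OF j]])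
    have yt: "((\<lambda>t. y t i) \<longlongrightarrow> y a i) (at a)" for i
    proof (cases "i < k")
      case True
      then show ?thesis using DERIV_isCont[OF dy[OF True]] by (simp add: isCont_def)
    next
      case False
      then have "y t i = 0" for t using y[of t] by (simp add: Rn_def)
      then show ?thesis by simp
    qed
    have st: "((\<lambda>t. s j t) \<longlongrightarrow> y a j) (at a)"
    proof -
      have "((\<lambda>t. \<bar>y t j - y a j\<bar>) \<longlongrightarrow> 0) (at a)"
        using yt[of j] by (simp add: LIM_zero tendsto_rabs_zero)
      then have "((\<lambda>t. s j t - y a j) \<longlongrightarrow> 0) (at a)"
        by (rule Lim_null_comparison[rotated]) (use s(2)[OF j] in auto)
      then show ?thesis by (simp add: LIM_zero_iff)
    qed
    show "((\<lambda>t. (z j t)(j := s j t)) \<longlongrightarrow> y a) (at a)"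
    proof (rule tendsto_vec)
      fix i show "((\<lambda>t. ((z j t)(j := s j t)) i) \<longlongrightarrow> y a i) (at a)"
        using yt[of i] st by (cases "i = j"; cases "i < j") (auto simp: z_def)
    qed
    show "\<forall>\<^sub>F t in at a. (z j t)(j := s j t) \<in> Rn k"
      using z_Rn j by (simp add: Rn_upd)
  qed (rule y)
  moreover have eq: "G a = (\<Sum>i<k. h' i (y a) * d i)"
    unfolding G_def
  proof (rule sum.cong, simp)
    fix j assume "j \<in> {..<k}"
    then have j: "j < k" by simp
    have "s j a = y a j" using s(2)[OF j, of a] by simp
    then have "(z j a)(j := s j a) = y a" by (auto simp: z_def)
    then show "g j a * h' j ((z j a)(j := s j a)) = h' j (y a) * d j"
      by (simp add: g j)
  qed
  moreover have "isCont G a"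
  proof -
    have "(G \<longlongrightarrow> (\<Sum>j<k. d j * h' j (y a))) (at a)"
      unfolding G_def
    proof (intro tendsto_sum tendsto_mult)
      fix j assume "j \<in> {..<k}"
      then have j: "j < k" by simp
      show "(g j \<longlongrightarrow> d j) (at a)" using g(2,3)[OF j] by (auto simp: isCont_def)
      show "((\<lambda>t. h' j ((z j t)(j := s j t))) \<longlongrightarrow> h' j (y a)) (at a)" by (rule tend[OF j])
    qed
    then show ?thesis by (simp add: isCont_def eq mult.commute)
  qed
  ultimately show ?thesis unfolding CARAT_DERIV by blast
qed

text \<open>Differentiation replaces \<open>h\<close> by its partial derivatives and leaves
  \<open>f\<close> in place, so the induction on \<open>r\<close> generalises over \<open>h\<close>
  only. The derivatives of the coordinates of \<open>f\<close> enter as factors through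
  \<open>Cr_mult\<close>.\<close>

lemma Cr_compose:
  assumes "Cr r k h" "\<And>i. i < k \<Longrightarrow> Cr r l (\<lambda>x. f x i)" "f \<in> Rn l \<rightarrow> Rn k"
  shows "Cr r l (\<lambda>x. h (f x))"
  using assms
proof (induction r arbitrary: h)
  case 0
  have "continuous_on (Rn l) (\<lambda>x. f x i)" for i
  proof (cases "i < k")
    case False
    then have "f x i = 0" if "x \<in> Rn l" for x using 0(3) that by (auto simp: Rn_def Pi_def)
    then show ?thesis by (simp cong: continuous_on_cong)
  qed (use 0 in auto)
  then have "continuous_on (Rn l) f"
    by (rule continuous_on_coordinatewise_then_product)
  then show ?case
    using 0 by (auto intro!: continuous_on_compose2[of "Rn k" h])
next
  case (Suc r)
  obtain h' where h': "\<And>i. i < k \<Longrightarrow> Cr r k (h' i)"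
    "\<And>i x. i < k \<Longrightarrow> x \<in> Rn k \<Longrightarrow> ((\<lambda>t. h (x(i := t))) has_real_derivative h' i x) (at (x i))"
    using Cr_SucE[OF Suc.prems(1)] by blast
  have "\<forall>i. \<exists>f'. i < k \<longrightarrow> (\<forall>j<l. Cr r l (f' j)) \<and> (\<forall>j<l. \<forall>x\<in>Rn l.
      ((\<lambda>t. f (x(j := t)) i) has_real_derivative f' j x) (at (x j)))"
  proof
    fix i
    show "\<exists>f'. i < k \<longrightarrow> (\<forall>j<l. Cr r l (f' j)) \<and> (\<forall>j<l. \<forall>x\<in>Rn l.
      ((\<lambda>t. f (x(j := t)) i) has_real_derivative f' j x) (at (x j)))"
    proof (cases "i < k")
      case True
      obtain F where "\<And>j. j < l \<Longrightarrow> Cr r l (F j)" "\<And>j x. j < l \<Longrightarrow> x \<in> Rn l \<Longrightarrow>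
          ((\<lambda>t. f (x(j := t)) i) has_real_derivative F j x) (at (x j))"
        using Cr_SucE[OF Suc.prems(2)[OF True]] by blast
      then show ?thesis by (intro exI[of _ F]) auto
    qed simp
  qed
  then obtain f' where f': "\<And>i j. i < k \<Longrightarrow> j < l \<Longrightarrow> Cr r l (f' i j)"
    "\<And>i j x. i < k \<Longrightarrow> j < l \<Longrightarrow> x \<in> Rn l \<Longrightarrow>
      ((\<lambda>t. f (x(j := t)) i) has_real_derivative f' i j x) (at (x j))" by metis
  have fr: "Cr r l (\<lambda>x. f x i)" if "i < k" for i
    using Suc.prems(2)[OF that] by (rule Cr_Suc_D)
  show ?case
  proof (rule Cr_SucI[where f' = "\<lambda>j x. \<Sum>i<k. h' i (f x) * f' i j x"])
    show "continuous_on (Rn l) (\<lambda>x. h (f x))"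
      by (rule Cr_continuous[OF Suc.IH[OF Cr_Suc_D[OF Suc.prems(1)] fr Suc.prems(3)]])
    show "Cr r l (\<lambda>x. \<Sum>i<k. h' i (f x) * f' i j x)" if "j < l" for j
    proof (rule Cr_sum)
      fix i assume "i \<in> {..<k}"
      then have i: "i < k" by simp
      show "Cr r l (\<lambda>x. h' i (f x) * f' i j x)"
        by (rule Cr_mult[OF Suc.IH[OF h'(1)[OF i] fr Suc.prems(3)] f'(1)[OF i that]])
    qed
    fix j x assume j: "j < l" and x: "x \<in> Rn l"
    have mem: "f (x(j := t)) \<in> Rn k" for t
      by (rule funcset_mem[OF Suc.prems(3) Rn_upd[OF x j]])
    have "((\<lambda>t. f (x(j := t)) i) has_real_derivative f' i j x) (at (x j))" if "i < k" for i
      using f'(2)[OF that j x] .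
    from curve_chain_rule[OF h'(2) Cr_continuous[OF h'(1)] mem this]
    show "((\<lambda>t. h (f (x(j := t)))) has_real_derivative (\<Sum>i<k. h' i (f x) * f' i j x)) (at (x j))"
      by simp
  qed
qed

lemma Cinf_const [simp, intro]: "Cinf k (\<lambda>x. c)"
  by (simp add: Cinf_def Cr_const)

lemma Cinf_coord [simp, intro]: "Cinf k (\<lambda>x. x i)"
  by (simp add: Cinf_def Cr_coord)

lemma Cinf_add [intro]: "Cinf k f \<Longrightarrow> Cinf k g \<Longrightarrow> Cinf k (\<lambda>x. f x + g x)"
  by (simp add: Cinf_def Cr_add)

lemma Cinf_mult [intro]: "Cinf k f \<Longrightarrow> Cinf k g \<Longrightarrow> Cinf k (\<lambda>x. f x * g x)"
  by (simp add: Cinf_def Cr_mult)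

lemma Cinf_sum: "(\<And>i. i \<in> A \<Longrightarrow> Cinf k (f i)) \<Longrightarrow> Cinf k (\<lambda>x. \<Sum>i\<in>A. f i x)"
  by (simp add: Cinf_def Cr_sum)

lemma Cinf_prod: "(\<And>i. i \<in> A \<Longrightarrow> Cinf k (f i)) \<Longrightarrow> Cinf k (\<lambda>x. \<Prod>i\<in>A. f i x)"
  by (induction A rule: infinite_finite_induct) auto

lemma Cinf_diff [intro]:
  assumes "Cinf k f" "Cinf k g" shows "Cinf k (\<lambda>x. f x - g x)"
proof -
  have "Cinf k (\<lambda>x. f x + (-1) * g x)" by (rule Cinf_add Cinf_mult Cinf_const assms)+
  then show ?thesis by simp
qed

lemma Cinf_compose:
  assumes "Cinf k h" "\<And>i. i < k \<Longrightarrow> Cinf l (\<lambda>x. f x i)" "f \<in> Rn l \<rightarrow> Rn k"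
  shows "Cinf l (\<lambda>x. h (f x))"
  using assms Cr_compose unfolding Cinf_def by blast

definition partial :: "nat \<Rightarrow> (vec \<Rightarrow> real) \<Rightarrow> vec \<Rightarrow> real" where
  "partial i f x = deriv (\<lambda>t. f (x(i := t))) (x i)"

text \<open>\<open>Cr (Suc r)\<close> provides a derivative that may depend on \<open>r\<close>.
  Uniqueness of derivatives makes all of them equal to \<open>partial i f\<close> on
  \<open>Rn k\<close>, which is therefore of every class at once.\<close>

lemma Cinf_partial:
  assumes f: "Cinf k f" and i: "i < k"
  shows "Cinf k (partial i f)"
    and "x \<in> Rn k \<Longrightarrow> ((\<lambda>t. f (x(i := t))) has_real_derivative partial i f x) (at (x i))"
proof -
  have *: "\<exists>f'. Cr r k f' \<and> (\<forall>x\<in>Rn k. ((\<lambda>t. f (x(i := t))) has_real_derivative f' x) (at (x i)))" for r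
    using f i Cr.simps(2)[of r k f] unfolding Cinf_def by blast
  show "Cinf k (partial i f)"
    unfolding Cinf_def
  proof
    fix r
    from *[of r] obtain f' where f': "Cr r k f'"
      "\<forall>x\<in>Rn k. ((\<lambda>t. f (x(i := t))) has_real_derivative f' x) (at (x i))" by blast
    then have "partial i f x = f' x" if "x \<in> Rn k" for x
      using that unfolding partial_def by (blast intro: DERIV_imp_deriv)
    then show "Cr r k (partial i f)" using f'(1) Cr_cong by blast
  qed
  assume "x \<in> Rn k"
  with *[of 0] show "((\<lambda>t. f (x(i := t))) has_real_derivative partial i f x) (at (x i))"
    unfolding partial_def by (metis DERIV_imp_deriv)
qed

lemma partial_cong:
  assumes "\<And>x. x \<in> Rn k \<Longrightarrow> f x = g x" "i < k" "x \<in> Rn k"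
  shows "partial i f x = partial i g x"
proof -
  have "(\<lambda>t. f (x(i := t))) = (\<lambda>t. g (x(i := t)))"
    using assms by (auto simp: Rn_upd)
  then show ?thesis by (simp add: partial_def)
qed

section \<open>Differentiation under the integral sign and Hadamard's lemma\<close>

lemma continuous_on_scaled_coordinate:
  assumes "continuous_on (Rn k) f" "i < k"
  shows "continuous_on (Rn k \<times> cbox 0 1) (\<lambda>(x, s). s ^ a * f (x(i := s * x i)))"
proof -
  have "continuous_on (Rn k \<times> cbox 0 1) (\<lambda>p. (fst p)(i := snd p * fst p i) :: vec)"
  proof (rule continuous_on_coordinatewise_then_product)
    have c: "continuous_on A (\<lambda>p. fst p j :: real)" for j and A :: "(vec \<times> real) set"
      by (rule continuous_on_compose2[OF continuous_on_product_coordinates])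
        (auto intro: continuous_intros)
    show "continuous_on (Rn k \<times> cbox 0 1) (\<lambda>p. ((fst p)(i := snd p * fst p i)) j)" for j
      by (cases "j = i") (auto intro!: continuous_intros c)
  qed
  then have "continuous_on (Rn k \<times> cbox 0 1) (\<lambda>p. f ((fst p)(i := snd p * fst p i)))"
    by (rule continuous_on_compose2[OF assms(1)]) (auto simp: Rn_upd assms(2))
  then show ?thesis
    by (auto simp: case_prod_unfold intro!: continuous_intros)
qed

text \<open>The weight \<open>s ^ a\<close> makes the statement inductive: differentiating in
  direction \<open>i\<close> produces a factor \<open>s\<close> and raises \<open>a\<close> by one,
  every other direction keeps \<open>a\<close>. In both cases a partial derivative of
  \<open>f\<close> takes the place of \<open>f\<close>.\<close>

lemma Cr_integral_scaled:
  assumes "Cinf k f" "i < k"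
  shows "Cr r k (\<lambda>x. integral (cbox 0 1) (\<lambda>s. s ^ a * f (x(i := s * x i))))"
  using assms(1)
proof (induction r arbitrary: f a)
  case 0
  then have "continuous_on (Rn k) f" by (auto simp: Cinf_def dest: Cr_continuous)
  from integral_continuous_on_param[OF continuous_on_scaled_coordinate[OF this assms(2)]]
  show ?case unfolding Cr.simps(1) .
next
  case (Suc r)
  have cont: "continuous_on (Rn k) g" if "Cinf k g" for g
    using that by (auto simp: Cinf_def dest: Cr_continuous)
  show ?case
  proof (rule Cr_SucI[where f' = "\<lambda>j x. integral (cbox 0 1)
        (\<lambda>s. s ^ (if j = i then Suc a else a) * partial j f (x(i := s * x i)))"])
    show "continuous_on (Rn k) (\<lambda>x. integral (cbox 0 1) (\<lambda>s. s ^ a * f (x(i := s * x i))))"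
      by (rule integral_continuous_on_param continuous_on_scaled_coordinate cont Suc.prems assms(2))+
    show "Cr r k (\<lambda>x. integral (cbox 0 1)
        (\<lambda>s. s ^ (if j = i then Suc a else a) * partial j f (x(i := s * x i))))" if "j < k" for j
      using that by (intro Suc.IH Cinf_partial Suc.prems)
    fix j x assume j: "j < k" and x: "x \<in> Rn k"
    let ?e = "if j = i then Suc a else a"
    have cont_line: "continuous_on A (\<lambda>p. x(j := fst p) :: vec)" for A :: "(real \<times> real) set"
    proof (rule continuous_on_coordinatewise_then_product)
      show "continuous_on A (\<lambda>p. (x(j := fst p)) l)" for l
        by (cases "l = j") (auto intro!: continuous_intros)
    qed
    have "((\<lambda>t. integral (cbox 0 1) (\<lambda>s. s ^ a * f ((x(j := t))(i := s * (x(j := t)) i))))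
        has_field_derivative integral (cbox 0 1)
          (\<lambda>s. s ^ ?e * partial j f ((x(j := x j))(i := s * (x(j := x j)) i)))) (at (x j) within UNIV)"
    proof (rule leibniz_rule_field_derivative[where fx = "\<lambda>t s. s ^ ?e * partial j f ((x(j := t))(i := s * (x(j := t)) i))"])
      fix t s :: real
      have mem: "(x(j := t))(i := s * (x(j := t)) i) \<in> Rn k"
        using x j assms(2) by (intro Rn_upd)
      show "((\<lambda>t. s ^ a * f ((x(j := t))(i := s * (x(j := t)) i))) has_field_derivative
          s ^ ?e * partial j f ((x(j := t))(i := s * (x(j := t)) i))) (at t within UNIV)"
      proof (cases "j = i")
        case True
        have "((\<lambda>u. f (x(j := u))) has_real_derivative partial j f (x(j := s * t))) (at (s * t))"
          using Cinf_partial(2)[OF Suc.prems j Rn_upd[OF x j, of "s * t"]] by (simp only: fun_upd_upd fun_upd_same)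
        then have "((\<lambda>u. f (x(j := s * u))) has_real_derivative partial j f (x(j := s * t)) * s) (at t)"
          by (rule DERIV_chain2) (auto intro!: derivative_eq_intros)
        then have "((\<lambda>u. s ^ a * f (x(j := s * u))) has_real_derivative s ^ a * (partial j f (x(j := s * t)) * s)) (at t)"
          by (rule DERIV_cmult)
        then show ?thesis using True by (simp add: ac_simps)
      next
        case False
        have "((\<lambda>u. f ((x(i := s * x i))(j := u))) has_real_derivative partial j f ((x(i := s * x i))(j := t))) (at t)"
          using Cinf_partial(2)[OF Suc.prems j Rn_upd[OF Rn_upd[OF x assms(2)] j, of "s * x i" t]] by (simp only: fun_upd_upd fun_upd_same)
        then show ?thesis using False by (auto simp: fun_upd_twist intro: DERIV_cmult)
      qed
    next
      fix t :: real
      have "x(j := t) \<in> Rn k" using x j by (rule Rn_upd)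
      then have "continuous_on (cbox 0 1) (\<lambda>s. (\<lambda>(x, s). s ^ a * f (x(i := s * x i))) (x(j := t), s))"
        by (intro continuous_on_compose2[OF continuous_on_scaled_coordinate[OF cont[OF Suc.prems] assms(2)]])
          (auto intro!: continuous_intros)
      then show "(\<lambda>s. s ^ a * f ((x(j := t))(i := s * (x(j := t)) i))) integrable_on cbox 0 1"
        by (intro integrable_continuous) simp
    next
      have "continuous_on (UNIV \<times> cbox 0 1)
          (\<lambda>p. (\<lambda>(x, s). s ^ ?e * partial j f (x(i := s * x i))) (x(j := fst p), snd p))"
        by (intro continuous_on_compose2[OF continuous_on_scaled_coordinate[OF cont[OF Cinf_partial(1)[OF Suc.prems j]] assms(2)]])
          (auto intro!: continuous_on_Pair cont_line continuous_on_snd continuous_on_id simp: Rn_upd x j)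
      then show "continuous_on (UNIV \<times> cbox 0 1)
          (\<lambda>(t, s). s ^ ?e * partial j f ((x(j := t))(i := s * (x(j := t)) i)))"
        by (simp add: case_prod_unfold)
    qed auto
    then show "((\<lambda>t. integral (cbox 0 1) (\<lambda>s. s ^ a * f ((x(j := t))(i := s * (x(j := t)) i))))
        has_real_derivative integral (cbox 0 1)
          (\<lambda>s. s ^ ?e * partial j f (x(i := s * x i)))) (at (x j))"
      by simp
  qed
qed

text \<open>The increment from \<open>x(i := 0)\<close> to \<open>x\<close> is the integral of the
  derivative along the segment \<open>x(i := s * x i)\<close>, and the factor \<open>x i\<close>
  splits off.\<close>

lemma Hadamard:
  assumes f: "Cinf k f" and i: "i < k"
  obtains q where "Cinf k q" "\<And>x. x \<in> Rn k \<Longrightarrow> f x = f (x(i := 0)) + x i * q x"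
proof
  \<comment> \<open>The trivial factor \<open>s ^ 0\<close> is kept so that
    \<open>Cr_integral_scaled\<close> applies with \<open>a = 0\<close>.\<close>
  let ?q = "\<lambda>x. integral (cbox 0 1) (\<lambda>s. s ^ 0 * partial i f (x(i := s * x i)))"
  show "Cinf k ?q"
    unfolding Cinf_def by (intro allI Cr_integral_scaled Cinf_partial f i)
  fix x assume x: "x \<in> Rn k"
  have "((\<lambda>s. partial i f (x(i := s * x i)) * x i) has_integral
      f (x(i := 1 * x i)) - f (x(i := 0 * x i))) {0..1}"
  proof (rule fundamental_theorem_of_calculus)
    fix s :: real
    have "((\<lambda>u. f (x(i := u))) has_real_derivative partial i f (x(i := s * x i))) (at (s * x i))"
      using Cinf_partial(2)[OF f i Rn_upd[OF x i, of "s * x i"]] by (simp only: fun_upd_upd fun_upd_same)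
    then have "((\<lambda>s. f (x(i := s * x i))) has_real_derivative partial i f (x(i := s * x i)) * x i) (at s)"
      by (rule DERIV_chain2) (auto intro!: derivative_eq_intros)
    then show "((\<lambda>s. f (x(i := s * x i))) has_vector_derivative partial i f (x(i := s * x i)) * x i)
        (at s within {0..1})"
      by (simp add: has_real_derivative_iff_has_vector_derivative has_vector_derivative_at_within)
  qed simp
  then have "integral {0..1} (\<lambda>s. partial i f (x(i := s * x i)) * x i) = f x - f (x(i := 0))"
    by (auto dest: integral_unique)
  then show "f x = f (x(i := 0)) + x i * ?q x"
    by (simp add: integral_mult_left cbox_interval mult.commute)
qed

section \<open>Ideals of \<open>C^\<infinity>(R^k)\<close>\<close>

text \<open>Elements of \<open>cinf_ring k\<close> are extensional, so each of them is
  \<open>rst k f\<close> for some smooth \<open>f\<close>. Computations are done with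
  \<open>f\<close> and transferred pointwise.\<close>

abbreviation rst :: "nat \<Rightarrow> (vec \<Rightarrow> real) \<Rightarrow> vec \<Rightarrow> real" where
  "rst k f \<equiv> restrict f (Rn k)"

lemma Cinf_restrict [simp]: "Cinf k (rst k f) \<longleftrightarrow> Cinf k f"
  by (rule Cinf_cong) simp

lemma carrier_cinf: "f \<in> carrier (cinf_ring k) \<longleftrightarrow> f \<in> extensional (Rn k) \<and> Cinf k f"
  by (simp add: cinf_ring_def)

lemma restrict_carrier [simp]: "rst k f \<in> carrier (cinf_ring k) \<longleftrightarrow> Cinf k f"
  by (simp add: carrier_cinf)

lemma restrict_eq: "f \<in> carrier (cinf_ring k) \<Longrightarrow> rst k f = f"
  by (simp add: carrier_cinf extensional_restrict)

lemma carrier_cinfE: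
  assumes "f \<in> carrier (cinf_ring k)"
  obtains f' where "f = rst k f'" "Cinf k f'"
  using assms restrict_eq carrier_cinf by metis

lemma rst_eqI: "(\<And>x. x \<in> Rn k \<Longrightarrow> f x = g x) \<Longrightarrow> rst k f = rst k g"
  by (auto simp: restrict_def)

lemma cinf_ring_ops:
  "mult (cinf_ring k) (rst k f) (rst k g) = rst k (\<lambda>x. f x * g x)"
  "add (cinf_ring k) (rst k f) (rst k g) = rst k (\<lambda>x. f x + g x)"
  "one (cinf_ring k) = rst k (\<lambda>x. 1)"
  "zero (cinf_ring k) = rst k (\<lambda>x. 0)"
  by (auto simp: cinf_ring_def intro: rst_eqI)

lemma cring_cinf_ring: "cring (cinf_ring k)"
proof (rule cringI)
  show "abelian_group (cinf_ring k)"
  proof (rule abelian_groupI)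
    fix f assume "f \<in> carrier (cinf_ring k)"
    then obtain f' where f: "f = rst k f'" "Cinf k f'" by (rule carrier_cinfE)
    have "Cinf k (\<lambda>x. (-1) * f' x)" by (intro Cinf_mult Cinf_const f)
    then show "\<exists>g\<in>carrier (cinf_ring k). add (cinf_ring k) g f = zero (cinf_ring k)"
      unfolding f by (intro bexI[of _ "rst k (\<lambda>x. (-1) * f' x)"]) (auto simp: cinf_ring_ops)
  qed (auto simp: cinf_ring_ops algebra_simps Cinf_add elim!: carrier_cinfE intro!: rst_eqI)
  show "comm_monoid (cinf_ring k)"
    by (rule comm_monoidI)
      (auto simp: cinf_ring_ops algebra_simps Cinf_mult elim!: carrier_cinfE intro!: rst_eqI)
qed (auto simp: cinf_ring_ops algebra_simps elim!: carrier_cinfE intro!: rst_eqI)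

interpretation cinf: cring "cinf_ring k" for k
  by (rule cring_cinf_ring)

lemma a_inv_cinf: "Cinf k f \<Longrightarrow> a_inv (cinf_ring k) (rst k f) = rst k (\<lambda>x. - f x)"
proof (rule cinf.minus_equality)
  assume f: "Cinf k f"
  have "Cinf k (\<lambda>x. (-1) * f x)" by (intro Cinf_mult Cinf_const f)
  then show "rst k (\<lambda>x. - f x) \<in> carrier (cinf_ring k)" by simp
qed (auto simp: cinf_ring_ops)

lemma a_minus_cinf: "Cinf k f \<Longrightarrow> Cinf k g \<Longrightarrow>
    a_minus (cinf_ring k) (rst k f) (rst k g) = rst k (\<lambda>x. f x - g x)"
  by (simp add: a_minus_def a_inv_cinf cinf_ring_ops)

lemma ideal_cinf_subset: "ideal I (cinf_ring k) \<Longrightarrow> I \<subseteq> carrier (cinf_ring k)"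
  by (rule additive_subgroup.a_subset[OF ideal.axioms(1)])

lemma ideal_cinf_Cinf: "ideal I (cinf_ring k) \<Longrightarrow> rst k f \<in> I \<Longrightarrow> Cinf k f"
  using ideal_cinf_subset by force

lemma ideal_cinf_zero: "ideal I (cinf_ring k) \<Longrightarrow> rst k (\<lambda>x. 0) \<in> I"
  using additive_subgroup.zero_closed[OF ideal.axioms(1)] by (fastforce simp: cinf_ring_ops)

lemma ideal_cinf_add: "ideal I (cinf_ring k) \<Longrightarrow> rst k f \<in> I \<Longrightarrow> rst k g \<in> I \<Longrightarrow> rst k (\<lambda>x. f x + g x) \<in> I"
  using additive_subgroup.a_closed[OF ideal.axioms(1)] by (fastforce simp flip: cinf_ring_ops)

lemma ideal_cinf_mult: "ideal I (cinf_ring k) \<Longrightarrow> Cinf k q \<Longrightarrow> rst k f \<in> I \<Longrightarrow> rst k (\<lambda>x. q x * f x) \<in> I"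
  using ideal.I_l_closed[of I "cinf_ring k" "rst k f" "rst k q"] by (simp flip: cinf_ring_ops)

lemma ideal_cinf_diff:
  assumes "ideal I (cinf_ring k)" "rst k f \<in> I" "rst k g \<in> I"
  shows "rst k (\<lambda>x. f x - g x) \<in> I"
  using ideal_cinf_add[OF assms(1,2) ideal_cinf_mult[OF assms(1) Cinf_const[of k "-1"] assms(3)]]
  by simp

lemma ideal_cinf_sum:
  assumes "ideal I (cinf_ring k)" "\<And>a. a \<in> A \<Longrightarrow> rst k (f a) \<in> I"
  shows "rst k (\<lambda>x. \<Sum>a\<in>A. f a x) \<in> I"
  using assms(2) by (induction A rule: infinite_finite_induct)
    (auto intro: ideal_cinf_zero ideal_cinf_add assms(1))

text \<open>Negatives come from the multiplier -1. The closure conditions mention only restrictions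
  \<open>rst k f\<close>, so an ideal defined by a property of functions is checked without ring
  notation.\<close>

lemma ideal_cinfI:
  assumes carr: "J \<subseteq> carrier (cinf_ring k)"
    and zero: "rst k (\<lambda>x. 0) \<in> J"
    and add: "\<And>f g. rst k f \<in> J \<Longrightarrow> rst k g \<in> J \<Longrightarrow> rst k (\<lambda>x. f x + g x) \<in> J"
    and mult: "\<And>f q. Cinf k q \<Longrightarrow> rst k f \<in> J \<Longrightarrow> rst k (\<lambda>x. q x * f x) \<in> J"
  shows "ideal J (cinf_ring k)"
proof (rule idealI)
  have el: "\<exists>f'. f = rst k f' \<and> Cinf k f'" if "f \<in> J" for f
    using carr that by (blast elim: carrier_cinfE)
  show "ring (cinf_ring k)" by (rule cinf.ring_axioms)
  show "subgroup J (add_monoid (cinf_ring k))"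
  proof (rule cinf.add.subgroupI)
    fix f assume "f \<in> J"
    with el obtain f' where f: "f = rst k f'" "Cinf k f'" "rst k f' \<in> J" by blast
    have "rst k (\<lambda>x. (-1) * f' x) \<in> J" using mult[OF Cinf_const f(3)] .
    then show "a_inv (cinf_ring k) f \<in> J" using f by (simp add: a_inv_cinf)
    fix g assume "g \<in> J"
    with el obtain g' where g: "g = rst k g'" "rst k g' \<in> J" by blast
    show "add (cinf_ring k) f g \<in> J" using add[OF f(3) g(2)] f g by (simp add: cinf_ring_ops)
  qed (use carr zero in auto)
  fix a q assume "a \<in> J" and q: "q \<in> carrier (cinf_ring k)"
  with el obtain f where f: "a = rst k f" "Cinf k f" "rst k f \<in> J" by blast
  from q obtain q' where q': "q = rst k q'" "Cinf k q'" by (rule carrier_cinfE)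
  show "mult (cinf_ring k) q a \<in> J" using mult[OF q'(2) f(3)] f q' by (simp add: cinf_ring_ops)
  then show "mult (cinf_ring k) a q \<in> J" using f q' by (simp add: cinf_ring_ops mult.commute)
qed

lemma wres_eq_iff:
  assumes "ideal (wideal W) (cinf_ring (wdim W))" "Cinf (wdim W) f" "Cinf (wdim W) g"
  shows "wres W f = wres W g \<longleftrightarrow> rst (wdim W) (\<lambda>x. f x - g x) \<in> wideal W"
  using cinf.quotient_eq_iff_same_a_r_cos[OF assms(1), of "rst (wdim W) f" "rst (wdim W) g"] assms(2,3)
  by (simp add: wres_def a_minus_cinf)

lemma wring_ops:
  assumes "ideal (wideal W) (cinf_ring (wdim W))" "Cinf (wdim W) f" "Cinf (wdim W) g"
  shows "mult (wring W) (wres W f) (wres W g) = wres W (\<lambda>x. f x * g x)"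
    "add (wring W) (wres W f) (wres W g) = wres W (\<lambda>x. f x + g x)"
proof -
  interpret ideal "wideal W" "cinf_ring (wdim W)" by (rule assms(1))
  have "ring_hom_ring (cinf_ring (wdim W)) (wring W) ((+>\<^bsub>cinf_ring (wdim W)\<^esub>) (wideal W))"
    unfolding wring_def by (rule rcos_ring_hom_ring)
  then interpret h: ring_hom_ring "cinf_ring (wdim W)" "wring W" "(+>\<^bsub>cinf_ring (wdim W)\<^esub>) (wideal W)" .
  show "mult (wring W) (wres W f) (wres W g) = wres W (\<lambda>x. f x * g x)"
    "add (wring W) (wres W f) (wres W g) = wres W (\<lambda>x. f x + g x)"
    unfolding wres_def using assms(2,3) by (simp_all flip: h.hom_mult h.hom_add add: cinf_ring_ops)
qed

lemma wring_one_zero: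
  assumes "ideal (wideal W) (cinf_ring (wdim W))"
  shows "one (wring W) = wres W (\<lambda>x. 1)" "zero (wring W) = wres W (\<lambda>x. 0)"
proof -
  interpret ideal "wideal W" "cinf_ring (wdim W)" by (rule assms(1))
  have "ring_hom_ring (cinf_ring (wdim W)) (wring W) ((+>\<^bsub>cinf_ring (wdim W)\<^esub>) (wideal W))"
    unfolding wring_def by (rule rcos_ring_hom_ring)
  then interpret h: ring_hom_ring "cinf_ring (wdim W)" "wring W" "(+>\<^bsub>cinf_ring (wdim W)\<^esub>) (wideal W)" .
  show "one (wring W) = wres W (\<lambda>x. 1)" "zero (wring W) = wres W (\<lambda>x. 0)"
    unfolding wres_def by (simp_all flip: h.hom_one h.hom_zero cinf_ring_ops)
qed

lemma carrier_wring:
  "carrier (wring W) = {wres W f | f. Cinf (wdim W) f}"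
proof -
  have "carrier (wring W) = (\<lambda>f. wideal W +>\<^bsub>cinf_ring (wdim W)\<^esub> f) ` carrier (cinf_ring (wdim W))"
    by (auto simp: wring_def FactRing_def A_RCOSETS_def')
  also have "\<dots> = {wres W f | f. Cinf (wdim W) f}"
    unfolding wres_def by (force elim!: carrier_cinfE)
  finally show ?thesis .
qed


section \<open>Taylor coefficients at the origin\<close>

text \<open>
  \<open>coef S k f\<close> is the coefficient of the squarefree monomial \<open>\<Prod>i\<in>S. x i\<close> in the Taylor expansion
  of \<open>f\<close> at \<open>0\<close>.
\<close>

definition slice :: "nat \<Rightarrow> bool \<Rightarrow> (vec \<Rightarrow> real) \<Rightarrow> vec \<Rightarrow> real" where
  "slice i b f x = (if b then partial i f else f) (x(i := 0))"

primrec coef :: "nat set \<Rightarrow> nat \<Rightarrow> (vec \<Rightarrow> real) \<Rightarrow> real" where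
  "coef S 0 f = f (\<lambda>i. 0)"
| "coef S (Suc j) f = coef S j (slice j (j \<in> S) f)"

lemma Cinf_zero_coordinate:
  assumes "Cinf k f" "i < k" shows "Cinf k (\<lambda>x. f (x(i := 0)))"
proof (rule Cinf_compose[OF assms(1)])
  show "Cinf k (\<lambda>x. (x(i := 0)) j)" for j by (cases "j = i") auto
qed (use assms(2) in \<open>auto simp: Rn_upd\<close>)

lemma Cinf_slice: "Cinf k f \<Longrightarrow> i < k \<Longrightarrow> Cinf k (slice i b f)"
  unfolding slice_def[abs_def] by (cases b) (simp_all add: Cinf_zero_coordinate Cinf_partial(1))

lemma slice_cong:
  assumes "\<And>x. x \<in> Rn k \<Longrightarrow> f x = g x" "i < k" "x \<in> Rn k"
  shows "slice i b f x = slice i b g x"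
  using assms partial_cong[of k f g i] by (simp add: slice_def Rn_upd)

lemma coef_cong:
  assumes "\<And>x. x \<in> Rn k \<Longrightarrow> f x = g x" "j \<le> k"
  shows "coef S j f = coef S j g"
  using assms
proof (induction j arbitrary: f g)
  case (Suc j)
  have j: "j < k" "j \<le> k" using Suc.prems(2) by auto
  show ?case unfolding coef.simps
    by (rule Suc.IH[OF slice_cong[OF Suc.prems(1) j(1)] j(2)])
qed simp

lemma slice_linear:
  assumes "Cinf k f" "Cinf k g" "i < k" "x \<in> Rn k"
  shows "slice i b (\<lambda>x. a * f x + g x) x = a * slice i b f x + slice i b g x"
proof -
  have y: "x(i := 0) \<in> Rn k" using assms by (simp add: Rn_upd)
  have "((\<lambda>t. a * f ((x(i := 0))(i := t)) + g ((x(i := 0))(i := t))) has_real_derivative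
      a * partial i f (x(i := 0)) + partial i g (x(i := 0))) (at ((x(i := 0)) i))"
    by (intro DERIV_add DERIV_cmult Cinf_partial(2)[OF _ _ y] assms)
  then have "partial i (\<lambda>x. a * f x + g x) (x(i := 0)) = a * partial i f (x(i := 0)) + partial i g (x(i := 0))"
    unfolding partial_def[of _ "\<lambda>x. a * f x + g x"] by (rule DERIV_imp_deriv)
  then show ?thesis by (simp add: slice_def)
qed

lemma coef_linear:
  assumes "Cinf k f" "Cinf k g" "j \<le> k"
  shows "coef S j (\<lambda>x. a * f x + g x) = a * coef S j f + coef S j g"
  using assms
proof (induction j arbitrary: f g)
  case (Suc j)
  then have j: "j < k" by simp
  have "coef S j (slice j (j \<in> S) (\<lambda>x. a * f x + g x)) =
      coef S j (\<lambda>x. a * slice j (j \<in> S) f x + slice j (j \<in> S) g x)"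
    by (rule coef_cong[OF slice_linear[OF Suc.prems(1,2) j]]) (use j in auto)
  then show ?case using Suc j by (simp add: Cinf_slice)
qed simp

lemma coef_zero: "j \<le> k \<Longrightarrow> coef S j (\<lambda>x. 0) = 0"
  using coef_linear[of k "\<lambda>x. 0" "\<lambda>x. 0" j S 1] by simp

lemma coef_add:
  assumes "Cinf k f" "Cinf k g" "j \<le> k"
  shows "coef S j (\<lambda>x. f x + g x) = coef S j f + coef S j g"
  using coef_linear[OF assms, of S 1] by simp

lemma coef_cmult:
  assumes "Cinf k f" "j \<le> k"
  shows "coef S j (\<lambda>x. a * f x) = a * coef S j f"
  using coef_linear[OF assms(1) Cinf_const[of k 0] assms(2), of S a] coef_zero[OF assms(2)] by simp

lemma coef_diff:
  assumes "Cinf k f" "Cinf k g" "j \<le> k"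
  shows "coef S j (\<lambda>x. f x - g x) = coef S j f - coef S j g"
  using coef_linear[OF assms(2,1,3), of S "-1"] by simp

lemma coef_sum:
  assumes "\<And>a. a \<in> A \<Longrightarrow> Cinf k (f a)" "j \<le> k"
  shows "coef S j (\<lambda>x. \<Sum>a\<in>A. f a x) = (\<Sum>a\<in>A. coef S j (f a))"
  using assms by (induction A rule: infinite_finite_induct)
    (auto simp: coef_zero coef_add[of k] Cinf_sum)

text \<open>The recursion reads only coordinates below \<open>j\<close>; this allows the element
  \<open>j\<close> itself to be added to or removed from \<open>S\<close> after its slice has been
  taken.\<close>

lemma coef_subset: "S \<inter> {..<j} = T \<inter> {..<j} \<Longrightarrow> coef S j f = coef T j f"
proof (induction j arbitrary: f)
  case (Suc j)
  have "S \<inter> {..<j} = T \<inter> {..<j}" using Suc.prems by (auto simp: lessThan_Suc)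
  moreover have "j \<in> S \<longleftrightarrow> j \<in> T" using Suc.prems by (auto simp: lessThan_Suc)
  ultimately show ?case using Suc.IH by simp
qed simp

lemma coef_empty: "coef {} j f = f (\<lambda>i. 0)"
  by (induction j arbitrary: f) (auto simp: slice_def fun_upd_idem)

text \<open>Leibniz rule at \<open>x j = 0\<close>. If \<open>i = j\<close>, only the summand with
  the differentiated factor survives; otherwise the factor \<open>x i\<close> is constant in
  direction \<open>j\<close>.\<close>

lemma slice_times:
  assumes "Cinf k f" "j < k" "x \<in> Rn k"
  shows "slice j b (\<lambda>x. x i * f x) x =
    (if i = j then (if b then slice j False f x else 0) else x i * slice j b f x)"
proof -
  have y: "x(j := 0) \<in> Rn k" using assms by (simp add: Rn_upd)
  have "((\<lambda>t. ((x(j := 0))(j := t)) i * f ((x(j := 0))(j := t))) has_real_derivative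
      (if i = j then 1 else 0) * f ((x(j := 0))(j := (x(j := 0)) j)) +
      partial j f (x(j := 0)) * ((x(j := 0))(j := (x(j := 0)) j)) i) (at ((x(j := 0)) j))"
    by (rule DERIV_mult[OF _ Cinf_partial(2)[OF assms(1,2) y]]) auto
  then have "partial j (\<lambda>x. x i * f x) (x(j := 0)) =
      (if i = j then f (x(j := 0)) else x i * partial j f (x(j := 0)))"
    unfolding partial_def[of _ "\<lambda>x. x i * f x"] by (subst DERIV_imp_deriv, assumption) auto
  then show ?thesis by (cases "i = j") (auto simp: slice_def)
qed

text \<open>Multiplication by \<open>x i\<close> shifts the monomial of \<open>S - {i}\<close> to
  that of \<open>S\<close> and reaches no monomial free of \<open>x i\<close>. This is how the
  coefficients see divisibility.\<close>

lemma coef_times: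
  assumes "Cinf k f" "j \<le> k" "i < j"
  shows "coef S j (\<lambda>x. x i * f x) = (if i \<in> S then coef (S - {i}) j f else 0)"
  using assms
proof (induction j arbitrary: f)
  case (Suc j)
  then have j: "j < k" by simp
  have "coef S (Suc j) (\<lambda>x. x i * f x) = coef S j (\<lambda>x.
      if i = j then (if j \<in> S then slice j False f x else 0) else x i * slice j (j \<in> S) f x)"
    unfolding coef.simps
  proof (rule coef_cong)
    show "slice j (j \<in> S) (\<lambda>x. x i * f x) x =
        (if i = j then (if j \<in> S then slice j False f x else 0) else x i * slice j (j \<in> S) f x)"
      if "x \<in> Rn k" for x
      using slice_times[OF Suc.prems(1) j that] by simp
  qed (use j in simp)
  also have "\<dots> = (if i \<in> S then coef (S - {i}) (Suc j) f else 0)"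
  proof (cases "i = j")
    case True
    have "coef (S - {j}) j g = coef S j g" for g by (rule coef_subset) auto
    then show ?thesis using True j by (simp add: coef_zero[of j k])
  next
    case False
    then have "i < j" using Suc.prems by simp
    with Suc.IH[OF Cinf_slice[OF Suc.prems(1) j] _ this] False j show ?thesis by simp
  qed
  finally show ?case .
qed simp

lemma coef_const: "j \<le> k \<Longrightarrow> coef S j (\<lambda>x. c) = (if S \<inter> {..<j} = {} then c else 0)"
proof (induction j)
  case (Suc j)
  have "slice j b (\<lambda>x. c) = (\<lambda>x. if b then 0 else c)" for b
    by (auto simp: slice_def partial_def fun_eq_iff)
  moreover have "S \<inter> {..<Suc j} = {} \<longleftrightarrow> j \<notin> S \<and> S \<inter> {..<j} = {}" by (auto simp: lessThan_Suc)
  ultimately show ?case using Suc by (auto simp: coef_zero[of j k])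
qed simp

lemma coef_times_monomial:
  assumes "Cinf k f" "T \<subseteq> {..<k}"
  shows "coef S k (\<lambda>x. (\<Prod>i\<in>T. x i) * f x) = (if T \<subseteq> S then coef (S - T) k f else 0)"
  using finite_subset[OF assms(2) finite_lessThan] assms
proof (induction T arbitrary: S rule: finite_induct)
  case (insert i T)
  have "coef S k (\<lambda>x. (\<Prod>i\<in>insert i T. x i) * f x) = coef S k (\<lambda>x. x i * ((\<Prod>i\<in>T. x i) * f x))"
    using insert by (simp add: mult.assoc)
  also have "\<dots> = (if i \<in> S then coef (S - {i}) k (\<lambda>x. (\<Prod>i\<in>T. x i) * f x) else 0)"
    by (rule coef_times[OF Cinf_mult[OF Cinf_prod insert.prems(1)] order_refl]) (use insert in auto)
  also have "\<dots> = (if insert i T \<subseteq> S then coef (S - insert i T) k f else 0)"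
  proof -
    have "S - {i} - T = S - insert i T" "T \<subseteq> S - {i} \<longleftrightarrow> T \<subseteq> S" using insert.hyps(2) by auto
    then show ?thesis using insert.IH[of "S - {i}"] insert.prems by simp
  qed
  finally show ?case .
qed simp

abbreviation monomial :: "nat set \<Rightarrow> vec \<Rightarrow> real" where
  "monomial S x \<equiv> \<Prod>i\<in>S. x i"

lemma coef_monomial:
  assumes "S \<subseteq> {..<k}" "T \<subseteq> {..<k}"
  shows "coef S k (monomial T) = (if S = T then 1 else 0)"
proof -
  have "coef S k (monomial T) = (if T \<subseteq> S then coef (S - T) k (\<lambda>x. 1) else 0)"
    using coef_times_monomial[OF Cinf_const[of k 1] assms(2), of S] by simp
  moreover have "(S - T) \<inter> {..<k} = {} \<longleftrightarrow> S \<subseteq> T" using assms by auto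
  ultimately show ?thesis by (auto simp: coef_const[of k k])
qed

lemma Cinf_monomial: "Cinf k (monomial T)"
  by (intro Cinf_prod) auto

lemma coef_polynomial:
  assumes "finite A" "A \<subseteq> Pow {..<k}" "S \<subseteq> {..<k}"
  shows "coef S k (\<lambda>x. \<Sum>T\<in>A. a T * monomial T x) = (if S \<in> A then a S else 0)"
proof -
  have "coef S k (\<lambda>x. \<Sum>T\<in>A. a T * monomial T x) = (\<Sum>T\<in>A. a T * coef S k (monomial T))"
    by (simp add: coef_sum[of _ k] coef_cmult[of k] Cinf_mult Cinf_monomial)
  also have "\<dots> = (\<Sum>T\<in>A. if S = T then a T else 0)"
  proof (rule sum.cong)
    fix T assume "T \<in> A"
    then have "T \<subseteq> {..<k}" using assms(2) by auto
    then show "a T * coef S k (monomial T) = (if S = T then a T else 0)"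
      using coef_monomial[OF assms(3)] by simp
  qed simp
  finally show ?thesis using assms(1) by simp
qed

text \<open>Two applications of Hadamard's lemma in the same coordinate. The linear coefficient
  appears as the first quotient at \<open>x i = 0\<close> and is identified by differentiating the
  first expansion.\<close>

lemma Taylor_slice:
  assumes f: "Cinf k f" and i: "i < k"
  obtains q where "Cinf k q" "\<And>x. x \<in> Rn k \<Longrightarrow> f x = slice i False f x + x i * slice i True f x + x i * x i * q x"
proof -
  obtain p where p: "Cinf k p" "\<And>x. x \<in> Rn k \<Longrightarrow> f x = f (x(i := 0)) + x i * p x"
    using Hadamard[OF f i] by blast
  obtain q where q: "Cinf k q" "\<And>x. x \<in> Rn k \<Longrightarrow> p x = p (x(i := 0)) + x i * q x"
    using Hadamard[OF p(1) i] by blast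
  have "slice i True f x = p (x(i := 0))" if x: "x \<in> Rn k" for x
  proof -
    have "slice i True f x = slice i True (\<lambda>x. 1 * f (x(i := 0)) + x i * p x) x"
      using p(2) by (intro slice_cong[OF _ i x]) simp
    also have "\<dots> = 1 * slice i True (\<lambda>x. f (x(i := 0))) x + slice i True (\<lambda>x. x i * p x) x"
      by (rule slice_linear[OF Cinf_zero_coordinate[OF f i] _ i x]) (auto intro: p)
    also have "slice i True (\<lambda>x. f (x(i := 0))) x = 0" by (simp add: slice_def partial_def)
    also have "slice i True (\<lambda>x. x i * p x) x = p (x(i := 0))"
      using slice_times[OF p(1) i x, of True i] by (simp add: slice_def)
    finally show ?thesis by simp
  qed
  then have "f x = slice i False f x + x i * slice i True f x + x i * x i * q x" if "x \<in> Rn k" for x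
    using p(2)[OF that] q(2)[OF that] that by (simp add: slice_def algebra_simps)
  with q(1) show ?thesis using that by blast
qed

lemma Pow_lessThan_Suc:
  "Pow {..<Suc j} = Pow {..<j} \<union> insert j ` Pow {..<j}" "Pow {..<j} \<inter> insert j ` Pow {..<j} = {}"
  "inj_on (insert j) (Pow {..<j})"
proof -
  show "Pow {..<Suc j} = Pow {..<j} \<union> insert j ` Pow {..<j}"
    by (simp add: lessThan_Suc Pow_insert)
  show "Pow {..<j} \<inter> insert j ` Pow {..<j} = {}" by auto
  show "inj_on (insert j) (Pow {..<j})" by (rule inj_onI) (auto simp: insert_ident subset_eq)
qed

text \<open>Induction on the number of coordinates that \<open>f\<close> depends on, expressed by
  \<open>f x = f (vtake j x)\<close>. Splitting off coordinate \<open>j\<close> leaves two slices in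
  fewer coordinates and a multiple of the square of \<open>x j\<close>, which lies in
  \<open>I\<close>.\<close>

lemma Taylor_aux:
  assumes I: "ideal I (cinf_ring k)" and sq: "\<And>i. i < k \<Longrightarrow> rst k (\<lambda>x. x i * x i) \<in> I"
  shows "j \<le> k \<Longrightarrow> Cinf k f \<Longrightarrow> (\<And>x. x \<in> Rn k \<Longrightarrow> f x = f (vtake j x)) \<Longrightarrow>
    rst k (\<lambda>x. f x - (\<Sum>S\<in>Pow {..<j}. coef S j f * monomial S x)) \<in> I"
proof (induction j arbitrary: f)
  case 0
  have "rst k (\<lambda>x. f x - (\<Sum>S\<in>Pow {..<0}. coef S 0 f * monomial S x)) = rst k (\<lambda>x. 0)"
  proof (rule rst_eqI)
    fix x assume x: "x \<in> Rn k"
    have "vtake 0 x = (\<lambda>i. 0)" by (simp add: vtake_def)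
    then show "f x - (\<Sum>S\<in>Pow {..<0}. coef S 0 f * monomial S x) = 0" using 0(3)[OF x] by simp
  qed
  then show ?case using ideal_cinf_zero[OF I] by (simp only:)
next
  case (Suc j)
  then have j: "j < k" by simp
  obtain q where q: "Cinf k q"
    "\<And>x. x \<in> Rn k \<Longrightarrow> f x = slice j False f x + x j * slice j True f x + x j * x j * q x"
    using Taylor_slice[OF Suc.prems(2) j] by blast
  have dep: "slice j b f x = slice j b f (vtake j x)" if x: "x \<in> Rn k" for b x
  proof -
    have v: "(vtake j x)(j := t) = vtake (Suc j) (x(j := t))" for t by (auto simp: vtake_def)
    have v': "f (x(j := t)) = f ((vtake j x)(j := t))" for t
      unfolding v by (rule Suc.prems(3)[OF Rn_upd[OF x j]])
    show ?thesis by (simp add: slice_def partial_def v')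
  qed
  have r: "rst k (\<lambda>x. slice j b f x - (\<Sum>S\<in>Pow {..<j}. coef S j (slice j b f) * monomial S x)) \<in> I" for b
    using j by (intro Suc.IH Cinf_slice Suc.prems dep) auto
  have "rst k (\<lambda>x. (slice j False f x - (\<Sum>S\<in>Pow {..<j}. coef S j (slice j False f) * monomial S x)) +
      (x j * (slice j True f x - (\<Sum>S\<in>Pow {..<j}. coef S j (slice j True f) * monomial S x)) +
       q x * (x j * x j))) \<in> I"
    by (intro ideal_cinf_add ideal_cinf_mult I r sq j q Cinf_coord)
  also have "rst k (\<lambda>x. (slice j False f x - (\<Sum>S\<in>Pow {..<j}. coef S j (slice j False f) * monomial S x)) +
      (x j * (slice j True f x - (\<Sum>S\<in>Pow {..<j}. coef S j (slice j True f) * monomial S x)) +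
       q x * (x j * x j))) = rst k (\<lambda>x. f x - (\<Sum>S\<in>Pow {..<Suc j}. coef S (Suc j) f * monomial S x))"
  proof (rule rst_eqI)
    fix x assume x: "x \<in> Rn k"
    \<comment> \<open>The subsets of \<open>{..<Suc j}\<close> without and with \<open>j\<close>
      correspond to the two slices.\<close>
    have "(\<Sum>S\<in>Pow {..<Suc j}. coef S (Suc j) f * monomial S x) =
      (\<Sum>S\<in>Pow {..<j}. coef S (Suc j) f * monomial S x) +
      (\<Sum>S\<in>Pow {..<j}. coef (insert j S) (Suc j) f * monomial (insert j S) x)"
      unfolding Pow_lessThan_Suc(1)
      by (subst sum.union_disjoint) (auto simp: Pow_lessThan_Suc(2) sum.reindex[OF Pow_lessThan_Suc(3)])
    also have "(\<Sum>S\<in>Pow {..<j}. coef S (Suc j) f * monomial S x) =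
        (\<Sum>S\<in>Pow {..<j}. coef S j (slice j False f) * monomial S x)"
    proof (rule sum.cong)
      fix S assume "S \<in> Pow {..<j}"
      then have "j \<notin> S" by auto
      then show "coef S (Suc j) f * monomial S x = coef S j (slice j False f) * monomial S x" by simp
    qed simp
    also have "(\<Sum>S\<in>Pow {..<j}. coef (insert j S) (Suc j) f * monomial (insert j S) x) =
        (\<Sum>S\<in>Pow {..<j}. x j * (coef S j (slice j True f) * monomial S x))"
    proof (rule sum.cong)
      fix S assume S: "S \<in> Pow {..<j}"
      then have "j \<notin> S" "finite S" by (auto intro: finite_subset)
      moreover have "coef (insert j S) j g = coef S j g" for g by (rule coef_subset) auto
      ultimately show "coef (insert j S) (Suc j) f * monomial (insert j S) x =
          x j * (coef S j (slice j True f) * monomial S x)" by simp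
    qed simp
    finally show "(slice j False f x - (\<Sum>S\<in>Pow {..<j}. coef S j (slice j False f) * monomial S x)) +
      (x j * (slice j True f x - (\<Sum>S\<in>Pow {..<j}. coef S j (slice j True f) * monomial S x)) +
       q x * (x j * x j)) = f x - (\<Sum>S\<in>Pow {..<Suc j}. coef S (Suc j) f * monomial S x)"
      using q(2)[OF x] by (simp add: algebra_simps sum_distrib_left)
  qed
  finally show ?case .
qed

lemma Taylor:
  assumes "ideal I (cinf_ring k)" "\<And>i. i < k \<Longrightarrow> rst k (\<lambda>x. x i * x i) \<in> I" "Cinf k f"
  shows "rst k (\<lambda>x. f x - (\<Sum>S\<in>Pow {..<k}. coef S k f * monomial S x)) \<in> I"
proof (rule Taylor_aux[OF assms(1,2) order_refl assms(3)])
  fix x assume "x \<in> Rn k"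
  then have "vtake k x = x" by (auto simp: vtake_def Rn_def)
  then show "f x = f (vtake k x)" by simp
qed

text \<open>The coordinates are set to 0 one after the other, each contributing one quotient. For
  \<open>f\<close> vanishing at the origin this writes \<open>f\<close> as a combination of the
  coordinates, the form used for nilpotency.\<close>

lemma Hadamard_all:
  assumes f: "Cinf k f"
  obtains g where "\<And>i. i < k \<Longrightarrow> Cinf k (g i)" "\<And>x. x \<in> Rn k \<Longrightarrow> f x = f (\<lambda>i. 0) + (\<Sum>i<k. x i * g i x)"
proof -
  have "\<exists>g. (\<forall>i<j. Cinf k (g i)) \<and> (\<forall>x\<in>Rn k. f x = f (\<lambda>i. if i < j then 0 else x i) + (\<Sum>i<j. x i * g i x))"
    if "j \<le> k" for j
    using that
  proof (induction j)
    case (Suc j)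
    then obtain g where g: "\<forall>i<j. Cinf k (g i)"
      "\<forall>x\<in>Rn k. f x = f (\<lambda>i. if i < j then 0 else x i) + (\<Sum>i<j. x i * g i x)" by auto
    have j: "j < k" using Suc.prems by simp
    have "Cinf k (\<lambda>x. f (\<lambda>i. if i < j then 0 else x i))"
    proof (rule Cinf_compose[OF f])
      show "Cinf k (\<lambda>x. if i < j then 0 else x i)" for i by (cases "i < j") auto
    qed (auto simp: Rn_def)
    from Hadamard[OF this j]
    obtain q where q: "Cinf k q" "\<And>x. x \<in> Rn k \<Longrightarrow> f (\<lambda>i. if i < j then 0 else x i) =
        f (\<lambda>i. if i < j then 0 else (x(j := 0)) i) + x j * q x"
      by blast
    have eq: "(\<lambda>i. if i < j then 0 else (x(j := 0)) i) = (\<lambda>i. if i < Suc j then 0 else x i)" for x :: vec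
      by auto
    have "\<forall>x\<in>Rn k. f x = f (\<lambda>i. if i < Suc j then 0 else x i) + (\<Sum>i<Suc j. x i * (g(j := q)) i x)"
      using g(2) q(2) by (auto simp: eq)
    moreover have "\<forall>i<Suc j. Cinf k ((g(j := q)) i)" using g(1) q(1) by (auto simp: less_Suc_eq)
    ultimately show ?case by blast
  qed simp
  from this[of k] obtain g where g: "\<forall>i<k. Cinf k (g i)"
    "\<forall>x\<in>Rn k. f x = f (\<lambda>i. if i < k then 0 else x i) + (\<Sum>i<k. x i * g i x)" by auto
  have "(\<lambda>i. if i < k then 0 else x i) = (\<lambda>i. 0)" if "x \<in> Rn k" for x
    using that by (auto simp: Rn_def)
  then show ?thesis using that[of g] g by metis
qed

section \<open>Weil algebras with squarefree monomial bases\<close>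

lemma smooth_map_euc:
  "smooth_map (euc l) (euc k) f \<longleftrightarrow> f \<in> Rn l \<rightarrow> Rn k \<and> (\<forall>h. Cinf k h \<longrightarrow> Cinf l (\<lambda>x. h (f x)))"
  by (simp add: smooth_map_def euc_def comp_def)

lemma smooth_map_eucI:
  assumes "f \<in> Rn l \<rightarrow> Rn k" "\<And>i. i < k \<Longrightarrow> Cinf l (\<lambda>x. f x i)"
  shows "smooth_map (euc l) (euc k) f"
  using assms Cinf_compose[of k _ l f] by (auto simp: smooth_map_euc)

text \<open>A smooth map that restricts to a map of formal spaces, from that of \<open>V\<close> to that of \<open>W\<close>.\<close>

definition wmor :: "weil \<Rightarrow> weil \<Rightarrow> (vec \<Rightarrow> vec) \<Rightarrow> bool" where
  "wmor W V f \<longleftrightarrow> smooth_map (euc (wdim V)) (euc (wdim W)) f \<and>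
     (\<forall>h. rst (wdim W) h \<in> wideal W \<longrightarrow> rst (wdim V) (\<lambda>x. h (f x)) \<in> wideal V)"

lemma wmor_smooth: "wmor W V f \<Longrightarrow> smooth_map (euc (wdim V)) (euc (wdim W)) f"
  by (simp add: wmor_def)

lemma wmor_mem: "wmor W V f \<Longrightarrow> x \<in> Rn (wdim V) \<Longrightarrow> f x \<in> Rn (wdim W)"
  by (auto simp: wmor_def smooth_map_euc)

lemma wmor_Cinf: "wmor W V f \<Longrightarrow> Cinf (wdim W) h \<Longrightarrow> Cinf (wdim V) (\<lambda>x. h (f x))"
  by (auto simp: wmor_def smooth_map_euc)

lemma wmor_ideal: "wmor W V f \<Longrightarrow> rst (wdim W) h \<in> wideal W \<Longrightarrow> rst (wdim V) (\<lambda>x. h (f x)) \<in> wideal V"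
  by (simp add: wmor_def)

lemma wmor_compose: "wmor W V f \<Longrightarrow> wmor V U g \<Longrightarrow> wmor W U (\<lambda>x. f (g x))"
  unfolding wmor_def smooth_map_euc by fastforce

lemma wmor_cong:
  assumes "\<And>x. x \<in> Rn (wdim V) \<Longrightarrow> f x = g x" "wmor W V f"
  shows "wmor W V g"
proof -
  have eq: "rst (wdim V) (\<lambda>x. h (g x)) = rst (wdim V) (\<lambda>x. h (f x))" for h
    using assms(1) by (intro rst_eqI) simp
  have "Cinf (wdim V) (\<lambda>x. h (g x)) \<longleftrightarrow> Cinf (wdim V) (\<lambda>x. h (f x))" for h
    using assms(1) by (intro Cinf_cong) simp
  moreover have "g \<in> Rn (wdim V) \<rightarrow> Rn (wdim W) \<longleftrightarrow> f \<in> Rn (wdim V) \<rightarrow> Rn (wdim W)"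
    using assms(1) by (simp add: Pi_def)
  ultimately show ?thesis using assms(2) unfolding wmor_def smooth_map_euc eq by blast
qed

definition pairs :: "(nat \<times> nat) set \<Rightarrow> (vec \<Rightarrow> real) set" where
  "pairs R = {\<lambda>d. d i * d j | i j. (i, j) \<in> R}"

definition flag :: "nat \<Rightarrow> (nat \<times> nat) set \<Rightarrow> weil" where
  "flag k R = winf k (pairs R)"

text \<open>Once all squares are generators, these sets index the squarefree monomials divisible by
  no generator: the simplices of the flag complex whose missing edges are the pairs in
  \<open>R\<close>. Both orders of a pair are tested, so one orientation in \<open>R\<close> is
  enough; diagonal pairs stand for squares and exclude no vertex.\<close>

definition faces :: "nat \<Rightarrow> (nat \<times> nat) set \<Rightarrow> nat set set" where
  "faces k R = {S. S \<subseteq> {..<k} \<and> (\<forall>i\<in>S. \<forall>j\<in>S. i \<noteq> j \<longrightarrow> (i, j) \<notin> R)}"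

definition flag_rel :: "nat \<Rightarrow> (nat \<times> nat) set \<Rightarrow> bool" where
  "flag_rel k R \<longleftrightarrow> R \<subseteq> {..<k} \<times> {..<k} \<and> (\<forall>i<k. (i, i) \<in> R)"

lemma wdim_flag [simp]: "wdim (flag k R) = k"
  by (simp add: flag_def winf_def)

lemma wideal_flag: "wideal (flag k R) = genideal (cinf_ring k) (rst k ` pairs R)"
  by (simp add: flag_def winf_def)

lemma pairs_carrier: "rst k ` pairs R \<subseteq> carrier (cinf_ring k)"
  by (auto simp: pairs_def Cinf_mult)

lemma ideal_flag: "ideal (wideal (flag k R)) (cinf_ring k)"
  unfolding wideal_flag by (rule cinf.genideal_ideal[OF pairs_carrier])

lemma flag_generator: "(i, j) \<in> R \<Longrightarrow> rst k (\<lambda>x. x i * x j) \<in> wideal (flag k R)"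
  using cinf.genideal_self[OF pairs_carrier, of k R] unfolding wideal_flag pairs_def by blast

lemma wideal_flag_minimal:
  assumes "ideal J (cinf_ring k)" "\<And>i j. (i, j) \<in> R \<Longrightarrow> rst k (\<lambda>x. x i * x j) \<in> J"
  shows "wideal (flag k R) \<subseteq> J"
  unfolding wideal_flag by (rule cinf.genideal_minimal[OF assms(1)]) (use assms(2) in \<open>auto simp: pairs_def\<close>)

lemma finite_faces [simp]: "finite (faces k R)"
  by (rule finite_subset[of _ "Pow {..<k}"]) (auto simp: faces_def)

lemma Taylor_flag:
  assumes R: "flag_rel k R" and f: "Cinf k f"
  shows "rst k (\<lambda>x. f x - (\<Sum>S\<in>faces k R. coef S k f * monomial S x)) \<in> wideal (flag k R)"
proof -
  let ?I = "wideal (flag k R)"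
  note I = ideal_flag[of k R]
  have T: "rst k (\<lambda>x. f x - (\<Sum>S\<in>Pow {..<k}. coef S k f * monomial S x)) \<in> ?I"
    using R by (intro Taylor[OF I _ f] flag_generator) (auto simp: flag_rel_def)
  have "rst k (\<lambda>x. \<Sum>S\<in>Pow {..<k} - faces k R. coef S k f * monomial S x) \<in> ?I"
  proof (intro ideal_cinf_sum[OF I] ideal_cinf_mult[OF I] Cinf_const)
    fix S assume "S \<in> Pow {..<k} - faces k R"
    then obtain i j where S: "S \<subseteq> {..<k}" "i \<in> S" "j \<in> S" "i \<noteq> j" "(i, j) \<in> R"
      by (auto simp: faces_def)
    have fin: "finite S" using S(1) by (rule finite_subset) simp
    have "monomial S x = monomial (S - {i} - {j}) x * (x i * x j)" for x :: vec
      using fin S by (simp add: prod.remove[of S i] prod.remove[of "S - {i}" j])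
    moreover have "rst k (\<lambda>x. monomial (S - {i} - {j}) x * (x i * x j)) \<in> ?I"
      by (intro ideal_cinf_mult[OF I] Cinf_monomial flag_generator S)
    ultimately show "rst k (monomial S) \<in> ?I" by (simp only:)
  qed
  from ideal_cinf_add[OF I T this]
  have "rst k (\<lambda>x. f x - (\<Sum>S\<in>Pow {..<k}. coef S k f * monomial S x) +
      (\<Sum>S\<in>Pow {..<k} - faces k R. coef S k f * monomial S x)) \<in> ?I" .
  also have "rst k (\<lambda>x. f x - (\<Sum>S\<in>Pow {..<k}. coef S k f * monomial S x) +
      (\<Sum>S\<in>Pow {..<k} - faces k R. coef S k f * monomial S x)) =
    rst k (\<lambda>x. f x - (\<Sum>S\<in>faces k R. coef S k f * monomial S x))"
    by (rule rst_eqI) (subst sum_diff, auto simp: faces_def)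
  finally show ?thesis .
qed

text \<open>A multiple of \<open>x i * x j\<close> has a coefficient at \<open>S\<close> only if
  \<open>S\<close> can lose \<open>i\<close> and then \<open>j\<close>. For \<open>i = j\<close>
  this is impossible, and for a pair of \<open>R\<close> with \<open>i \<noteq> j\<close> it
  contradicts that \<open>S\<close> is a face.\<close>

lemma wideal_flag_coef:
  assumes R: "flag_rel k R" and f: "rst k f \<in> wideal (flag k R)" and S: "S \<in> faces k R"
  shows "coef S k f = 0"
proof -
  \<comment> \<open>Vanishing of a single coefficient does not define an ideal; demanding it for all
    multiples gives the largest ideal in the kernel of the functional.\<close>
  define J where "J = {f \<in> carrier (cinf_ring k). \<forall>q. Cinf k q \<longrightarrow> coef S k (\<lambda>x. q x * f x) = 0}"
  have J: "rst k g \<in> J \<longleftrightarrow> Cinf k g \<and> (\<forall>q. Cinf k q \<longrightarrow> coef S k (\<lambda>x. q x * g x) = 0)" for g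
  proof -
    have "coef S k (\<lambda>x. q x * rst k g x) = coef S k (\<lambda>x. q x * g x)" for q
      by (rule coef_cong[of k]) auto
    then show ?thesis by (simp add: J_def)
  qed
  have "wideal (flag k R) \<subseteq> J"
  proof (rule wideal_flag_minimal)
    show "ideal J (cinf_ring k)"
    proof (rule ideal_cinfI)
      show "J \<subseteq> carrier (cinf_ring k)" by (auto simp: J_def)
      show "rst k (\<lambda>x. 0) \<in> J" by (simp add: J coef_zero[of k k])
      show "rst k (\<lambda>x. f x + g x) \<in> J" if "rst k f \<in> J" "rst k g \<in> J" for f g
        using that by (auto simp: J distrib_left coef_add[of k] Cinf_mult Cinf_add)
      show "rst k (\<lambda>x. q x * f x) \<in> J" if "Cinf k q" "rst k f \<in> J" for f q
        using that by (auto simp: J Cinf_mult simp flip: mult.assoc)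
    qed
    fix i j assume ij: "(i, j) \<in> R"
    then have ijk: "i < k" "j < k" using R by (auto simp: flag_rel_def)
    have "coef S k (\<lambda>x. q x * (x i * x j)) = 0" if q: "Cinf k q" for q
    proof -
      have "coef S k (\<lambda>x. q x * (x i * x j)) = coef S k (\<lambda>x. x i * (x j * q x))"
        by (simp add: ac_simps)
      also have "\<dots> = (if i \<in> S then coef (S - {i}) k (\<lambda>x. x j * q x) else 0)"
        by (rule coef_times[OF Cinf_mult[OF Cinf_coord q] order_refl ijk(1)])
      also have "\<dots> = 0"
        using S ij by (auto simp: coef_times[OF q order_refl ijk(2)] faces_def)
      finally show ?thesis .
    qed
    then show "rst k (\<lambda>x. x i * x j) \<in> J" by (simp add: J Cinf_mult)
  qed
  with f have "rst k f \<in> J" by blast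
  then have "coef S k (\<lambda>x. 1 * f x) = 0" unfolding J using Cinf_const by blast
  then show ?thesis by simp
qed

lemma wideal_flag_iff:
  assumes "flag_rel k R"
  shows "rst k f \<in> wideal (flag k R) \<longleftrightarrow> Cinf k f \<and> (\<forall>S\<in>faces k R. coef S k f = 0)"
proof
  assume "rst k f \<in> wideal (flag k R)"
  then show "Cinf k f \<and> (\<forall>S\<in>faces k R. coef S k f = 0)"
    using wideal_flag_coef[OF assms] ideal_cinf_Cinf[OF ideal_flag] by blast
next
  assume "Cinf k f \<and> (\<forall>S\<in>faces k R. coef S k f = 0)"
  then show "rst k f \<in> wideal (flag k R)"
    using Taylor_flag[OF assms, of f] by (simp cong: sum.cong)
qed

text \<open>Each factor \<open>f\<close> is a combination of the \<open>x i\<close>, and each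
  \<open>x i\<close> uses up an element of \<open>S\<close>; with more factors than elements nothing
  is left. The multiplier \<open>q\<close> absorbs the Hadamard quotients during the
  induction.\<close>

lemma coef_power_zero:
  assumes "Cinf k f" "f (\<lambda>i. 0) = 0" "Cinf k q"
  shows "finite S \<Longrightarrow> S \<subseteq> {..<k} \<Longrightarrow> card S < r \<Longrightarrow> coef S k (\<lambda>x. q x * f x ^ r) = 0"
  using assms(3)
proof (induction r arbitrary: S q)
  case (Suc r)
  obtain g where g: "\<And>i. i < k \<Longrightarrow> Cinf k (g i)" "\<And>x. x \<in> Rn k \<Longrightarrow> f x = f (\<lambda>i. 0) + (\<Sum>i<k. x i * g i x)"
    using Hadamard_all[OF assms(1)] by blast
  have pw: "Cinf k (\<lambda>x. f x ^ a)" for a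
    by (induction a) (auto intro: assms(1))
  have sm: "Cinf k (\<lambda>x. (g i x * q x) * f x ^ r)" if "i < k" for i
    using that by (intro Cinf_mult g Suc.prems pw)
  have "coef S k (\<lambda>x. q x * f x ^ Suc r) = coef S k (\<lambda>x. \<Sum>i<k. x i * ((g i x * q x) * f x ^ r))"
  proof (rule coef_cong)
    fix x assume "x \<in> Rn k"
    from g(2)[OF this] have "f x * (q x * f x ^ r) = (\<Sum>i<k. x i * g i x) * (q x * f x ^ r)"
      using assms(2) by simp
    also have "\<dots> = (\<Sum>i<k. x i * ((g i x * q x) * f x ^ r))"
      unfolding sum_distrib_right by (simp add: ac_simps)
    finally show "q x * f x ^ Suc r = (\<Sum>i<k. x i * ((g i x * q x) * f x ^ r))"
      by (simp add: ac_simps)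
  qed simp
  also have "\<dots> = (\<Sum>i<k. coef S k (\<lambda>x. x i * ((g i x * q x) * f x ^ r)))"
    using sm by (intro coef_sum) auto
  also have "\<dots> = 0"
  proof (intro sum.neutral ballI)
    fix i assume "i \<in> {..<k}"
    then have i: "i < k" by simp
    have "coef (S - {i}) k (\<lambda>x. (g i x * q x) * f x ^ r) = 0" if "i \<in> S"
      using that Suc.prems card_gt_0_iff[of S] i
      by (intro Suc.IH Cinf_mult g) (auto simp: card_Diff_singleton)
    then show "coef S k (\<lambda>x. x i * ((g i x * q x) * f x ^ r)) = 0"
      by (simp add: coef_times[OF sm[OF i] order_refl i])
  qed
  finally show ?case .
qed simp

lemma empty_face [simp]: "{} \<in> faces k R"
  by (simp add: faces_def)

text \<open>The monomials of the faces span by Taylor's formula. The functions vanishing at the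
  origin give the maximal ideal, whose elements are nilpotent because a face has at most
  \<open>k\<close> elements.\<close>

lemma weil_algebra_flag:
  assumes R: "flag_rel k R"
  shows "weil_algebra (flag k R)"
proof -
  let ?W = "flag k R"
  let ?I = "wideal ?W"
  note I = ideal_flag[of k R]
  have IW: "ideal (wideal ?W) (cinf_ring (wdim ?W))" using I by simp
  let ?B = "(\<lambda>S. rst k (monomial S)) ` faces k R"
  have inj: "inj_on (\<lambda>S. rst k (monomial S)) (faces k R)"
  proof (rule inj_onI)
    fix S T assume S: "S \<in> faces k R" and T: "T \<in> faces k R" and "rst k (monomial S) = rst k (monomial T)"
    then have "coef S k (monomial S) = coef S k (monomial T)"
      by (intro coef_cong[of k]) (auto dest: fun_cong simp: restrict_def split: if_splits)
    then show "S = T" using S T by (auto simp: coef_monomial faces_def split: if_splits)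
  qed
  have span: "\<exists>a. wres ?W f = wres ?W (\<lambda>x. \<Sum>b\<in>?B. a b * b x)" if f: "Cinf k f" for f
  proof
    \<comment> \<open>Coefficients are indexed by basis functions, so a face has to be recovered
      from its monomial; this is why injectivity was established.\<close>
    let ?a = "\<lambda>b. coef (the_inv_into (faces k R) (\<lambda>S. rst k (monomial S)) b) k f"
    have a: "(\<Sum>b\<in>?B. ?a b * b x) = (\<Sum>S\<in>faces k R. coef S k f * rst k (monomial S) x)" for x
      by (simp add: sum.reindex[OF inj] the_inv_into_f_f[OF inj])
    have "rst k (\<lambda>x. f x - (\<Sum>b\<in>?B. ?a b * b x)) \<in> ?I"
      unfolding a using Taylor_flag[OF R f] by (simp cong: restrict_cong)
    moreover have "Cinf k (\<lambda>x. \<Sum>b\<in>?B. ?a b * b x)"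
      unfolding a by (intro Cinf_sum Cinf_mult Cinf_const) (simp only: Cinf_restrict Cinf_monomial)
    ultimately show "wres ?W f = wres ?W (\<lambda>x. \<Sum>b\<in>?B. ?a b * b x)"
      using wres_eq_iff[OF IW] f by simp
  qed
  define N where "N = {f \<in> carrier (cinf_ring k). f (\<lambda>i. 0) = 0}"
  have N: "rst k f \<in> N \<longleftrightarrow> Cinf k f \<and> f (\<lambda>i. 0) = 0" for f
    by (simp add: N_def)
  have "ideal N (cinf_ring k)"
    by (rule ideal_cinfI) (auto simp: N, auto simp: N_def)
  then have m: "ideal ((+>\<^bsub>cinf_ring k\<^esub>) ?I ` N) (wring ?W)"
    using cinf.ring_ideal_imp_quot_ideal[OF I] by (simp add: wring_def)
  have mem: "wres ?W f \<in> (+>\<^bsub>cinf_ring k\<^esub>) ?I ` N \<longleftrightarrow> f (\<lambda>i. 0) = 0" if f: "Cinf k f" for f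
  proof
    assume "wres ?W f \<in> (+>\<^bsub>cinf_ring k\<^esub>) ?I ` N"
    then obtain g where g: "g \<in> N" "wres ?W f = wres ?W g"
      by (auto simp: wres_def restrict_eq N_def)
    then have "rst k (\<lambda>x. f x - g x) \<in> ?I"
      using wres_eq_iff[OF IW, of f g] f by (auto simp: N_def carrier_cinf)
    then have "coef {} k (\<lambda>x. f x - g x) = 0" by (rule wideal_flag_coef[OF R _ empty_face])
    then show "f (\<lambda>i. 0) = 0" using g(1) by (simp add: coef_empty N_def)
  next
    assume "f (\<lambda>i. 0) = 0"
    then have "rst k f \<in> N" using f by (simp add: N)
    then show "wres ?W f \<in> (+>\<^bsub>cinf_ring k\<^esub>) ?I ` N" by (auto simp: wres_def)
  qed
  have "\<exists>!a::real. wres ?W (\<lambda>x. f x - a) \<in> (+>\<^bsub>cinf_ring k\<^esub>) ?I ` N" if "Cinf k f" for f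
    using that by (intro ex1I[of _ "f (\<lambda>i. 0)"]) (auto simp: mem Cinf_diff)
  moreover have "\<exists>r::nat. w [^]\<^bsub>wring ?W\<^esub> r = \<zero>\<^bsub>wring ?W\<^esub>" if w: "w \<in> (+>\<^bsub>cinf_ring k\<^esub>) ?I ` N" for w
  proof -
    interpret Q: ring "wring ?W"
      unfolding wring_def by (rule ideal.quotient_is_ring[OF IW])
    obtain f where f: "Cinf k f" "f (\<lambda>i. 0) = 0" "w = wres ?W f"
    proof -
      obtain g where g: "g \<in> N" "w = ?I +>\<^bsub>cinf_ring k\<^esub> g" using w by blast
      then have "g \<in> carrier (cinf_ring k)" "g (\<lambda>i. 0) = 0" by (auto simp: N_def)
      then show thesis using that[of g] g(2) by (simp add: wres_def restrict_eq carrier_cinf)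
    qed
    have pw: "Cinf k (\<lambda>x. f x ^ a)" for a
      by (induction a) (auto intro: f)
    have "w [^]\<^bsub>wring ?W\<^esub> r = wres ?W (\<lambda>x. f x ^ r)" for r :: nat
      by (induction r) (auto simp: wring_one_zero[OF IW] f wring_ops[OF IW] pw mult.commute)
    \<comment> \<open>The exponent \<open>Suc k\<close> exceeds the size of every face.\<close>
    moreover have "rst k (\<lambda>x. f x ^ Suc k) \<in> ?I"
    proof -
      have "coef S k (\<lambda>x. f x ^ Suc k) = 0" if "S \<in> faces k R" for S
      proof -
        have "S \<subseteq> {..<k}" using that by (simp add: faces_def)
        then have "finite S" "card S < Suc k"
          using card_mono[of "{..<k}" S] by (auto intro: finite_subset)
        then show ?thesis
          using coef_power_zero[OF f(1,2) Cinf_const[of k 1], of S "Suc k"] \<open>S \<subseteq> {..<k}\<close> by simp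
      qed
      then show ?thesis using wideal_flag_iff[OF R] pw by blast
    qed
    ultimately have "w [^]\<^bsub>wring ?W\<^esub> Suc k = \<zero>\<^bsub>wring ?W\<^esub>"
      using wres_eq_iff[OF IW, of "\<lambda>x. f x ^ Suc k" "\<lambda>x. 0"] pw[of "Suc k"]
      by (simp only: wring_one_zero[OF IW] wdim_flag diff_0_right Cinf_const)
    then show ?thesis by blast
  qed
  moreover have "finite ?B" "?B \<subseteq> carrier (cinf_ring k)" by (auto simp: Cinf_monomial)
  moreover have "\<forall>f\<in>carrier (cinf_ring k). \<exists>a. wres ?W f = wres ?W (\<lambda>x. \<Sum>b\<in>?B. a b * b x)"
    using span by (simp add: carrier_cinf)
  ultimately show ?thesis
    unfolding weil_algebra_def wdim_flag
    by (intro conjI exI[of _ ?B] exI[of _ "(+>\<^bsub>cinf_ring k\<^esub>) ?I ` N"] I m) (auto simp: carrier_cinf)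
qed

text \<open>The functions whose pullback lies in the ideal of \<open>V\<close> form an ideal
  themselves, so it is enough that they include the generators.\<close>

lemma wmor_flagI:
  assumes V: "ideal (wideal V) (cinf_ring (wdim V))"
    and f: "f \<in> Rn (wdim V) \<rightarrow> Rn k" "\<And>i. i < k \<Longrightarrow> Cinf (wdim V) (\<lambda>x. f x i)"
    and gens: "\<And>i j. (i, j) \<in> R \<Longrightarrow> rst (wdim V) (\<lambda>x. f x i * f x j) \<in> wideal V"
  shows "wmor (flag k R) V f"
proof -
  have sm: "smooth_map (euc (wdim V)) (euc k) f" by (rule smooth_map_eucI[OF f])
  define J where "J = {h \<in> carrier (cinf_ring k). rst (wdim V) (\<lambda>x. h (f x)) \<in> wideal V}"
  have J: "rst k h \<in> J \<longleftrightarrow> Cinf k h \<and> rst (wdim V) (\<lambda>x. h (f x)) \<in> wideal V" for h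
  proof -
    have "rst (wdim V) (\<lambda>x. rst k h (f x)) = rst (wdim V) (\<lambda>x. h (f x))"
      using f(1) by (intro rst_eqI) auto
    then show ?thesis by (simp add: J_def)
  qed
  have "wideal (flag k R) \<subseteq> J"
  proof (rule wideal_flag_minimal)
    show "ideal J (cinf_ring k)"
    proof (rule ideal_cinfI)
      show "J \<subseteq> carrier (cinf_ring k)" by (auto simp: J_def)
      show "rst k (\<lambda>x. 0) \<in> J" by (simp add: J ideal_cinf_zero[OF V] del: restrict_apply)
      show "rst k (\<lambda>x. g x + h x) \<in> J" if "rst k g \<in> J" "rst k h \<in> J" for g h
        using that Cinf_add[of k g h] ideal_cinf_add[OF V, of "\<lambda>x. g (f x)" "\<lambda>x. h (f x)"]
        unfolding J by simp
      show "rst k (\<lambda>x. q x * h x) \<in> J" if q: "Cinf k q" and h: "rst k h \<in> J" for q h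
      proof -
        have "Cinf (wdim V) (\<lambda>x. q (f x))" using sm q by (simp add: smooth_map_euc)
        then show ?thesis
          using h Cinf_mult[of k q h] q ideal_cinf_mult[OF V, of "\<lambda>x. q (f x)" "\<lambda>x. h (f x)"]
          unfolding J by simp
      qed
    qed
    show "rst k (\<lambda>x. x i * x j) \<in> J" if "(i, j) \<in> R" for i j
      using gens[OF that] by (simp add: J Cinf_mult)
  qed
  then show ?thesis using sm J by (auto simp: wmor_def)
qed


section \<open>Homomorphisms induced by smooth maps\<close>

text \<open>Homomorphisms act on cosets, so a representative has to be chosen; by
  \<open>pull_wres\<close> the choice does not matter when \<open>f\<close> respects the
  ideals.\<close>

definition pull :: "weil \<Rightarrow> (vec \<Rightarrow> vec) \<Rightarrow> whom" where
  "pull V f A = wres V (\<lambda>x. (SOME h. h \<in> A) (f x))"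

lemma pull_wres:
  assumes W: "ideal (wideal W) (cinf_ring (wdim W))" and V: "ideal (wideal V) (cinf_ring (wdim V))"
    and f: "wmor W V f" and h: "Cinf (wdim W) h"
  shows "pull V f (wres W h) = wres V (\<lambda>x. h (f x))"
proof -
  define g where "g = (SOME g. g \<in> wres W h)"
  interpret ideal "wideal W" "cinf_ring (wdim W)" by (rule W)
  have hc: "rst (wdim W) h \<in> carrier (cinf_ring (wdim W))" using h by simp
  have "rst (wdim W) h \<in> wres W h"
    unfolding wres_def by (rule a_rcos_self[OF hc])
  then have g: "g \<in> wres W h" unfolding g_def by (rule someI[of "\<lambda>g. g \<in> wres W h"])
  moreover have "wres W h \<subseteq> carrier (cinf_ring (wdim W))"
    unfolding wres_def by (rule cinf.a_r_coset_subset_G[OF a_subset hc])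
  ultimately have gc: "g \<in> carrier (cinf_ring (wdim W))" by blast
  have "wres W g = wres W h"
    using a_repr_independence'[OF _ hc, of g] g unfolding wres_def restrict_eq[OF gc] by simp
  then have "rst (wdim W) (\<lambda>x. g x - h x) \<in> wideal W"
    using wres_eq_iff[OF W, of g h] h gc by (simp add: carrier_cinf)
  from wmor_ideal[OF f this] have "rst (wdim V) (\<lambda>x. g (f x) - h (f x)) \<in> wideal V" .
  then show ?thesis
    using wres_eq_iff[OF V, of "\<lambda>x. g (f x)" "\<lambda>x. h (f x)"] gc h f
    by (simp add: pull_def flip: g_def) (simp add: wmor_Cinf carrier_cinf)
qed

lemma induces_pull:
  assumes "ideal (wideal W) (cinf_ring (wdim W))" "ideal (wideal V) (cinf_ring (wdim V))" "wmor W V f"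
  shows "induces W V f (pull V f)"
  unfolding induces_def using pull_wres[OF assms] wmor_smooth[OF assms(3)] by (auto simp: carrier_cinf)

lemma weil_hom_pull:
  assumes W: "ideal (wideal W) (cinf_ring (wdim W))" and V: "ideal (wideal V) (cinf_ring (wdim V))"
    and f: "wmor W V f"
  shows "weil_hom W V (pull V f)"
proof -
  have "pull V f \<in> ring_hom (wring W) (wring V)"
    by (rule ring_hom_memI)
      (auto simp: carrier_wring pull_wres[OF assms] wring_ops[OF W] wring_ops[OF V] wring_one_zero[OF W]
        wring_one_zero[OF V] Cinf_mult Cinf_add wmor_Cinf[OF f])
  then show ?thesis unfolding weil_hom_def by (simp add: pull_wres[OF assms])
qed

text \<open>Reduces a limit cone to statements on representatives. Since the legs are additive,
  uniqueness becomes triviality of the joint kernel; existence is asked only up to the ideals of the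
  vertices.\<close>

lemma weil_limit_coneI:
  assumes fin: "finite J" "finite Q"
    and W: "weil_algebra W" and Ws: "\<And>j. j \<in> J \<Longrightarrow> weil_algebra (Ws j)"
    and Q: "\<And>i j f. (i, j, f) \<in> Q \<Longrightarrow> i \<in> J \<and> j \<in> J \<and> wmor (Ws i) (Ws j) f"
    and p: "\<And>j. j \<in> J \<Longrightarrow> wmor W (Ws j) (p j)"
    and comm: "\<And>i j f x. (i, j, f) \<in> Q \<Longrightarrow> x \<in> Rn (wdim (Ws j)) \<Longrightarrow> p i (f x) = p j x"
    and ex: "\<And>h. (\<And>j. j \<in> J \<Longrightarrow> Cinf (wdim (Ws j)) (h j)) \<Longrightarrow>
      (\<And>i j f. (i, j, f) \<in> Q \<Longrightarrow> rst (wdim (Ws j)) (\<lambda>x. h i (f x) - h j x) \<in> wideal (Ws j)) \<Longrightarrow>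
      \<exists>g. Cinf (wdim W) g \<and> (\<forall>j\<in>J. rst (wdim (Ws j)) (\<lambda>x. g (p j x) - h j x) \<in> wideal (Ws j))"
    and uniq: "\<And>g. Cinf (wdim W) g \<Longrightarrow>
      (\<And>j. j \<in> J \<Longrightarrow> rst (wdim (Ws j)) (\<lambda>x. g (p j x)) \<in> wideal (Ws j)) \<Longrightarrow> rst (wdim W) g \<in> wideal W"
  shows "weil_limit_cone J Ws ((\<lambda>(i, j, f). (i, j, pull (Ws j) f)) ` Q) W (\<lambda>j. pull (Ws j) (p j))"
proof -
  have IW: "ideal (wideal W) (cinf_ring (wdim W))" using W by (simp add: weil_algebra_def)
  have I: "ideal (wideal (Ws j)) (cinf_ring (wdim (Ws j)))" if "j \<in> J" for j
    using Ws[OF that] by (simp add: weil_algebra_def)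
  have com: "pull (Ws j) f (pull (Ws i) (p i) w) = pull (Ws j) (p j) w"
    if ijf: "(i, j, f) \<in> Q" and w: "w \<in> carrier (wring W)" for i j f w
  proof -
    from Q[OF ijf] have ij: "i \<in> J" "j \<in> J" and f: "wmor (Ws i) (Ws j) f" by auto
    from w obtain g where g: "w = wres W g" "Cinf (wdim W) g" by (auto simp: carrier_wring)
    have "wres (Ws j) (\<lambda>x. g (p i (f x))) = wres (Ws j) (\<lambda>x. g (p j x))"
      unfolding wres_def using comm[OF ijf] by (simp cong: restrict_cong)
    then show ?thesis
      using g by (simp add: pull_wres[OF IW I[OF ij(1)] p[OF ij(1)]] pull_wres[OF IW I[OF ij(2)] p[OF ij(2)]]
        pull_wres[OF I[OF ij(1)] I[OF ij(2)] f] wmor_Cinf[OF p[OF ij(1)]])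
  qed
  have lim: "\<exists>!w. w \<in> carrier (wring W) \<and> (\<forall>j\<in>J. pull (Ws j) (p j) w = a j)"
    if a: "\<And>j. j \<in> J \<Longrightarrow> a j \<in> carrier (wring (Ws j))"
      and compat: "\<And>i j f. (i, j, f) \<in> Q \<Longrightarrow> pull (Ws j) f (a i) = a j" for a
  proof -
    have "\<forall>j. \<exists>h. j \<in> J \<longrightarrow> a j = wres (Ws j) h \<and> Cinf (wdim (Ws j)) h"
      using a by (fastforce simp: carrier_wring)
    then obtain h where h: "\<And>j. j \<in> J \<Longrightarrow> a j = wres (Ws j) (h j)"
      "\<And>j. j \<in> J \<Longrightarrow> Cinf (wdim (Ws j)) (h j)" by metis
    have "rst (wdim (Ws j)) (\<lambda>x. h i (f x) - h j x) \<in> wideal (Ws j)" if ijf: "(i, j, f) \<in> Q" for i j f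
    proof -
      from Q[OF ijf] have ij: "i \<in> J" "j \<in> J" and f: "wmor (Ws i) (Ws j) f" by auto
      have "wres (Ws j) (\<lambda>x. h i (f x)) = wres (Ws j) (h j)"
        using compat[OF ijf] by (simp add: h ij pull_wres[OF I[OF ij(1)] I[OF ij(2)] f])
      then show ?thesis
        using wres_eq_iff[OF I[OF ij(2)] wmor_Cinf[OF f h(2)[OF ij(1)]] h(2)[OF ij(2)]] by simp
    qed
    from ex[OF h(2) this] obtain g where g: "Cinf (wdim W) g"
      "\<And>j. j \<in> J \<Longrightarrow> rst (wdim (Ws j)) (\<lambda>x. g (p j x) - h j x) \<in> wideal (Ws j)" by blast
    have ga: "pull (Ws j) (p j) (wres W g) = a j" if j: "j \<in> J" for j
      using g(2)[OF j] wres_eq_iff[OF I[OF j] wmor_Cinf[OF p[OF j] g(1)] h(2)[OF j]]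
      by (simp add: pull_wres[OF IW I[OF j] p[OF j] g(1)] h(1)[OF j])
    show ?thesis
    proof (rule ex1I[of _ "wres W g"])
      show "wres W g \<in> carrier (wring W) \<and> (\<forall>j\<in>J. pull (Ws j) (p j) (wres W g) = a j)"
        using g(1) ga by (auto simp: carrier_wring)
      fix w assume w: "w \<in> carrier (wring W) \<and> (\<forall>j\<in>J. pull (Ws j) (p j) w = a j)"
      then obtain g' where g': "w = wres W g'" "Cinf (wdim W) g'" by (auto simp: carrier_wring)
      have "rst (wdim W) (\<lambda>x. g' x - g x) \<in> wideal W"
      proof (rule uniq)
        show "Cinf (wdim W) (\<lambda>x. g' x - g x)" by (rule Cinf_diff[OF g'(2) g(1)])
        fix j assume j: "j \<in> J"
        have "wres (Ws j) (\<lambda>x. g' (p j x)) = wres (Ws j) (\<lambda>x. g (p j x))"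
          using w[THEN conjunct2, rule_format, OF j] ga[OF j]
          by (simp add: g'(1) pull_wres[OF IW I[OF j] p[OF j] g(1)] pull_wres[OF IW I[OF j] p[OF j] g'(2)])
        then show "rst (wdim (Ws j)) (\<lambda>x. g' (p j x) - g (p j x)) \<in> wideal (Ws j)"
          using wres_eq_iff[OF I[OF j] wmor_Cinf[OF p[OF j] g'(2)] wmor_Cinf[OF p[OF j] g(1)]] by simp
      qed
      then show "w = wres W g" using wres_eq_iff[OF IW g'(2) g(1)] g'(1) by simp
    qed
  qed
  have homs: "\<And>i j f. (i, j, f) \<in> Q \<Longrightarrow> i \<in> J \<and> j \<in> J \<and> weil_hom (Ws i) (Ws j) (pull (Ws j) f)"
    using Q weil_hom_pull I by metis
  show ?thesis
    unfolding weil_limit_cone_def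
  proof (intro conjI allI impI)
    fix a
    assume "(\<forall>j\<in>J. a j \<in> carrier (wring (Ws j))) \<and>
      (\<forall>(i, j, \<phi>)\<in>(\<lambda>(i, j, f). (i, j, pull (Ws j) f)) ` Q. \<phi> (a i) = a j)"
    then show "\<exists>!w. w \<in> carrier (wring W) \<and> (\<forall>j\<in>J. pull (Ws j) (p j) w = a j)"
      by (intro lim) (fastforce+)
  qed (use fin W Ws homs weil_hom_pull[OF IW I p] com in auto)
qed

section \<open>The algebras of \<open>D^N \<oplus> D \<oplus> ... \<oplus> D\<close>\<close>

text \<open>Diagonal pairs give the squares. Pairs with \<open>N \<le> j\<close> give the products
  of an added coordinate with all earlier ones, so that the added copies of \<open>D\<close> meet
  \<open>D^N\<close> and one another only at the origin.\<close>

definition wedge_rel :: "nat \<Rightarrow> nat \<Rightarrow> (nat \<times> nat) set" where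
  "wedge_rel N r = {(i, j). i \<le> j \<and> j < N + r \<and> (i = j \<or> N \<le> j)}"

text \<open>\<open>D^N \<oplus> D \<oplus> ... \<oplus> D\<close> with \<open>r\<close> additional copies of \<open>D\<close>, which use the coordinates from \<open>N\<close> on.\<close>

definition wedge :: "nat \<Rightarrow> nat \<Rightarrow> weil" where
  "wedge N r = flag (N + r) (wedge_rel N r)"

lemma flag_rel_wedge: "flag_rel (N + r) (wedge_rel N r)"
  by (auto simp: flag_rel_def wedge_rel_def)

lemma wdim_wedge [simp]: "wdim (wedge N r) = N + r"
  by (simp add: wedge_def)

lemma weil_algebra_wedge: "weil_algebra (wedge N r)"
  unfolding wedge_def by (rule weil_algebra_flag[OF flag_rel_wedge])

lemma ideal_wedge: "ideal (wideal (wedge N r)) (cinf_ring (N + r))"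
  unfolding wedge_def by (rule ideal_flag)

lemma W_Dpow_wedge: "W_Dpow N = wedge N 0"
proof -
  have "{\<lambda>d. d i ^ 2 | i. i < N} = pairs (wedge_rel N 0)"
    by (auto simp: pairs_def wedge_rel_def power2_eq_square)
  then show ?thesis by (simp add: W_Dpow_def wedge_def flag_def)
qed

lemma W_one_wedge: "W_one = wedge 0 0"
proof -
  have "pairs (wedge_rel 0 0) = {}" by (auto simp: pairs_def wedge_rel_def)
  then show ?thesis by (simp add: W_one_def wedge_def flag_def)
qed

lemma W_Dplus_wedge: "W_Dplus N = wedge N 1"
proof -
  have "{\<lambda>d. d i ^ 2 | i. i \<le> N} \<union> {\<lambda>d. d i * d N | i. i < N} = pairs (wedge_rel N 1)"
    (is "?A \<union> ?B = _")
  proof (intro equalityI subsetI)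
    fix p assume "p \<in> pairs (wedge_rel N 1)"
    then obtain i j where "p = (\<lambda>d. d i * d j)" "i \<le> j" "j \<le> N" "i = j \<or> j = N"
      by (auto simp: pairs_def wedge_rel_def)
    then show "p \<in> ?A \<union> ?B"
      by (cases "i = j") (auto simp: power2_eq_square)
  next
    fix p assume "p \<in> ?A \<union> ?B"
    then show "p \<in> pairs (wedge_rel N 1)"
      by (fastforce simp: pairs_def wedge_rel_def power2_eq_square)
  qed
  then show ?thesis by (simp add: W_Dplus_def wedge_def flag_def)
qed

text \<open>The object on which sums of tangent vectors live is the wedge of two copies of
  \<open>D\<close>, hence the case \<open>N = 1\<close> of the object used for strong
  addition.\<close>

lemma W_Dbrace_wedge: "W_Dbrace 2 1 = wedge 1 1"
proof -
  have "S = {0, 1}" if "S \<subseteq> {..<2}" "card S = 2" for S :: "nat set"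
    using card_subset_eq[of "{..<2}" S] that by (auto simp: less_2_cases_iff)
  then have "{S. S \<subseteq> {..<2} \<and> card S = 1 + 1} = {{0, 1::nat}}"
    by (auto simp: numeral_2_eq_2)
  then have "(\<lambda>S d. \<Prod>i\<in>S. d i :: real) ` {S. S \<subseteq> {..<2::nat} \<and> card S = 1 + 1} = {\<lambda>d. d 0 * d 1}"
    by simp
  then have "{\<lambda>d. \<Prod>i\<in>S. d i :: real | S. S \<subseteq> {..<2::nat} \<and> card S = 1 + 1} = {\<lambda>d. d i * d 1 | i. i < 1}"
    by (simp add: image_Collect)
  moreover have "{\<lambda>d. d i ^ 2 | i. i < (2::nat)} = {\<lambda>d. d i ^ 2 :: real | i. i \<le> 1}"
    by (auto simp: less_Suc_eq_le numeral_2_eq_2)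
  ultimately have "W_Dbrace 2 1 = W_Dplus 1"
    by (simp add: W_Dbrace_def W_Dplus_def numeral_2_eq_2)
  then show ?thesis by (simp add: W_Dplus_wedge)
qed

lemma wedge_square: "i < N + r \<Longrightarrow> rst (N + r) (\<lambda>x. x i * x i) \<in> wideal (wedge N r)"
  unfolding wedge_def by (rule flag_generator) (auto simp: wedge_rel_def)

lemma wedge_product:
  assumes "i < N + r" "j < N + r" "N \<le> i \<or> N \<le> j"
  shows "rst (N + r) (\<lambda>x. x i * x j) \<in> wideal (wedge N r)"
proof -
  have "rst (N + r) (\<lambda>x. x (min i j) * x (max i j)) \<in> wideal (wedge N r)"
    unfolding wedge_def by (rule flag_generator) (use assms in \<open>auto simp: wedge_rel_def\<close>)
  moreover have "x (min i j) * x (max i j) = x i * x j" for x :: vec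
    by (auto simp: min_def max_def)
  ultimately show ?thesis by (simp only:)
qed

text \<open>The product of an added coordinate with any other coordinate is a generator, so a face
  containing an added coordinate is a singleton.\<close>

lemma faces_wedge: "faces (N + r) (wedge_rel N r) = Pow {..<N} \<union> (\<lambda>j. {N + j}) ` {..<r}"
proof (intro equalityI subsetI)
  fix S assume S: "S \<in> faces (N + r) (wedge_rel N r)"
  show "S \<in> Pow {..<N} \<union> (\<lambda>j. {N + j}) ` {..<r}"
  proof (cases "S \<subseteq> {..<N}")
    case False
    then obtain m where m: "m \<in> S" "N \<le> m" by (auto simp: subset_eq not_less)
    then have mr: "m < N + r" using S by (auto simp: faces_def)
    have "i = m" if "i \<in> S" for i
    proof (rule ccontr)
      assume "i \<noteq> m"
      then have "(i, m) \<notin> wedge_rel N r" "(m, i) \<notin> wedge_rel N r" "i < N + r"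
        using S that m(1) by (auto simp: faces_def)
      then show False using m mr by (auto simp: wedge_rel_def)
    qed
    then have "S = {m}" using m(1) by blast
    then have "S = {N + (m - N)}" using m(2) by simp
    then show ?thesis using mr m(2) by (intro UnI2 image_eqI[of _ _ "m - N"]) auto
  qed auto
next
  fix S assume "S \<in> Pow {..<N} \<union> (\<lambda>j. {N + j}) ` {..<r}"
  then show "S \<in> faces (N + r) (wedge_rel N r)"
    by (auto simp: faces_def wedge_rel_def subset_eq)
qed

lemma Taylor_wedge:
  assumes "Cinf (N + r) f"
  shows "rst (N + r) (\<lambda>x. f x - ((\<Sum>S\<in>Pow {..<N}. coef S (N + r) f * monomial S x) +
      (\<Sum>j<r. coef {N + j} (N + r) f * x (N + j)))) \<in> wideal (wedge N r)"
proof -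
  have "(\<Sum>S\<in>Pow {..<N} \<union> (\<lambda>j. {N + j}) ` {..<r}. g S) = (\<Sum>S\<in>Pow {..<N}. g S) + (\<Sum>j<r. g {N + j})"
    for g :: "nat set \<Rightarrow> real"
  proof -
    have "inj_on (\<lambda>j. {N + j}) {..<r}" by (rule inj_onI) simp
    moreover have "Pow {..<N} \<inter> (\<lambda>j. {N + j}) ` {..<r} = {}" by auto
    ultimately show ?thesis by (simp add: sum.union_disjoint sum.reindex)
  qed
  with Taylor_flag[OF flag_rel_wedge assms] show ?thesis
    by (simp add: faces_wedge wedge_def)
qed

lemma wedge_memI:
  assumes "Cinf (N + r) f" "\<And>S. S \<subseteq> {..<N} \<Longrightarrow> coef S (N + r) f = 0"
    "\<And>j. j < r \<Longrightarrow> coef {N + j} (N + r) f = 0"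
  shows "rst (N + r) f \<in> wideal (wedge N r)"
proof -
  have "\<forall>S\<in>faces (N + r) (wedge_rel N r). coef S (N + r) f = 0"
    unfolding faces_wedge using assms(2,3) by auto
  then show ?thesis
    unfolding wedge_def wideal_flag_iff[OF flag_rel_wedge] using assms(1) by blast
qed

lemma wedge_memD:
  assumes "rst (N + r) f \<in> wideal (wedge N r)"
  shows "Cinf (N + r) f" "S \<subseteq> {..<N} \<Longrightarrow> coef S (N + r) f = 0" "j < r \<Longrightarrow> coef {N + j} (N + r) f = 0"
proof -
  have "Cinf (N + r) f \<and> (\<forall>S\<in>faces (N + r) (wedge_rel N r). coef S (N + r) f = 0)"
    using assms unfolding wedge_def wideal_flag_iff[OF flag_rel_wedge] .
  then show "Cinf (N + r) f" "S \<subseteq> {..<N} \<Longrightarrow> coef S (N + r) f = 0" "j < r \<Longrightarrow> coef {N + j} (N + r) f = 0"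
    by (auto simp: faces_wedge)
qed

lemma wedge_zero_dim: "rst 0 f \<in> wideal (wedge 0 0) \<Longrightarrow> f (\<lambda>i. 0) = 0"
  using wedge_memD(2)[of f 0 0 "{}"] by (simp add: coef_empty)

lemma wmor_wedgeI:
  assumes f: "f \<in> Rn (N' + r') \<rightarrow> Rn (N + r)" "\<And>i. i < N + r \<Longrightarrow> Cinf (N' + r') (\<lambda>x. f x i)"
    and square: "\<And>i. i < N + r \<Longrightarrow> rst (N' + r') (\<lambda>x. f x i * f x i) \<in> wideal (wedge N' r')"
    and product: "\<And>i j. i < j \<Longrightarrow> N \<le> j \<Longrightarrow> j < N + r \<Longrightarrow>
      rst (N' + r') (\<lambda>x. f x i * f x j) \<in> wideal (wedge N' r')"
  shows "wmor (wedge N r) (wedge N' r') f"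
  unfolding wedge_def[of N r]
proof (rule wmor_flagI)
  show "rst (wdim (wedge N' r')) (\<lambda>x. f x i * f x j) \<in> wideal (wedge N' r')"
    if "(i, j) \<in> wedge_rel N r" for i j
    using that square[of i] product[of i j] by (cases "i = j") (auto simp: wedge_rel_def)
qed (use f ideal_wedge in auto)

lemma wedge_multiple:
  assumes "rst (N + r) f \<in> wideal (wedge N r)" "Cinf (N + r) q" "\<And>x. x \<in> Rn (N + r) \<Longrightarrow> g x = q x * f x"
  shows "rst (N + r) g \<in> wideal (wedge N r)"
  using ideal_cinf_mult[OF ideal_wedge assms(2,1)] rst_eqI[of "N + r" g "\<lambda>x. q x * f x"] assms(3) by simp

lemma wedge_zero: "(\<And>x. x \<in> Rn (N + r) \<Longrightarrow> g x = 0) \<Longrightarrow> rst (N + r) g \<in> wideal (wedge N r)"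
  using ideal_cinf_zero[OF ideal_wedge, of N r] rst_eqI[of "N + r" g "\<lambda>x. 0"] by simp

section \<open>Maps between wedges that serve as legs and arrows of the diagrams\<close>

lemma wmor_zero: "wmor (wedge N r) (wedge N' r') (\<lambda>x i. 0)"
  by (rule wmor_wedgeI) (auto intro: wedge_zero)

lemma wmor_scale: "wmor (wedge N 0) (wedge N 0) (\<lambda>d. d(i := \<alpha> * d i))"
proof (rule wmor_wedgeI)
  show "(\<lambda>d. d(i := \<alpha> * d i)) \<in> Rn (N + 0) \<rightarrow> Rn (N + 0)" by (auto simp: Rn_def)
  show "Cinf (N + 0) (\<lambda>x. (x(i := \<alpha> * x i)) j)" for j by (cases "j = i") auto
  show "rst (N + 0) (\<lambda>x. (x(i := \<alpha> * x i)) j * (x(i := \<alpha> * x i)) j) \<in> wideal (wedge N 0)"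
    if "j < N + 0" for j
    by (rule wedge_multiple[OF wedge_square[OF that], of "\<lambda>x. if j = i then \<alpha> * \<alpha> else 1"]) auto
qed auto

lemma wmor_zero_coordinate: "wmor (wedge N 0) (wedge N 0) (\<lambda>d. d(i := 0))"
  using wmor_scale[of N i 0] by simp

lemma wmor_Phi: "wmor (wedge N r) (wedge N 0) (\<lambda>d. d(N := 0))"
proof (rule wmor_wedgeI)
  show "Cinf (N + 0) (\<lambda>x. (x(N := 0)) j)" for j by (cases "j = N") auto
  show "rst (N + 0) (\<lambda>x. (x(N := 0)) j * (x(N := 0)) j) \<in> wideal (wedge N 0)" for j
  proof (cases "j < N")
    case True
    then show ?thesis by (intro wedge_multiple[OF wedge_square, of j N 0 "\<lambda>x. 1"]) auto
  next
    case False
    then show ?thesis by (intro wedge_zero) (auto simp: Rn_def)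
  qed
  show "rst (N + 0) (\<lambda>x. (x(N := 0)) i * (x(N := 0)) j) \<in> wideal (wedge N 0)" if "N \<le> j" for i j
    using that by (intro wedge_zero) (auto simp: Rn_def)
qed (auto simp: Rn_def)

lemma wmor_axis:
  assumes "j < r"
  shows "wmor (wedge N r) (wedge 1 0) (\<lambda>d. (\<lambda>i. 0)(N + j := d 0))"
proof (rule wmor_wedgeI)
  show "Cinf (1 + 0) (\<lambda>x. ((\<lambda>i. 0)(N + j := x 0)) i)" for i by (cases "i = N + j") auto
  show "rst (1 + 0) (\<lambda>x. ((\<lambda>i. 0)(N + j := x 0)) i * ((\<lambda>i. 0)(N + j := x 0)) i) \<in> wideal (wedge 1 0)" for i
    by (rule wedge_multiple[OF wedge_square, of 0 1 0 "\<lambda>x. if i = N + j then 1 else 0"]) auto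
  show "rst (1 + 0) (\<lambda>x. ((\<lambda>i. 0)(N + j := x 0)) i * ((\<lambda>i. 0)(N + j := x 0)) l) \<in> wideal (wedge 1 0)"
    if "i < l" for i l
    using that by (intro wedge_zero) auto
qed (use assms in \<open>auto simp: Rn_def\<close>)

text \<open>The product of all coordinates has square 0 and annihilates each coordinate, because
  both expressions contain the square of a coordinate. For the first, \<open>N \<ge> 1\<close>
  provides such a coordinate; the empty product would be 1.\<close>

lemma wmor_Psi:
  assumes "N \<ge> 1"
  shows "wmor (wedge N 1) (wedge N 0) (Psi N)"
proof (rule wmor_wedgeI)
  have pr: "(\<Prod>i<N. x i) = (\<Prod>i\<in>{..<N} - {j}. x i) * x j" if "j < N" for j and x :: vec
    using that by (simp add: prod.remove[of "{..<N}" j] mult.commute)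
  show "Cinf (N + 0) (\<lambda>x. Psi N x j)" for j
    by (cases "j = N") (auto simp: Psi_def Cinf_prod)
  show "rst (N + 0) (\<lambda>x. Psi N x j * Psi N x j) \<in> wideal (wedge N 0)" if "j < N + 1" for j
  proof (cases "j = N")
    case True
    show ?thesis
    proof (rule wedge_multiple[OF wedge_square, of 0 N 0 "\<lambda>x. (\<Prod>i\<in>{..<N} - {0}. x i) * (\<Prod>i\<in>{..<N} - {0}. x i)"])
      show "Cinf (N + 0) (\<lambda>x. (\<Prod>i\<in>{..<N} - {0}. x i) * (\<Prod>i\<in>{..<N} - {0}. x i))"
        by (intro Cinf_mult Cinf_prod) auto
      show "Psi N x j * Psi N x j = (\<Prod>i\<in>{..<N} - {0}. x i) * (\<Prod>i\<in>{..<N} - {0}. x i) * (x 0 * x 0)" for x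
        using True pr[of 0 x] assms by (simp add: Psi_def)
    qed (use assms in simp)
  next
    case False
    then show ?thesis
      using that by (intro wedge_multiple[OF wedge_square, of j N 0 "\<lambda>x. 1"]) (auto simp: Psi_def)
  qed
  fix i j assume ij: "i < j" "N \<le> j" "j < N + 1"
  show "rst (N + 0) (\<lambda>x. Psi N x i * Psi N x j) \<in> wideal (wedge N 0)"
  proof (rule wedge_multiple[OF wedge_square, of i N 0 "\<lambda>x. \<Prod>i\<in>{..<N} - {i}. x i"])
    show "Cinf (N + 0) (\<lambda>x. \<Prod>i\<in>{..<N} - {i}. x i)" by (intro Cinf_prod) auto
    show "Psi N x i * Psi N x j = (\<Prod>i\<in>{..<N} - {i}. x i) * (x i * x i)" for x
      using ij pr[of i x] by (simp add: Psi_def)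
  qed (use ij in simp)
qed (auto simp: Psi_def Rn_def)


subsection \<open>The quasi-colimit diagrams of the strong operations\<close>

text \<open>Vertex 0 is the part \<open>D^N\<close>, the vertices 1 to \<open>r\<close> are the
  added axes, and vertex \<open>Suc r\<close> is the common origin, to which all arrows of the
  diagram lead.\<close>

definition axes_leg :: "nat \<Rightarrow> nat \<Rightarrow> nat \<Rightarrow> vec \<Rightarrow> vec" where
  "axes_leg N r j = (if j = 0 then (\<lambda>d. d(N := 0))
     else if j \<le> r then (\<lambda>d. (\<lambda>i. 0)(N + (j - 1) := d 0)) else (\<lambda>d i. 0))"

definition axes_obj :: "nat \<Rightarrow> nat \<Rightarrow> nat \<Rightarrow> weil" where
  "axes_obj N r j = (if j = 0 then wedge N 0 else if j \<le> r then wedge 1 0 else wedge 0 0)"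

definition axes_arrows :: "nat \<Rightarrow> (nat \<times> nat \<times> (vec \<Rightarrow> vec)) set" where
  "axes_arrows r = (\<lambda>j. (j, Suc r, \<lambda>x i. 0)) ` {..r}"

lemma axes_leg_wmor:
  assumes "j \<in> {..Suc r}" shows "wmor (wedge N r) (axes_obj N r j) (axes_leg N r j)"
proof (cases "j = 0 \<or> r < j")
  case True
  then show ?thesis
    using wmor_Phi[of N r] wmor_zero[of N r 0 0] by (auto simp: axes_obj_def axes_leg_def)
next
  case False
  then have "axes_obj N r j = wedge 1 0" "axes_leg N r j = (\<lambda>d. (\<lambda>i. 0)(N + (j - 1) := d 0))" "j - 1 < r"
    by (auto simp: axes_obj_def axes_leg_def)
  then show ?thesis by (simp only: wmor_axis)
qed

lemma axes_arrows_wmor: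
  "(i, j, f) \<in> axes_arrows r \<Longrightarrow> i \<in> {..Suc r} \<and> j \<in> {..Suc r} \<and> wmor (axes_obj N r i) (axes_obj N r j) f"
  by (auto simp: axes_arrows_def axes_obj_def wmor_zero)

lemma axes_limit:
  "weil_limit_cone {..Suc r} (axes_obj N r)
     ((\<lambda>(i, j, f). (i, j, pull (axes_obj N r j) f)) ` axes_arrows r)
     (wedge N r) (\<lambda>j. pull (axes_obj N r j) (axes_leg N r j))"
proof (rule weil_limit_coneI)
  show wa: "weil_algebra (axes_obj N r j)" for j
    by (simp add: axes_obj_def weil_algebra_wedge)
  show "wmor (wedge N r) (axes_obj N r j) (axes_leg N r j)" if "j \<in> {..Suc r}" for j
    using that by (rule axes_leg_wmor)
  show "i \<in> {..Suc r} \<and> j \<in> {..Suc r} \<and> wmor (axes_obj N r i) (axes_obj N r j) f"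
    if "(i, j, f) \<in> axes_arrows r" for i j f
    using that by (rule axes_arrows_wmor)
  show "axes_leg N r i (f x) = axes_leg N r j x"
    if "(i, j, f) \<in> axes_arrows r" for i j f x
    using that by (auto simp: axes_arrows_def axes_leg_def fun_eq_iff)
next
  fix h
  assume sm: "\<And>j. j \<in> {..Suc r} \<Longrightarrow> Cinf (wdim (axes_obj N r j)) (h j)"
    and compat: "\<And>i j f. (i, j, f) \<in> axes_arrows r \<Longrightarrow>
      rst (wdim (axes_obj N r j)) (\<lambda>x. h i (f x) - h j x) \<in> wideal (axes_obj N r j)"
  have base: "h j (\<lambda>i. 0) = h (Suc r) (\<lambda>i. 0)" if "j \<le> r" for j
    using wedge_zero_dim[of "\<lambda>x. h j (\<lambda>i. 0) - h (Suc r) x"] compat[of j "Suc r" "\<lambda>x i. 0"] that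
    by (auto simp: axes_arrows_def axes_obj_def)
  define e :: "nat \<Rightarrow> vec \<Rightarrow> vec" where "e j x = (\<lambda>i. 0)(0 := x (N + j))" for j x
  \<comment> \<open>Glues the data: \<open>h 0\<close> is extended by the projection to
    \<open>D^N\<close>, each axis function by the projection to its axis, and the common value at
    the origin is subtracted once per axis.\<close>
  define g where "g x = h 0 (vtake N x) + (\<Sum>j<r. h (Suc j) (e j x) - h (Suc j) (\<lambda>i. 0))" for x
  have "Cinf (N + r) g"
    unfolding g_def
  proof (intro Cinf_add Cinf_sum Cinf_diff Cinf_const)
    show "Cinf (N + r) (\<lambda>x. h 0 (vtake N x))"
    proof (rule Cinf_compose[where h = "h 0" and f = "vtake N" and k = N])
      show "Cinf N (h 0)" using sm[of 0] by (simp add: axes_obj_def)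
      show "Cinf (N + r) (\<lambda>x. vtake N x i)" for i by (cases "i < N") (auto simp: vtake_def)
    qed (auto simp: vtake_def Rn_def)
    show "Cinf (N + r) (\<lambda>x. h (Suc j) (e j x))" if "j \<in> {..<r}" for j
    proof (rule Cinf_compose[where h = "h (Suc j)" and f = "e j" and k = 1])
      show "Cinf 1 (h (Suc j))" using sm[of "Suc j"] that by (simp add: axes_obj_def)
      show "Cinf (N + r) (\<lambda>x. e j x i)" for i by (cases "i = 0") (auto simp: e_def)
    qed (auto simp: e_def Rn_def)
  qed
  moreover have "rst (wdim (axes_obj N r j)) (\<lambda>x. g (axes_leg N r j x) - h j x) \<in> wideal (axes_obj N r j)"
    if j: "j \<in> {..Suc r}" for j
  proof -
    have "g (axes_leg N r j x) = h j x" if x: "x \<in> Rn (wdim (axes_obj N r j))" for x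
    proof -
      consider "j = 0" | "j \<noteq> 0" "j \<le> r" | "j = Suc r" using j by force
      then show ?thesis
      proof cases
        case 1
        have "vtake N (x(N := 0)) = x" "\<And>j. e j (x(N := 0)) = (\<lambda>i. 0)"
          using x 1 by (auto simp: axes_obj_def vtake_def Rn_def e_def fun_eq_iff)
        then show ?thesis using 1 by (simp add: axes_leg_def g_def)
      next
        case 2
        define y where "y = (\<lambda>i. 0)(N + (j - 1) := x 0)"
        have y0: "vtake N y = (\<lambda>i. 0)" by (auto simp: y_def vtake_def)
        have ye: "e l y = (if l = j - 1 then x else (\<lambda>i. 0))" for l
          using x 2 by (auto simp: axes_obj_def Rn_def e_def y_def fun_eq_iff)
        have "(\<Sum>l<r. h (Suc l) (e l y) - h (Suc l) (\<lambda>i. 0)) =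
            (\<Sum>l<r. if l = j - 1 then h j x - h j (\<lambda>i. 0) else 0)"
          using 2 by (intro sum.cong) (auto simp: ye)
        also have "\<dots> = h j x - h j (\<lambda>i. 0)"
        proof -
          have "j - 1 < r" using 2 by linarith
          then show ?thesis by simp
        qed
        finally have "g y = h j x" using base[of 0] base[of j] 2 by (simp add: g_def y0)
        then show ?thesis using 2 by (simp add: axes_leg_def y_def)
      next
        case 3
        have "vtake N (\<lambda>i. 0) = (\<lambda>i. 0)" "\<And>j. e j (\<lambda>i. 0) = (\<lambda>i. 0)" "x = (\<lambda>i. 0)"
          using x 3 by (auto simp: axes_obj_def vtake_def Rn_def e_def fun_eq_iff)
        then show ?thesis using 3 base[of 0] by (simp add: axes_leg_def g_def)
      qed
    qed
    moreover obtain a b where "axes_obj N r j = wedge a b" unfolding axes_obj_def by metis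
    ultimately show ?thesis
      using wedge_zero[of a b "\<lambda>x. g (axes_leg N r j x) - h j x"] by (simp del: restrict_apply)
  qed
  ultimately show "\<exists>g. Cinf (wdim (wedge N r)) g \<and>
      (\<forall>j\<in>{..Suc r}. rst (wdim (axes_obj N r j)) (\<lambda>x. g (axes_leg N r j x) - h j x) \<in> wideal (axes_obj N r j))"
    by auto
next
  fix g
  assume g: "Cinf (wdim (wedge N r)) g"
    and legs: "\<And>j. j \<in> {..Suc r} \<Longrightarrow>
      rst (wdim (axes_obj N r j)) (\<lambda>x. g (axes_leg N r j x)) \<in> wideal (axes_obj N r j)"
  \<comment> \<open>Modulo the ideal \<open>g\<close> is this polynomial. Its composite with a leg
    is explicit, so its coefficients can be read off the legs.\<close>
  define P where "P x = (\<Sum>S\<in>Pow {..<N}. coef S (N + r) g * monomial S x) +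
      (\<Sum>j<r. coef {N + j} (N + r) g * x (N + j))" for x
  have gP: "rst (N + r) (\<lambda>x. g x - P x) \<in> wideal (wedge N r)"
    unfolding P_def using g by (intro Taylor_wedge) simp
  have gP': "rst (wdim (wedge N r)) (\<lambda>x. g x - P x) \<in> wideal (wedge N r)" using gP by simp
  \<comment> \<open>The composite of \<open>P\<close> with the leg, written as a difference of two
    members of the ideal.\<close>
  have P0: "rst (N + 0) (\<lambda>x. g (x(N := 0)) - (g (x(N := 0)) - P (x(N := 0)))) \<in> wideal (wedge N 0)"
  proof (rule ideal_cinf_diff[OF ideal_wedge])
    show "rst (N + 0) (\<lambda>x. g (x(N := 0))) \<in> wideal (wedge N 0)"
      using legs[of 0] by (simp add: axes_obj_def axes_leg_def del: restrict_apply)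
    show "rst (N + 0) (\<lambda>x. g (x(N := 0)) - P (x(N := 0))) \<in> wideal (wedge N 0)"
      using wmor_ideal[OF wmor_Phi gP'] by (simp del: restrict_apply)
  qed
  have c0: "coef S (N + r) g = 0" if S: "S \<subseteq> {..<N}" for S
  proof -
    have "coef S N (\<lambda>x. P (x(N := 0))) = coef S N (\<lambda>x. \<Sum>S\<in>Pow {..<N}. coef S (N + r) g * monomial S x)"
    proof (rule coef_cong)
      fix x assume x: "x \<in> Rn N"
      have "x(N := 0) = x" "x (N + j) = 0" for j using x by (auto simp: Rn_def)
      then show "P (x(N := 0)) = (\<Sum>S\<in>Pow {..<N}. coef S (N + r) g * monomial S x)" by (simp add: P_def)
    qed simp
    also have "\<dots> = coef S (N + r) g" using S by (subst coef_polynomial) auto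
    finally show ?thesis using wedge_memD(2)[OF P0 S] by simp
  qed
  have c1: "coef {N + j} (N + r) g = 0" if j: "j < r" for j
  proof -
    let ?a = "\<lambda>x :: vec. (\<lambda>i. 0)(N + j := x 0) :: vec"
    have "rst (1 + 0) (\<lambda>x. g (?a x) - (g (?a x) - P (?a x))) \<in> wideal (wedge 1 0)"
    proof (rule ideal_cinf_diff[OF ideal_wedge])
      show "rst (1 + 0) (\<lambda>x. g (?a x)) \<in> wideal (wedge 1 0)"
        using legs[of "Suc j"] j by (simp add: axes_obj_def axes_leg_def del: restrict_apply)
      show "rst (1 + 0) (\<lambda>x. g (?a x) - P (?a x)) \<in> wideal (wedge 1 0)"
        using wmor_ideal[OF wmor_axis[OF j] gP'] by (simp del: restrict_apply)
    qed
    from wedge_memD(2)[OF this, of "{0}"]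
    have "coef {0} 1 (\<lambda>x. P (?a x)) = 0" by (simp add: lessThan_Suc del: coef.simps)
    moreover have "P ((\<lambda>i. 0)(N + j := x 0)) = coef {N + j} (N + r) g * x 0" for x :: vec
    proof -
      have "(\<Sum>l<r. coef {N + l} (N + r) g * ((\<lambda>i. 0)(N + j := x 0)) (N + l)) =
          (\<Sum>l<r. if l = j then coef {N + j} (N + r) g * x 0 else 0)"
        by (rule sum.cong) auto
      then show ?thesis using j by (simp add: P_def c0)
    qed
    moreover have "coef {0} 1 (\<lambda>x. coef {N + j} (N + r) g * x 0) = coef {N + j} (N + r) g"
      using coef_monomial[of "{0}" 1 "{0}"] by (simp add: coef_cmult[of 1] del: coef.simps)
    ultimately show ?thesis by (simp only:)
  qed
  show "rst (wdim (wedge N r)) g \<in> wideal (wedge N r)"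
    using g c0 c1 by (simp add: wedge_memI del: restrict_apply)
qed (auto simp: axes_arrows_def weil_algebra_wedge)

text \<open>Vertices 0 and 1 carry the restrictions along \<open>Psi\<close> and \<open>Phi\<close>,
  vertex \<open>i + 2\<close> their common restriction to the face where coordinate \<open>i\<close>
  is 0; hence the shift by 2 in the arrows.\<close>

definition top_leg :: "nat \<Rightarrow> nat \<Rightarrow> vec \<Rightarrow> vec" where
  "top_leg N j = (if j = 0 then Psi N else if j = 1 then Phi N else (\<lambda>x. x(j - 2 := 0)))"

definition top_arrows :: "nat \<Rightarrow> (nat \<times> nat \<times> (vec \<Rightarrow> vec)) set" where
  "top_arrows N = (\<lambda>(b, i). (b, i + 2, \<lambda>x. x(i := 0))) ` ({0, 1} \<times> {..<N})"

lemma top_wmor: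
  assumes "N \<ge> 1"
  shows "(i, j, f) \<in> top_arrows N \<Longrightarrow> i \<in> {..<N + 2} \<and> j \<in> {..<N + 2} \<and> wmor (wedge N 0) (wedge N 0) f"
    and "wmor (wedge N 1) (wedge N 0) (top_leg N j)"
proof -
  show "i \<in> {..<N + 2} \<and> j \<in> {..<N + 2} \<and> wmor (wedge N 0) (wedge N 0) f" if "(i, j, f) \<in> top_arrows N"
    using that wmor_zero_coordinate by (auto simp: top_arrows_def)
  have "wmor (wedge N 1) (wedge N 0) (\<lambda>x. x(i := 0))" for i
    by (rule wmor_cong[OF _ wmor_compose[OF wmor_Phi wmor_zero_coordinate]]) (auto simp: Rn_def)
  then show "wmor (wedge N 1) (wedge N 0) (top_leg N j)"
    using wmor_Psi[OF assms] wmor_Phi[of N 1] by (auto simp: top_leg_def Phi_def[abs_def])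
qed

text \<open>By Hadamard's lemma the change is a multiple of \<open>x i\<close>, which has
  coefficient 0 at every set without \<open>i\<close>.\<close>

lemma coef_zero_coordinate:
  assumes f: "Cinf k f" and i: "i < k" "i \<notin> S"
  shows "coef S k (\<lambda>x. f (x(i := 0))) = coef S k f"
proof -
  obtain q where q: "Cinf k q" "\<And>x. x \<in> Rn k \<Longrightarrow> f x = f (x(i := 0)) + x i * q x"
    using Hadamard[OF f i(1)] by blast
  have "coef S k f = coef S k (\<lambda>x. f (x(i := 0)) + x i * q x)"
    by (rule coef_cong) (use q in auto)
  also have "\<dots> = coef S k (\<lambda>x. f (x(i := 0))) + coef S k (\<lambda>x. x i * q x)"
    by (rule coef_add[OF Cinf_zero_coordinate[OF f i(1)] Cinf_mult[OF Cinf_coord q(1)] order_refl])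
  finally show ?thesis using coef_times[OF q(1) order_refl i(1), of S] i(2) by simp
qed

text \<open>
  Two elements of the algebra of \<open>D^N\<close> agree after every substitution \<open>d_i = 0\<close> iff they differ by a
  multiple of \<open>d_1...d_N\<close>. This replaces the restriction to \<open>D{N}_{N-1}\<close>.
\<close>

lemma top_limit:
  assumes N: "N \<ge> 1"
  shows "weil_limit_cone {..<N + 2} (\<lambda>j. wedge N 0)
     ((\<lambda>(i, j, f). (i, j, pull (wedge N 0) f)) ` top_arrows N)
     (wedge N 1) (\<lambda>j. pull (wedge N 0) (top_leg N j))"
proof (rule weil_limit_coneI)
  show "wmor (wedge N 1) (wedge N 0) (top_leg N j)" for j by (rule top_wmor(2)[OF N])
  show "i \<in> {..<N + 2} \<and> j \<in> {..<N + 2} \<and> wmor (wedge N 0) (wedge N 0) f"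
    if "(i, j, f) \<in> top_arrows N" for i j f
    using that by (rule top_wmor(1)[OF N])
  show "top_leg N i (f x) = top_leg N j x" if "(i, j, f) \<in> top_arrows N" "x \<in> Rn (wdim (wedge N 0))" for i j f x
  proof -
    from that(1) obtain l where l: "l < N" "j = l + 2" "f = (\<lambda>x. x(l := 0))" "i = 0 \<or> i = 1"
      by (auto simp: top_arrows_def)
    have "(\<Prod>i<N. (x(l := 0)) i) = 0" using l(1) by (intro prod_zero) auto
    then show ?thesis using that(2) l by (auto simp: top_leg_def Psi_def Phi_def Rn_def fun_eq_iff)
  qed
next
  fix h
  assume "\<And>j. j \<in> {..<N + 2} \<Longrightarrow> Cinf (wdim (wedge N 0)) (h j)"
    and "\<And>i j f. (i, j, f) \<in> top_arrows N \<Longrightarrow>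
      rst (wdim (wedge N 0)) (\<lambda>x. h i (f x) - h j x) \<in> wideal (wedge N 0)"
  then have sm: "\<And>j. j < N + 2 \<Longrightarrow> Cinf N (h j)"
    and compat: "\<And>i j f. (i, j, f) \<in> top_arrows N \<Longrightarrow> rst N (\<lambda>x. h i (f x) - h j x) \<in> wideal (wedge N 0)"
    by auto
  have arr: "(0, i + 2, \<lambda>x. x(i := 0)) \<in> top_arrows N" "(1, i + 2, \<lambda>x. x(i := 0)) \<in> top_arrows N"
    if "i < N" for i
    using that by (auto simp: top_arrows_def)
  \<comment> \<open>By compatibility on the faces, \<open>h 0\<close> and \<open>h 1\<close> can
    differ only in the top coefficient. The coordinate \<open>x N\<close> becomes the top monomial
    under \<open>Psi\<close> and 0 under the other legs, so adding \<open>c * x N\<close> corrects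
    exactly this difference.\<close>
  define c where "c = coef {..<N} N (h 0) - coef {..<N} N (h 1)"
  define g where "g x = h 1 (vtake N x) + c * x N" for x
  have "Cinf (N + 1) g"
    unfolding g_def
  proof (intro Cinf_add Cinf_mult Cinf_const Cinf_coord)
    show "Cinf (N + 1) (\<lambda>x. h 1 (vtake N x))"
    proof (rule Cinf_compose[where h = "h 1" and f = "vtake N" and k = N])
      show "Cinf N (h 1)" using sm by simp
      show "Cinf (N + 1) (\<lambda>x. vtake N x i)" for i by (cases "i < N") (auto simp: vtake_def)
    qed (auto simp: vtake_def Rn_def)
  qed
  moreover have "rst N (\<lambda>x. g (top_leg N j x) - h j x) \<in> wideal (wedge N 0)" if j: "j < N + 2" for j
  proof -
    consider "j = 0" | "j = 1" | i where "i < N" "j = i + 2"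
      using j by (metis One_nat_def Suc_1 add_2_eq_Suc' add_less_cancel_right less_2_cases_iff
        le_add_diff_inverse2 not_le)
    then show ?thesis
    proof cases
      case 1
      have Psi: "g (Psi N x) = h 1 x + c * monomial {..<N} x" if "x \<in> Rn N" for x
      proof -
        have "vtake N (Psi N x) = x" using that by (auto simp: vtake_def Psi_def Rn_def)
        then show ?thesis by (simp add: g_def Psi_def)
      qed
      have smg: "Cinf N (\<lambda>x. h 1 x + c * monomial {..<N} x)"
        by (intro Cinf_add Cinf_mult Cinf_const Cinf_monomial sm) simp
      have "rst (N + 0) (\<lambda>x. (h 1 x + c * monomial {..<N} x) - h 0 x) \<in> wideal (wedge N 0)"
      proof (rule wedge_memI)
        show "Cinf (N + 0) (\<lambda>x. (h 1 x + c * monomial {..<N} x) - h 0 x)"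
          using smg sm[of 0] by (simp add: Cinf_diff)
        fix S assume S: "S \<subseteq> {..<N}"
        have "coef S N (\<lambda>x. (h 1 x + c * monomial {..<N} x) - h 0 x) =
            coef S N (h 1) + c * (if S = {..<N} then 1 else 0) - coef S N (h 0)"
        proof -
          have cm: "Cinf N (\<lambda>x. c * monomial {..<N} x)" by (intro Cinf_mult Cinf_const Cinf_monomial)
          have sm01: "Cinf N (h 0)" "Cinf N (h 1)" using sm by auto
          show ?thesis
            unfolding coef_diff[OF smg sm01(1) order_refl] coef_add[OF sm01(2) cm order_refl]
              coef_cmult[OF Cinf_monomial order_refl] coef_monomial[OF S order_refl] ..
        qed
        also have "\<dots> = 0"
        proof (cases "S = {..<N}")
          case False
          \<comment> \<open>A proper subset misses some \<open>i\<close>, and setting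
            \<open>x i\<close> to 0 does not change its coefficient. The face at \<open>i\<close>
            therefore compares \<open>h 0\<close> with \<open>h 1\<close>.\<close>
          then obtain i where i: "i < N" "i \<notin> S" using S by auto
          have "coef S N (h b) = coef S N (h (i + 2))" if "b = 0 \<or> b = 1" for b
          proof -
            have "rst (N + 0) (\<lambda>x. h b (x(i := 0)) - h (i + 2) x) \<in> wideal (wedge N 0)"
              using compat arr[OF i(1)] that by auto
            from wedge_memD(2)[OF this S]
            have "coef S N (\<lambda>x. h b (x(i := 0)) - h (i + 2) x) = 0" by simp
            then have "coef S N (\<lambda>x. h b (x(i := 0))) = coef S N (h (i + 2))"
              using sm[of b] sm[of "i + 2"] i that
              by (subst (asm) coef_diff[of N]) (auto intro: Cinf_zero_coordinate)
            then show ?thesis using coef_zero_coordinate[OF sm[of b] i] that by auto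
          qed
          then show ?thesis using False by simp
        qed (simp add: c_def)
        finally show "coef S (N + 0) (\<lambda>x. (h 1 x + c * monomial {..<N} x) - h 0 x) = 0" by simp
      qed simp
      moreover have "rst N (\<lambda>x. g (top_leg N j x) - h j x) = rst N (\<lambda>x. (h 1 x + c * monomial {..<N} x) - h 0 x)"
        by (rule rst_eqI) (simp add: 1 top_leg_def Psi)
      ultimately show ?thesis by (simp del: restrict_apply)
    next
      case 2
      have "g (Phi N x) = h 1 x" if "x \<in> Rn N" for x
      proof -
        have "vtake N (Phi N x) = x" using that by (auto simp: vtake_def Phi_def Rn_def)
        then show ?thesis by (simp add: g_def Phi_def)
      qed
      then show ?thesis using wedge_zero[of N 0 "\<lambda>x. g (top_leg N j x) - h j x"] 2
        by (simp add: top_leg_def del: restrict_apply)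
    next
      case 3
      have "g (x(i := 0)) = h 1 (x(i := 0))" if "x \<in> Rn N" for x
      proof -
        have "vtake N (x(i := 0)) = x(i := 0)" "(x(i := 0)) N = 0"
          using that by (auto simp: vtake_def Rn_def)
        then show ?thesis by (simp add: g_def del: fun_upd_apply)
      qed
      then have "rst N (\<lambda>x. g (top_leg N j x) - h j x) = rst N (\<lambda>x. h 1 (x(i := 0)) - h (i + 2) x)"
        by (intro rst_eqI) (simp add: 3 top_leg_def)
      then show ?thesis using compat[OF arr(2)[OF 3(1)]] by (simp del: restrict_apply)
    qed
  qed
  ultimately show "\<exists>g. Cinf (wdim (wedge N 1)) g \<and>
      (\<forall>j\<in>{..<N + 2}. rst (wdim (wedge N 0)) (\<lambda>x. g (top_leg N j x) - h j x) \<in> wideal (wedge N 0))"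
    by auto
next
  fix g
  assume g: "Cinf (wdim (wedge N 1)) g"
    and "\<And>j. j \<in> {..<N + 2} \<Longrightarrow> rst (wdim (wedge N 0)) (\<lambda>x. g (top_leg N j x)) \<in> wideal (wedge N 0)"
  then have legs: "rst (N + 0) (\<lambda>x. g (Psi N x)) \<in> wideal (wedge N 0)"
      "rst (N + 0) (\<lambda>x. g (x(N := 0))) \<in> wideal (wedge N 0)"
    by (force simp: top_leg_def Phi_def)+
  let ?c = "coef {N} (N + 1) g"
  define P where "P x = (\<Sum>S\<in>Pow {..<N}. coef S (N + 1) g * monomial S x) + ?c * x N" for x
  have gP: "rst (N + 1) (\<lambda>x. g x - P x) \<in> wideal (wedge N 1)"
    using Taylor_wedge[of N 1 g] g by (simp add: P_def lessThan_Suc del: restrict_apply)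
  have PPhi: "rst (N + 0) (\<lambda>x. g (x(N := 0)) - (g (x(N := 0)) - P (x(N := 0)))) \<in> wideal (wedge N 0)"
    by (rule ideal_cinf_diff[OF ideal_wedge legs(2)]) (use wmor_ideal[OF wmor_Phi[of N 1], simplified, OF gP[simplified]] in \<open>simp del: restrict_apply\<close>)
  have PPsi: "rst (N + 0) (\<lambda>x. g (Psi N x) - (g (Psi N x) - P (Psi N x))) \<in> wideal (wedge N 0)"
    by (rule ideal_cinf_diff[OF ideal_wedge legs(1)]) (use wmor_ideal[OF wmor_Psi[OF N], simplified, OF gP[simplified]] in \<open>simp del: restrict_apply\<close>)
  \<comment> \<open>\<open>Phi\<close> detects the coefficients on \<open>D^N\<close>; once these
    vanish, \<open>Psi\<close> sees only the coefficient of \<open>x N\<close>, as that of the top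
    monomial.\<close>
  have c0: "coef S (N + 1) g = 0" if S: "S \<subseteq> {..<N}" for S
  proof -
    have "coef S N (\<lambda>x. P (x(N := 0))) = coef S N (\<lambda>x. \<Sum>S\<in>Pow {..<N}. coef S (N + 1) g * monomial S x)"
    proof (rule coef_cong)
      fix x assume "x \<in> Rn N"
      then have "x(N := 0) = x" "x N = 0" by (auto simp: Rn_def)
      then show "P (x(N := 0)) = (\<Sum>S\<in>Pow {..<N}. coef S (N + 1) g * monomial S x)" by (simp add: P_def)
    qed simp
    also have "\<dots> = coef S (N + 1) g" using S by (subst coef_polynomial) auto
    finally show ?thesis using wedge_memD(2)[OF PPhi S] by simp
  qed
  have "?c = 0"
  proof -
    have "P (Psi N x) = ?c * monomial {..<N} x" for x
    proof -
      have "(\<Sum>S\<in>Pow {..<N}. coef S (N + 1) g * monomial S (Psi N x)) = 0"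
        by (intro sum.neutral ballI) (simp only: c0 Pow_iff mult_zero_left)
      then show ?thesis by (simp add: P_def Psi_def del: coef.simps)
    qed
    then have "coef {..<N} N (\<lambda>x. ?c * monomial {..<N} x) = 0"
      using wedge_memD(2)[OF PPsi, of "{..<N}"] by simp
    then show ?thesis by (simp add: coef_cmult[of N] Cinf_monomial coef_monomial)
  qed
  then have "rst (N + 1) g \<in> wideal (wedge N 1)"
    using g c0 by (intro wedge_memI) auto
  then show "rst (wdim (wedge N 1)) g \<in> wideal (wedge N 1)" by simp
qed (auto simp: weil_algebra_wedge top_arrows_def)

section \<open>The calculus of Weil prolongations\<close>

abbreviation wideal_ok :: "weil \<Rightarrow> bool" where
  "wideal_ok W \<equiv> ideal (wideal W) (cinf_ring (wdim W))"

lemma wideal_ok_wedge [simp]: "wideal_ok (wedge N r)"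
  using ideal_wedge by simp

lemma wideal_ok_winf:
  assumes "\<And>p. p \<in> P \<Longrightarrow> Cinf k p" shows "wideal_ok (winf k P)"
proof -
  have "(\<lambda>p. rst k p) ` P \<subseteq> carrier (cinf_ring k)" using assms by auto
  from cinf.genideal_ideal[OF this] show ?thesis by (simp add: winf_def)
qed

lemma smooth_euc_iff:
  "smooth_map (euc k) X g \<longleftrightarrow> g \<in> Rn k \<rightarrow> pts X \<and> (\<forall>h\<in>funs X. Cinf k (\<lambda>x. h (g x)))"
  by (simp add: smooth_map_def euc_def comp_def)

lemma smooth_euc_cong:
  assumes "\<And>x. x \<in> Rn k \<Longrightarrow> f x = g x"
  shows "smooth_map (euc k) X f \<longleftrightarrow> smooth_map (euc k) X g"
proof -
  have "Cinf k (\<lambda>x. h (f x)) \<longleftrightarrow> Cinf k (\<lambda>x. h (g x))" for h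
    by (rule Cinf_cong) (simp add: assms)
  then show ?thesis using assms by (auto simp: smooth_euc_iff Pi_def)
qed

lemma smooth_euc_restrict [simp]:
  "smooth_map (euc k) X (restrict g (Rn k)) \<longleftrightarrow> smooth_map (euc k) X g"
  by (rule smooth_euc_cong) simp

lemma smooth_map_compose: "smooth_map X Y f \<Longrightarrow> smooth_map Y Z g \<Longrightarrow> smooth_map X Z (\<lambda>x. g (f x))"
  by (auto simp: smooth_map_def comp_def Pi_def)

lemma smooth_euc_wmor: "wmor W V f \<Longrightarrow> smooth_map (euc (wdim W)) X g \<Longrightarrow>
    smooth_map (euc (wdim V)) X (\<lambda>x. g (f x))"
  by (rule smooth_map_compose[OF wmor_smooth])

lemma pts_euc [simp]: "pts (euc k) = Rn k"
  by (simp add: euc_def)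

lemma pts_fexp: "f \<in> pts (fexp Y X) \<longleftrightarrow> f \<in> extensional (pts Y) \<and> smooth_map Y X f"
  by (simp add: fexp_def Let_def)

lemma weil_rel_iff:
  "(f, g) \<in> weil_rel X W \<longleftrightarrow>
     f \<in> extensional (Rn (wdim W)) \<and> smooth_map (euc (wdim W)) X f \<and>
     g \<in> extensional (Rn (wdim W)) \<and> smooth_map (euc (wdim W)) X g \<and>
     (\<forall>h\<in>funs X. rst (wdim W) (\<lambda>x. h (f x) - h (g x)) \<in> wideal W)"
  by (auto simp: weil_rel_def pts_fexp)

lemma equiv_weil_rel:
  assumes W: "wideal_ok W"
  shows "equiv (pts (fexp (euc (wdim W)) X)) (weil_rel X W)"
proof (rule equivI)
  show "weil_rel X W \<subseteq> pts (fexp (euc (wdim W)) X) \<times> pts (fexp (euc (wdim W)) X)"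
    by (auto simp: weil_rel_def)
  show "refl_on (pts (fexp (euc (wdim W)) X)) (weil_rel X W)"
    by (rule refl_onI) (auto simp: weil_rel_def ideal_cinf_zero[OF W] simp del: restrict_apply)
  show "sym (weil_rel X W)"
  proof (rule symI)
    fix f g assume fg: "(f, g) \<in> weil_rel X W"
    have "rst (wdim W) (\<lambda>x. h (g x) - h (f x)) \<in> wideal W" if "h \<in> funs X" for h
    proof -
      have "rst (wdim W) (\<lambda>x. h (f x) - h (g x)) \<in> wideal W" using fg that by (auto simp: weil_rel_iff)
      from ideal_cinf_diff[OF W ideal_cinf_zero[OF W] this] show ?thesis by simp
    qed
    then show "(g, f) \<in> weil_rel X W" using fg by (simp add: weil_rel_iff)
  qed
  show "trans (weil_rel X W)"
  proof (rule transI)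
    fix f g k assume fg: "(f, g) \<in> weil_rel X W" "(g, k) \<in> weil_rel X W"
    have "rst (wdim W) (\<lambda>x. h (f x) - h (k x)) \<in> wideal W" if "h \<in> funs X" for h
    proof -
      have "rst (wdim W) (\<lambda>x. h (f x) - h (g x)) \<in> wideal W" "rst (wdim W) (\<lambda>x. h (g x) - h (k x)) \<in> wideal W"
        using fg that by (auto simp: weil_rel_iff)
      from ideal_cinf_add[OF W this] show ?thesis by simp
    qed
    then show "(f, k) \<in> weil_rel X W" using fg by (simp add: weil_rel_iff)
  qed
qed

lemma pts_weil_prol:
  "pts (weil_prol X W) = {wcls X W g | g. smooth_map (euc (wdim W)) X g}"
proof -
  have "pts (weil_prol X W) = (\<lambda>g. weil_rel X W `` {g}) ` pts (fexp (euc (wdim W)) X)"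
    by (auto simp: weil_prol_def fquot_def Let_def quotient_def)
  also have "\<dots> = {wcls X W g | g. smooth_map (euc (wdim W)) X g}"
  proof (intro equalityI subsetI)
    fix A assume "A \<in> (\<lambda>g. weil_rel X W `` {g}) ` pts (fexp (euc (wdim W)) X)"
    then obtain g where g: "g \<in> extensional (Rn (wdim W))" "smooth_map (euc (wdim W)) X g"
      "A = weil_rel X W `` {g}" by (auto simp: pts_fexp)
    then have "A = wcls X W g" by (simp add: wcls_def extensional_restrict)
    then show "A \<in> {wcls X W g | g. smooth_map (euc (wdim W)) X g}" using g(2) by blast
  next
    fix A assume "A \<in> {wcls X W g | g. smooth_map (euc (wdim W)) X g}"
    then obtain g where "smooth_map (euc (wdim W)) X g" "A = wcls X W g" by blast
    then show "A \<in> (\<lambda>g. weil_rel X W `` {g}) ` pts (fexp (euc (wdim W)) X)"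
      unfolding wcls_def by (intro image_eqI[of _ _ "restrict g (Rn (wdim W))"]) (auto simp: pts_fexp)
  qed
  finally show ?thesis .
qed

lemma weil_prolE:
  assumes "A \<in> pts (weil_prol X W)"
  obtains g where "smooth_map (euc (wdim W)) X g" "A = wcls X W g"
  using assms by (auto simp: pts_weil_prol)

lemma wcls_cong: "(\<And>x. x \<in> Rn (wdim W) \<Longrightarrow> f x = g x) \<Longrightarrow> wcls X W f = wcls X W g"
  unfolding wcls_def by (metis restrict_ext)

lemma mem_wcls:
  assumes "f \<in> wcls X W g"
  shows "f \<in> extensional (Rn (wdim W))" "smooth_map (euc (wdim W)) X f" "smooth_map (euc (wdim W)) X g"
    "(restrict g (Rn (wdim W)), f) \<in> weil_rel X W"
  using assms by (auto simp: wcls_def weil_rel_iff)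

lemma wcls_self: "wideal_ok W \<Longrightarrow> smooth_map (euc (wdim W)) X g \<Longrightarrow> restrict g (Rn (wdim W)) \<in> wcls X W g"
  unfolding wcls_def by (rule equiv_class_self[OF equiv_weil_rel]) (auto simp: pts_fexp)

lemma weil_rel_restrict:
  "(restrict f (Rn (wdim W)), restrict g (Rn (wdim W))) \<in> weil_rel X W \<longleftrightarrow>
     smooth_map (euc (wdim W)) X f \<and> smooth_map (euc (wdim W)) X g \<and>
     (\<forall>h\<in>funs X. rst (wdim W) (\<lambda>x. h (f x) - h (g x)) \<in> wideal W)"
  by (simp add: weil_rel_iff cong: restrict_cong)

lemma wcls_eq_iff:
  assumes "wideal_ok W" "smooth_map (euc (wdim W)) X f" "smooth_map (euc (wdim W)) X g"
  shows "wcls X W f = wcls X W g \<longleftrightarrow> (\<forall>h\<in>funs X. rst (wdim W) (\<lambda>x. h (f x) - h (g x)) \<in> wideal W)"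
  using eq_equiv_class_iff[OF equiv_weil_rel[OF assms(1)], of "restrict f (Rn (wdim W))" X "restrict g (Rn (wdim W))"]
    assms(2,3) unfolding wcls_def by (simp add: pts_fexp weil_rel_restrict)

text \<open>\<open>wcomp\<close> and \<open>wmap\<close> apply a map to all representatives and
  saturate. If all images are related to one \<open>c\<close>, the union of their classes is the
  class of \<open>c\<close>.\<close>

lemma weil_rel_image_class:
  assumes W: "wideal_ok W" and A: "a \<in> A" and F: "\<And>g. g \<in> A \<Longrightarrow> (c, F g) \<in> weil_rel X W"
  shows "weil_rel X W `` (F ` A) = weil_rel X W `` {c}"
proof -
  have "weil_rel X W `` {F g} = weil_rel X W `` {c}" if "g \<in> A" for g
    using equiv_class_eq[OF equiv_weil_rel[OF W] F[OF that]] by simp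
  then show ?thesis using A by blast
qed

lemma wcomp_wcls:
  assumes W: "wideal_ok W" and V: "wideal_ok V" and f: "wmor W V f" and g: "smooth_map (euc (wdim W)) X g"
  shows "wcomp X V f (wcls X W g) = wcls X V (\<lambda>x. g (f x))"
  unfolding wcomp_def wcls_def[of X V]
proof (rule weil_rel_image_class[OF V wcls_self[OF W g]])
  fix g' assume g': "g' \<in> wcls X W g"
  have "rst (wdim V) (\<lambda>x. h (g (f x)) - h (g' (f x))) \<in> wideal V" if h: "h \<in> funs X" for h
  proof (rule wmor_ideal[OF f])
    have "rst (wdim W) (\<lambda>x. h (rst' x) - h (g' x)) \<in> wideal W" if "rst' = restrict g (Rn (wdim W))" for rst'
      using mem_wcls(4)[OF g'] h that by (auto simp: weil_rel_iff)
    then show "rst (wdim W) (\<lambda>x. h (g x) - h (g' x)) \<in> wideal W"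
      by (simp cong: restrict_cong)
  qed
  then show "(restrict (\<lambda>x. g (f x)) (Rn (wdim V)), \<lambda>x\<in>Rn (wdim V). g' (f x)) \<in> weil_rel X V"
    unfolding weil_rel_restrict
    using smooth_euc_wmor[OF f g] smooth_euc_wmor[OF f mem_wcls(2)[OF g']] by blast
qed

lemma wmap_wcls:
  assumes W: "wideal_ok W" and u: "smooth_map X Y u" and g: "smooth_map (euc (wdim W)) X g"
  shows "wmap Y W u (wcls X W g) = wcls Y W (\<lambda>x. u (g x))"
  unfolding wmap_def wcls_def[of Y W]
proof (rule weil_rel_image_class[OF W wcls_self[OF W g]])
  fix g' assume g': "g' \<in> wcls X W g"
  have "rst (wdim W) (\<lambda>x. h (u (g x)) - h (u (g' x))) \<in> wideal W" if h: "h \<in> funs Y" for h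
  proof -
    have "h \<circ> u \<in> funs X" using u h by (simp add: smooth_map_def)
    then have "rst (wdim W) (\<lambda>x. (h \<circ> u) (restrict g (Rn (wdim W)) x) - (h \<circ> u) (g' x)) \<in> wideal W"
      using mem_wcls(4)[OF g'] by (auto simp: weil_rel_iff simp del: restrict_apply)
    then show ?thesis by (simp cong: restrict_cong)
  qed
  then show "(restrict (\<lambda>x. u (g x)) (Rn (wdim W)), \<lambda>x\<in>Rn (wdim W). u (g' x)) \<in> weil_rel Y W"
    unfolding weil_rel_restrict
    using smooth_map_compose[OF g u] smooth_map_compose[OF mem_wcls(2)[OF g'] u] by blast
qed

lemma wcls_pts: "smooth_map (euc (wdim W)) X g \<Longrightarrow> wcls X W g \<in> pts (weil_prol X W)"
  by (auto simp: pts_weil_prol)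

lemma wcomp_pts:
  assumes "wideal_ok W" "wideal_ok V" "wmor W V f" "A \<in> pts (weil_prol X W)"
  shows "wcomp X V f A \<in> pts (weil_prol X V)"
  using assms(4) by (rule weil_prolE) (simp add: wcomp_wcls[OF assms(1-3)] wcls_pts smooth_euc_wmor[OF assms(3)])

lemma wmap_pts:
  assumes "wideal_ok W" "smooth_map X Y u" "A \<in> pts (weil_prol X W)"
  shows "wmap Y W u A \<in> pts (weil_prol Y W)"
  using assms(3) by (rule weil_prolE) (simp add: wmap_wcls[OF assms(1,2)] wcls_pts smooth_map_compose[OF _ assms(2)])

lemma wcomp_wcomp:
  assumes "wideal_ok W" "wideal_ok V" "wideal_ok U" "wmor W V f" "wmor V U g" "A \<in> pts (weil_prol X W)"
  shows "wcomp X U g (wcomp X V f A) = wcomp X U (\<lambda>x. f (g x)) A"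
  using assms(6)
proof (rule weil_prolE)
  fix a assume a: "smooth_map (euc (wdim W)) X a" "A = wcls X W a"
  show ?thesis
    by (simp add: a(2) wcomp_wcls[OF assms(1,2,4) a(1)] wcomp_wcls[OF assms(2,3,5) smooth_euc_wmor[OF assms(4) a(1)]]
      wcomp_wcls[OF assms(1,3) wmor_compose[OF assms(4,5)] a(1)])
qed

lemma wcomp_wmap:
  assumes "wideal_ok W" "wideal_ok V" "wmor W V f" "smooth_map X Y u" "A \<in> pts (weil_prol X W)"
  shows "wcomp Y V f (wmap Y W u A) = wmap Y V u (wcomp X V f A)"
  using assms(5)
proof (rule weil_prolE)
  fix a assume a: "smooth_map (euc (wdim W)) X a" "A = wcls X W a"
  show ?thesis
    by (simp add: a(2) wcomp_wcls[OF assms(1-3) a(1)] wmap_wcls[OF assms(1,4) a(1)]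
      wcomp_wcls[OF assms(1-3) smooth_map_compose[OF a(1) assms(4)]]
      wmap_wcls[OF assms(2,4) smooth_euc_wmor[OF assms(3) a(1)]])
qed

lemma wcomp_cong: "(\<And>x. x \<in> Rn (wdim V) \<Longrightarrow> f x = g x) \<Longrightarrow> wcomp X V f A = wcomp X V g A"
  unfolding wcomp_def by (intro arg_cong[of _ _ "\<lambda>B. weil_rel X V `` B"] image_cong restrict_ext) auto

lemma wmor_id: "wmor W W (\<lambda>x. x)"
  by (simp add: wmor_def smooth_map_euc)

lemma wcomp_id: "wideal_ok W \<Longrightarrow> A \<in> pts (weil_prol X W) \<Longrightarrow> wcomp X W (\<lambda>x. x) A = A"
  by (erule weil_prolE) (simp add: wcomp_wcls[OF _ _ wmor_id])

lemma smooth_const: "x \<in> pts X \<Longrightarrow> smooth_map (euc k) X (\<lambda>v. x)"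
  by (simp add: smooth_euc_iff)

lemma wconst_pts: "x \<in> pts X \<Longrightarrow> wconst X W x \<in> pts (weil_prol X W)"
  unfolding wconst_def by (intro wcls_pts smooth_const)

lemma wcomp_wconst:
  assumes "wideal_ok W" "wideal_ok V" "wmor W V f" "x \<in> pts X"
  shows "wcomp X V f (wconst X W x) = wconst X V x"
  unfolding wconst_def by (rule wcomp_wcls[OF assms(1-3) smooth_const[OF assms(4)]])

lemma wmap_wconst:
  assumes "wideal_ok W" "smooth_map X Y u" "x \<in> pts X"
  shows "wmap Y W u (wconst X W x) = wconst Y W (u x)"
  unfolding wconst_def by (rule wmap_wcls[OF assms(1,2) smooth_const[OF assms(3)]])

text \<open>Composition with the zero map factors through the one-point object, so only the base
  point of \<open>A\<close> matters.\<close>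

lemma wcomp_const:
  assumes "wideal_ok W" "wideal_ok V" "A \<in> pts (weil_prol X W)"
    "wmor W (wedge 0 0) (\<lambda>x i. 0)" "wcomp X (wedge 0 0) (\<lambda>x i. 0) A = wconst X (wedge 0 0) x"
    "wmor (wedge 0 0) V (\<lambda>x i. 0)" "x \<in> pts X"
  shows "wcomp X V (\<lambda>x i. 0) A = wconst X V x"
  using wcomp_wcomp[OF assms(1) wideal_ok_wedge assms(2,4,6,3)]
  by (simp add: assms(5) wcomp_wconst[OF wideal_ok_wedge assms(2,6,7)])


subsection \<open>Smoothness in terms of curves\<close>

lemma curves_fquot:
  assumes "range c \<subseteq> pts (fquot X r)" "\<And>f. f \<in> funs (fquot X r) \<Longrightarrow> Cinf_real (f \<circ> c)"
  shows "c \<in> curves (fquot X r)"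
  using assms by (simp add: fquot_def Let_def)

lemma curves_weil_prolI:
  assumes "range c \<subseteq> pts (weil_prol X W)" "\<And>f. f \<in> funs (weil_prol X W) \<Longrightarrow> Cinf_real (f \<circ> c)"
  shows "c \<in> curves (weil_prol X W)"
  using assms unfolding weil_prol_def by (rule curves_fquot)

lemma curves_weil_prolD:
  assumes "c \<in> curves (weil_prol X W)"
  shows "range c \<subseteq> pts (weil_prol X W)" "f \<in> funs (weil_prol X W) \<Longrightarrow> Cinf_real (f \<circ> c)"
  using assms by (auto simp: weil_prol_def fquot_def Let_def)

text \<open>The generating curves of the exponential, before saturation. Functions on the
  exponential, and hence functions on a prolongation, are tested on these alone.\<close>

definition fexp_plots :: "'y fspace \<Rightarrow> 'a fspace \<Rightarrow> (real \<Rightarrow> 'y \<Rightarrow> 'a) set" where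
  "fexp_plots Y X = {c. range c \<subseteq> pts (fexp Y X) \<and>
     (\<forall>s d. Cinf_real s \<and> d \<in> curves Y \<longrightarrow> (\<lambda>t. c (s t) (d t)) \<in> curves X)}"

lemma funs_fexp: "funs (fexp Y X) = {f. \<forall>c\<in>fexp_plots Y X. Cinf_real (f \<circ> c)}"
  by (auto simp: fexp_def Let_def fexp_plots_def)

lemma funs_weil_prol: "f \<in> funs (weil_prol X W) \<longleftrightarrow>
    (\<forall>c\<in>fexp_plots (euc (wdim W)) X. Cinf_real (\<lambda>t. f (weil_rel X W `` {c t})))"
  by (simp add: weil_prol_def fquot_def Let_def funs_fexp comp_def)

lemma fexp_plots_pts: "c \<in> fexp_plots Y X \<Longrightarrow> c t \<in> extensional (pts Y) \<and> smooth_map Y X (c t)"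
  by (auto simp: fexp_plots_def pts_fexp subset_eq)

lemma curve_of_plot:
  assumes "c \<in> fexp_plots (euc (wdim W)) X"
  shows "(\<lambda>t. wcls X W (c t)) \<in> curves (weil_prol X W)"
proof (rule curves_weil_prolI)
  show "range (\<lambda>t. wcls X W (c t)) \<subseteq> pts (weil_prol X W)"
    using fexp_plots_pts[OF assms] by (auto intro!: wcls_pts)
  show "Cinf_real (f \<circ> (\<lambda>t. wcls X W (c t)))" if "f \<in> funs (weil_prol X W)" for f
    using that assms fexp_plots_pts[OF assms]
    by (auto simp: funs_weil_prol wcls_def extensional_restrict comp_def)
qed

lemma curves_euc_wmor:
  assumes "smooth_map (euc l) (euc k) f" "d \<in> curves (euc l)"
  shows "(\<lambda>t. f (d t)) \<in> curves (euc k)"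
proof -
  have d: "range d \<subseteq> Rn l" "\<And>i. i < l \<Longrightarrow> Cinf_real (\<lambda>t. d t i)" using assms(2) by (auto simp: euc_def)
  have "Cinf_real (\<lambda>t. f (d t) i)" for i
  proof -
    have "Cinf l (\<lambda>x. f x i)"
      using assms(1)[unfolded smooth_map_euc, THEN conjunct2, rule_format, OF Cinf_coord] .
    then have "Cinf 1 (\<lambda>v. f (d (v 0)) i)"
      by (rule Cinf_compose[where f = "\<lambda>v. d (v 0)"]) (use d in \<open>auto simp: Cinf_real_def\<close>)
    then show ?thesis by (simp add: Cinf_real_def)
  qed
  moreover have "f (d t) \<in> Rn k" for t using assms(1) d(1) by (auto simp: smooth_map_euc)
  ultimately show ?thesis by (auto simp: euc_def)
qed

text \<open>Precomposition with \<open>f\<close> turns a plot over \<open>W\<close> into a plot over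
  \<open>V\<close>. So functions on the prolongation over \<open>V\<close> pull back to functions on
  the one over \<open>W\<close>, and functions determine the curves.\<close>

lemma curves_wcomp:
  assumes W: "wideal_ok W" and V: "wideal_ok V" and f: "wmor W V f" and c: "c \<in> curves (weil_prol X W)"
  shows "(\<lambda>t. wcomp X V f (c t)) \<in> curves (weil_prol X V)"
proof (rule curves_weil_prolI)
  show "range (\<lambda>t. wcomp X V f (c t)) \<subseteq> pts (weil_prol X V)"
    using curves_weil_prolD(1)[OF c] by (auto intro!: wcomp_pts[OF W V f])
  fix h assume h: "h \<in> funs (weil_prol X V)"
  have "(\<lambda>A. h (wcomp X V f A)) \<in> funs (weil_prol X W)"
    unfolding funs_weil_prol
  proof
    fix p assume p: "p \<in> fexp_plots (euc (wdim W)) X"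
    define q where "q t = (\<lambda>x\<in>Rn (wdim V). p t (f x))" for t
    have "q \<in> fexp_plots (euc (wdim V)) X"
      unfolding fexp_plots_def
    proof (intro CollectI conjI allI impI)
      show "range q \<subseteq> pts (fexp (euc (wdim V)) X)"
        using smooth_euc_wmor[OF f conjunct2[OF fexp_plots_pts[OF p]]] by (auto simp: pts_fexp q_def)
      fix s d assume "Cinf_real s \<and> d \<in> curves (euc (wdim V))"
      then have "(\<lambda>t. p (s t) (f (d t))) \<in> curves X"
        using p curves_euc_wmor[OF wmor_smooth[OF f]] by (auto simp: fexp_plots_def)
      moreover have "d t \<in> Rn (wdim V)" for t
        using \<open>Cinf_real s \<and> d \<in> curves (euc (wdim V))\<close> by (auto simp: euc_def)
      ultimately show "(\<lambda>t. q (s t) (d t)) \<in> curves X" by (simp add: q_def)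
    qed
    then have "Cinf_real (\<lambda>t. h (weil_rel X V `` {q t}))" using h by (simp add: funs_weil_prol)
    moreover have "wcomp X V f (weil_rel X W `` {p t}) = weil_rel X V `` {q t}" for t
      using wcomp_wcls[OF W V f, of X "p t"] fexp_plots_pts[OF p, of t]
      by (simp add: wcls_def extensional_restrict q_def)
    ultimately show "Cinf_real (\<lambda>t. h (wcomp X V f (weil_rel X W `` {p t})))" by simp
  qed
  from curves_weil_prolD(2)[OF c this] show "Cinf_real (h \<circ> (\<lambda>t. wcomp X V f (c t)))"
    by (simp add: comp_def)
qed

lemma Cinf_real_const [simp]: "Cinf_real (\<lambda>t. a)"
  by (simp add: Cinf_real_def)

lemma curves_weil_prol_const: "A \<in> pts (weil_prol X W) \<Longrightarrow> (\<lambda>t. A) \<in> curves (weil_prol X W)"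
  by (rule curves_weil_prolI) (auto simp: comp_def)

text \<open>Functions on a subspace are dual to the curves inside it, and functions on the whole
  space are among them. This trades a condition on all functions for one on curves, the form in
  which limits are described.\<close>

lemma smooth_fsub_iff:
  assumes "S' \<subseteq> pts (weil_prol Y V)"
  shows "smooth_map (fsub X S) (fsub (weil_prol Y V) S') F \<longleftrightarrow> F \<in> S \<rightarrow> S' \<and>
    (\<forall>c\<in>curves X. range c \<subseteq> S \<longrightarrow> (\<lambda>t. F (c t)) \<in> curves (weil_prol Y V))"
proof
  assume F: "smooth_map (fsub X S) (fsub (weil_prol Y V) S') F"
  then have FS: "F \<in> S \<rightarrow> S'" by (simp add: smooth_map_def fsub_def)
  have "(\<lambda>t. F (c t)) \<in> curves (weil_prol Y V)" if c: "c \<in> curves X" "range c \<subseteq> S" for c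
  proof (rule curves_weil_prolI)
    show "range (\<lambda>t. F (c t)) \<subseteq> pts (weil_prol Y V)" using FS c(2) assms by auto
    fix h assume "h \<in> funs (weil_prol Y V)"
    then have "h \<in> funs (fsub (weil_prol Y V) S')"
      by (auto simp: fsub_def dest: curves_weil_prolD(2))
    then have "h \<circ> F \<in> funs (fsub X S)" using F by (simp add: smooth_map_def)
    then show "Cinf_real (h \<circ> (\<lambda>t. F (c t)))" using c by (simp add: fsub_def comp_def)
  qed
  then show "F \<in> S \<rightarrow> S' \<and> (\<forall>c\<in>curves X. range c \<subseteq> S \<longrightarrow> (\<lambda>t. F (c t)) \<in> curves (weil_prol Y V))"
    using FS by blast
next
  assume F: "F \<in> S \<rightarrow> S' \<and> (\<forall>c\<in>curves X. range c \<subseteq> S \<longrightarrow> (\<lambda>t. F (c t)) \<in> curves (weil_prol Y V))"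
  have "h \<circ> F \<in> funs (fsub X S)" if h: "h \<in> funs (fsub (weil_prol Y V) S')" for h
  proof -
    have "Cinf_real (h \<circ> F \<circ> c)" if c: "c \<in> curves X" "range c \<subseteq> S" for c
    proof -
      have "(\<lambda>t. F (c t)) \<in> curves (weil_prol Y V)" "range (\<lambda>t. F (c t)) \<subseteq> S'" using F c by auto
      then have "Cinf_real (h \<circ> (\<lambda>t. F (c t)))" using h by (simp add: fsub_def)
      then show ?thesis by (simp add: comp_def)
    qed
    then show ?thesis by (simp add: fsub_def)
  qed
  then show "smooth_map (fsub X S) (fsub (weil_prol Y V) S') F" using F by (simp add: smooth_map_def fsub_def)
qed

lemma frolicher_curveI:
  assumes X: "frolicher X" and c: "\<And>t. c t \<in> pts X" "\<And>h. h \<in> funs X \<Longrightarrow> Cinf_real (\<lambda>t. h (c t))"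
  shows "c \<in> curves X"
proof -
  have "curves X = {c. range c \<subseteq> pts X \<and> (\<forall>f\<in>funs X. Cinf_real (f \<circ> c))}"
    using X unfolding frolicher_def by (rule conjunct1)
  moreover have "range c \<subseteq> pts X \<and> (\<forall>f\<in>funs X. Cinf_real (f \<circ> c))"
    using c by (auto simp: comp_def)
  ultimately show ?thesis by blast
qed

text \<open>A representative \<open>g\<close> gives the jointly smooth map sending \<open>t\<close>
  and \<open>d\<close> to \<open>g (d(i := t * d i))\<close>, so its scalings form a plot of the
  exponential. \<open>frolicher X\<close> converts smoothness against functions into curves of
  \<open>X\<close>.\<close>

lemma scale_curve:
  assumes X: "frolicher X" and A: "A \<in> pts (weil_prol X (wedge N 0))" and i: "i < N"
  shows "(\<lambda>t. wcomp X (wedge N 0) (\<lambda>d. d(i := t * d i)) A) \<in> curves (weil_prol X (wedge N 0))"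
proof -
  from A obtain g where g: "smooth_map (euc (wdim (wedge N 0))) X g" "A = wcls X (wedge N 0) g"
    by (rule weil_prolE)
  define c where "c t = (\<lambda>d\<in>Rn N. g (d(i := t * d i)))" for t
  have mem: "x(i := t * x i) \<in> Rn N" if "x \<in> Rn N" for x t using that i by (rule Rn_upd)
  have sm: "smooth_map (euc N) X (\<lambda>d. g (d(i := t * d i)))" for t
    using smooth_euc_wmor[OF wmor_scale g(1)] by simp
  have "c \<in> fexp_plots (euc N) X"
    unfolding fexp_plots_def
  proof (intro CollectI conjI allI impI)
    show "range c \<subseteq> pts (fexp (euc N) X)"
      using sm by (auto simp: pts_fexp c_def)
    fix s d assume sd: "Cinf_real s \<and> d \<in> curves (euc N)"
    then have d: "d t \<in> Rn N" "\<And>j. j < N \<Longrightarrow> Cinf_real (\<lambda>t. d t j)" for t by (auto simp: euc_def)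
    have "Cinf_real (\<lambda>t. h (g ((d t)(i := s t * d t i))))" if h: "h \<in> funs X" for h
    proof -
      have "Cinf N (\<lambda>x. h (g x))" using g(1) h by (simp add: smooth_euc_iff)
      then have "Cinf 1 (\<lambda>v. h (g ((d (v 0))(i := s (v 0) * d (v 0) i))))"
      proof (rule Cinf_compose[where f = "\<lambda>v. (d (v 0))(i := s (v 0) * d (v 0) i)"])
        show "Cinf 1 (\<lambda>v. ((d (v 0))(i := s (v 0) * d (v 0) i)) j)" if "j < N" for j
          using sd d(2) that i by (cases "j = i") (auto simp: Cinf_real_def intro: Cinf_mult)
        show "(\<lambda>v. (d (v 0))(i := s (v 0) * d (v 0) i)) \<in> Rn 1 \<rightarrow> Rn N" using mem[OF d(1)] by auto
      qed
      then show ?thesis by (simp add: Cinf_real_def)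
    qed
    moreover have "g ((d t)(i := s t * d t i)) \<in> pts X" for t
      using g(1) mem[OF d(1)] by (auto simp: smooth_euc_iff)
    ultimately have "(\<lambda>t. g ((d t)(i := s t * d t i))) \<in> curves X"
      by (intro frolicher_curveI[OF X])
    then show "(\<lambda>t. c (s t) (d t)) \<in> curves X" by (simp add: c_def d(1))
  qed
  then have "c \<in> fexp_plots (euc (wdim (wedge N 0))) X" by simp
  from curve_of_plot[OF this] have "(\<lambda>t. wcls X (wedge N 0) (c t)) \<in> curves (weil_prol X (wedge N 0))" .
  moreover have "wcls X (wedge N 0) (c t) = wcomp X (wedge N 0) (\<lambda>d. d(i := t * d i)) A" for t
    unfolding g(2) wcomp_wcls[OF wideal_ok_wedge wideal_ok_wedge wmor_scale g(1)]
    by (rule wcls_cong) (simp add: c_def)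
  ultimately show ?thesis by simp
qed


subsection \<open>Homotheties\<close>

lemma wideal_ok_W_Dsub: "wideal_ok (W_Dsub m)"
  unfolding W_Dsub_def
proof (rule wideal_ok_winf)
  fix p :: "vec \<Rightarrow> real" assume "p \<in> {\<lambda>d. d 0 ^ (m + 1)}"
  moreover have "Cinf 1 (\<lambda>d. d 0 ^ a)" for a by (induction a) auto
  ultimately show "Cinf 1 p" by (simp only: singleton_iff)
qed

lemma wdim_W_Dsub [simp]: "wdim (W_Dsub m) = 1"
  by (simp add: W_Dsub_def winf_def)

lemma wcls_of_member:
  assumes "wideal_ok W" "g \<in> A" "A \<in> pts (weil_prol X W)"
  shows "smooth_map (euc (wdim W)) X g" "A = wcls X W g"
proof -
  obtain a where a: "A = wcls X W a" using assms(3) by (rule weil_prolE)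
  with assms(2) have g: "g \<in> wcls X W a" by simp
  show "smooth_map (euc (wdim W)) X g" by (rule mem_wcls(2)[OF g])
  have "weil_rel X W `` {restrict a (Rn (wdim W))} = weil_rel X W `` {g}"
    by (rule equiv_class_eq[OF equiv_weil_rel[OF assms(1)] mem_wcls(4)[OF g]])
  then show "A = wcls X W g"
    unfolding a wcls_def using mem_wcls(1)[OF g] by (simp add: extensional_restrict)
qed

text \<open>For fixed \<open>z\<close> the map \<open>mu\<close> is scaling by \<open>z 0\<close>,
  and its effect on the class does not depend on the representative. The image of \<open>A\<close>
  in the definition of \<open>wcurry\<close> is therefore a single function, the curve of scalings
  of \<open>A\<close>.\<close>

lemma wcurry_mu:
  assumes A: "A \<in> pts (weil_prol X (wedge N 0))" and i: "i < N"
  shows "wcurry S X (wedge N 0) (W_Dsub m) (mu N i) A =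
    wcls S (W_Dsub m) (\<lambda>z. wcomp X (wedge N 0) (\<lambda>d. d(i := z 0 * d i)) A)"
proof -
  have "(\<lambda>z\<in>Rn 1. wcls X (wedge N 0) (\<lambda>x. g (mu N i (vjoin N x z)))) =
      (\<lambda>z\<in>Rn 1. wcomp X (wedge N 0) (\<lambda>d. d(i := z 0 * d i)) A)" if g: "g \<in> A" for g
  proof (rule restrict_ext)
    fix z
    note ga = wcls_of_member[OF wideal_ok_wedge g A]
    have "wcls X (wedge N 0) (\<lambda>x. g (mu N i (vjoin N x z))) = wcls X (wedge N 0) (\<lambda>x. g (x(i := z 0 * x i)))"
    proof (rule wcls_cong)
      fix x assume "x \<in> Rn (wdim (wedge N 0))"
      then have "mu N i (vjoin N x z) = x(i := z 0 * x i)"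
        using i by (auto simp: mu_def vjoin_def Rn_def fun_eq_iff)
      then show "g (mu N i (vjoin N x z)) = g (x(i := z 0 * x i))" by simp
    qed
    also have "\<dots> = wcomp X (wedge N 0) (\<lambda>d. d(i := z 0 * d i)) A"
      unfolding ga(2) by (rule wcomp_wcls[OF wideal_ok_wedge wideal_ok_wedge wmor_scale ga(1), symmetric])
    finally show "wcls X (wedge N 0) (\<lambda>x. g (mu N i (vjoin N x z))) =
        wcomp X (wedge N 0) (\<lambda>d. d(i := z 0 * d i)) A" .
  qed
  moreover have "A \<noteq> {}"
    using A by (rule weil_prolE) (use wcls_self[OF wideal_ok_wedge] in blast)
  ultimately have "(\<lambda>g. \<lambda>z\<in>Rn 1. wcls X (wedge N 0) (\<lambda>x. g (mu N i (vjoin N x z)))) ` A =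
      {\<lambda>z\<in>Rn 1. wcomp X (wedge N 0) (\<lambda>d. d(i := z 0 * d i)) A}"
    by (auto simp: image_iff)
  then show ?thesis by (simp add: wcurry_def wcls_def)
qed

lemma smooth_of_curve:
  assumes "c \<in> curves X" "range c \<subseteq> S"
  shows "smooth_map (euc 1) (fsub X S) (\<lambda>z. c (z 0))"
proof -
  have "Cinf 1 (\<lambda>z. h (c (z 0)))" if "h \<in> funs (fsub X S)" for h
    using that assms by (auto simp: fsub_def Cinf_real_def comp_def)
  then show ?thesis using assms(2) by (auto simp: smooth_euc_iff fsub_def)
qed

text \<open>
  Condition (3) of a pseudotangential and condition (2) of a form say that a smooth map commutes with
  the scalings by the elements of \<open>D_m\<close>; as \<open>S \<otimes> D_m\<close> is made of classes of curves in \<open>S\<close>, this is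
  implied by the same condition for real scalars.
\<close>

lemma homothety:
  assumes X: "frolicher X" and S: "S \<subseteq> pts (weil_prol X (wedge N 0))"
    and S': "S' \<subseteq> pts (weil_prol Y (wedge N' 0))"
    and T: "smooth_map (fsub (weil_prol X (wedge N 0)) S) (fsub (weil_prol Y (wedge N' 0)) S') T"
    and i: "i < N" "i' < N'" and \<gamma>: "\<gamma> \<in> S"
    and closed: "\<And>t. wcomp X (wedge N 0) (\<lambda>d. d(i := t * d i)) \<gamma> \<in> S"
    and hom: "\<And>t. T (wcomp X (wedge N 0) (\<lambda>d. d(i := t * d i)) \<gamma>) =
      wcomp Y (wedge N' 0) (\<lambda>d. d(i' := t * d i')) (T \<gamma>)"
  shows "wmap (fsub (weil_prol Y (wedge N' 0)) S') (W_Dsub m) T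
      (wcurry (fsub (weil_prol X (wedge N 0)) S) X (wedge N 0) (W_Dsub m) (mu N i) \<gamma>) =
    wcurry (fsub (weil_prol Y (wedge N' 0)) S') Y (wedge N' 0) (W_Dsub m) (mu N' i') (T \<gamma>)"
proof -
  have "T \<gamma> \<in> S'" using T \<gamma> by (auto simp: smooth_map_def fsub_def)
  then have T\<gamma>: "T \<gamma> \<in> pts (weil_prol Y (wedge N' 0))" using S' by blast
  have \<gamma>': "\<gamma> \<in> pts (weil_prol X (wedge N 0))" using S \<gamma> by blast
  \<comment> \<open>The real scalings of \<gamma> form a curve inside \<open>S\<close>, which
    represents an element of the prolongation of \<open>S\<close> itself, as \<open>wmap\<close>
    along \<open>T\<close> requires.\<close>
  have "smooth_map (euc (wdim (W_Dsub m))) (fsub (weil_prol X (wedge N 0)) S)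
      (\<lambda>z. wcomp X (wedge N 0) (\<lambda>d. d(i := z 0 * d i)) \<gamma>)"
    using smooth_of_curve[OF scale_curve[OF X \<gamma>' i(1)]] closed by auto
  then show ?thesis
    by (simp add: wcurry_mu[OF \<gamma>' i(1)] wcurry_mu[OF T\<gamma> i(2)] wmap_wcls[OF wideal_ok_W_Dsub T] hom)
qed


subsection \<open>Lifting along quasi-colimit diagrams\<close>

text \<open>Compatibility with a map of cosets forces \<open>f\<close> to respect the ideals, since
  members of the ideal have the same coset as 0. This applies to the map chosen by
  \<open>SOME\<close> in \<open>wfun\<close>.\<close>

lemma induces_wmor:
  assumes W: "wideal_ok W" and V: "wideal_ok V" and f: "induces W V f \<phi>"
  shows "wmor W V f"
  unfolding wmor_def
proof (intro conjI allI impI)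
  show sm: "smooth_map (euc (wdim V)) (euc (wdim W)) f" using f by (simp add: induces_def)
  fix h assume h: "rst (wdim W) h \<in> wideal W"
  have hC: "Cinf (wdim W) h" by (rule ideal_cinf_Cinf[OF W h])
  have "wres W (rst (wdim W) h) = wres W (rst (wdim W) (\<lambda>x. 0))"
    using wres_eq_iff[OF W, of "rst (wdim W) h" "rst (wdim W) (\<lambda>x. 0)"] hC h by (simp cong: restrict_cong)
  then have "wres V (\<lambda>x. rst (wdim W) h (f x)) = wres V (\<lambda>x. rst (wdim W) (\<lambda>x. 0) (f x))"
    using f hC unfolding induces_def by (metis Cinf_const restrict_carrier)
  moreover have "wres V (\<lambda>x. rst (wdim W) g (f x)) = wres V (\<lambda>x. g (f x))" for g
  proof -
    have "rst (wdim V) (\<lambda>x. rst (wdim W) g (f x)) = rst (wdim V) (\<lambda>x. g (f x))"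
      using sm by (intro rst_eqI) (auto simp: smooth_map_euc)
    then show ?thesis unfolding wres_def by (rule arg_cong)
  qed
  ultimately have "wres V (\<lambda>x. h (f x)) = wres V (\<lambda>x. 0)" by (simp only:)
  then show "rst (wdim V) (\<lambda>x. h (f x)) \<in> wideal V"
    using wres_eq_iff[OF V, of "\<lambda>x. h (f x)" "\<lambda>x. 0"] sm hC by (simp add: smooth_map_euc)
qed

text \<open>Whatever map is chosen induces the same homomorphism as \<open>f\<close>. Evaluated at
  \<open>h\<close> composed with a representative, this says that the two compositions differ by a
  member of the ideal for every \<open>h\<close>.\<close>

lemma wfun_pull:
  assumes W: "wideal_ok W" and V: "wideal_ok V" and f: "wmor W V f" and A: "A \<in> pts (weil_prol X W)"
  shows "wfun X W V (pull V f) A = wcomp X V f A"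
proof -
  define f' where "f' = (SOME f'. induces W V f' (pull V f))"
  have f': "induces W V f' (pull V f)"
    unfolding f'_def by (rule someI[of "\<lambda>f'. induces W V f' (pull V f)"]) (rule induces_pull[OF W V f])
  note m' = induces_wmor[OF W V f']
  from A obtain g where g: "smooth_map (euc (wdim W)) X g" "A = wcls X W g" by (rule weil_prolE)
  have "rst (wdim V) (\<lambda>x. h (g (f' x)) - h (g (f x))) \<in> wideal V" if h: "h \<in> funs X" for h
  proof -
    have hg: "Cinf (wdim W) (\<lambda>x. h (g x))" using g(1) h by (simp add: smooth_euc_iff)
    let ?r = "rst (wdim W) (\<lambda>x. h (g x))"
    have "wres V (\<lambda>x. ?r (f' x)) = wres V (\<lambda>x. ?r (f x))"
      using f' pull_wres[OF W V f, of ?r] hg by (simp add: induces_def)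
    moreover have "wres V (\<lambda>x. ?r (a x)) = wres V (\<lambda>x. h (g (a x)))" if "wmor W V a" for a
      unfolding wres_def using wmor_mem[OF that] by (simp cong: restrict_cong)
    ultimately have "wres V (\<lambda>x. h (g (f' x))) = wres V (\<lambda>x. h (g (f x)))" using m' f by simp
    then show ?thesis
      using wres_eq_iff[OF V wmor_Cinf[OF m' hg] wmor_Cinf[OF f hg]] by simp
  qed
  then have "wcls X V (\<lambda>x. g (f' x)) = wcls X V (\<lambda>x. g (f x))"
    using wcls_eq_iff[OF V smooth_euc_wmor[OF m' g(1)] smooth_euc_wmor[OF f g(1)]] by blast
  then show ?thesis
    unfolding wfun_def f'_def[symmetric] g(2) by (simp add: wcomp_wcls[OF W V m' g(1)] wcomp_wcls[OF W V f g(1)])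
qed

text \<open>Both halves of microlinearity are wanted in terms of \<open>wcomp\<close>: the universal
  property makes the operations well defined, and the initial structure of the limit makes them
  smooth.\<close>

lemma microlinear_lift:
  assumes X: "microlinear X"
    and cone: "weil_limit_cone J Ws ((\<lambda>(i, j, f). (i, j, pull (Ws j) f)) ` Q) W (\<lambda>j. pull (Ws j) (p j))"
    and W: "wideal_ok W" and Ws: "\<And>j. j \<in> J \<Longrightarrow> wideal_ok (Ws j)"
    and Q: "\<And>i j f. (i, j, f) \<in> Q \<Longrightarrow> i \<in> J \<and> j \<in> J \<and> wmor (Ws i) (Ws j) f"
    and p: "\<And>j. j \<in> J \<Longrightarrow> wmor W (Ws j) (p j)"
  shows "(\<And>j. j \<in> J \<Longrightarrow> a j \<in> pts (weil_prol X (Ws j))) \<Longrightarrow>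
      (\<And>i j f. (i, j, f) \<in> Q \<Longrightarrow> wcomp X (Ws j) f (a i) = a j) \<Longrightarrow>
      \<exists>!y. y \<in> pts (weil_prol X W) \<and> (\<forall>j\<in>J. wcomp X (Ws j) (p j) y = a j)"
    and "range c \<subseteq> pts (weil_prol X W) \<Longrightarrow>
      (\<And>j. j \<in> J \<Longrightarrow> (\<lambda>t. wcomp X (Ws j) (p j) (c t)) \<in> curves (weil_prol X (Ws j))) \<Longrightarrow>
      c \<in> curves (weil_prol X W)"
proof -
  let ?Q = "(\<lambda>(i, j, \<phi>). (i, j, wfun X (Ws i) (Ws j) \<phi>)) ` (\<lambda>(i, j, f). (i, j, pull (Ws j) f)) ` Q"
  have lim: "frolicher_limit_cone J (\<lambda>j. weil_prol X (Ws j)) ?Q (weil_prol X W) (\<lambda>j. wfun X W (Ws j) (pull (Ws j) (p j)))"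
    using X cone unfolding microlinear_def by blast
  have pw: "wfun X W (Ws j) (pull (Ws j) (p j)) y = wcomp X (Ws j) (p j) y"
    if "j \<in> J" "y \<in> pts (weil_prol X W)" for j y
    using wfun_pull[OF W Ws[OF that(1)] p[OF that(1)] that(2)] .
  {
    assume a: "\<And>j. j \<in> J \<Longrightarrow> a j \<in> pts (weil_prol X (Ws j))"
      and compat: "\<And>i j f. (i, j, f) \<in> Q \<Longrightarrow> wcomp X (Ws j) f (a i) = a j"
    have "\<forall>(i, j, u)\<in>?Q. u (a i) = a j"
    proof clarsimp
      fix i j f assume ijf: "(i, j, f) \<in> Q"
      then have "i \<in> J" "j \<in> J" "wmor (Ws i) (Ws j) f" using Q by blast+
      then show "wfun X (Ws i) (Ws j) (pull (Ws j) f) (a i) = a j"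
        using wfun_pull[OF Ws Ws _ a] compat[OF ijf] by simp
    qed
    then have pre: "(\<forall>j\<in>J. a j \<in> pts (weil_prol X (Ws j))) \<and> (\<forall>(i, j, u)\<in>?Q. u (a i) = a j)"
      using a by simp
    have "\<forall>a. (\<forall>j\<in>J. a j \<in> pts (weil_prol X (Ws j))) \<and> (\<forall>(i, j, u)\<in>?Q. u (a i) = a j) \<longrightarrow>
        (\<exists>!y. y \<in> pts (weil_prol X W) \<and> (\<forall>j\<in>J. wfun X W (Ws j) (pull (Ws j) (p j)) y = a j))"
      using lim unfolding frolicher_limit_cone_def by (elim conjE) assumption
    from this[THEN spec, THEN mp, OF pre]
    have "\<exists>!y. y \<in> pts (weil_prol X W) \<and> (\<forall>j\<in>J. wfun X W (Ws j) (pull (Ws j) (p j)) y = a j)" .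
    moreover have "(y \<in> pts (weil_prol X W) \<and> (\<forall>j\<in>J. wfun X W (Ws j) (pull (Ws j) (p j)) y = a j)) \<longleftrightarrow>
        (y \<in> pts (weil_prol X W) \<and> (\<forall>j\<in>J. wcomp X (Ws j) (p j) y = a j))" for y
      using pw by auto
    ultimately show "\<exists>!y. y \<in> pts (weil_prol X W) \<and> (\<forall>j\<in>J. wcomp X (Ws j) (p j) y = a j)" by simp
  next
    assume c: "range c \<subseteq> pts (weil_prol X W)"
      "\<And>j. j \<in> J \<Longrightarrow> (\<lambda>t. wcomp X (Ws j) (p j) (c t)) \<in> curves (weil_prol X (Ws j))"
    have "wfun X W (Ws j) (pull (Ws j) (p j)) \<circ> c \<in> curves (weil_prol X (Ws j))" if "j \<in> J" for j
    proof -
      have "wfun X W (Ws j) (pull (Ws j) (p j)) \<circ> c = (\<lambda>t. wcomp X (Ws j) (p j) (c t))"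
        using c(1) pw[OF that] by (auto simp: fun_eq_iff)
      then show ?thesis using c(2)[OF that] by simp
    qed
    moreover have "curves (weil_prol X W) = {c. range c \<subseteq> pts (weil_prol X W) \<and>
        (\<forall>j\<in>J. wfun X W (Ws j) (pull (Ws j) (p j)) \<circ> c \<in> curves (weil_prol X (Ws j)))}"
      using lim unfolding frolicher_limit_cone_def by (elim conjE) assumption
    ultimately show "c \<in> curves (weil_prol X W)" using c(1) by blast
  }
qed

abbreviation Prol :: "'a fspace \<Rightarrow> nat \<Rightarrow> nat \<Rightarrow> (vec \<Rightarrow> 'a) set set" where
  "Prol X N r \<equiv> pts (weil_prol X (wedge N r))"

abbreviation base :: "'a fspace \<Rightarrow> (vec \<Rightarrow> 'a) set \<Rightarrow> (vec \<Rightarrow> 'a) set" where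
  "base X A \<equiv> wcomp X (wedge 0 0) (\<lambda>x i. 0) A"

abbreviation axis_map :: "nat \<Rightarrow> vec \<Rightarrow> vec" where
  "axis_map k \<equiv> (\<lambda>d. (\<lambda>i. 0)(k := d 0))"

lemma wideal_ok_axes_obj: "wideal_ok (axes_obj N r j)"
proof -
  obtain a b where ab: "axes_obj N r j = wedge a b" unfolding axes_obj_def by metis
  show ?thesis unfolding ab by (rule wideal_ok_wedge)
qed

text \<open>The vertex over the origin receives the common base point. The condition on its leg
  follows from the one on the leg to \<open>D^N\<close> and so disappears from the
  conclusion.\<close>

lemma axes_lift:
  assumes X: "microlinear X" and g: "g \<in> Prol X N 0" and t: "\<And>j. j < r \<Longrightarrow> t j \<in> Prol X 1 0"
    and b: "\<And>j. j < r \<Longrightarrow> base X (t j) = base X g"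
  shows "\<exists>!y. y \<in> Prol X N r \<and> wcomp X (wedge N 0) (\<lambda>d. d(N := 0)) y = g \<and>
    (\<forall>j<r. wcomp X (wedge 1 0) (axis_map (N + j)) y = t j)"
proof -
  define a where "a j = (if j = 0 then g else if j \<le> r then t (j - 1) else base X g)" for j
  have "\<exists>!y. y \<in> Prol X N r \<and> (\<forall>j\<in>{..Suc r}. wcomp X (axes_obj N r j) (axes_leg N r j) y = a j)"
  proof (rule microlinear_lift(1)[OF X axes_limit wideal_ok_wedge wideal_ok_axes_obj axes_arrows_wmor axes_leg_wmor])
    show "a j \<in> pts (weil_prol X (axes_obj N r j))" if "j \<in> {..Suc r}" for j
      using g t[of "j - 1"] wcomp_pts[OF wideal_ok_wedge wideal_ok_wedge wmor_zero g, of 0 0]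
      by (auto simp: a_def axes_obj_def)
    show "wcomp X (axes_obj N r j) f (a i) = a j"
      if "(i, j, f) \<in> axes_arrows r" for i j f
    proof -
      have "j = Suc r" "f = (\<lambda>x i. 0)" "i \<le> r" using that by (auto simp: axes_arrows_def)
      then show ?thesis using b[of "i - 1"] by (simp add: axes_obj_def a_def)
    qed
  qed
  moreover have "(\<forall>j\<in>{..Suc r}. wcomp X (axes_obj N r j) (axes_leg N r j) y = a j) \<longleftrightarrow>
      wcomp X (wedge N 0) (\<lambda>d. d(N := 0)) y = g \<and> (\<forall>j<r. wcomp X (wedge 1 0) (axis_map (N + j)) y = t j)"
    (is "?L \<longleftrightarrow> ?R") if y: "y \<in> Prol X N r" for y
  proof
    assume L: ?L
    have "wcomp X (wedge 1 0) (axis_map (N + j)) y = t j" if "j < r" for j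
      using L[rule_format, of "Suc j"] that by (simp add: axes_obj_def axes_leg_def a_def)
    moreover have "wcomp X (wedge N 0) (\<lambda>d. d(N := 0)) y = g"
      using L[rule_format, of 0] by (simp add: axes_obj_def axes_leg_def a_def)
    ultimately show ?R by blast
  next
    assume R: ?R
    show ?L
    proof
      fix j assume "j \<in> {..Suc r}"
      then consider "j = 0" | l where "j = Suc l" "l < r" | "j = Suc r"
        by (cases j) (auto simp: le_less)
      then show "wcomp X (axes_obj N r j) (axes_leg N r j) y = a j"
      proof cases
        case 3
        have "base X y = base X g"
          using R wcomp_wcomp[OF wideal_ok_wedge wideal_ok_wedge wideal_ok_wedge wmor_Phi wmor_zero y, of 0 0]
            wcomp_cong[of "wedge 0 0" "\<lambda>x. (\<lambda>i. 0)(N := 0)" "\<lambda>x i. 0" X y] by (simp add: fun_upd_idem)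
        then show ?thesis using 3 by (simp add: axes_obj_def axes_leg_def a_def)
      qed (use R in \<open>simp_all add: axes_obj_def axes_leg_def a_def\<close>)
    qed
  qed
  ultimately show ?thesis by (simp cong: conj_cong)
qed

lemma axes_curve:
  assumes X: "microlinear X" and c: "range c \<subseteq> Prol X N r"
    and g: "(\<lambda>t. wcomp X (wedge N 0) (\<lambda>d. d(N := 0)) (c t)) \<in> curves (weil_prol X (wedge N 0))"
    and t: "\<And>j. j < r \<Longrightarrow> (\<lambda>t. wcomp X (wedge 1 0) (axis_map (N + j)) (c t)) \<in> curves (weil_prol X (wedge 1 0))"
  shows "c \<in> curves (weil_prol X (wedge N r))"
proof (rule microlinear_lift(2)[OF X axes_limit wideal_ok_wedge wideal_ok_axes_obj axes_arrows_wmor axes_leg_wmor c])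
  fix j assume "j \<in> {..Suc r}"
  then consider "j = 0" | l where "j = Suc l" "l < r" | "j = Suc r"
    by (cases j) (auto simp: le_less)
  then show "(\<lambda>t. wcomp X (axes_obj N r j) (axes_leg N r j) (c t)) \<in> curves (weil_prol X (axes_obj N r j))"
  proof cases
    case 3
    have "wcomp X (wedge 0 0) (\<lambda>x i. 0) (wcomp X (wedge N 0) (\<lambda>d. d(N := 0)) (c t)) = base X (c t)" for t
      using wcomp_wcomp[OF wideal_ok_wedge wideal_ok_wedge wideal_ok_wedge wmor_Phi wmor_zero, of "c t" X N r 0 0] c
        wcomp_cong[of "wedge 0 0" "\<lambda>x. (\<lambda>i. 0)(N := 0)" "\<lambda>x i. 0" X "c t"] by (auto simp: fun_upd_idem)
    then show ?thesis
      using curves_wcomp[OF wideal_ok_wedge wideal_ok_wedge wmor_zero g, of 0 0] 3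
      by (simp add: axes_obj_def axes_leg_def)
  qed (use g t in \<open>simp_all add: axes_obj_def axes_leg_def\<close>)
qed

text \<open>On a face the product of all coordinates is 0, so \<open>Psi\<close> and
  \<open>Phi\<close> both restrict to the inclusion of the face.\<close>

lemma top_legs:
  assumes N: "N \<ge> 1" and y: "y \<in> Prol X N 1" and i: "i < N"
  shows "wcomp X (wedge N 0) (\<lambda>x. x(i := 0)) (wcomp X (wedge N 0) (Psi N) y) =
      wcomp X (wedge N 0) (\<lambda>x. x(i := 0)) y"
    "wcomp X (wedge N 0) (\<lambda>x. x(i := 0)) (wcomp X (wedge N 0) (Phi N) y) =
      wcomp X (wedge N 0) (\<lambda>x. x(i := 0)) y"
proof -
  note z = wmor_zero_coordinate[of N i]
  have pr: "(\<Prod>j<N. (x(i := 0)) j) = 0" for x :: vec using i by (intro prod_zero) auto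
  show "wcomp X (wedge N 0) (\<lambda>x. x(i := 0)) (wcomp X (wedge N 0) (Psi N) y) =
      wcomp X (wedge N 0) (\<lambda>x. x(i := 0)) y"
    unfolding wcomp_wcomp[OF wideal_ok_wedge wideal_ok_wedge wideal_ok_wedge wmor_Psi[OF N] z y]
    by (rule wcomp_cong) (use i pr in \<open>auto simp: Psi_def Rn_def fun_eq_iff\<close>)
  have "wmor (wedge N 1) (wedge N 0) (Phi N)" using wmor_Phi[of N 1] by (simp add: Phi_def[abs_def])
  note wcomp_wcomp[OF wideal_ok_wedge wideal_ok_wedge wideal_ok_wedge this z y]
  then show "wcomp X (wedge N 0) (\<lambda>x. x(i := 0)) (wcomp X (wedge N 0) (Phi N) y) =
      wcomp X (wedge N 0) (\<lambda>x. x(i := 0)) y"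
    by (rule trans) (rule wcomp_cong, auto simp: Phi_def Rn_def fun_eq_iff)
qed

lemma top_cases:
  fixes j N :: nat
  assumes "j \<in> {..<N + 2}"
  obtains "j = 0" | "j = 1" | i where "i < N" "j = i + 2"
proof -
  have "j = 0 \<or> j = 1 \<or> (\<exists>i<N. j = i + 2)"
  proof (cases "2 \<le> j")
    case True
    then show ?thesis using assms by (intro disjI2 exI[of _ "j - 2"]) auto
  qed auto
  then show ?thesis using that by blast
qed

text \<open>Equality on the faces is the compatibility at the face vertices, whose legs are then
  determined by the leg along \<open>Phi\<close>.\<close>

lemma top_lift:
  assumes X: "microlinear X" and N: "N \<ge> 1" and gp: "gp \<in> Prol X N 0" and gm: "gm \<in> Prol X N 0"
    and eq: "\<And>i. i < N \<Longrightarrow> wcomp X (wedge N 0) (\<lambda>x. x(i := 0)) gp = wcomp X (wedge N 0) (\<lambda>x. x(i := 0)) gm"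
  shows "\<exists>!y. y \<in> Prol X N 1 \<and> wcomp X (wedge N 0) (Psi N) y = gp \<and> wcomp X (wedge N 0) (Phi N) y = gm"
proof -
  define a where "a j = (if j = 0 then gp else if j = 1 then gm
      else wcomp X (wedge N 0) (\<lambda>x. x(j - 2 := 0)) gm)" for j :: nat
  note z = wmor_zero_coordinate[of N]
  have "\<exists>!y. y \<in> Prol X N 1 \<and> (\<forall>j\<in>{..<N + 2}. wcomp X (wedge N 0) (top_leg N j) y = a j)"
  proof (rule microlinear_lift(1)[OF X top_limit[OF N] wideal_ok_wedge wideal_ok_wedge top_wmor[OF N]])
    show "a j \<in> Prol X N 0" for j
      using gp gm wcomp_pts[OF wideal_ok_wedge wideal_ok_wedge z gm] by (simp add: a_def)
    show "wcomp X (wedge N 0) f (a i) = a j" if ijf: "(i, j, f) \<in> top_arrows N" for i j f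
    proof -
      obtain l where l: "l < N" "j = l + 2" "f = (\<lambda>x. x(l := 0))" "i = 0 \<or> i = 1"
        using ijf by (auto simp: top_arrows_def)
      then show ?thesis using eq[OF l(1)] by (auto simp: a_def)
    qed
  qed
  moreover have "(\<forall>j\<in>{..<N + 2}. wcomp X (wedge N 0) (top_leg N j) y = a j) \<longleftrightarrow>
      wcomp X (wedge N 0) (Psi N) y = gp \<and> wcomp X (wedge N 0) (Phi N) y = gm" (is "?L \<longleftrightarrow> ?R")
    if y: "y \<in> Prol X N 1" for y
  proof
    assume L: ?L
    show ?R using L[rule_format, of 0] L[rule_format, of 1] by (simp add: top_leg_def a_def)
  next
    assume R: ?R
    show ?L
    proof
      fix j assume "j \<in> {..<N + 2}"
      then show "wcomp X (wedge N 0) (top_leg N j) y = a j"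
        by (cases rule: top_cases) (use R top_legs(2)[OF N y] in \<open>auto simp: top_leg_def a_def\<close>)
    qed
  qed
  ultimately show ?thesis by (simp cong: conj_cong)
qed

lemma top_curve:
  assumes X: "microlinear X" and N: "N \<ge> 1" and c: "range c \<subseteq> Prol X N 1"
    and gp: "(\<lambda>t. wcomp X (wedge N 0) (Psi N) (c t)) \<in> curves (weil_prol X (wedge N 0))"
    and gm: "(\<lambda>t. wcomp X (wedge N 0) (Phi N) (c t)) \<in> curves (weil_prol X (wedge N 0))"
  shows "c \<in> curves (weil_prol X (wedge N 1))"
proof (rule microlinear_lift(2)[OF X top_limit[OF N] wideal_ok_wedge wideal_ok_wedge top_wmor[OF N] c])
  fix j assume "j \<in> {..<N + 2}"
  then show "(\<lambda>t. wcomp X (wedge N 0) (top_leg N j) (c t)) \<in> curves (weil_prol X (wedge N 0))"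
  proof (cases rule: top_cases)
    case (3 i)
    note z = wmor_zero_coordinate[of N i]
    have "wcomp X (wedge N 0) (\<lambda>x. x(i := 0)) (wcomp X (wedge N 0) (Phi N) (c t)) =
        wcomp X (wedge N 0) (\<lambda>x. x(i := 0)) (c t)" for t
      by (rule top_legs(2)[OF N _ 3(1)]) (use c in auto)
    then show ?thesis using curves_wcomp[OF wideal_ok_wedge wideal_ok_wedge z gm] 3(2)
      by (simp add: top_leg_def)
  qed (use gp gm in \<open>simp_all add: top_leg_def\<close>)
qed

section \<open>Strong difference and strong addition\<close>

declare One_nat_def [simp del]

lemma lessThan_one: "{..<1::nat} = {0}"
  by auto

section \<open>Maps behind the naturality and the algebra of the strong operations\<close>

lemma wmor_permute:
  assumes "\<sigma> permutes {..<N}"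
  shows "wmor (wedge N r) (wedge N r) (\<lambda>d i. d (\<sigma> i))"
proof (rule wmor_wedgeI)
  have s: "\<sigma> i = i" if "N \<le> i" for i using assms that by (simp add: permutes_def)
  have lt: "\<sigma> i < N" if "i < N" for i using permutes_in_image[OF assms, of i] that by simp
  have lt': "\<sigma> i < N + r" if "i < N + r" for i
    using lt[of i] s[of i] that by (cases "i < N") auto
  show "(\<lambda>d i. d (\<sigma> i)) \<in> Rn (N + r) \<rightarrow> Rn (N + r)" by (auto simp: Rn_def s)
  show "rst (N + r) (\<lambda>x. x (\<sigma> i) * x (\<sigma> i)) \<in> wideal (wedge N r)" if "i < N + r" for i
    by (rule wedge_square[OF lt'[OF that]])
  show "rst (N + r) (\<lambda>x. x (\<sigma> i) * x (\<sigma> j)) \<in> wideal (wedge N r)" if "i < j" "N \<le> j" "j < N + r" for i j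
    using that by (intro wedge_product lt') (auto simp: s)
qed auto

text \<open>Under \<open>Psi\<close> the added coordinate is the product of the others, so scaling
  one of them must scale it as well; \<open>Phi\<close> and \<open>Xi\<close> are compatible with
  the same map.\<close>

lemma wmor_scale_plus:
  assumes "i < N"
  shows "wmor (wedge N 1) (wedge N 1) (\<lambda>d. d(i := \<alpha> * d i, N := \<alpha> * d N))"
proof (rule wmor_wedgeI)
  define q :: "nat \<Rightarrow> real" where "q j = (if j = i \<or> j = N then \<alpha> else 1)" for j
  have eq: "(x(i := \<alpha> * x i, N := \<alpha> * x N)) j = q j * x j" for x :: vec and j
    using assms by (auto simp: q_def)
  show "(\<lambda>d. d(i := \<alpha> * d i, N := \<alpha> * d N)) \<in> Rn (N + 1) \<rightarrow> Rn (N + 1)"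
    using assms by (auto simp: Rn_def)
  show "Cinf (N + 1) (\<lambda>x. (x(i := \<alpha> * x i, N := \<alpha> * x N)) j)" for j
    unfolding eq by (intro Cinf_mult) auto
  show "rst (N + 1) (\<lambda>x. (x(i := \<alpha> * x i, N := \<alpha> * x N)) j * (x(i := \<alpha> * x i, N := \<alpha> * x N)) j)
      \<in> wideal (wedge N 1)" if "j < N + 1" for j
    unfolding eq by (rule wedge_multiple[OF wedge_square[OF that], of "\<lambda>x. q j * q j"]) auto
  show "rst (N + 1) (\<lambda>x. (x(i := \<alpha> * x i, N := \<alpha> * x N)) l * (x(i := \<alpha> * x i, N := \<alpha> * x N)) j)
      \<in> wideal (wedge N 1)" if "l < j" "N \<le> j" "j < N + 1" for l j
    unfolding eq by (rule wedge_multiple[OF wedge_product, of l N 1 j "\<lambda>x. q l * q j"]) (use that in auto)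
qed

lemma wmor_vtake: "wmor (wedge N 0) (wedge N r) (vtake N)"
proof (rule wmor_wedgeI)
  show "Cinf (N + r) (\<lambda>x. vtake N x j)" for j by (cases "j < N") (auto simp: vtake_def)
  show "rst (N + r) (\<lambda>x. vtake N x j * vtake N x j) \<in> wideal (wedge N r)" if "j < N + 0" for j
    by (rule wedge_multiple[OF wedge_square, of j N r "\<lambda>x. 1"]) (use that in \<open>auto simp: vtake_def\<close>)
qed (auto simp: vtake_def Rn_def)

lemma wmor_face: "wmor (wedge (Suc n) 0) (wedge n 0) (\<lambda>d. d(n := 0))"
proof (rule wmor_wedgeI)
  show "Cinf (n + 0) (\<lambda>x. (x(n := 0)) j)" for j by (cases "j = n") auto
  show "rst (n + 0) (\<lambda>x. (x(n := 0)) j * (x(n := 0)) j) \<in> wideal (wedge n 0)" if "j < Suc n + 0" for j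
  proof (cases "j = n")
    case True
    then show ?thesis by (intro wedge_zero) simp
  next
    case False
    then show ?thesis
      using that by (intro wedge_multiple[OF wedge_square, of j n 0 "\<lambda>x. 1"]) auto
  qed
qed (auto simp: Rn_def)

lemma wmor_vtake_Suc: "wmor (wedge n 0) (wedge (Suc n) 0) (vtake n)"
proof (rule wmor_wedgeI)
  show "Cinf (Suc n + 0) (\<lambda>x. vtake n x j)" for j by (cases "j < n") (auto simp: vtake_def)
  show "rst (Suc n + 0) (\<lambda>x. vtake n x j * vtake n x j) \<in> wideal (wedge (Suc n) 0)" if "j < n + 0" for j
    by (rule wedge_multiple[OF wedge_square, of j "Suc n" 0 "\<lambda>x. 1"]) (use that in \<open>auto simp: vtake_def\<close>)
qed (auto simp: vtake_def Rn_def)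

lemma wmor_kappa:
  assumes "n \<ge> 1"
  shows "wmor (wedge n 0) (wedge (Suc n) 0) (kappa n)"
proof (rule wmor_wedgeI)
  show "Cinf (Suc n + 0) (\<lambda>x. kappa n x j)" for j
    by (cases "j < n - 1"; cases "j = n - 1") (auto simp: kappa_def)
  show "rst (Suc n + 0) (\<lambda>x. kappa n x j * kappa n x j) \<in> wideal (wedge (Suc n) 0)" if "j < n + 0" for j
  proof (rule wedge_multiple[OF wedge_square, of j "Suc n" 0 "\<lambda>x. if j < n - 1 then 1 else x n * x n"])
    show "Cinf (Suc n + 0) (\<lambda>x. if j < n - 1 then 1 else x n * x n)"
      by (cases "j < n - 1") auto
    show "kappa n x j * kappa n x j = (if j < n - 1 then 1 else x n * x n) * (x j * x j)" for x
    proof (cases "j < n - 1")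
      case False
      then have "j = n - 1" using that by simp
      then show ?thesis by (simp add: kappa_def ac_simps)
    qed (simp add: kappa_def)
  qed (use that in simp)
qed (use assms in \<open>auto simp: kappa_def Rn_def\<close>)

text \<open>Coordinate \<open>Suc N\<close> of a point of \<open>Rn (N + 1)\<close> is 0, so the
  inclusion that omits the second added axis is the identity on sequences.\<close>

lemma wmor_first_axis: "wmor (wedge N 2) (wedge N 1) (\<lambda>x. x)"
proof (rule wmor_wedgeI)
  show "rst (N + 1) (\<lambda>x. x j * x j) \<in> wideal (wedge N 1)" if "j < N + 2" for j
  proof (cases "j = Suc N")
    case True
    then show ?thesis by (intro wedge_zero) (simp add: Rn_def)
  next
    case False
    then show ?thesis using that by (intro wedge_square) simp
  qed
  show "rst (N + 1) (\<lambda>x. x i * x j) \<in> wideal (wedge N 1)" if "i < j" "N \<le> j" "j < N + 2" for i j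
  proof (cases "j = Suc N")
    case True
    then show ?thesis by (intro wedge_zero) (simp add: Rn_def)
  next
    case False
    then show ?thesis using that by (intro wedge_product) simp_all
  qed
qed (auto simp: Rn_def)

lemma wmor_diagonal_axes: "wmor (wedge N 2) (wedge N 1) (\<lambda>x. x(Suc N := x N))"
proof (rule wmor_wedgeI)
  define s where "s j = (if j = Suc N then N else j)" for j
  have eq: "(x(Suc N := x N)) j = x (s j)" for x :: vec and j by (simp add: s_def)
  show "(\<lambda>x. x(Suc N := x N)) \<in> Rn (N + 1) \<rightarrow> Rn (N + 2)" by (auto simp: Rn_def)
  show "rst (N + 1) (\<lambda>x. (x(Suc N := x N)) j * (x(Suc N := x N)) j) \<in> wideal (wedge N 1)"
    if "j < N + 2" for j
    unfolding eq by (rule wedge_square) (use that in \<open>auto simp: s_def\<close>)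
  show "rst (N + 1) (\<lambda>x. (x(Suc N := x N)) i * (x(Suc N := x N)) j) \<in> wideal (wedge N 1)"
    if "i < j" "N \<le> j" "j < N + 2" for i j
    unfolding eq by (rule wedge_product) (use that in \<open>auto simp: s_def\<close>)
  show "Cinf (N + 1) (\<lambda>x. (x(Suc N := x N)) j)" for j unfolding eq by simp
qed

text \<open>The map (d, e) to (d, d_1...d_N, e). Restricted along \<open>Phi\<close> it is
  \<open>Psi\<close> into the first added axis, restricted along \<open>Xi\<close> it is the second
  added axis; this is the shape of a vector added to a result of strong addition.\<close>

lemma wmor_Psi_axis:
  assumes "N \<ge> 1"
  shows "wmor (wedge N 2) (wedge N 1) (\<lambda>x. x(N := \<Prod>i<N. x i, Suc N := x N))"
proof (rule wmor_wedgeI)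
  let ?f = "\<lambda>x. x(N := \<Prod>i<N. x i, Suc N := x N) :: vec"
  have pr: "(\<Prod>i<N. x i) = (\<Prod>i\<in>{..<N} - {j}. x i) * x j" if "j < N" for j and x :: vec
    using that by (simp add: prod.remove[of "{..<N}" j] mult.commute)
  have smp: "Cinf (N + 1) (\<lambda>x. \<Prod>i\<in>A. x i)" for A by (intro Cinf_prod) auto
  show "?f \<in> Rn (N + 1) \<rightarrow> Rn (N + 2)" by (auto simp: Rn_def)
  show "Cinf (N + 1) (\<lambda>x. ?f x j)" for j
    using smp[of "{..<N}"] by (cases "j = N"; cases "j = Suc N") simp_all
  show "rst (N + 1) (\<lambda>x. ?f x j * ?f x j) \<in> wideal (wedge N 1)" if jN: "j < N + 2" for j
  proof -
    consider "j < N" | "j = N" | "j = Suc N" using jN by linarith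
    then show ?thesis
    proof cases
      case 1
      then show ?thesis by (intro wedge_multiple[OF wedge_square, of j N 1 "\<lambda>x. 1"]) auto
    next
      case 2
      show ?thesis
      proof (rule wedge_multiple[OF wedge_square, of 0 N 1 "\<lambda>x. (\<Prod>i\<in>{..<N} - {0}. x i) * (\<Prod>i\<in>{..<N} - {0}. x i)"])
        show "?f x j * ?f x j = (\<Prod>i\<in>{..<N} - {0}. x i) * (\<Prod>i\<in>{..<N} - {0}. x i) * (x 0 * x 0)" for x
          using 2 pr[of 0 x] assms by simp
      qed (use assms smp in auto)
    next
      case 3
      then show ?thesis by (intro wedge_multiple[OF wedge_square, of N N 1 "\<lambda>x. 1"]) auto
    qed
  qed
  show "rst (N + 1) (\<lambda>x. ?f x i * ?f x j) \<in> wideal (wedge N 1)" if ij: "i < j" "N \<le> j" "j < N + 2" for i j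
  proof -
    consider "i < N" "j = N" | "i < N" "j = Suc N" | "i = N" "j = Suc N" using ij by linarith
    then show ?thesis
    proof cases
      case 1
      show ?thesis
      proof (rule wedge_multiple[OF wedge_square, of i N 1 "\<lambda>x. \<Prod>l\<in>{..<N} - {i}. x l"])
        show "?f x i * ?f x j = (\<Prod>l\<in>{..<N} - {i}. x l) * (x i * x i)" for x
          using 1 pr[of i x] by simp
      qed (use 1 smp in auto)
    next
      case 2
      then show ?thesis by (intro wedge_multiple[OF wedge_product, of i N 1 N "\<lambda>x. 1"]) auto
    next
      case 3
      show ?thesis
      proof (rule wedge_multiple[OF wedge_product, of 0 N 1 N "\<lambda>x. \<Prod>l\<in>{..<N} - {0}. x l"])
        show "?f x i * ?f x j = (\<Prod>l\<in>{..<N} - {0}. x l) * (x 0 * x N)" for x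
          using 3 pr[of 0 x] assms by simp
      qed (use assms smp in auto)
    qed
  qed
qed

text \<open>The coordinates are exchanged so that \<open>Phi 1\<close> meets the second added axis
  and \<open>Xi 1\<close> the first, matching the order of arguments in
  \<open>sadd_sadd\<close>.\<close>

lemma wmor_axes: "wmor (wedge N 2) (wedge 1 1) (\<lambda>x. (\<lambda>i. 0)(N := x 1, Suc N := x 0))"
proof (rule wmor_wedgeI)
  let ?f = "\<lambda>x :: vec. (\<lambda>i. 0)(N := x 1, Suc N := x 0) :: vec"
  show "?f \<in> Rn (1 + 1) \<rightarrow> Rn (N + 2)" by (auto simp: Rn_def)
  show "Cinf (1 + 1) (\<lambda>x. ?f x j)" for j
    by (cases "j = N"; cases "j = Suc N") auto
  show "rst (1 + 1) (\<lambda>x. ?f x j * ?f x j) \<in> wideal (wedge 1 1)" if jN: "j < N + 2" for j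
  proof -
    consider "j < N" | "j = N" | "j = Suc N" using jN by linarith
    then show ?thesis
    proof cases
      case 1
      then show ?thesis by (intro wedge_zero) auto
    next
      case 2
      then show ?thesis by (intro wedge_multiple[OF wedge_square, of 1 1 1 "\<lambda>x. 1"]) auto
    next
      case 3
      then show ?thesis by (intro wedge_multiple[OF wedge_square, of 0 1 1 "\<lambda>x. 1"]) auto
    qed
  qed
  show "rst (1 + 1) (\<lambda>x. ?f x i * ?f x j) \<in> wideal (wedge 1 1)" if "i < j" "N \<le> j" "j < N + 2" for i j
  proof (cases "i < N")
    case True
    then show ?thesis by (intro wedge_zero) auto
  next
    case False
    then have "i = N" "j = Suc N" using that by auto
    then show ?thesis by (intro wedge_multiple[OF wedge_product, of 0 1 1 1 "\<lambda>x. 1"]) auto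
  qed
qed

text \<open>The square of \<open>a * x 0 + b * x 1\<close> lies in the ideal because the mixed
  product does so too on a wedge of two copies of \<open>D\<close>.\<close>

lemma wmor_linear: "wmor (wedge 1 0) (wedge 1 1) (\<lambda>x. (\<lambda>i. 0)(0 := a * x 0 + b * x 1))"
proof (rule wmor_wedgeI)
  let ?f = "\<lambda>x :: vec. (\<lambda>i. 0)(0 := a * x 0 + b * x 1) :: vec"
  show "Cinf (1 + 1) (\<lambda>x. ?f x j)" if "j < 1 + 0" for j
    using that by (auto intro!: Cinf_add Cinf_mult)
  show "rst (1 + 1) (\<lambda>x. ?f x j * ?f x j) \<in> wideal (wedge 1 1)" if "j < 1 + 0" for j
  proof -
    have "rst (1 + 1) (\<lambda>x. (a * a) * (x 0 * x 0) + ((2 * a * b) * (x 0 * x 1) + (b * b) * (x 1 * x 1)))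
        \<in> wideal (wedge 1 1)"
      by (intro ideal_cinf_add[OF ideal_wedge] ideal_cinf_mult[OF ideal_wedge] Cinf_const
        wedge_square wedge_product) auto
    also have "(\<lambda>x. (a * a) * (x 0 * x 0) + ((2 * a * b) * (x 0 * x 1) + (b * b) * (x 1 * x 1))) =
        (\<lambda>x. ?f x j * ?f x j)"
      using that by (auto simp: fun_eq_iff algebra_simps)
    finally show ?thesis .
  qed
qed (auto simp: Rn_def)

lemma wmor_Xi: "wmor (wedge N 1) (wedge 1 0) (Xi N)"
  using wmor_axis[of 0 1 N] by (simp add: Xi_def[abs_def])

lemma wmor_Phi': "wmor (wedge N 1) (wedge N 0) (Phi N)"
  using wmor_Phi[of N 1] by (simp add: Phi_def[abs_def])

lemmas W_simps = W_Dpow_wedge W_one_wedge W_Dplus_wedge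

lemmas wcomp2 = wcomp_wcomp[OF wideal_ok_wedge wideal_ok_wedge wideal_ok_wedge]

text \<open>For \<open>N = 1\<close> the maps \<open>Phi\<close>, \<open>Xi\<close> and
  \<open>Psi\<close> are the first axis, the second axis and the diagonal. The arguments change
  sides because \<open>sadd\<close> takes the vector along \<open>Xi\<close> first.\<close>

lemma tadd_sadd: "tadd X s t = sadd X 1 t s"
proof -
  have 1: "wcomp X W_D (\<lambda>d. (\<lambda>i. 0)(0 := d 0)) l = wcomp X W_D (Phi 1) l"
    "wcomp X W_D (\<lambda>d. (\<lambda>i. 0)(1 := d 0)) l = wcomp X W_D (Xi 1) l"
    "wcomp X W_D (\<lambda>d. (\<lambda>i. 0)(0 := d 0, 1 := d 0)) l = wcomp X W_D (Psi 1) l" for l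
    by (rule wcomp_cong, (auto simp: W_simps Phi_def Xi_def Psi_def Rn_def fun_eq_iff lessThan_one)[1])+
  have 2: "W_Dbrace 2 1 = W_Dplus 1" by (simp add: W_Dbrace_wedge W_Dplus_wedge)
  have "(THE l. l \<in> pts (weil_prol X (W_Dplus 1)) \<and> wcomp X W_D (Phi 1) l = s \<and> wcomp X W_D (Xi 1) l = t) =
      (THE l. l \<in> pts (weil_prol X (W_Dplus 1)) \<and> wcomp X W_D (Xi 1) l = t \<and> wcomp X W_D (Phi 1) l = s)"
    by (rule arg_cong[of _ _ The]) auto
  then show ?thesis unfolding tadd_def sadd_def 1 2 by simp
qed

lemma base_wcomp:
  assumes "wmor (wedge N r) (wedge N' r') f" "A \<in> Prol X N r" "f (\<lambda>i. 0) = (\<lambda>i. 0)"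
  shows "base X (wcomp X (wedge N' r') f A) = base X A"
  unfolding wcomp2[OF assms(1) wmor_zero assms(2)] assms(3) ..

lemma Psi_0 [simp]: "N \<ge> 1 \<Longrightarrow> Psi N (\<lambda>i. 0) = (\<lambda>i. 0)"
  by (auto simp: Psi_def fun_eq_iff)

lemma Phi_0 [simp]: "Phi N (\<lambda>i. 0) = (\<lambda>i. 0)"
  by (auto simp: Phi_def)

lemma Xi_0 [simp]: "Xi N (\<lambda>i. 0) = (\<lambda>i. 0)"
  by (auto simp: Xi_def)

lemmas wcomp_wconst_wedge = wcomp_wconst[OF wideal_ok_wedge wideal_ok_wedge]
lemmas wcomp_const_wedge = wcomp_const[OF wideal_ok_wedge wideal_ok_wedge]
lemmas curves_wcomp_wedge = curves_wcomp[OF wideal_ok_wedge wideal_ok_wedge]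

lemma wcomp_wedge_pts: "wmor (wedge N r) (wedge N' r') f \<Longrightarrow> A \<in> Prol X N r \<Longrightarrow>
    wcomp X (wedge N' r') f A \<in> Prol X N' r'"
  by (rule wcomp_pts[OF wideal_ok_wedge wideal_ok_wedge])

section \<open>Strong operations in a microlinear space, computed with fillers\<close>

locale microlinear_space =
  fixes X :: "'a fspace"
  assumes micro: "microlinear X"
begin

text \<open>Turns the description operator into a computation: any element over
  \<open>D^N \<oplus> D\<close> exhibits the strong difference of its own restrictions. Identities
  are then proved by naming such an element.\<close>

lemma sdiff_fill:
  assumes N: "N \<ge> 1" and y: "y \<in> Prol X N 1"
  shows "sdiff X N (wcomp X (wedge N 0) (Psi N) y) (wcomp X (wedge N 0) (Phi N) y) =
    wcomp X (wedge 1 0) (Xi N) y"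
proof -
  have "\<exists>!z. z \<in> Prol X N 1 \<and> wcomp X (wedge N 0) (Psi N) z = wcomp X (wedge N 0) (Psi N) y \<and>
      wcomp X (wedge N 0) (Phi N) z = wcomp X (wedge N 0) (Phi N) y"
    by (rule top_lift[OF micro N wcomp_wedge_pts[OF wmor_Psi[OF N] y] wcomp_wedge_pts[OF wmor_Phi' y]])
      (simp only: top_legs[OF N y])
  then have "(THE z. z \<in> Prol X N 1 \<and> wcomp X (wedge N 0) (Psi N) z = wcomp X (wedge N 0) (Psi N) y \<and>
      wcomp X (wedge N 0) (Phi N) z = wcomp X (wedge N 0) (Phi N) y) = y"
    by (rule the1_equality) (simp add: y)
  then show ?thesis by (simp add: sdiff_def W_simps)
qed

lemma sdiffE:
  assumes "N \<ge> 1" "gp \<in> Prol X N 0" "gm \<in> Prol X N 0"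
    "\<And>i. i < N \<Longrightarrow> wcomp X (wedge N 0) (\<lambda>x. x(i := 0)) gp = wcomp X (wedge N 0) (\<lambda>x. x(i := 0)) gm"
  obtains y where "y \<in> Prol X N 1" "wcomp X (wedge N 0) (Psi N) y = gp" "wcomp X (wedge N 0) (Phi N) y = gm"
  using top_lift[OF micro assms] by blast

lemma axes_lift1:
  assumes "g \<in> Prol X N 0" "t \<in> Prol X 1 0" "base X t = base X g"
  shows "\<exists>!y. y \<in> Prol X N 1 \<and> wcomp X (wedge 1 0) (Xi N) y = t \<and> wcomp X (wedge N 0) (Phi N) y = g"
proof -
  have "\<exists>!y. y \<in> Prol X N 1 \<and> wcomp X (wedge N 0) (\<lambda>d. d(N := 0)) y = g \<and>
      (\<forall>j<1. wcomp X (wedge 1 0) (axis_map (N + j)) y = t)"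
    by (rule axes_lift[OF micro assms(1)]) (use assms in auto)
  moreover have "(wcomp X (wedge N 0) (\<lambda>d. d(N := 0)) y = g \<and>
      (\<forall>j<1. wcomp X (wedge 1 0) (axis_map (N + j)) y = t)) \<longleftrightarrow>
      (wcomp X (wedge 1 0) (Xi N) y = t \<and> wcomp X (wedge N 0) (Phi N) y = g)" for y
    by (auto simp: Xi_def[abs_def] Phi_def[abs_def])
  ultimately show ?thesis by simp
qed

text \<open>The same element read along the other cone; uniqueness now comes from \<open>D^N\<close>
  and the added axis.\<close>

lemma sadd_fill:
  assumes y: "y \<in> Prol X N 1"
  shows "sadd X N (wcomp X (wedge 1 0) (Xi N) y) (wcomp X (wedge N 0) (Phi N) y) =
    wcomp X (wedge N 0) (Psi N) y"
proof -
  have "\<exists>!z. z \<in> Prol X N 1 \<and> wcomp X (wedge 1 0) (Xi N) z = wcomp X (wedge 1 0) (Xi N) y \<and>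
      wcomp X (wedge N 0) (Phi N) z = wcomp X (wedge N 0) (Phi N) y"
    by (rule axes_lift1[OF wcomp_wedge_pts[OF wmor_Phi' y] wcomp_wedge_pts[OF wmor_Xi y]])
      (simp add: base_wcomp[OF wmor_Phi' y] base_wcomp[OF wmor_Xi y])
  then have "(THE z. z \<in> Prol X N 1 \<and> wcomp X (wedge 1 0) (Xi N) z = wcomp X (wedge 1 0) (Xi N) y \<and>
      wcomp X (wedge N 0) (Phi N) z = wcomp X (wedge N 0) (Phi N) y) = y"
    by (rule the1_equality) (simp add: y)
  then show ?thesis by (simp add: sadd_def W_simps)
qed

lemma saddE:
  assumes "t \<in> Prol X 1 0" "g \<in> Prol X N 0" "base X t = base X g"
  obtains y where "y \<in> Prol X N 1" "wcomp X (wedge 1 0) (Xi N) y = t" "wcomp X (wedge N 0) (Phi N) y = g"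
  using axes_lift1[OF assms(2,1,3)] by blast

lemma sadd_pts:
  assumes "N \<ge> 1" "t \<in> Prol X 1 0" "g \<in> Prol X N 0" "base X t = base X g"
  shows "sadd X N t g \<in> Prol X N 0" "base X (sadd X N t g) = base X g"
proof -
  obtain y where y: "y \<in> Prol X N 1" "wcomp X (wedge 1 0) (Xi N) y = t" "wcomp X (wedge N 0) (Phi N) y = g"
    using saddE[OF assms(2-4)] .
  show "sadd X N t g \<in> Prol X N 0"
    using sadd_fill[OF y(1)] wcomp_wedge_pts[OF wmor_Psi[OF assms(1)] y(1)] by (simp add: y)
  show "base X (sadd X N t g) = base X g"
    using sadd_fill[OF y(1)] base_wcomp[OF wmor_Psi[OF assms(1)] y(1)] base_wcomp[OF wmor_Phi' y(1)] assms(1)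
    by (simp add: y)
qed

lemma sdiff_pts:
  assumes "N \<ge> 1" "gp \<in> Prol X N 0" "gm \<in> Prol X N 0"
    "\<And>i. i < N \<Longrightarrow> wcomp X (wedge N 0) (\<lambda>x. x(i := 0)) gp = wcomp X (wedge N 0) (\<lambda>x. x(i := 0)) gm"
  shows "sdiff X N gp gm \<in> Prol X 1 0" "base X (sdiff X N gp gm) = base X gm"
    "sadd X N (sdiff X N gp gm) gm = gp"
proof -
  obtain y where y: "y \<in> Prol X N 1" "wcomp X (wedge N 0) (Psi N) y = gp" "wcomp X (wedge N 0) (Phi N) y = gm"
    using sdiffE[OF assms] .
  have d: "sdiff X N gp gm = wcomp X (wedge 1 0) (Xi N) y" using sdiff_fill[OF assms(1) y(1)] by (simp add: y)
  show "sdiff X N gp gm \<in> Prol X 1 0" unfolding d by (rule wcomp_wedge_pts[OF wmor_Xi y(1)])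
  show "base X (sdiff X N gp gm) = base X gm"
    unfolding d using base_wcomp[OF wmor_Xi y(1)] base_wcomp[OF wmor_Phi' y(1)] by (simp add: y)
  show "sadd X N (sdiff X N gp gm) gm = gp"
    unfolding d using sadd_fill[OF y(1)] by (simp add: y)
qed

lemma sdiff_sadd:
  assumes "N \<ge> 1" "t \<in> Prol X 1 0" "g \<in> Prol X N 0" "base X t = base X g"
  shows "sdiff X N (sadd X N t g) g = t"
proof -
  obtain y where y: "y \<in> Prol X N 1" "wcomp X (wedge 1 0) (Xi N) y = t" "wcomp X (wedge N 0) (Phi N) y = g"
    using saddE[OF assms(2-4)] .
  show ?thesis using sdiff_fill[OF assms(1) y(1)] sadd_fill[OF y(1)] by (simp add: y)
qed

lemma sadd_face:
  assumes "N \<ge> 1" "t \<in> Prol X 1 0" "g \<in> Prol X N 0" "base X t = base X g" "i < N"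
  shows "wcomp X (wedge N 0) (\<lambda>x. x(i := 0)) (sadd X N t g) = wcomp X (wedge N 0) (\<lambda>x. x(i := 0)) g"
proof -
  obtain y where y: "y \<in> Prol X N 1" "wcomp X (wedge 1 0) (Xi N) y = t" "wcomp X (wedge N 0) (Phi N) y = g"
    using saddE[OF assms(2-4)] .
  show ?thesis using sadd_fill[OF y(1)] top_legs[OF assms(1) y(1) assms(5)] by (simp add: y)
qed

text \<open>If \<open>u\<close> covers \<open>f\<close> and \<open>s\<close>, then composing a
  filler with \<open>u\<close> gives a filler of the transformed data. Scalings and permutations are
  the instances.\<close>

lemma natural_legs:
  assumes u: "wmor (wedge N 1) (wedge N 1) u" and f: "wmor (wedge N 0) (wedge N 0) f"
    and s: "wmor (wedge 1 0) (wedge 1 0) s" and N: "N \<ge> 1"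
    and eqs: "\<And>x. x \<in> Rn N \<Longrightarrow> u (Psi N x) = Psi N (f x)" "\<And>x. x \<in> Rn N \<Longrightarrow> u (Phi N x) = Phi N (f x)"
      "\<And>x. x \<in> Rn 1 \<Longrightarrow> u (Xi N x) = Xi N (s x)"
    and y: "y \<in> Prol X N 1"
  shows "wcomp X (wedge N 0) (Psi N) (wcomp X (wedge N 1) u y) = wcomp X (wedge N 0) f (wcomp X (wedge N 0) (Psi N) y)"
    "wcomp X (wedge N 0) (Phi N) (wcomp X (wedge N 1) u y) = wcomp X (wedge N 0) f (wcomp X (wedge N 0) (Phi N) y)"
    "wcomp X (wedge 1 0) (Xi N) (wcomp X (wedge N 1) u y) = wcomp X (wedge 1 0) s (wcomp X (wedge 1 0) (Xi N) y)"
  unfolding wcomp2[OF u wmor_Psi[OF N] y] wcomp2[OF u wmor_Phi' y] wcomp2[OF u wmor_Xi y]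
    wcomp2[OF wmor_Psi[OF N] f y] wcomp2[OF wmor_Phi' f y] wcomp2[OF wmor_Xi s y]
  by (rule wcomp_cong, use eqs in simp)+

lemma sadd_natural:
  assumes u: "wmor (wedge N 1) (wedge N 1) u" and f: "wmor (wedge N 0) (wedge N 0) f"
    and s: "wmor (wedge 1 0) (wedge 1 0) s" and N: "N \<ge> 1"
    and eqs: "\<And>x. x \<in> Rn N \<Longrightarrow> u (Psi N x) = Psi N (f x)" "\<And>x. x \<in> Rn N \<Longrightarrow> u (Phi N x) = Phi N (f x)"
      "\<And>x. x \<in> Rn 1 \<Longrightarrow> u (Xi N x) = Xi N (s x)"
    and t: "t \<in> Prol X 1 0" "g \<in> Prol X N 0" "base X t = base X g"
  shows "sadd X N (wcomp X (wedge 1 0) s t) (wcomp X (wedge N 0) f g) = wcomp X (wedge N 0) f (sadd X N t g)"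
proof -
  obtain y where y: "y \<in> Prol X N 1" "wcomp X (wedge 1 0) (Xi N) y = t" "wcomp X (wedge N 0) (Phi N) y = g"
    using saddE[OF t] .
  show ?thesis
    using sadd_fill[OF wcomp_wedge_pts[OF u y(1)]] sadd_fill[OF y(1)] natural_legs[OF u f s N eqs y(1)]
    by (simp add: y)
qed

lemma sdiff_natural:
  assumes u: "wmor (wedge N 1) (wedge N 1) u" and f: "wmor (wedge N 0) (wedge N 0) f"
    and s: "wmor (wedge 1 0) (wedge 1 0) s" and N: "N \<ge> 1"
    and eqs: "\<And>x. x \<in> Rn N \<Longrightarrow> u (Psi N x) = Psi N (f x)" "\<And>x. x \<in> Rn N \<Longrightarrow> u (Phi N x) = Phi N (f x)"
      "\<And>x. x \<in> Rn 1 \<Longrightarrow> u (Xi N x) = Xi N (s x)"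
    and g: "gp \<in> Prol X N 0" "gm \<in> Prol X N 0"
      "\<And>i. i < N \<Longrightarrow> wcomp X (wedge N 0) (\<lambda>x. x(i := 0)) gp = wcomp X (wedge N 0) (\<lambda>x. x(i := 0)) gm"
  shows "sdiff X N (wcomp X (wedge N 0) f gp) (wcomp X (wedge N 0) f gm) = wcomp X (wedge 1 0) s (sdiff X N gp gm)"
proof -
  obtain y where y: "y \<in> Prol X N 1" "wcomp X (wedge N 0) (Psi N) y = gp" "wcomp X (wedge N 0) (Phi N) y = gm"
    using sdiffE[OF N g] .
  show ?thesis
    using sdiff_fill[OF N wcomp_wedge_pts[OF u y(1)]] sdiff_fill[OF N y(1)] natural_legs[OF u f s N eqs y(1)]
    by (simp add: y)
qed

lemma scale_eqs:
  fixes \<alpha> :: real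
  assumes "i < N"
  shows "(Psi N x)(i := \<alpha> * Psi N x i, N := \<alpha> * Psi N x N) = Psi N (x(i := \<alpha> * x i))"
    "(Phi N x)(i := \<alpha> * Phi N x i, N := \<alpha> * Phi N x N) = Phi N (x(i := \<alpha> * x i))"
    "(Xi N x)(i := \<alpha> * Xi N x i, N := \<alpha> * Xi N x N) = Xi N (x(0 := \<alpha> * x 0))"
proof -
  have "(\<Prod>j<N. (x(i := \<alpha> * x i)) j) = \<alpha> * (\<Prod>j<N. x j)"
    using assms by (simp add: prod.remove[of "{..<N}" i])
  then show "(Psi N x)(i := \<alpha> * Psi N x i, N := \<alpha> * Psi N x N) = Psi N (x(i := \<alpha> * x i))"
    using assms by (auto simp: Psi_def fun_eq_iff)
qed (use assms in \<open>auto simp: Phi_def Xi_def fun_eq_iff\<close>)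

text \<open>A permutation of the first \<open>N\<close> coordinates fixes coordinate
  \<open>N\<close> and the product of the others. So \<open>u\<close> and \<open>f\<close> are given
  by the same formula and \<open>s\<close> is the identity.\<close>

lemma permute_eqs:
  assumes "\<sigma> permutes {..<N}"
  shows "(\<lambda>i. Psi N x (\<sigma> i)) = Psi N (\<lambda>i. x (\<sigma> i))"
    "(\<lambda>i. Phi N x (\<sigma> i)) = Phi N (\<lambda>i. x (\<sigma> i))"
    "(\<lambda>i. Xi N x (\<sigma> i)) = Xi N x"
proof -
  have N: "\<sigma> i = N \<longleftrightarrow> i = N" for i
    using assms permutes_inj[OF assms] by (metis injD lessThan_iff less_irrefl permutes_def)
  have "(\<Prod>i<N. x i) = (\<Prod>i<N. x (\<sigma> i))"
    by (rule prod.permute[OF assms, unfolded comp_def])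
  then show "(\<lambda>i. Psi N x (\<sigma> i)) = Psi N (\<lambda>i. x (\<sigma> i))"
    by (auto simp: Psi_def fun_eq_iff N)
qed (auto simp: Phi_def Xi_def fun_eq_iff, (metis assms lessThan_iff less_irrefl permutes_def injD[OF permutes_inj[OF assms]])+)

lemma sadd_scale:
  assumes "i < N" "t \<in> Prol X 1 0" "g \<in> Prol X N 0" "base X t = base X g"
  shows "sadd X N (wcomp X (wedge 1 0) (\<lambda>d. d(0 := \<alpha> * d 0)) t) (wcomp X (wedge N 0) (\<lambda>d. d(i := \<alpha> * d i)) g) =
    wcomp X (wedge N 0) (\<lambda>d. d(i := \<alpha> * d i)) (sadd X N t g)"
  by (rule sadd_natural[OF wmor_scale_plus[OF assms(1)] wmor_scale wmor_scale _ scale_eqs[OF assms(1)] assms(2-4)])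
    (use assms(1) in simp)

lemma sdiff_scale:
  assumes "i < N" "gp \<in> Prol X N 0" "gm \<in> Prol X N 0"
    "\<And>i. i < N \<Longrightarrow> wcomp X (wedge N 0) (\<lambda>x. x(i := 0)) gp = wcomp X (wedge N 0) (\<lambda>x. x(i := 0)) gm"
  shows "sdiff X N (wcomp X (wedge N 0) (\<lambda>d. d(i := \<alpha> * d i)) gp) (wcomp X (wedge N 0) (\<lambda>d. d(i := \<alpha> * d i)) gm) =
    wcomp X (wedge 1 0) (\<lambda>d. d(0 := \<alpha> * d 0)) (sdiff X N gp gm)"
  by (rule sdiff_natural[OF wmor_scale_plus[OF assms(1)] wmor_scale wmor_scale _ scale_eqs[OF assms(1)] assms(2-4)])
    (use assms(1) in simp_all)

lemma sadd_permute:
  assumes "\<sigma> permutes {..<N}" "N \<ge> 1" "t \<in> Prol X 1 0" "g \<in> Prol X N 0" "base X t = base X g"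
  shows "sadd X N t (wcomp X (wedge N 0) (\<lambda>d i. d (\<sigma> i)) g) =
    wcomp X (wedge N 0) (\<lambda>d i. d (\<sigma> i)) (sadd X N t g)"
  using sadd_natural[OF wmor_permute[OF assms(1)] wmor_permute[OF assms(1)] wmor_id assms(2)
      permute_eqs[OF assms(1)] assms(3-5)]
  by (simp add: wcomp_id[OF wideal_ok_wedge assms(3)])

lemma sdiff_permute:
  assumes "\<sigma> permutes {..<N}" "N \<ge> 1" "gp \<in> Prol X N 0" "gm \<in> Prol X N 0"
    "\<And>i. i < N \<Longrightarrow> wcomp X (wedge N 0) (\<lambda>x. x(i := 0)) gp = wcomp X (wedge N 0) (\<lambda>x. x(i := 0)) gm"
  shows "sdiff X N (wcomp X (wedge N 0) (\<lambda>d i. d (\<sigma> i)) gp) (wcomp X (wedge N 0) (\<lambda>d i. d (\<sigma> i)) gm) =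
    sdiff X N gp gm"
  using sdiff_natural[OF wmor_permute[OF assms(1)] wmor_permute[OF assms(1)] wmor_id assms(2)
      permute_eqs[OF assms(1)] assms(3-5)]
  by (simp add: wcomp_id[OF wideal_ok_wedge sdiff_pts(1)[OF assms(2-5)]])

text \<open>Pulling \<open>g\<close> back along the projection to \<open>D^N\<close> gives the
  filler that is constant in the added direction; it serves both \<open>sadd_zero\<close> and
  \<open>sdiff_self\<close>.\<close>

lemma degenerate_fill:
  assumes N: "N \<ge> 1" and g: "g \<in> Prol X N 0" "base X g = wconst X (wedge 0 0) x" "x \<in> pts X"
  shows "wcomp X (wedge N 1) (vtake N) g \<in> Prol X N 1"
    "wcomp X (wedge N 0) (Psi N) (wcomp X (wedge N 1) (vtake N) g) = g"
    "wcomp X (wedge N 0) (Phi N) (wcomp X (wedge N 1) (vtake N) g) = g"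
    "wcomp X (wedge 1 0) (Xi N) (wcomp X (wedge N 1) (vtake N) g) = wconst X (wedge 1 0) x"
proof -
  show "wcomp X (wedge N 1) (vtake N) g \<in> Prol X N 1" by (rule wcomp_wedge_pts[OF wmor_vtake g(1)])
  have "wcomp X (wedge N 0) (\<lambda>x. vtake N (Psi N x)) g = wcomp X (wedge N 0) (\<lambda>x. x) g"
    "wcomp X (wedge N 0) (\<lambda>x. vtake N (Phi N x)) g = wcomp X (wedge N 0) (\<lambda>x. x) g"
    by (rule wcomp_cong, (auto simp: vtake_def Psi_def Phi_def Rn_def fun_eq_iff lessThan_one)[1])+
  then show "wcomp X (wedge N 0) (Psi N) (wcomp X (wedge N 1) (vtake N) g) = g"
    "wcomp X (wedge N 0) (Phi N) (wcomp X (wedge N 1) (vtake N) g) = g"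
    by (simp_all add: wcomp2[OF wmor_vtake _ g(1)] wmor_Psi[OF N] wmor_Phi' wcomp_id[OF wideal_ok_wedge g(1)])
  have "wcomp X (wedge 1 0) (\<lambda>x. vtake N (Xi N x)) g = wcomp X (wedge 1 0) (\<lambda>x i. 0) g"
    by (rule wcomp_cong) (auto simp: vtake_def Xi_def)
  then show "wcomp X (wedge 1 0) (Xi N) (wcomp X (wedge N 1) (vtake N) g) = wconst X (wedge 1 0) x"
    unfolding wcomp2[OF wmor_vtake wmor_Xi g(1)]
    using wcomp_const_wedge[OF g(1) wmor_zero g(2) wmor_zero g(3)] by simp
qed

lemma sadd_zero:
  assumes "N \<ge> 1" "g \<in> Prol X N 0" "base X g = wconst X (wedge 0 0) x" "x \<in> pts X"
  shows "sadd X N (wconst X (wedge 1 0) x) g = g"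
  using sadd_fill[OF degenerate_fill(1)[OF assms]] by (simp add: degenerate_fill[OF assms])

lemma sdiff_self:
  assumes "N \<ge> 1" "g \<in> Prol X N 0" "base X g = wconst X (wedge 0 0) x" "x \<in> pts X"
  shows "sdiff X N g g = wconst X (wedge 1 0) x"
  using sdiff_fill[OF assms(1) degenerate_fill(1)[OF assms]] by (simp add: degenerate_fill[OF assms])

text \<open>All additions involved are restrictions of one element \<open>y\<close> over
  \<open>D^N \<oplus> D \<oplus> D\<close> with \<open>w\<close> and \<open>v\<close> on the added
  axes, so the equality comes down to an identity of maps on \<open>D^N\<close>.\<close>

lemma sadd_sadd:
  assumes N: "N \<ge> 1" and v: "v \<in> Prol X 1 0" "base X v = base X a" and w: "w \<in> Prol X 1 0" "base X w = base X a"
    and a: "a \<in> Prol X N 0"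
  shows "sadd X N v (sadd X N w a) = sadd X N (sadd X 1 w v) a"
proof -
  have "\<exists>!y. y \<in> Prol X N 2 \<and> wcomp X (wedge N 0) (\<lambda>d. d(N := 0)) y = a \<and>
      (\<forall>j<2. wcomp X (wedge 1 0) (axis_map (N + j)) y = (if j = 0 then w else v))"
    by (rule axes_lift[OF micro a]) (use v w in auto)
  then obtain y where y: "y \<in> Prol X N 2" and ya: "wcomp X (wedge N 0) (\<lambda>d. d(N := 0)) y = a"
    and yj: "\<forall>j<2. wcomp X (wedge 1 0) (axis_map (N + j)) y = (if j = 0 then w else v)" by blast
  have yw: "wcomp X (wedge 1 0) (axis_map N) y = w" and yv: "wcomp X (wedge 1 0) (axis_map (Suc N)) y = v"
    using yj[rule_format, of 0] yj[rule_format, of 1] by (simp_all add: Suc_eq_plus1)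
  \<comment> \<open>\<open>?p1\<close> serves for \<open>w\<close> added to \<open>a\<close>,
    \<open>?p2\<close> for \<open>v\<close> added to the result, \<open>?q\<close> for the sum of
    the two vectors, and \<open>?p3\<close> for that sum added to \<open>a\<close>.\<close>
  let ?p1 = "\<lambda>x :: vec. x" and ?p2 = "\<lambda>x :: vec. x(N := \<Prod>i<N. x i, Suc N := x N)"
    and ?p3 = "\<lambda>x :: vec. x(Suc N := x N)" and ?q = "\<lambda>x :: vec. (\<lambda>i. 0)(N := x 1, Suc N := x 0) :: vec"
  note m1 = wmor_first_axis[of N] and m2 = wmor_Psi_axis[OF N] and m3 = wmor_diagonal_axes[of N]
    and mq = wmor_axes[of N]
  have psi0: "(\<Prod>i<N. (if i = N then c else 0)) = (0::real)" for c using N by (intro prod_zero) (auto intro!: exI[of _ 0])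
  let ?wa = "wcomp X (wedge N 0) (Psi N) y"
  have wa: "sadd X N w a = ?wa"
  proof -
    have "wcomp X (wedge 1 0) (\<lambda>x. Xi N x) y = w" "wcomp X (wedge N 0) (\<lambda>x. Phi N x) y = a"
      unfolding yw[symmetric] ya[symmetric] by (rule wcomp_cong, simp add: Xi_def Phi_def)+
    then show ?thesis
      using sadd_fill[OF wcomp_wedge_pts[OF m1 y]]
      by (simp add: wcomp2[OF m1 wmor_Xi y] wcomp2[OF m1 wmor_Phi' y] wcomp2[OF m1 wmor_Psi[OF N] y])
  qed
  have vwa: "sadd X N v ?wa = wcomp X (wedge N 0) (\<lambda>x. ?p2 (Psi N x)) y"
  proof -
    have "wcomp X (wedge 1 0) (\<lambda>x. ?p2 (Xi N x)) y = v"
      unfolding yv[symmetric] by (rule wcomp_cong) (use N in \<open>auto simp: Xi_def fun_eq_iff psi0\<close>)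
    moreover have "wcomp X (wedge N 0) (\<lambda>x. ?p2 (Phi N x)) y = ?wa"
      by (rule wcomp_cong) (auto simp: Phi_def Psi_def Rn_def fun_eq_iff)
    ultimately show ?thesis
      using sadd_fill[OF wcomp_wedge_pts[OF m2 y]]
      by (simp only: wcomp2[OF m2 wmor_Xi y] wcomp2[OF m2 wmor_Phi' y] wcomp2[OF m2 wmor_Psi[OF N] y])
  qed
  let ?vw = "wcomp X (wedge 1 0) (\<lambda>x. ?p3 (Xi N x)) y"
  have vw: "sadd X 1 w v = ?vw"
  proof -
    have "wcomp X (wedge 1 0) (\<lambda>x. ?q (Xi 1 x)) y = w"
      unfolding yw[symmetric] by (rule wcomp_cong) (auto simp: Xi_def fun_eq_iff)
    moreover have "wcomp X (wedge 1 0) (\<lambda>x. ?q (Phi 1 x)) y = v"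
      unfolding yv[symmetric] by (rule wcomp_cong) (auto simp: Phi_def fun_eq_iff)
    moreover have "wcomp X (wedge 1 0) (\<lambda>x. ?q (Psi 1 x)) y = ?vw"
      by (rule wcomp_cong) (auto simp: Psi_def lessThan_one Xi_def fun_eq_iff)
    ultimately show ?thesis
      using sadd_fill[OF wcomp_wedge_pts[OF mq y]]
      by (simp only: wcomp2[OF mq wmor_Xi y] wcomp2[OF mq wmor_Phi' y] wcomp2[OF mq wmor_Psi[OF order_refl] y])
  qed
  have "sadd X N ?vw a = wcomp X (wedge N 0) (\<lambda>x. ?p3 (Psi N x)) y"
  proof -
    have "wcomp X (wedge N 0) (\<lambda>x. ?p3 (Phi N x)) y = a"
      unfolding ya[symmetric] by (rule wcomp_cong) (auto simp: Phi_def Rn_def fun_eq_iff)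
    then show ?thesis
      using sadd_fill[OF wcomp_wedge_pts[OF m3 y]]
      by (simp only: wcomp2[OF m3 wmor_Xi y] wcomp2[OF m3 wmor_Phi' y] wcomp2[OF m3 wmor_Psi[OF N] y])
  qed
  \<comment> \<open>Both composites send d to (d, d_1...d_N, d_1...d_N).\<close>
  moreover have "wcomp X (wedge N 0) (\<lambda>x. ?p3 (Psi N x)) y = wcomp X (wedge N 0) (\<lambda>x. ?p2 (Psi N x)) y"
    by (rule wcomp_cong) (auto simp: Psi_def fun_eq_iff)
  ultimately show ?thesis unfolding wa vwa vw by simp
qed

text \<open>Exchanging the two axes exchanges the summands and fixes the diagonal.\<close>

lemma tadd_commute:
  assumes "s \<in> Prol X 1 0" "t \<in> Prol X 1 0" "base X s = base X t"
  shows "tadd X s t = tadd X t s"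
proof -
  obtain y where y: "y \<in> Prol X 1 1" "wcomp X (wedge 1 0) (Xi 1) y = t" "wcomp X (wedge 1 0) (Phi 1) y = s"
    using saddE[OF assms(2,1) assms(3)[symmetric]] .
  let ?f = "\<lambda>x :: vec. (\<lambda>i. 0)(0 := x 1, 1 := x 0) :: vec"
  have f: "wmor (wedge 1 1) (wedge 1 1) ?f"
  proof (rule wmor_wedgeI)
    define \<tau> :: "nat \<Rightarrow> nat" where "\<tau> i = 1 - i" for i
    have eq: "?f x i = x (\<tau> i)" if "i < 1 + 1" for x i using that by (auto simp: \<tau>_def less_2_cases_iff)
    show "?f \<in> Rn (1 + 1) \<rightarrow> Rn (1 + 1)" by (auto simp: Rn_def)
    show "Cinf (1 + 1) (\<lambda>x. ?f x i)" if "i < 1 + 1" for i unfolding eq[OF that] by simp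
    show "rst (1 + 1) (\<lambda>x. ?f x i * ?f x i) \<in> wideal (wedge 1 1)" if "i < 1 + 1" for i
      unfolding eq[OF that] by (rule wedge_square) (simp add: \<tau>_def)
    show "rst (1 + 1) (\<lambda>x. ?f x i * ?f x j) \<in> wideal (wedge 1 1)" if "i < j" "1 \<le> j" "j < 1 + 1" for i j
      unfolding eq[OF that(3)] eq[OF order.strict_trans[OF that(1,3)]]
      by (rule wedge_product) (use that in \<open>auto simp: \<tau>_def\<close>)
  qed
  have "wcomp X (wedge 1 0) (\<lambda>x. ?f (Xi 1 x)) y = s" "wcomp X (wedge 1 0) (\<lambda>x. ?f (Phi 1 x)) y = t"
    "wcomp X (wedge 1 0) (\<lambda>x. ?f (Psi 1 x)) y = wcomp X (wedge 1 0) (Psi 1) y"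
    unfolding y(2)[symmetric] y(3)[symmetric]
    by (rule wcomp_cong, (auto simp: Xi_def Phi_def Psi_def Rn_def fun_eq_iff lessThan_one)[1])+
  then show ?thesis
    using sadd_fill[OF y(1)] sadd_fill[OF wcomp_wedge_pts[OF f y(1)]]
    by (simp add: tadd_sadd y wcomp2[OF f wmor_Xi y(1)] wcomp2[OF f wmor_Phi' y(1)]
      wcomp2[OF f wmor_Psi[OF order_refl] y(1)])
qed

text \<open>The filler is \<open>t\<close> composed with \<open>a * x 0 + b * x 1\<close>, which on
  the diagonal is scaling by \<open>a + b\<close>.\<close>

lemma tadd_tscale:
  assumes t: "t \<in> Prol X 1 0"
  shows "tadd X (tscale X a t) (tscale X b t) = tscale X (a + b) t"
proof -
  let ?f = "\<lambda>x :: vec. (\<lambda>i. 0)(0 := a * x 0 + b * x 1) :: vec"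
  note f = wmor_linear[of a b]
  have "wcomp X (wedge 1 0) (\<lambda>x. ?f (Xi 1 x)) t = tscale X b t"
    "wcomp X (wedge 1 0) (\<lambda>x. ?f (Phi 1 x)) t = tscale X a t"
    "wcomp X (wedge 1 0) (\<lambda>x. ?f (Psi 1 x)) t = tscale X (a + b) t"
    unfolding tscale_def scale_def W_simps
    by (rule wcomp_cong, (auto simp: Xi_def Phi_def Psi_def Rn_def fun_eq_iff algebra_simps lessThan_one)[1])+
  then show ?thesis
    using sadd_fill[OF wcomp_wedge_pts[OF f t]]
    by (simp add: tadd_sadd wcomp2[OF f wmor_Xi t] wcomp2[OF f wmor_Phi' t] wcomp2[OF f wmor_Psi[OF order_refl] t])
qed

lemma tadd_assoc:
  assumes "u \<in> Prol X 1 0" "v \<in> Prol X 1 0" "w \<in> Prol X 1 0" "base X v = base X u" "base X w = base X u"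
  shows "tadd X (tadd X u v) w = tadd X u (tadd X v w)"
proof -
  have "tadd X (tadd X u v) w = sadd X 1 (sadd X 1 v w) u"
    unfolding tadd_sadd by (rule sadd_sadd) (use assms in auto)
  also have "sadd X 1 v w = tadd X v w"
    using tadd_commute[OF assms(3,2)] assms(4,5) by (simp add: tadd_sadd)
  finally show ?thesis by (simp add: tadd_sadd)
qed

lemma tscale_tadd:
  assumes "u \<in> Prol X 1 0" "v \<in> Prol X 1 0" "base X v = base X u"
  shows "tscale X a (tadd X u v) = tadd X (tscale X a u) (tscale X a v)"
  unfolding tadd_sadd tscale_def scale_def W_simps
  by (rule sadd_scale[symmetric]) (use assms in auto)

text \<open>The fillers are chosen pointwise. Their legs are the given curves, so the initial
  structure of the limit makes the fillers a curve, and composition with \<open>Psi\<close>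
  preserves this.\<close>

lemma sadd_curve:
  assumes N: "N \<ge> 1" and t: "t \<in> curves (weil_prol X (wedge 1 0))" and g: "g \<in> curves (weil_prol X (wedge N 0))"
    and b: "\<And>s. base X (t s) = base X (g s)"
  shows "(\<lambda>s. sadd X N (t s) (g s)) \<in> curves (weil_prol X (wedge N 0))"
proof -
  have "t s \<in> Prol X 1 0" "g s \<in> Prol X N 0" for s
    using curves_weil_prolD(1)[OF t] curves_weil_prolD(1)[OF g] by auto
  then have "\<forall>s. \<exists>y. y \<in> Prol X N 1 \<and> wcomp X (wedge 1 0) (Xi N) y = t s \<and> wcomp X (wedge N 0) (Phi N) y = g s"
    using saddE b by metis
  then obtain y where y: "\<And>s. y s \<in> Prol X N 1" "\<And>s. wcomp X (wedge 1 0) (Xi N) (y s) = t s"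
    "\<And>s. wcomp X (wedge N 0) (Phi N) (y s) = g s" by metis
  have "y \<in> curves (weil_prol X (wedge N 1))"
  proof (rule axes_curve[OF micro])
    show "range y \<subseteq> Prol X N 1" using y(1) by blast
    show "(\<lambda>s. wcomp X (wedge N 0) (\<lambda>d. d(N := 0)) (y s)) \<in> curves (weil_prol X (wedge N 0))"
      using g y(3) by (simp add: Phi_def[abs_def])
    show "(\<lambda>s. wcomp X (wedge 1 0) (axis_map (N + j)) (y s)) \<in> curves (weil_prol X (wedge 1 0))" if "j < 1" for j
      using that t y(2) by (simp add: Xi_def[abs_def])
  qed
  from curves_wcomp_wedge[OF wmor_Psi[OF N] this]
  show ?thesis using sadd_fill[OF y(1)] by (simp add: y)
qed

lemma sdiff_curve:
  assumes N: "N \<ge> 1" and gp: "gp \<in> curves (weil_prol X (wedge N 0))" and gm: "gm \<in> curves (weil_prol X (wedge N 0))"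
    and eq: "\<And>s i. i < N \<Longrightarrow> wcomp X (wedge N 0) (\<lambda>x. x(i := 0)) (gp s) = wcomp X (wedge N 0) (\<lambda>x. x(i := 0)) (gm s)"
  shows "(\<lambda>s. sdiff X N (gp s) (gm s)) \<in> curves (weil_prol X (wedge 1 0))"
proof -
  have "gp s \<in> Prol X N 0" "gm s \<in> Prol X N 0" for s
    using curves_weil_prolD(1)[OF gp] curves_weil_prolD(1)[OF gm] by auto
  then have "\<forall>s. \<exists>y. y \<in> Prol X N 1 \<and> wcomp X (wedge N 0) (Psi N) y = gp s \<and> wcomp X (wedge N 0) (Phi N) y = gm s"
    using sdiffE[OF N] eq by metis
  then obtain y where y: "\<And>s. y s \<in> Prol X N 1" "\<And>s. wcomp X (wedge N 0) (Psi N) (y s) = gp s"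
    "\<And>s. wcomp X (wedge N 0) (Phi N) (y s) = gm s" by metis
  have "y \<in> curves (weil_prol X (wedge N 1))"
    by (rule top_curve[OF micro N]) (use y gp gm in auto)
  from curves_wcomp_wedge[OF wmor_Xi this]
  show ?thesis using sdiff_fill[OF N y(1)] by (simp add: y)
qed

end

section \<open>Naturality of the strong operations with respect to the space\<close>

lemma wcomp_wmap_wedge:
  assumes "wmor (wedge N r) (wedge N' r') f" "smooth_map X Y u" "A \<in> Prol X N r"
  shows "wcomp Y (wedge N' r') f (wmap Y (wedge N r) u A) = wmap Y (wedge N' r') u (wcomp X (wedge N' r') f A)"
  by (rule wcomp_wmap[OF wideal_ok_wedge wideal_ok_wedge assms])

text \<open>The image of a filler under \<open>u\<close> fills the images of the data.\<close>

lemma sadd_wmap: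
  assumes X: "microlinear X" and Y: "microlinear Y" and u: "smooth_map X Y u" and N: "N \<ge> 1"
    and t: "t \<in> Prol X 1 0" "g \<in> Prol X N 0" "base X t = base X g"
  shows "wmap Y (wedge N 0) u (sadd X N t g) = sadd Y N (wmap Y (wedge 1 0) u t) (wmap Y (wedge N 0) u g)"
proof -
  interpret X: microlinear_space X by (rule microlinear_space.intro[OF X])
  interpret Y: microlinear_space Y by (rule microlinear_space.intro[OF Y])
  obtain y where y: "y \<in> Prol X N 1" "wcomp X (wedge 1 0) (Xi N) y = t" "wcomp X (wedge N 0) (Phi N) y = g"
    using X.saddE[OF t] .
  show ?thesis
    using X.sadd_fill[OF y(1)] Y.sadd_fill[OF wmap_pts[OF wideal_ok_wedge u y(1)]]
    by (simp add: y wcomp_wmap_wedge[OF wmor_Xi u y(1)] wcomp_wmap_wedge[OF wmor_Phi' u y(1)]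
      wcomp_wmap_wedge[OF wmor_Psi[OF N] u y(1)])
qed

lemma sdiff_wmap:
  assumes X: "microlinear X" and Y: "microlinear Y" and u: "smooth_map X Y u" and N: "N \<ge> 1"
    and g: "gp \<in> Prol X N 0" "gm \<in> Prol X N 0"
      "\<And>i. i < N \<Longrightarrow> wcomp X (wedge N 0) (\<lambda>x. x(i := 0)) gp = wcomp X (wedge N 0) (\<lambda>x. x(i := 0)) gm"
  shows "wmap Y (wedge 1 0) u (sdiff X N gp gm) = sdiff Y N (wmap Y (wedge N 0) u gp) (wmap Y (wedge N 0) u gm)"
proof -
  interpret X: microlinear_space X by (rule microlinear_space.intro[OF X])
  interpret Y: microlinear_space Y by (rule microlinear_space.intro[OF Y])
  obtain y where y: "y \<in> Prol X N 1" "wcomp X (wedge N 0) (Psi N) y = gp" "wcomp X (wedge N 0) (Phi N) y = gm"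
    using X.sdiffE[OF N g] .
  show ?thesis
    using X.sdiff_fill[OF N y(1)] Y.sdiff_fill[OF N wmap_pts[OF wideal_ok_wedge u y(1)]]
    by (simp add: y wcomp_wmap_wedge[OF wmor_Xi u y(1)] wcomp_wmap_wedge[OF wmor_Phi' u y(1)]
      wcomp_wmap_wedge[OF wmor_Psi[OF N] u y(1)])
qed

section \<open>The affine bundle of tangentials\<close>

abbreviation Fib :: "'a fspace \<Rightarrow> nat \<Rightarrow> 'a \<Rightarrow> (vec \<Rightarrow> 'a) set set" where
  "Fib X N x \<equiv> fibre X (wedge N 0) x"

lemma fibre_iff: "A \<in> Fib X N x \<longleftrightarrow> A \<in> Prol X N 0 \<and> base X A = wconst X (wedge 0 0) x"
  by (simp add: fibre_def W_one_wedge)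

lemma fibre_sub: "Fib X N x \<subseteq> Prol X N 0"
  by (auto simp: fibre_iff)

lemma wcomp_fibre:
  assumes "wmor (wedge N 0) (wedge N' 0) f" "f (\<lambda>i. 0) = (\<lambda>i. 0)" "A \<in> Fib X N x"
  shows "wcomp X (wedge N' 0) f A \<in> Fib X N' x"
proof -
  have A: "A \<in> Prol X N 0" "base X A = wconst X (wedge 0 0) x" using assms(3) by (auto simp: fibre_iff)
  show ?thesis
    unfolding fibre_iff base_wcomp[OF assms(1) A(1) assms(2)] using wcomp_wedge_pts[OF assms(1) A(1)] A(2) by blast
qed

lemma scale_fibre: "A \<in> Fib X N x \<Longrightarrow> wcomp X (wedge N 0) (\<lambda>d. d(i := \<alpha> * d i)) A \<in> Fib X N x"
  by (rule wcomp_fibre[OF wmor_scale]) auto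

lemma permute_fibre: "\<sigma> permutes {..<N} \<Longrightarrow> A \<in> Fib X N x \<Longrightarrow> wcomp X (wedge N 0) (\<lambda>d i. d (\<sigma> i)) A \<in> Fib X N x"
  by (rule wcomp_fibre[OF wmor_permute]) auto

lemma kappa_fibre: "n \<ge> 1 \<Longrightarrow> A \<in> Fib X n x \<Longrightarrow> wcomp X (wedge (Suc n) 0) (kappa n) A \<in> Fib X (Suc n) x"
  by (rule wcomp_fibre[OF wmor_kappa]) (auto simp: kappa_def)

lemma up_fibre: "A \<in> Fib X n x \<Longrightarrow> wcomp X (wedge (Suc n) 0) (vtake n) A \<in> Fib X (Suc n) x"
  by (rule wcomp_fibre[OF wmor_vtake_Suc]) (auto simp: vtake_def)

lemma down_fibre: "A \<in> Fib X (Suc n) x \<Longrightarrow> wcomp X (wedge n 0) (\<lambda>d. d(n := 0)) A \<in> Fib X n x"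
  by (rule wcomp_fibre[OF wmor_face]) auto

lemma wconst_fibre: "x \<in> pts X \<Longrightarrow> wconst X (wedge N 0) x \<in> Fib X N x"
  by (simp add: fibre_iff wconst_pts wcomp_wconst_wedge[OF wmor_zero])

locale tangential_setting =
  fixes E :: "'e fspace" and M :: "'m fspace" and \<pi> :: "'e \<Rightarrow> 'm"
  assumes M: "frolicher M" and \<pi>: "smooth_map E M \<pi>" and mE: "microlinear E" and mM: "microlinear M"
begin

sublocale E: microlinear_space E by (rule microlinear_space.intro[OF mE])

lemma pi_pts: "x \<in> pts E \<Longrightarrow> \<pi> x \<in> pts M"
  using \<pi> by (auto simp: smooth_map_def)

abbreviation FE where "FE \<equiv> Fib E"
abbreviation FM where "FM \<equiv> Fib M"
abbreviation proj :: "nat \<Rightarrow> (vec \<Rightarrow> 'e) set \<Rightarrow> (vec \<Rightarrow> 'm) set" where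
  "proj N \<equiv> wmap M (wedge N 0) \<pi>"

text \<open>Smoothness on a fibre, in the form that \<open>sadd_curve\<close> and
  \<open>sdiff_curve\<close> transport through the pointwise operations.\<close>

definition curve_smooth :: "nat \<Rightarrow> nat \<Rightarrow> 'e \<Rightarrow> ('m, 'e) tmap \<Rightarrow> bool" where
  "curve_smooth N N' x T \<longleftrightarrow> (\<forall>c\<in>curves (weil_prol M (wedge N 0)). range c \<subseteq> FM N (\<pi> x) \<longrightarrow>
     (\<lambda>t. T (c t)) \<in> curves (weil_prol E (wedge N' 0)))"

lemma curve_smoothD:
  "curve_smooth N N' x T \<Longrightarrow> c \<in> curves (weil_prol M (wedge N 0)) \<Longrightarrow> range c \<subseteq> FM N (\<pi> x) \<Longrightarrow>
     (\<lambda>t. T (c t)) \<in> curves (weil_prol E (wedge N' 0))"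
  by (simp add: curve_smooth_def)

lemma curve_smooth_cong:
  "(\<And>\<gamma>. \<gamma> \<in> FM N (\<pi> x) \<Longrightarrow> T \<gamma> = T' \<gamma>) \<Longrightarrow> curve_smooth N N' x T \<longleftrightarrow> curve_smooth N N' x T'"
proof -
  assume eq: "\<And>\<gamma>. \<gamma> \<in> FM N (\<pi> x) \<Longrightarrow> T \<gamma> = T' \<gamma>"
  have "(\<lambda>t. T (c t)) = (\<lambda>t. T' (c t))" if "range c \<subseteq> FM N (\<pi> x)" for c :: "real \<Rightarrow> _"
    using that eq by (auto simp: fun_eq_iff)
  then show ?thesis unfolding curve_smooth_def by auto
qed

text \<open>Smoothness becomes a condition on curves, and the condition over \<open>D_m\<close> is
  discharged by \<open>homothety\<close>. What remains to be checked are conditions at single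
  elements and along curves.\<close>

lemma pseudotangential_iff:
  "pseudotangential E M \<pi> x N T \<longleftrightarrow> T \<in> extensional (FM N (\<pi> x)) \<and> T \<in> FM N (\<pi> x) \<rightarrow> FE N x \<and>
     curve_smooth N N x T \<and> (\<forall>\<gamma>\<in>FM N (\<pi> x). proj N (T \<gamma>) = \<gamma>) \<and>
     (\<forall>\<gamma>\<in>FM N (\<pi> x). \<forall>\<alpha>. \<forall>i<N. T (wcomp M (wedge N 0) (\<lambda>d. d(i := \<alpha> * d i)) \<gamma>) =
        wcomp E (wedge N 0) (\<lambda>d. d(i := \<alpha> * d i)) (T \<gamma>)) \<and>
     (\<forall>\<gamma>\<in>FM N (\<pi> x). \<forall>\<sigma>. \<sigma> permutes {..<N} \<longrightarrow> T (wcomp M (wedge N 0) (\<lambda>d i. d (\<sigma> i)) \<gamma>) =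
        wcomp E (wedge N 0) (\<lambda>d i. d (\<sigma> i)) (T \<gamma>))"
  (is "?L \<longleftrightarrow> ?e \<and> ?f \<and> ?c \<and> ?p \<and> ?s \<and> ?r")
proof -
  have sm: "smooth_map (fibre_space M (wedge N 0) (\<pi> x)) (fibre_space E (wedge N 0) x) T \<longleftrightarrow> ?f \<and> ?c"
    unfolding fibre_space_def curve_smooth_def by (rule smooth_fsub_iff[OF fibre_sub])
  have hom: "wmap (fibre_space E (wedge N 0) x) (W_Dsub m) T
          (wcurry (fibre_space M (wedge N 0) (\<pi> x)) M (wedge N 0) (W_Dsub m) (mu N i) \<gamma>) =
        wcurry (fibre_space E (wedge N 0) x) E (wedge N 0) (W_Dsub m) (mu N i) (T \<gamma>)"
    if "?f" "?c" "?s" "\<gamma> \<in> FM N (\<pi> x)" "i < N" for \<gamma> m i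
    unfolding fibre_space_def
    by (rule homothety[OF M fibre_sub fibre_sub])
      (use that sm[unfolded fibre_space_def] in \<open>auto intro: scale_fibre\<close>)
  define H where "H \<longleftrightarrow> (\<forall>\<gamma>\<in>FM N (\<pi> x). \<forall>m\<ge>1. \<forall>i<N.
      wmap (fibre_space E (wedge N 0) x) (W_Dsub m) T
        (wcurry (fibre_space M (wedge N 0) (\<pi> x)) M (wedge N 0) (W_Dsub m) (mu N i) \<gamma>) =
      wcurry (fibre_space E (wedge N 0) x) E (wedge N 0) (W_Dsub m) (mu N i) (T \<gamma>))"
  have "?L \<longleftrightarrow> ?e \<and> (?f \<and> ?c) \<and> ?p \<and> ?s \<and> H \<and> ?r"
    unfolding pseudotangential_def scale_def permute_def W_simps sm H_def ..
  moreover have "H" if "?f" "?c" "?s"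
    unfolding H_def using hom[OF that] by (intro ballI allI impI)
  ultimately show ?thesis by argo
qed

definition Vert :: "'e \<Rightarrow> (vec \<Rightarrow> 'e) set set" where
  "Vert x = {t \<in> FE 1 x. proj 1 t = wconst M (wedge 1 0) (\<pi> x)}"

lemma vertical_Vert: "vertical E M \<pi> x = Vert x"
  by (simp add: vertical_def Vert_def W_simps)

lemma Vert_fibre: "t \<in> Vert x \<Longrightarrow> t \<in> FE 1 x"
  by (simp add: Vert_def)

lemma Vert_pts: "t \<in> Vert x \<Longrightarrow> t \<in> Prol E 1 0"
  by (simp add: Vert_def fibre_iff)

lemma Vert_base: "t \<in> Vert x \<Longrightarrow> A \<in> FE N x \<Longrightarrow> base E t = base E A"
  by (simp add: Vert_def fibre_iff)

lemma tscale_wcomp: "tscale E \<alpha> = wcomp E (wedge 1 0) (\<lambda>d. d(0 := \<alpha> * d 0))"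
  by (simp add: tscale_def scale_def W_simps fun_eq_iff)

text \<open>As for pseudotangentials, with \<open>homothety\<close> applied to the scaling of
  tangent vectors on the target side.\<close>

lemma symmetric_form_iff:
  "symmetric_form E M \<pi> x N \<omega> \<longleftrightarrow> \<omega> \<in> extensional (FM N (\<pi> x)) \<and> \<omega> \<in> FM N (\<pi> x) \<rightarrow> Vert x \<and>
     curve_smooth N 1 x \<omega> \<and>
     (\<forall>\<gamma>\<in>FM N (\<pi> x). \<forall>\<alpha>. \<forall>i<N. \<omega> (wcomp M (wedge N 0) (\<lambda>d. d(i := \<alpha> * d i)) \<gamma>) = tscale E \<alpha> (\<omega> \<gamma>)) \<and>
     (\<forall>\<gamma>\<in>FM N (\<pi> x). \<forall>\<sigma>. \<sigma> permutes {..<N} \<longrightarrow> \<omega> (wcomp M (wedge N 0) (\<lambda>d i. d (\<sigma> i)) \<gamma>) = \<omega> \<gamma>) \<and>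
     (N \<ge> 2 \<longrightarrow> (\<forall>\<gamma>\<in>FM (N - 1) (\<pi> x).
        \<omega> (wcomp M (wedge N 0) (kappa (N - 1)) \<gamma>) = wconst E (wedge 1 0) x))"
  (is "?L \<longleftrightarrow> ?e \<and> ?f \<and> ?c \<and> ?s \<and> ?r \<and> ?k")
proof -
  have Vs: "Vert x \<subseteq> Prol E 1 0" using Vert_pts by blast
  have sm: "smooth_map (fibre_space M (wedge N 0) (\<pi> x)) (vertical_space E M \<pi> x) \<omega> \<longleftrightarrow> ?f \<and> ?c"
    unfolding fibre_space_def curve_smooth_def vertical_space_def vertical_Vert W_simps
    by (rule smooth_fsub_iff[OF Vs])
  have hom: "wmap (vertical_space E M \<pi> x) (W_Dsub m) \<omega>
          (wcurry (fibre_space M (wedge N 0) (\<pi> x)) M (wedge N 0) (W_Dsub m) (mu N i) \<gamma>) =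
        wcurry (vertical_space E M \<pi> x) E (wedge 1 0) (W_Dsub m) (mu 1 0) (\<omega> \<gamma>)"
    if "?f" "?c" "?s" "\<gamma> \<in> FM N (\<pi> x)" "i < N" for \<gamma> m i
    unfolding fibre_space_def vertical_space_def vertical_Vert W_simps
    by (rule homothety[OF M fibre_sub Vs])
      (use that sm[unfolded fibre_space_def vertical_space_def vertical_Vert W_simps]
        in \<open>auto intro: scale_fibre simp: tscale_wcomp\<close>)
  define H where "H \<longleftrightarrow> (\<forall>\<gamma>\<in>FM N (\<pi> x). \<forall>m\<ge>1. \<forall>i<N.
      wmap (vertical_space E M \<pi> x) (W_Dsub m) \<omega>
        (wcurry (fibre_space M (wedge N 0) (\<pi> x)) M (wedge N 0) (W_Dsub m) (mu N i) \<gamma>) =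
      wcurry (vertical_space E M \<pi> x) E (wedge 1 0) (W_Dsub m) (mu 1 0) (\<omega> \<gamma>))"
  have "?L \<longleftrightarrow> ?e \<and> (?f \<and> ?c) \<and> ?s \<and> H \<and> ?r \<and> ?k"
    unfolding symmetric_form_def scale_def permute_def W_simps sm H_def ..
  moreover have "H" if "?f" "?c" "?s"
    unfolding H_def using hom[OF that] by (intro ballI allI impI)
  ultimately show ?thesis by argo
qed

lemma tangential_Suc:
  assumes "n \<ge> 1"
  shows "tangential E M \<pi> x (Suc n) T \<longleftrightarrow> pseudotangential E M \<pi> x (Suc n) T \<and>
    tangential E M \<pi> x n (pi_hat E M \<pi> x n T) \<and>
    (\<forall>\<gamma>\<in>FM n (\<pi> x). T (wcomp M (wedge (Suc n) 0) (kappa n) \<gamma>) =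
       wcomp E (wedge (Suc n) 0) (kappa n) (pi_hat E M \<pi> x n T \<gamma>))"
proof
  assume "tangential E M \<pi> x (Suc n) T"
  then show "pseudotangential E M \<pi> x (Suc n) T \<and> tangential E M \<pi> x n (pi_hat E M \<pi> x n T) \<and>
    (\<forall>\<gamma>\<in>FM n (\<pi> x). T (wcomp M (wedge (Suc n) 0) (kappa n) \<gamma>) =
       wcomp E (wedge (Suc n) 0) (kappa n) (pi_hat E M \<pi> x n T \<gamma>))"
    by (cases rule: tangential.cases) (use assms in \<open>auto simp: W_simps\<close>)
qed (use assms in \<open>auto intro!: tangential.step simp: W_simps\<close>)

lemma tangential_pseudo: "tangential E M \<pi> x n T \<Longrightarrow> pseudotangential E M \<pi> x n T"
  by (erule tangential.cases) auto

lemma pi_hat_eq: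
  "\<gamma> \<in> FM n (\<pi> x) \<Longrightarrow> pi_hat E M \<pi> x n T \<gamma> =
     wcomp E (wedge n 0) (\<lambda>d. d(n := 0)) (T (wcomp M (wedge (Suc n) 0) (vtake n) \<gamma>))"
  by (simp add: pi_hat_def W_simps)

lemma pi_hat_ext: "pi_hat E M \<pi> x n T \<in> extensional (FM n (\<pi> x))"
  by (simp add: pi_hat_def W_simps)

lemma pseudo_props:
  assumes "pseudotangential E M \<pi> x N T"
  shows "T \<in> extensional (FM N (\<pi> x))" "curve_smooth N N x T"
    and "\<gamma> \<in> FM N (\<pi> x) \<Longrightarrow> T \<gamma> \<in> FE N x" "\<gamma> \<in> FM N (\<pi> x) \<Longrightarrow> proj N (T \<gamma>) = \<gamma>"
    and "\<gamma> \<in> FM N (\<pi> x) \<Longrightarrow> i < N \<Longrightarrow> T (wcomp M (wedge N 0) (\<lambda>d. d(i := \<alpha> * d i)) \<gamma>) =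
        wcomp E (wedge N 0) (\<lambda>d. d(i := \<alpha> * d i)) (T \<gamma>)"
    and "\<gamma> \<in> FM N (\<pi> x) \<Longrightarrow> \<sigma> permutes {..<N} \<Longrightarrow> T (wcomp M (wedge N 0) (\<lambda>d i. d (\<sigma> i)) \<gamma>) =
        wcomp E (wedge N 0) (\<lambda>d i. d (\<sigma> i)) (T \<gamma>)"
  using assms unfolding pseudotangential_iff by (auto simp: Pi_def)

lemma form_props:
  assumes "symmetric_form E M \<pi> x N \<omega>"
  shows "\<omega> \<in> extensional (FM N (\<pi> x))" "curve_smooth N 1 x \<omega>"
    and "\<gamma> \<in> FM N (\<pi> x) \<Longrightarrow> \<omega> \<gamma> \<in> Vert x"
    and "\<gamma> \<in> FM N (\<pi> x) \<Longrightarrow> i < N \<Longrightarrow> \<omega> (wcomp M (wedge N 0) (\<lambda>d. d(i := \<alpha> * d i)) \<gamma>) = tscale E \<alpha> (\<omega> \<gamma>)"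
    and "\<gamma> \<in> FM N (\<pi> x) \<Longrightarrow> \<sigma> permutes {..<N} \<Longrightarrow> \<omega> (wcomp M (wedge N 0) (\<lambda>d i. d (\<sigma> i)) \<gamma>) = \<omega> \<gamma>"
    and "N \<ge> 2 \<Longrightarrow> \<gamma> \<in> FM (N - 1) (\<pi> x) \<Longrightarrow> \<omega> (wcomp M (wedge N 0) (kappa (N - 1)) \<gamma>) = wconst E (wedge 1 0) x"
  using assms unfolding symmetric_form_iff by (auto simp: Pi_def)

subsection \<open>Comparable tangentials have the same faces\<close>

lemma scale_zero_up_down:
  assumes "A \<in> Prol X (Suc n) 0"
  shows "wcomp X (wedge (Suc n) 0) (\<lambda>d. d(n := 0 * d n)) A =
    wcomp X (wedge (Suc n) 0) (vtake n) (wcomp X (wedge n 0) (\<lambda>d. d(n := 0)) A)"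
  unfolding wcomp2[OF wmor_face wmor_vtake_Suc assms]
  by (rule wcomp_cong) (auto simp: vtake_def Rn_def fun_eq_iff)

lemma scale_zero_idem:
  assumes "A \<in> Prol X N 0"
  shows "wcomp X (wedge N 0) (\<lambda>d. d(i := 0 * d i)) (wcomp X (wedge N 0) (\<lambda>d. d(i := 0 * d i)) A) =
    wcomp X (wedge N 0) (\<lambda>d. d(i := 0 * d i)) A"
  unfolding wcomp2[OF wmor_scale wmor_scale assms]
  by (rule wcomp_cong) auto

text \<open>Scaling by 0 is idempotent, so the value of \<open>T\<close> at a rescaled element
  equals its own rescaling by 0. This involves only the last face of \<open>T\<close> at a
  degenerate element, which is what \<open>pi_hat\<close> records.\<close>

lemma last_face:
  assumes T: "pseudotangential E M \<pi> x (Suc n) T" and \<gamma>: "\<gamma> \<in> FM (Suc n) (\<pi> x)"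
  shows "T (wcomp M (wedge (Suc n) 0) (\<lambda>d. d(n := 0 * d n)) \<gamma>) =
    wcomp E (wedge (Suc n) 0) (vtake n) (pi_hat E M \<pi> x n T (wcomp M (wedge n 0) (\<lambda>d. d(n := 0)) \<gamma>))"
proof -
  let ?z = "\<lambda>X. wcomp X (wedge (Suc n) 0) (\<lambda>d. d(n := 0 * d n))"
  have \<gamma>p: "\<gamma> \<in> Prol M (Suc n) 0" using \<gamma> by (simp add: fibre_iff)
  have z\<gamma>: "?z M \<gamma> \<in> FM (Suc n) (\<pi> x)" by (rule scale_fibre[OF \<gamma>])
  \<comment> \<open>Duplicates the scaling, so that one copy can be pulled out of \<open>T\<close>
    while the other stays inside.\<close>
  have "T (?z M \<gamma>) = T (?z M (?z M \<gamma>))" by (simp only: scale_zero_idem[OF \<gamma>p])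
  also have "\<dots> = ?z E (T (?z M \<gamma>))" by (rule pseudo_props(5)[OF T z\<gamma>]) simp
  also have "\<dots> = wcomp E (wedge (Suc n) 0) (vtake n) (wcomp E (wedge n 0) (\<lambda>d. d(n := 0)) (T (?z M \<gamma>)))"
    by (rule scale_zero_up_down) (use pseudo_props(3)[OF T z\<gamma>] in \<open>simp add: fibre_iff\<close>)
  also have "\<dots> = wcomp E (wedge (Suc n) 0) (vtake n)
      (pi_hat E M \<pi> x n T (wcomp M (wedge n 0) (\<lambda>d. d(n := 0)) \<gamma>))"
    by (simp only: pi_hat_eq[OF down_fibre[OF \<gamma>]] scale_zero_up_down[OF \<gamma>p])
  finally show ?thesis .
qed

text \<open>
  The face \<open>d_n = 0\<close> is determined by \<open>pi_hat\<close>; a transposition moves every other face there.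
\<close>

lemma same_faces:
  assumes Tp: "pseudotangential E M \<pi> x (Suc n) Tp" and Tm: "pseudotangential E M \<pi> x (Suc n) Tm"
    and eq: "pi_hat E M \<pi> x n Tp = pi_hat E M \<pi> x n Tm" and \<gamma>: "\<gamma> \<in> FM (Suc n) (\<pi> x)" and i: "i < Suc n"
  shows "wcomp E (wedge (Suc n) 0) (\<lambda>d. d(i := 0)) (Tp \<gamma>) = wcomp E (wedge (Suc n) 0) (\<lambda>d. d(i := 0)) (Tm \<gamma>)"
proof -
  define \<sigma> where "\<sigma> = Transposition.transpose i n"
  have \<sigma>: "\<sigma> permutes {..<Suc n}" unfolding \<sigma>_def by (rule permutes_swap_id) (use i in auto)
  let ?s = "\<lambda>X. wcomp X (wedge (Suc n) 0) (\<lambda>d i. d (\<sigma> i))"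
  \<comment> \<open>The product \<open>0 * d i\<close> is left unsimplified to match homogeneity
    with scalar 0.\<close>
  let ?z = "\<lambda>X i. wcomp X (wedge (Suc n) 0) (\<lambda>d. d(i := 0 * d i))"
  note ms = wmor_permute[OF \<sigma>, of 0] and mz = wmor_scale[of "Suc n" _ 0]
  have s_s: "?s X (?s X A) = A" if A: "A \<in> Prol X (Suc n) 0" for X :: "'c fspace" and A
  proof -
    have "?s X (?s X A) = wcomp X (wedge (Suc n) 0) (\<lambda>x. x) A"
      unfolding wcomp2[OF ms ms A] by (rule wcomp_cong) (simp add: \<sigma>_def)
    then show ?thesis by (simp add: wcomp_id[OF wideal_ok_wedge A])
  qed
  have s_z: "?s X (?z X i A) = ?z X n (?s X A)" if A: "A \<in> Prol X (Suc n) 0" for X :: "'c fspace" and A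
    unfolding wcomp2[OF mz ms A] wcomp2[OF ms mz A]
    by (rule wcomp_cong) (auto simp: \<sigma>_def fun_eq_iff Transposition.transpose_def)
  have \<gamma>p: "\<gamma> \<in> Prol M (Suc n) 0" using \<gamma> by (simp add: fibre_iff)
  have s\<gamma>: "?s M \<gamma> \<in> FM (Suc n) (\<pi> x)" by (rule permute_fibre[OF \<sigma> \<gamma>])
  have z\<gamma>: "?z M i \<gamma> \<in> FM (Suc n) (\<pi> x)" by (rule scale_fibre[OF \<gamma>])
  \<comment> \<open>Expresses the face of \<open>T\<close> at \<gamma> through the value of
    \<open>T\<close> at a permuted element whose last coordinate is scaled by 0;
    \<open>last_face\<close> shows that this value depends only on \<open>pi_hat\<close>.\<close>
  have key: "?z E i (T \<gamma>) = ?s E (T (?z M n (?s M \<gamma>)))" if T: "pseudotangential E M \<pi> x (Suc n) T" for T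
  proof -
    have "T (?z M n (?s M \<gamma>)) = ?s E (T (?z M i \<gamma>))"
      unfolding s_z[OF \<gamma>p, symmetric] by (rule pseudo_props(6)[OF T z\<gamma> \<sigma>])
    moreover have "T (?z M i \<gamma>) = ?z E i (T \<gamma>)" by (rule pseudo_props(5)[OF T \<gamma> i])
    moreover have "T (?z M i \<gamma>) \<in> Prol E (Suc n) 0"
      using pseudo_props(3)[OF T z\<gamma>] by (simp add: fibre_iff)
    ultimately show ?thesis by (simp add: s_s)
  qed
  have "Tp (?z M n (?s M \<gamma>)) = Tm (?z M n (?s M \<gamma>))"
    unfolding last_face[OF Tp s\<gamma>] last_face[OF Tm s\<gamma>] eq ..
  then have "?z E i (Tp \<gamma>) = ?z E i (Tm \<gamma>)" by (simp only: key[OF Tp] key[OF Tm])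
  then show ?thesis by simp
qed

subsection \<open>The operations on tangentials and forms\<close>

text \<open>Each clause is a naturality property of the strong difference. Projection to
  \<open>M\<close> gives the difference of \<gamma> with itself, and on elements degenerate along
  \<open>kappa\<close> both tangentials take the value prescribed by their common
  projection.\<close>

lemma tang_diff_form:
  assumes x: "x \<in> pts E" and n: "n \<ge> 1" and Tp: "tangential E M \<pi> x (Suc n) Tp" and Tm: "tangential E M \<pi> x (Suc n) Tm"
    and eq: "pi_hat E M \<pi> x n Tp = pi_hat E M \<pi> x n Tm"
  shows "symmetric_form E M \<pi> x (Suc n) (tang_diff E M \<pi> (Suc n) x Tp Tm)"
proof -
  let ?N = "Suc n" and ?D = "tang_diff E M \<pi> (Suc n) x Tp Tm"
  note Pp = tangential_pseudo[OF Tp] and Pm = tangential_pseudo[OF Tm]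
  have N: "1 \<le> ?N" by simp
  have D: "?D \<gamma> = sdiff E ?N (Tp \<gamma>) (Tm \<gamma>)" if "\<gamma> \<in> FM ?N (\<pi> x)" for \<gamma>
    using that by (simp add: tang_diff_def W_simps)
  note faces = same_faces[OF Pp Pm eq]
  have pts: "Tp \<gamma> \<in> Prol E ?N 0" "Tm \<gamma> \<in> Prol E ?N 0" if "\<gamma> \<in> FM ?N (\<pi> x)" for \<gamma>
    using pseudo_props(3)[OF Pp that] pseudo_props(3)[OF Pm that] by (auto simp: fibre_iff)
  note sd = E.sdiff_pts[OF N pts faces]
  show ?thesis
    unfolding symmetric_form_iff
  proof (intro conjI ballI allI impI)
    show "?D \<in> extensional (FM ?N (\<pi> x))" by (simp add: tang_diff_def W_simps)
    show "?D \<in> FM ?N (\<pi> x) \<rightarrow> Vert x"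
    proof
      fix \<gamma> assume \<gamma>: "\<gamma> \<in> FM ?N (\<pi> x)"
      have "sdiff E ?N (Tp \<gamma>) (Tm \<gamma>) \<in> FE 1 x"
        using sd(1,2)[OF \<gamma> \<gamma> \<gamma>] pseudo_props(3)[OF Pm \<gamma>] by (simp add: fibre_iff)
      moreover have "proj 1 (sdiff E ?N (Tp \<gamma>) (Tm \<gamma>)) = wconst M (wedge 1 0) (\<pi> x)"
      proof -
        have "proj 1 (sdiff E ?N (Tp \<gamma>) (Tm \<gamma>)) = sdiff M ?N (proj ?N (Tp \<gamma>)) (proj ?N (Tm \<gamma>))"
          by (rule sdiff_wmap[OF mE mM \<pi> N pts[OF \<gamma>] faces[OF \<gamma>]])
        also have "\<dots> = sdiff M ?N \<gamma> \<gamma>"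
          by (simp only: pseudo_props(4)[OF Pp \<gamma>] pseudo_props(4)[OF Pm \<gamma>])
        also have "\<dots> = wconst M (wedge 1 0) (\<pi> x)"
          by (rule microlinear_space.sdiff_self[OF microlinear_space.intro[OF mM] N _ _ pi_pts[OF x]])
            (use \<gamma> in \<open>auto simp: fibre_iff\<close>)
        finally show ?thesis .
      qed
      ultimately show "?D \<gamma> \<in> Vert x" by (simp add: D[OF \<gamma>] Vert_def)
    qed
    have "curve_smooth ?N 1 x (\<lambda>\<gamma>. sdiff E ?N (Tp \<gamma>) (Tm \<gamma>))"
      unfolding curve_smooth_def
    proof (intro ballI impI)
      fix c assume c: "c \<in> curves (weil_prol M (wedge ?N 0))" "range c \<subseteq> FM ?N (\<pi> x)"
      show "(\<lambda>t. sdiff E ?N (Tp (c t)) (Tm (c t))) \<in> curves (weil_prol E (wedge 1 0))"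
        by (rule E.sdiff_curve[OF N curve_smoothD[OF pseudo_props(2)[OF Pp] c]
              curve_smoothD[OF pseudo_props(2)[OF Pm] c] faces]) (use c(2) in auto)
    qed
    then show "curve_smooth ?N 1 x ?D" using curve_smooth_cong[OF D] by simp
  next
    fix \<gamma> \<alpha> i assume \<gamma>: "\<gamma> \<in> FM ?N (\<pi> x)" and i: "i < ?N"
    show "?D (wcomp M (wedge ?N 0) (\<lambda>d. d(i := \<alpha> * d i)) \<gamma>) = tscale E \<alpha> (?D \<gamma>)"
      using E.sdiff_scale[OF i pts[OF \<gamma>] faces[OF \<gamma>]]
      by (simp add: D[OF \<gamma>] D[OF scale_fibre[OF \<gamma>]] pseudo_props(5)[OF Pp \<gamma> i] pseudo_props(5)[OF Pm \<gamma> i] tscale_wcomp)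
  next
    fix \<gamma> \<sigma> assume \<gamma>: "\<gamma> \<in> FM ?N (\<pi> x)" and \<sigma>: "\<sigma> permutes {..<?N}"
    show "?D (wcomp M (wedge ?N 0) (\<lambda>d i. d (\<sigma> i)) \<gamma>) = ?D \<gamma>"
      using E.sdiff_permute[OF \<sigma> N pts[OF \<gamma>] faces[OF \<gamma>]]
      by (simp add: D[OF \<gamma>] D[OF permute_fibre[OF \<sigma> \<gamma>]] pseudo_props(6)[OF Pp \<gamma> \<sigma>] pseudo_props(6)[OF Pm \<gamma> \<sigma>])
  next
    fix \<gamma> assume "\<gamma> \<in> FM (?N - 1) (\<pi> x)"
    then have \<gamma>: "\<gamma> \<in> FM n (\<pi> x)" by simp
    note k = kappa_fibre[OF n \<gamma>]
    have "Tp (wcomp M (wedge ?N 0) (kappa n) \<gamma>) = Tm (wcomp M (wedge ?N 0) (kappa n) \<gamma>)"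
      using Tp Tm \<gamma> eq unfolding tangential_Suc[OF n] by simp
    then have "?D (wcomp M (wedge ?N 0) (kappa n) \<gamma>) = wconst E (wedge 1 0) x"
      using E.sdiff_self[OF N pts(2)[OF k] _ x] pseudo_props(3)[OF Pm k] by (simp add: D[OF k] fibre_iff)
    then show "?D (wcomp M (wedge ?N 0) (kappa (?N - 1)) \<gamma>) = wconst E (wedge 1 0) x" by simp
  qed
qed

text \<open>Adding a tangent vector leaves every face unchanged, hence also the projection. On
  elements degenerate along \<open>kappa\<close> the form vanishes, so the defining equation of a
  tangential is inherited from \<open>T\<close>.\<close>

lemma tang_add_tangential:
  assumes x: "x \<in> pts E" and n: "n \<ge> 1" and T: "tangential E M \<pi> x (Suc n) T"
    and \<omega>: "symmetric_form E M \<pi> x (Suc n) \<omega>"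
  shows "tangential E M \<pi> x (Suc n) (tang_add E M \<pi> (Suc n) x \<omega> T)"
    and "pi_hat E M \<pi> x n (tang_add E M \<pi> (Suc n) x \<omega> T) = pi_hat E M \<pi> x n T"
proof -
  let ?N = "Suc n" and ?A = "tang_add E M \<pi> (Suc n) x \<omega> T"
  note P = tangential_pseudo[OF T]
  have N: "1 \<le> ?N" by simp
  have A: "?A \<gamma> = sadd E ?N (\<omega> \<gamma>) (T \<gamma>)" if "\<gamma> \<in> FM ?N (\<pi> x)" for \<gamma>
    using that by (simp add: tang_add_def W_simps)
  have d: "\<omega> \<gamma> \<in> Prol E 1 0" "T \<gamma> \<in> Prol E ?N 0" "base E (\<omega> \<gamma>) = base E (T \<gamma>)" if "\<gamma> \<in> FM ?N (\<pi> x)" for \<gamma>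
    using pseudo_props(3)[OF P that] form_props(3)[OF \<omega> that] by (auto simp: Vert_def fibre_iff)
  show pi: "pi_hat E M \<pi> x n ?A = pi_hat E M \<pi> x n T"
  proof (rule extensionalityI[OF pi_hat_ext pi_hat_ext])
    fix \<gamma> assume \<gamma>: "\<gamma> \<in> FM n (\<pi> x)"
    note u = up_fibre[OF \<gamma>]
    let ?r = "wcomp E (wedge n 0) (\<lambda>d. d(n := 0))" and ?z = "wcomp E (wedge ?N 0) (\<lambda>d. d(n := 0))"
    \<comment> \<open>The restriction in \<open>pi_hat\<close> depends only on the last face, which
      makes \<open>sadd_face\<close> applicable.\<close>
    have rz: "?r B = ?r (?z B)" if B: "B \<in> Prol E ?N 0" for B
    proof -
      show ?thesis unfolding wcomp2[OF wmor_zero_coordinate wmor_face B] by (rule wcomp_cong) simp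
    qed
    have "?r (sadd E ?N (\<omega> (wcomp M (wedge ?N 0) (vtake n) \<gamma>)) (T (wcomp M (wedge ?N 0) (vtake n) \<gamma>))) =
        ?r (T (wcomp M (wedge ?N 0) (vtake n) \<gamma>))"
      using rz[OF E.sadd_pts(1)[OF N d[OF u]]] rz[OF d(2)[OF u]] E.sadd_face[OF N d[OF u], of n] by simp
    then show "pi_hat E M \<pi> x n ?A \<gamma> = pi_hat E M \<pi> x n T \<gamma>"
      by (simp add: pi_hat_eq[OF \<gamma>] A[OF u])
  qed
  have "pseudotangential E M \<pi> x ?N ?A"
    unfolding pseudotangential_iff
  proof (intro conjI ballI allI impI)
    show "?A \<in> extensional (FM ?N (\<pi> x))" by (simp add: tang_add_def W_simps)
    show "?A \<in> FM ?N (\<pi> x) \<rightarrow> FE ?N x"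
    proof
      fix \<gamma> assume \<gamma>: "\<gamma> \<in> FM ?N (\<pi> x)"
      show "?A \<gamma> \<in> FE ?N x"
        using E.sadd_pts[OF N d[OF \<gamma>]] pseudo_props(3)[OF P \<gamma>] by (simp add: A[OF \<gamma>] fibre_iff)
    qed
    have "curve_smooth ?N ?N x (\<lambda>\<gamma>. sadd E ?N (\<omega> \<gamma>) (T \<gamma>))"
      unfolding curve_smooth_def
    proof (intro ballI impI)
      fix c assume c: "c \<in> curves (weil_prol M (wedge ?N 0))" "range c \<subseteq> FM ?N (\<pi> x)"
      show "(\<lambda>t. sadd E ?N (\<omega> (c t)) (T (c t))) \<in> curves (weil_prol E (wedge ?N 0))"
        by (rule E.sadd_curve[OF N curve_smoothD[OF form_props(2)[OF \<omega>] c]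
              curve_smoothD[OF pseudo_props(2)[OF P] c] d(3)]) (use c(2) in auto)
    qed
    then show "curve_smooth ?N ?N x ?A" using curve_smooth_cong[OF A] by simp
  next
    fix \<gamma> assume \<gamma>: "\<gamma> \<in> FM ?N (\<pi> x)"
    have "proj 1 (\<omega> \<gamma>) = wconst M (wedge 1 0) (\<pi> x)" using form_props(3)[OF \<omega> \<gamma>] by (simp add: Vert_def)
    then have "proj ?N (sadd E ?N (\<omega> \<gamma>) (T \<gamma>)) = sadd M ?N (wconst M (wedge 1 0) (\<pi> x)) \<gamma>"
      using sadd_wmap[OF mE mM \<pi> N d[OF \<gamma>]] pseudo_props(4)[OF P \<gamma>] by simp
    also have "\<dots> = \<gamma>"
      by (rule microlinear_space.sadd_zero[OF microlinear_space.intro[OF mM] N _ _ pi_pts[OF x]])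
        (use \<gamma> in \<open>auto simp: fibre_iff\<close>)
    finally show "proj ?N (?A \<gamma>) = \<gamma>" by (simp add: A[OF \<gamma>])
  next
    fix \<gamma> \<alpha> i assume \<gamma>: "\<gamma> \<in> FM ?N (\<pi> x)" and i: "i < ?N"
    show "?A (wcomp M (wedge ?N 0) (\<lambda>d. d(i := \<alpha> * d i)) \<gamma>) = wcomp E (wedge ?N 0) (\<lambda>d. d(i := \<alpha> * d i)) (?A \<gamma>)"
      using E.sadd_scale[OF i d[OF \<gamma>]]
      by (simp add: A[OF \<gamma>] A[OF scale_fibre[OF \<gamma>]] pseudo_props(5)[OF P \<gamma> i] form_props(4)[OF \<omega> \<gamma> i] tscale_wcomp)
  next
    fix \<gamma> \<sigma> assume \<gamma>: "\<gamma> \<in> FM ?N (\<pi> x)" and \<sigma>: "\<sigma> permutes {..<?N}"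
    show "?A (wcomp M (wedge ?N 0) (\<lambda>d i. d (\<sigma> i)) \<gamma>) = wcomp E (wedge ?N 0) (\<lambda>d i. d (\<sigma> i)) (?A \<gamma>)"
      using E.sadd_permute[OF \<sigma> N d[OF \<gamma>]]
      by (simp add: A[OF \<gamma>] A[OF permute_fibre[OF \<sigma> \<gamma>]] pseudo_props(6)[OF P \<gamma> \<sigma>] form_props(5)[OF \<omega> \<gamma> \<sigma>])
  qed
  moreover have "?A (wcomp M (wedge ?N 0) (kappa n) \<gamma>) = T (wcomp M (wedge ?N 0) (kappa n) \<gamma>)"
    if \<gamma>: "\<gamma> \<in> FM n (\<pi> x)" for \<gamma>
  proof -
    note k = kappa_fibre[OF n \<gamma>]
    have "\<omega> (wcomp M (wedge ?N 0) (kappa n) \<gamma>) = wconst E (wedge 1 0) x"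
      using form_props(6)[OF \<omega>] n \<gamma> by simp
    then show ?thesis
      using E.sadd_zero[OF N d(2)[OF k] _ x] pseudo_props(3)[OF P k] by (simp add: A[OF k] fibre_iff)
  qed
  ultimately show "tangential E M \<pi> x ?N ?A"
    using T unfolding tangential_Suc[OF n] pi by simp
qed

lemma form_zero_form:
  assumes x: "x \<in> pts E"
  shows "symmetric_form E M \<pi> x N (form_zero E M \<pi> N x)"
proof -
  let ?o = "wconst E (wedge 1 0) x"
  have Z: "form_zero E M \<pi> N x \<gamma> = ?o" if "\<gamma> \<in> FM N (\<pi> x)" for \<gamma>
    using that by (simp add: form_zero_def W_simps)
  have oV: "?o \<in> Vert x"
    by (simp add: Vert_def wconst_fibre[OF x] wmap_wconst[OF wideal_ok_wedge \<pi> x])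
  have osc: "tscale E \<alpha> ?o = ?o" for \<alpha>
    unfolding tscale_wcomp by (rule wcomp_wconst_wedge[OF wmor_scale x])
  have "curve_smooth N 1 x (\<lambda>\<gamma>. ?o)"
    unfolding curve_smooth_def using curves_weil_prol_const[OF Vert_pts[OF oV]] by simp
  then have "curve_smooth N 1 x (form_zero E M \<pi> N x)" using curve_smooth_cong[OF Z] by simp
  moreover have "form_zero E M \<pi> N x \<in> extensional (FM N (\<pi> x))" by (simp add: form_zero_def W_simps)
  moreover have "wcomp M (wedge N 0) (kappa (N - 1)) \<gamma> \<in> FM N (\<pi> x)" if "N \<ge> 2" "\<gamma> \<in> FM (N - 1) (\<pi> x)" for \<gamma>
    using kappa_fibre[of "N - 1" \<gamma> M "\<pi> x"] that by simp
  ultimately show ?thesis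
    unfolding symmetric_form_iff by (auto simp: Z scale_fibre permute_fibre oV osc)
qed

text \<open>The projection of the sum to \<open>M\<close> is the sum of two zero vectors.\<close>

lemma Vert_tadd:
  assumes x: "x \<in> pts E" and s: "s \<in> Vert x" and t: "t \<in> Vert x"
  shows "tadd E s t \<in> Vert x"
proof -
  have b: "base E t = base E s" using Vert_base[OF t Vert_fibre[OF s]] .
  note p = E.sadd_pts[OF order_refl Vert_pts[OF t] Vert_pts[OF s] b]
  have "proj 1 (sadd E 1 t s) = wconst M (wedge 1 0) (\<pi> x)"
    unfolding sadd_wmap[OF mE mM \<pi> order_refl Vert_pts[OF t] Vert_pts[OF s] b]
    using s t microlinear_space.sadd_zero[OF microlinear_space.intro[OF mM] order_refl _ _ pi_pts[OF x],
        of "wconst M (wedge 1 0) (\<pi> x)"] wconst_fibre[OF pi_pts[OF x], of 1]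
    by (simp add: Vert_def fibre_iff)
  then show ?thesis using p Vert_fibre[OF s] by (simp add: Vert_def tadd_sadd fibre_iff)
qed

lemma Vert_tscale:
  assumes x: "x \<in> pts E" and t: "t \<in> Vert x"
  shows "tscale E \<alpha> t \<in> Vert x"
proof -
  have "proj 1 (tscale E \<alpha> t) = wcomp M (wedge 1 0) (\<lambda>d. d(0 := \<alpha> * d 0)) (proj 1 t)"
    unfolding tscale_wcomp by (rule wcomp_wmap_wedge[OF wmor_scale \<pi> Vert_pts[OF t], symmetric])
  also have "\<dots> = wconst M (wedge 1 0) (\<pi> x)"
    using t wcomp_wconst_wedge[OF wmor_scale pi_pts[OF x]] by (simp add: Vert_def)
  finally show ?thesis using scale_fibre[OF Vert_fibre[OF t]] by (simp add: Vert_def tscale_wcomp)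
qed

lemma form_add_form:
  assumes x: "x \<in> pts E" and \<omega>: "symmetric_form E M \<pi> x N \<omega>" and \<eta>: "symmetric_form E M \<pi> x N \<eta>"
  shows "symmetric_form E M \<pi> x N (form_add E M \<pi> N x \<omega> \<eta>)"
proof -
  let ?A = "form_add E M \<pi> N x \<omega> \<eta>"
  have A: "?A \<gamma> = tadd E (\<omega> \<gamma>) (\<eta> \<gamma>)" if "\<gamma> \<in> FM N (\<pi> x)" for \<gamma>
    using that by (simp add: form_add_def W_simps)
  note V = form_props(3)[OF \<omega>] form_props(3)[OF \<eta>]
  have b: "base E (\<eta> \<gamma>) = base E (\<omega> \<gamma>)" if "\<gamma> \<in> FM N (\<pi> x)" for \<gamma>
    using Vert_base[OF V(2)[OF that] Vert_fibre[OF V(1)[OF that]]] .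
  show ?thesis
    unfolding symmetric_form_iff
  proof (intro conjI ballI allI impI)
    show "?A \<in> extensional (FM N (\<pi> x))" by (simp add: form_add_def W_simps)
    show "?A \<in> FM N (\<pi> x) \<rightarrow> Vert x" by (auto simp: A intro!: Vert_tadd[OF x] V)
    have "curve_smooth N 1 x (\<lambda>\<gamma>. tadd E (\<omega> \<gamma>) (\<eta> \<gamma>))"
      unfolding curve_smooth_def tadd_sadd
    proof (intro ballI impI)
      fix c assume c: "c \<in> curves (weil_prol M (wedge N 0))" "range c \<subseteq> FM N (\<pi> x)"
      show "(\<lambda>t. sadd E 1 (\<eta> (c t)) (\<omega> (c t))) \<in> curves (weil_prol E (wedge 1 0))"
        by (rule E.sadd_curve[OF order_refl curve_smoothD[OF form_props(2)[OF \<eta>] c]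
              curve_smoothD[OF form_props(2)[OF \<omega>] c] b]) (use c(2) in auto)
    qed
    then show "curve_smooth N 1 x ?A" using curve_smooth_cong[OF A] by simp
  next
    fix \<gamma> \<alpha> i assume \<gamma>: "\<gamma> \<in> FM N (\<pi> x)" and i: "i < N"
    show "?A (wcomp M (wedge N 0) (\<lambda>d. d(i := \<alpha> * d i)) \<gamma>) = tscale E \<alpha> (?A \<gamma>)"
      using E.tscale_tadd[OF Vert_pts[OF V(1)[OF \<gamma>]] Vert_pts[OF V(2)[OF \<gamma>]] b[OF \<gamma>]]
      by (simp add: A[OF \<gamma>] A[OF scale_fibre[OF \<gamma>]] form_props(4)[OF \<omega> \<gamma> i] form_props(4)[OF \<eta> \<gamma> i])
  next
    fix \<gamma> \<sigma> assume \<gamma>: "\<gamma> \<in> FM N (\<pi> x)" and \<sigma>: "\<sigma> permutes {..<N}"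
    show "?A (wcomp M (wedge N 0) (\<lambda>d i. d (\<sigma> i)) \<gamma>) = ?A \<gamma>"
      by (simp add: A[OF \<gamma>] A[OF permute_fibre[OF \<sigma> \<gamma>]] form_props(5)[OF \<omega> \<gamma> \<sigma>] form_props(5)[OF \<eta> \<gamma> \<sigma>])
  next
    fix \<gamma> assume N: "2 \<le> N" and \<gamma>: "\<gamma> \<in> FM (N - 1) (\<pi> x)"
    have k: "wcomp M (wedge N 0) (kappa (N - 1)) \<gamma> \<in> FM N (\<pi> x)"
      using kappa_fibre[of "N - 1" \<gamma> M "\<pi> x"] N \<gamma> by simp
    have o: "wconst E (wedge 1 0) x \<in> FE 1 x" by (rule wconst_fibre[OF x])
    show "?A (wcomp M (wedge N 0) (kappa (N - 1)) \<gamma>) = wconst E (wedge 1 0) x"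
      using E.sadd_zero[OF order_refl _ _ x, of "wconst E (wedge 1 0) x"] o
      by (simp add: A[OF k] form_props(6)[OF \<omega> N \<gamma>] form_props(6)[OF \<eta> N \<gamma>] tadd_sadd fibre_iff)
  qed
qed

lemma tscale_tscale:
  assumes "t \<in> Prol E 1 0" shows "tscale E a (tscale E b t) = tscale E (a * b) t"
  unfolding tscale_wcomp wcomp2[OF wmor_scale wmor_scale assms]
  by (rule wcomp_cong) (simp add: ac_simps)

lemma tscale_one:
  assumes "t \<in> Prol E 1 0" shows "tscale E 1 t = t"
  unfolding tscale_wcomp using wcomp_id[OF wideal_ok_wedge assms] by simp

lemma tscale_0:
  assumes x: "x \<in> pts E" and t: "t \<in> Vert x" shows "tscale E 0 t = wconst E (wedge 1 0) x"
proof -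
  have "tscale E 0 t = wcomp E (wedge 1 0) (\<lambda>x i. 0) t"
    unfolding tscale_wcomp by (rule wcomp_cong) (auto simp: Rn_def fun_eq_iff)
  also have "\<dots> = wconst E (wedge 1 0) x"
    by (rule wcomp_const_wedge[OF Vert_pts[OF t] wmor_zero _ wmor_zero x])
      (use Vert_fibre[OF t] in \<open>simp add: fibre_iff\<close>)
  finally show ?thesis .
qed

lemma form_scale_form:
  assumes x: "x \<in> pts E" and \<omega>: "symmetric_form E M \<pi> x N \<omega>"
  shows "symmetric_form E M \<pi> x N (form_scale E M \<pi> N x r \<omega>)"
proof -
  let ?A = "form_scale E M \<pi> N x r \<omega>"
  have A: "?A \<gamma> = tscale E r (\<omega> \<gamma>)" if "\<gamma> \<in> FM N (\<pi> x)" for \<gamma>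
    using that by (simp add: form_scale_def W_simps)
  note V = form_props(3)[OF \<omega>]
  show ?thesis
    unfolding symmetric_form_iff
  proof (intro conjI ballI allI impI)
    show "?A \<in> extensional (FM N (\<pi> x))" by (simp add: form_scale_def W_simps)
    show "?A \<in> FM N (\<pi> x) \<rightarrow> Vert x" by (auto simp: A intro!: Vert_tscale[OF x] V)
    have "curve_smooth N 1 x (\<lambda>\<gamma>. tscale E r (\<omega> \<gamma>))"
      unfolding curve_smooth_def tscale_wcomp
    proof (intro ballI impI)
      fix c assume c: "c \<in> curves (weil_prol M (wedge N 0))" "range c \<subseteq> FM N (\<pi> x)"
      then have "(\<lambda>t. \<omega> (c t)) \<in> curves (weil_prol E (wedge 1 0))"
        using form_props(2)[OF \<omega>] by (simp add: curve_smooth_def)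
      from curves_wcomp_wedge[OF wmor_scale this]
      show "(\<lambda>t. wcomp E (wedge 1 0) (\<lambda>d. d(0 := r * d 0)) (\<omega> (c t))) \<in> curves (weil_prol E (wedge 1 0))" .
    qed
    then show "curve_smooth N 1 x ?A" using curve_smooth_cong[OF A] by simp
  next
    fix \<gamma> \<alpha> i assume \<gamma>: "\<gamma> \<in> FM N (\<pi> x)" and i: "i < N"
    show "?A (wcomp M (wedge N 0) (\<lambda>d. d(i := \<alpha> * d i)) \<gamma>) = tscale E \<alpha> (?A \<gamma>)"
      by (simp add: A[OF \<gamma>] A[OF scale_fibre[OF \<gamma>]] form_props(4)[OF \<omega> \<gamma> i] tscale_tscale Vert_pts[OF V[OF \<gamma>]] mult.commute)
  next
    fix \<gamma> \<sigma> assume \<gamma>: "\<gamma> \<in> FM N (\<pi> x)" and \<sigma>: "\<sigma> permutes {..<N}"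
    show "?A (wcomp M (wedge N 0) (\<lambda>d i. d (\<sigma> i)) \<gamma>) = ?A \<gamma>"
      by (simp add: A[OF \<gamma>] A[OF permute_fibre[OF \<sigma> \<gamma>]] form_props(5)[OF \<omega> \<gamma> \<sigma>])
  next
    fix \<gamma> assume N: "2 \<le> N" and \<gamma>: "\<gamma> \<in> FM (N - 1) (\<pi> x)"
    have k: "wcomp M (wedge N 0) (kappa (N - 1)) \<gamma> \<in> FM N (\<pi> x)"
      using kappa_fibre[of "N - 1" \<gamma> M "\<pi> x"] N \<gamma> by simp
    show "?A (wcomp M (wedge N 0) (kappa (N - 1)) \<gamma>) = wconst E (wedge 1 0) x"
      by (simp add: A[OF k] form_props(6)[OF \<omega> N \<gamma>] tscale_wcomp
        wcomp_wconst_wedge[OF wmor_scale x])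
  qed
qed

lemma form_eqI:
  assumes "symmetric_form E M \<pi> x N \<omega>" "symmetric_form E M \<pi> x N \<eta>" "\<And>\<gamma>. \<gamma> \<in> FM N (\<pi> x) \<Longrightarrow> \<omega> \<gamma> = \<eta> \<gamma>"
  shows "\<omega> = \<eta>"
  by (rule extensionalityI[OF form_props(1)[OF assms(1)] form_props(1)[OF assms(2)] assms(3)])

lemma form_add_at: "\<gamma> \<in> FM N (\<pi> x) \<Longrightarrow> form_add E M \<pi> N x \<omega> \<eta> \<gamma> = tadd E (\<omega> \<gamma>) (\<eta> \<gamma>)"
  by (simp add: form_add_def W_simps)

lemma form_scale_at: "\<gamma> \<in> FM N (\<pi> x) \<Longrightarrow> form_scale E M \<pi> N x r \<omega> \<gamma> = tscale E r (\<omega> \<gamma>)"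
  by (simp add: form_scale_def W_simps)

lemma form_zero_at: "\<gamma> \<in> FM N (\<pi> x) \<Longrightarrow> form_zero E M \<pi> N x \<gamma> = wconst E (wedge 1 0) x"
  by (simp add: form_zero_def W_simps)

context
  fixes x :: 'e and N :: nat
  assumes x: "x \<in> pts E"
begin

abbreviation "Form \<equiv> symmetric_form E M \<pi> x N"
abbreviation "fadd \<equiv> form_add E M \<pi> N x"
abbreviation "fscl \<equiv> form_scale E M \<pi> N x"
abbreviation "fzer \<equiv> form_zero E M \<pi> N x"

lemmas form_closed = form_add_form[OF x, of N] form_scale_form[OF x, of N] form_zero_form[OF x, of N]
lemmas form_at = form_add_at form_scale_at form_zero_at

lemma form_pts: "Form \<omega> \<Longrightarrow> \<gamma> \<in> FM N (\<pi> x) \<Longrightarrow> \<omega> \<gamma> \<in> Prol E 1 0"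
  using form_props(3) Vert_pts by blast

lemma form_base: "Form \<omega> \<Longrightarrow> Form \<eta> \<Longrightarrow> \<gamma> \<in> FM N (\<pi> x) \<Longrightarrow> base E (\<omega> \<gamma>) = base E (\<eta> \<gamma>)"
  using form_props(3) Vert_base Vert_fibre by metis

lemma form_vector_space:
  assumes u: "Form u" and v: "Form v" and w: "Form w"
  shows "fadd (fadd u v) w = fadd u (fadd v w)" "fadd u v = fadd v u" "fadd fzer v = v"
    "fadd v (fscl (-1) v) = fzer" "fscl r (fadd u v) = fadd (fscl r u) (fscl r v)"
    "fscl (r + s) v = fadd (fscl r v) (fscl s v)" "fscl r (fscl s v) = fscl (r * s) v" "fscl 1 v = v"
proof -
  note p = form_pts[OF u] form_pts[OF v] form_pts[OF w]
  show "fadd (fadd u v) w = fadd u (fadd v w)"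
  proof (rule form_eqI[of x N])
    show "(fadd (fadd u v) w) \<gamma> = (fadd u (fadd v w)) \<gamma>" if \<gamma>: "\<gamma> \<in> FM N (\<pi> x)" for \<gamma>
      by (simp only: form_at[OF \<gamma>] E.tadd_assoc[OF p[OF \<gamma>] form_base[OF v u \<gamma>] form_base[OF w u \<gamma>]])
  qed (use u v w in \<open>auto intro: form_closed\<close>)
  have com: "fadd u v = fadd v u" if u: "Form u" and v: "Form v" for u v
  proof (rule form_eqI[of x N])
    show "fadd u v \<gamma> = fadd v u \<gamma>" if \<gamma>: "\<gamma> \<in> FM N (\<pi> x)" for \<gamma>
      unfolding form_at[OF \<gamma>]
      by (rule E.tadd_commute[OF form_pts[OF u \<gamma>] form_pts[OF v \<gamma>] form_base[OF u v \<gamma>]])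
  qed (use u v in \<open>auto intro: form_closed\<close>)
  show "fadd u v = fadd v u" by (rule com[OF u v])
  have zer: "fadd v fzer = v"
  proof (rule form_eqI[of x N])
    fix \<gamma> assume \<gamma>: "\<gamma> \<in> FM N (\<pi> x)"
    have "v \<gamma> \<in> FE 1 x" using form_props(3)[OF v \<gamma>] by (rule Vert_fibre)
    then show "fadd v fzer \<gamma> = v \<gamma>"
      using E.sadd_zero[OF order_refl p(2)[OF \<gamma>] _ x] by (simp add: form_at[OF \<gamma>] tadd_sadd fibre_iff)
  qed (use v in \<open>auto intro: form_closed\<close>)
  then show "fadd fzer v = v" using com[OF v form_closed(3)] by simp
  show "fadd v (fscl (-1) v) = fzer"
  proof (rule form_eqI[of x N])
    fix \<gamma> assume \<gamma>: "\<gamma> \<in> FM N (\<pi> x)"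
    \<comment> \<open>The vector itself is written as its multiple by 1, so that the inverse law is
      an instance of \<open>tadd_tscale\<close>.\<close>
    have "tadd E (tscale E 1 (v \<gamma>)) (tscale E (-1) (v \<gamma>)) = tscale E (1 + -1) (v \<gamma>)"
      by (rule E.tadd_tscale[OF p(2)[OF \<gamma>]])
    then show "fadd v (fscl (-1) v) \<gamma> = fzer \<gamma>"
      using tscale_0[OF x form_props(3)[OF v \<gamma>]] by (simp add: form_at \<gamma> tscale_one[OF p(2)[OF \<gamma>]])
  qed (use v in \<open>auto intro: form_closed\<close>)
  show "fscl r (fadd u v) = fadd (fscl r u) (fscl r v)"
  proof (rule form_eqI[of x N])
    show "(fscl r (fadd u v)) \<gamma> = (fadd (fscl r u) (fscl r v)) \<gamma>" if \<gamma>: "\<gamma> \<in> FM N (\<pi> x)" for \<gamma>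
      by (simp only: form_at[OF \<gamma>] E.tscale_tadd[OF p(1)[OF \<gamma>] p(2)[OF \<gamma>] form_base[OF v u \<gamma>]])
  qed (use u v w in \<open>auto intro: form_closed\<close>)
  show "fscl (r + s) v = fadd (fscl r v) (fscl s v)"
  proof (rule form_eqI[of x N])
    show "(fscl (r + s) v) \<gamma> = (fadd (fscl r v) (fscl s v)) \<gamma>" if \<gamma>: "\<gamma> \<in> FM N (\<pi> x)" for \<gamma>
      by (simp only: form_at[OF \<gamma>] E.tadd_tscale[OF p(2)[OF \<gamma>]])
  qed (use u v w in \<open>auto intro: form_closed\<close>)
  show "fscl r (fscl s v) = fscl (r * s) v"
  proof (rule form_eqI[of x N])
    show "(fscl r (fscl s v)) \<gamma> = (fscl (r * s) v) \<gamma>" if \<gamma>: "\<gamma> \<in> FM N (\<pi> x)" for \<gamma>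
      by (simp only: form_at[OF \<gamma>] tscale_tscale[OF p(2)[OF \<gamma>]])
  qed (use u v w in \<open>auto intro: form_closed\<close>)
  show "fscl 1 v = v"
  proof (rule form_eqI[of x N])
    show "(fscl 1 v) \<gamma> = (v) \<gamma>" if \<gamma>: "\<gamma> \<in> FM N (\<pi> x)" for \<gamma>
      by (simp only: form_at[OF \<gamma>] tscale_one[OF p(2)[OF \<gamma>]])
  qed (use u v w in \<open>auto intro: form_closed\<close>)
qed

end

text \<open>The laws are those of the strong operations at each \<gamma>; for the first,
  \<open>same_faces\<close> guarantees that the strong difference is defined.\<close>

lemma tang_affine:
  assumes x: "x \<in> pts E" and n: "n \<ge> 1"
  shows "tangential E M \<pi> x (Suc n) T \<Longrightarrow> tangential E M \<pi> x (Suc n) T' \<Longrightarrow>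
      pi_hat E M \<pi> x n T = pi_hat E M \<pi> x n T' \<Longrightarrow>
      tang_add E M \<pi> (Suc n) x (tang_diff E M \<pi> (Suc n) x T T') T' = T"
    and "symmetric_form E M \<pi> x (Suc n) \<omega> \<Longrightarrow> tangential E M \<pi> x (Suc n) T \<Longrightarrow>
      tang_diff E M \<pi> (Suc n) x (tang_add E M \<pi> (Suc n) x \<omega> T) T = \<omega>"
    and "tangential E M \<pi> x (Suc n) T \<Longrightarrow> tang_add E M \<pi> (Suc n) x (form_zero E M \<pi> (Suc n) x) T = T"
    and "symmetric_form E M \<pi> x (Suc n) \<omega> \<Longrightarrow> symmetric_form E M \<pi> x (Suc n) \<eta> \<Longrightarrow>
      tangential E M \<pi> x (Suc n) T \<Longrightarrow>
      tang_add E M \<pi> (Suc n) x \<omega> (tang_add E M \<pi> (Suc n) x \<eta> T) =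
      tang_add E M \<pi> (Suc n) x (form_add E M \<pi> (Suc n) x \<omega> \<eta>) T"
proof -
  let ?N = "Suc n"
  have N: "1 \<le> ?N" by simp
  have add_ext: "tang_add E M \<pi> ?N x \<omega> T \<in> extensional (FM ?N (\<pi> x))" for \<omega> T
    by (simp add: tang_add_def W_simps)
  have diff_ext: "tang_diff E M \<pi> ?N x T T' \<in> extensional (FM ?N (\<pi> x))" for T T'
    by (simp add: tang_diff_def W_simps)
  have add_at: "tang_add E M \<pi> ?N x \<omega> T \<gamma> = sadd E ?N (\<omega> \<gamma>) (T \<gamma>)" if "\<gamma> \<in> FM ?N (\<pi> x)" for \<omega> T \<gamma>
    using that by (simp add: tang_add_def W_simps)
  have diff_at: "tang_diff E M \<pi> ?N x T T' \<gamma> = sdiff E ?N (T \<gamma>) (T' \<gamma>)" if "\<gamma> \<in> FM ?N (\<pi> x)" for T T' \<gamma>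
    using that by (simp add: tang_diff_def W_simps)
  have Tfib: "T \<gamma> \<in> FE ?N x" if "tangential E M \<pi> x ?N T" "\<gamma> \<in> FM ?N (\<pi> x)" for T \<gamma>
    by (rule pseudo_props(3)[OF tangential_pseudo[OF that(1)] that(2)])
  then have Tp: "T \<gamma> \<in> Prol E ?N 0" if "tangential E M \<pi> x ?N T" "\<gamma> \<in> FM ?N (\<pi> x)" for T \<gamma>
    using that by (simp add: fibre_iff)
  have b: "base E (\<omega> \<gamma>) = base E (T \<gamma>)"
    if "symmetric_form E M \<pi> x ?N \<omega>" "tangential E M \<pi> x ?N T" "\<gamma> \<in> FM ?N (\<pi> x)" for \<omega> T \<gamma>
    by (rule Vert_base[OF form_props(3)[OF that(1,3)] Tfib[OF that(2,3)]])
  show "tang_add E M \<pi> ?N x (tang_diff E M \<pi> ?N x T T') T' = T"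
    if T: "tangential E M \<pi> x ?N T" and T': "tangential E M \<pi> x ?N T'" and eq: "pi_hat E M \<pi> x n T = pi_hat E M \<pi> x n T'"
  proof (rule extensionalityI[OF add_ext pseudo_props(1)[OF tangential_pseudo[OF T]]])
    fix \<gamma> assume \<gamma>: "\<gamma> \<in> FM ?N (\<pi> x)"
    show "tang_add E M \<pi> ?N x (tang_diff E M \<pi> ?N x T T') T' \<gamma> = T \<gamma>"
      unfolding add_at[OF \<gamma>] diff_at[OF \<gamma>]
      by (rule E.sdiff_pts(3)[OF N Tp[OF T \<gamma>] Tp[OF T' \<gamma>]
            same_faces[OF tangential_pseudo[OF T] tangential_pseudo[OF T'] eq \<gamma>]])
  qed
  show "tang_diff E M \<pi> ?N x (tang_add E M \<pi> ?N x \<omega> T) T = \<omega>"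
    if \<omega>: "symmetric_form E M \<pi> x ?N \<omega>" and T: "tangential E M \<pi> x ?N T"
  proof (rule extensionalityI[OF diff_ext form_props(1)[OF \<omega>]])
    fix \<gamma> assume \<gamma>: "\<gamma> \<in> FM ?N (\<pi> x)"
    show "tang_diff E M \<pi> ?N x (tang_add E M \<pi> ?N x \<omega> T) T \<gamma> = \<omega> \<gamma>"
      unfolding diff_at[OF \<gamma>] add_at[OF \<gamma>]
      by (rule E.sdiff_sadd[OF N form_pts[OF x \<omega> \<gamma>] Tp[OF T \<gamma>] b[OF \<omega> T \<gamma>]])
  qed
  show "tang_add E M \<pi> ?N x (form_zero E M \<pi> ?N x) T = T" if T: "tangential E M \<pi> x ?N T"
  proof (rule extensionalityI[OF add_ext pseudo_props(1)[OF tangential_pseudo[OF T]]])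
    fix \<gamma> assume \<gamma>: "\<gamma> \<in> FM ?N (\<pi> x)"
    show "tang_add E M \<pi> ?N x (form_zero E M \<pi> ?N x) T \<gamma> = T \<gamma>"
      unfolding add_at[OF \<gamma>] form_zero_at[OF \<gamma>]
      by (rule E.sadd_zero[OF N Tp[OF T \<gamma>] _ x]) (use Tfib[OF T \<gamma>] in \<open>simp add: fibre_iff\<close>)
  qed
  show "tang_add E M \<pi> ?N x \<omega> (tang_add E M \<pi> ?N x \<eta> T) = tang_add E M \<pi> ?N x (form_add E M \<pi> ?N x \<omega> \<eta>) T"
    if \<omega>: "symmetric_form E M \<pi> x ?N \<omega>" and \<eta>: "symmetric_form E M \<pi> x ?N \<eta>" and T: "tangential E M \<pi> x ?N T"
  proof (rule extensionalityI[OF add_ext add_ext])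
    fix \<gamma> assume \<gamma>: "\<gamma> \<in> FM ?N (\<pi> x)"
    have "tadd E (\<omega> \<gamma>) (\<eta> \<gamma>) = sadd E 1 (\<eta> \<gamma>) (\<omega> \<gamma>)" by (rule tadd_sadd)
    then show "tang_add E M \<pi> ?N x \<omega> (tang_add E M \<pi> ?N x \<eta> T) \<gamma> =
        tang_add E M \<pi> ?N x (form_add E M \<pi> ?N x \<omega> \<eta>) T \<gamma>"
      using E.sadd_sadd[OF N form_pts[OF x \<omega> \<gamma>] b[OF \<omega> T \<gamma>] form_pts[OF x \<eta> \<gamma>] b[OF \<eta> T \<gamma>] Tp[OF T \<gamma>]]
      by (simp add: add_at[OF \<gamma>] form_add_at[OF \<gamma>])
  qed
qed

section \<open>The vector bundle of forms and the affine structure of the jets\<close>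

lemma jet_forms_fibre:
  "v \<in> jet_forms E M \<pi> n \<and> fst v = (x, S) \<longleftrightarrow>
     (\<exists>\<omega>. v = ((x, S), (x, \<omega>)) \<and> (x, S) \<in> jets E M \<pi> n \<and> x \<in> pts E \<and> symmetric_form E M \<pi> x (Suc n) \<omega>)"
  by (cases v) (auto simp: jet_forms_def forms_def jets_def)

lemma vector_bundle_forms:
  "vector_bundle (jet_forms E M \<pi> n) (jets E M \<pi> n) fst (jf_zero E M \<pi> n) (jf_add E M \<pi> n) (jf_scale E M \<pi> n)"
  unfolding vector_bundle_def
proof (intro conjI ballI)
  show "fst \<in> jet_forms E M \<pi> n \<rightarrow> jets E M \<pi> n" by (auto simp: jet_forms_def)
  fix b assume b: "b \<in> jets E M \<pi> n"
  obtain x S where xS: "b = (x, S)" by (cases b)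
  have x: "x \<in> pts E" using b xS by (simp add: jets_def)
  \<comment> \<open>Identifies the fibre over \<open>b\<close> with the forms at \<open>x\<close>,
    so that quantifiers over the fibre become quantifiers over forms.\<close>
  define mk where "mk \<omega> = (b, (x, \<omega>))" for \<omega> :: "('m, 'e) tmap"
  have Vb: "{v \<in> jet_forms E M \<pi> n. fst v = b} = mk ` {\<omega>. symmetric_form E M \<pi> x (Suc n) \<omega>}"
    using jet_forms_fibre[of _ n x S] b x unfolding xS mk_def by auto
  have ops: "jf_zero E M \<pi> n b = mk (form_zero E M \<pi> (Suc n) x)"
    "jf_add E M \<pi> n (mk \<omega>) (mk \<eta>) = mk (form_add E M \<pi> (Suc n) x \<omega> \<eta>)"
    "jf_scale E M \<pi> n r (mk \<omega>) = mk (form_scale E M \<pi> (Suc n) x r \<omega>)" for \<omega> \<eta> r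
    by (simp_all add: jf_zero_def jf_add_def jf_scale_def mk_def xS)
  let ?V = "mk ` {\<omega>. symmetric_form E M \<pi> x (Suc n) \<omega>}"
  have VAll: "(\<forall>v\<in>?V. P v) \<longleftrightarrow> (\<forall>\<omega>. symmetric_form E M \<pi> x (Suc n) \<omega> \<longrightarrow> P (mk \<omega>))" for P
    by auto
  have VEx: "(\<exists>v\<in>?V. P v) \<longleftrightarrow> (\<exists>\<omega>. symmetric_form E M \<pi> x (Suc n) \<omega> \<and> P (mk \<omega>))" for P
    by auto
  have VMem: "mk \<omega> \<in> ?V \<longleftrightarrow> symmetric_form E M \<pi> x (Suc n) \<omega>" for \<omega>
    by (auto simp: mk_def)
  note closed = form_closed[OF x, of "Suc n"]
  note vs = form_vector_space[OF x, of "Suc n"]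
  show "let Vb = {v \<in> jet_forms E M \<pi> n. fst v = b} in
        jf_zero E M \<pi> n b \<in> Vb \<and> (\<forall>u\<in>Vb. \<forall>v\<in>Vb. jf_add E M \<pi> n u v \<in> Vb) \<and>
        (\<forall>r. \<forall>v\<in>Vb. jf_scale E M \<pi> n r v \<in> Vb) \<and>
        (\<forall>u\<in>Vb. \<forall>v\<in>Vb. \<forall>w\<in>Vb. jf_add E M \<pi> n (jf_add E M \<pi> n u v) w = jf_add E M \<pi> n u (jf_add E M \<pi> n v w)) \<and>
        (\<forall>u\<in>Vb. \<forall>v\<in>Vb. jf_add E M \<pi> n u v = jf_add E M \<pi> n v u) \<and>
        (\<forall>v\<in>Vb. jf_add E M \<pi> n (jf_zero E M \<pi> n b) v = v) \<and>
        (\<forall>v\<in>Vb. \<exists>w\<in>Vb. jf_add E M \<pi> n v w = jf_zero E M \<pi> n b) \<and>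
        (\<forall>r. \<forall>u\<in>Vb. \<forall>v\<in>Vb. jf_scale E M \<pi> n r (jf_add E M \<pi> n u v) =
           jf_add E M \<pi> n (jf_scale E M \<pi> n r u) (jf_scale E M \<pi> n r v)) \<and>
        (\<forall>r s. \<forall>v\<in>Vb. jf_scale E M \<pi> n (r + s) v = jf_add E M \<pi> n (jf_scale E M \<pi> n r v) (jf_scale E M \<pi> n s v)) \<and>
        (\<forall>r s. \<forall>v\<in>Vb. jf_scale E M \<pi> n r (jf_scale E M \<pi> n s v) = jf_scale E M \<pi> n (r * s) v) \<and>
        (\<forall>v\<in>Vb. jf_scale E M \<pi> n 1 v = v)"
    unfolding Vb Let_def VAll VEx VMem ops
    by (intro conjI allI impI)
      ((rule closed; assumption) | (rule arg_cong[of _ _ mk], rule vs; assumption) |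
       (rule exI, rule conjI, rule closed(2), assumption, rule arg_cong[of _ _ mk], rule vs(4); assumption))+
qed

lemma jets_fibre:
  "a \<in> jets E M \<pi> (Suc n) \<and> jet_proj E M \<pi> n a = (x, S) \<longleftrightarrow>
     (\<exists>T. a = (x, T) \<and> x \<in> pts E \<and> tangential E M \<pi> x (Suc n) T \<and> pi_hat E M \<pi> x n T = S)"
  by (cases a) (auto simp: jets_def jet_proj_def)

lemma affine_bundle_jets:
  assumes n: "n \<ge> 1"
  shows "affine_bundle (jets E M \<pi> (Suc n)) (jets E M \<pi> n) (jet_proj E M \<pi> n)
           (jet_forms E M \<pi> n) fst (jf_zero E M \<pi> n) (jf_add E M \<pi> n) (jf_scale E M \<pi> n)
           (jet_diff E M \<pi> n) (jet_add E M \<pi> n)"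
  unfolding affine_bundle_def
proof (intro conjI ballI)
  show "jet_proj E M \<pi> n \<in> jets E M \<pi> (Suc n) \<rightarrow> jets E M \<pi> n"
    by (auto simp: jets_def jet_proj_def tangential_Suc[OF n])
  show "vector_bundle (jet_forms E M \<pi> n) (jets E M \<pi> n) fst (jf_zero E M \<pi> n) (jf_add E M \<pi> n) (jf_scale E M \<pi> n)"
    by (rule vector_bundle_forms)
  fix b assume b: "b \<in> jets E M \<pi> n"
  obtain x S where xS: "b = (x, S)" by (cases b)
  have x: "x \<in> pts E" using b xS by (simp add: jets_def)
  let ?T = "\<lambda>T. tangential E M \<pi> x (Suc n) T \<and> pi_hat E M \<pi> x n T = S"
  have Ab: "{a \<in> jets E M \<pi> (Suc n). jet_proj E M \<pi> n a = b} = Pair x ` {T. ?T T}"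
    using jets_fibre[of _ n x S] x unfolding xS by auto
  have Vb: "{v \<in> jet_forms E M \<pi> n. fst v = b} = (\<lambda>\<omega>. (b, (x, \<omega>))) ` {\<omega>. symmetric_form E M \<pi> x (Suc n) \<omega>}"
    using jet_forms_fibre[of _ n x S] b x unfolding xS by auto
  \<comment> \<open>The base jet of a difference is computed from its first argument; it is
    \<open>b\<close> because \<open>T\<close> projects to \<open>S\<close>.\<close>
  have ops: "jet_diff E M \<pi> n (x, T) (x, T') = (b, (x, tang_diff E M \<pi> (Suc n) x T T'))" if "?T T" for T T'
    using that by (simp add: jet_diff_def jet_proj_def xS)
  have ops': "jet_add E M \<pi> n (b, (x, \<omega>)) (x, T) = (x, tang_add E M \<pi> (Suc n) x \<omega> T)"
    "jf_zero E M \<pi> n b = (b, (x, form_zero E M \<pi> (Suc n) x))"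
    "jf_add E M \<pi> n (b, (x, \<omega>)) (b, (x, \<eta>)) = (b, (x, form_add E M \<pi> (Suc n) x \<omega> \<eta>))" for \<omega> \<eta> T
    by (simp_all add: jet_add_def jf_zero_def jf_add_def xS)
  show "let Ab = {a \<in> jets E M \<pi> (Suc n). jet_proj E M \<pi> n a = b}; Vb = {v \<in> jet_forms E M \<pi> n. fst v = b} in
        (\<forall>a\<in>Ab. \<forall>a'\<in>Ab. jet_diff E M \<pi> n a a' \<in> Vb) \<and>
        (\<forall>v\<in>Vb. \<forall>a\<in>Ab. jet_add E M \<pi> n v a \<in> Ab) \<and>
        (\<forall>a\<in>Ab. \<forall>a'\<in>Ab. jet_add E M \<pi> n (jet_diff E M \<pi> n a a') a' = a) \<and>
        (\<forall>v\<in>Vb. \<forall>a\<in>Ab. jet_diff E M \<pi> n (jet_add E M \<pi> n v a) a = v) \<and>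
        (\<forall>a\<in>Ab. jet_add E M \<pi> n (jf_zero E M \<pi> n b) a = a) \<and>
        (\<forall>v\<in>Vb. \<forall>w\<in>Vb. \<forall>a\<in>Ab. jet_add E M \<pi> n v (jet_add E M \<pi> n w a) = jet_add E M \<pi> n (jf_add E M \<pi> n v w) a)"
    unfolding Ab Vb Let_def
    by (auto simp: ops ops' tang_diff_form[OF x n] tang_add_tangential[OF x n] tang_affine[OF x n])
qed

end

theorem theorem25:
  fixes E :: "'e fspace" and M :: "'m fspace" and \<pi> :: "'e \<Rightarrow> 'm" and n :: nat
  assumes "frolicher E" and "frolicher M" and "smooth_map E M \<pi>"
    and "microlinear E" and "microlinear M"
    and "weil_exponentiable TYPE('y) E" and "weil_exponentiable TYPE('y) M"
    and "n \<ge> 1"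
  shows "affine_bundle (jets E M \<pi> (Suc n)) (jets E M \<pi> n) (jet_proj E M \<pi> n)
           (jet_forms E M \<pi> n) fst (jf_zero E M \<pi> n) (jf_add E M \<pi> n) (jf_scale E M \<pi> n)
           (jet_diff E M \<pi> n) (jet_add E M \<pi> n)"
  by (rule tangential_setting.affine_bundle_jets[OF tangential_setting.intro[OF assms(2-5)] assms(8)])

end
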